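(* Let $A$ be a topological ring and let $B$, $C$ be two preadic topological $A$-algebras. Let $\mathfrak{m}$ be an ideal of definition of $B$ and $\mathfrak{n}$ an ideal of definition of $C$. Let $\mathfrak{r}$ be the ideal $\operatorname{Im}(\mathfrak{m}\otimes_A C)+\operatorname{Im}(B\otimes_A \mathfrak{n})$ of $B\otimes_A C$, and let $E=B\widehat{\otimes}_A C$ be the completed tensor product. Suppose that the ideals $\mathfrak{m}$ and $\mathfrak{n}$ are finitely generated, that $C$ is a coherent ring, and that the ideal $\mathfrak{n}$ of $C$ and the ideal $\mathfrak{r}E$ of $E$ satisfy property (APf). If $A$ is an absolutely flat ring, then $E$ is flat as a $C$-module.
   Context: All rings are commutative and unital; modules are unital. An ideal $\mathfrak{J}$ of a ring $R$ satisfies property (APf) (weak Artin property) if for every finitely generated $R$-module $M$ and every finitely generated submodule $N$ of $M$, the $\mathfrak{J}$-preadic topology of $N$ is induced by the $\mathfrak{J}$-preadic topology of $M$; i.e. for every integer $n>0$ there is an integer $k>0$ with $\mathfrak{J}^kM\cap N\subset \mathfrak{J}^nN$. A topological ring is preadic if there is an ideal (an ideal of definition) whose powers form a fundamental system of neighbourhoods of $0$ (neither separated nor complete is required). A preadic topological $A$-algebra is an $A$-algebra with a preadic ring topology such that the structure homomorphism from $A$ is continuous. The completed tensor product $B\widehat{\otimes}_A C$ is the separated completion of $B\otimes_A C$ for the tensor product topology, defined by the submodules $\operatorname{Im}(\mathfrak{m}^i\otimes_A C)+\operatorname{Im}(B\otimes_A\mathfrak{n}^j)$, which is the $\mathfrak{r}$-preadic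 topology; so $E=\varprojlim_n (B\otimes_A C)/\mathfrak{r}^n$. A ring is coherent if every finitely generated ideal is finitely presented. A ring is absolutely flat (von Neumann regular) if every module over it is flat. *)

theory Defs
  imports "HOL-Analysis.Product_Topology" "HOL-Library.Poly_Mapping" "HOL-Algebra.Module" "HOL-Algebra.QuotRing"
    "HOL-Algebra.Ideal_Product" "HOL-Algebra.Generated_Groups"
begin

section \<open>Ideals and modules\<close>

text \<open>
  Rings and modules are the records of HOL-Algebra; the locale \<open>module\<close> includes
  commutativity of the base ring, the locale \<open>algebra\<close> also that of the algebra.
  The record \<open>ideals_set R\<close> is the monoid of ideals of \<open>R\<close> with the product of ideals,
  whose unit is \<open>carrier R\<close>.
\<close>

abbreviation ideal_power :: "('a, 'r) ring_scheme \<Rightarrow> 'a set \<Rightarrow> nat \<Rightarrow> 'a set" where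
  "ideal_power R J n \<equiv> J [^]\<^bsub>ideals_set R\<^esub> n"

definition fin_gen_ideal :: "('a, 'r) ring_scheme \<Rightarrow> 'a set \<Rightarrow> bool" where
  "fin_gen_ideal R I \<longleftrightarrow> (\<exists>S. finite S \<and> S \<subseteq> carrier R \<and> I = Idl\<^bsub>R\<^esub> S)"

definition module_span ::
    "('a, 'r) ring_scheme \<Rightarrow> ('a, 'm, 's) module_scheme \<Rightarrow> 'm set \<Rightarrow> 'm set" where
  "module_span R M S = \<Inter>{H. submodule H R M \<and> S \<subseteq> H}"

definition fin_gen_submodule ::
    "('a, 'r) ring_scheme \<Rightarrow> ('a, 'm, 's) module_scheme \<Rightarrow> 'm set \<Rightarrow> bool" where
  "fin_gen_submodule R M N \<longleftrightarrow> (\<exists>S. finite S \<and> S \<subseteq> carrier M \<and> N = module_span R M S)"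

definition ideal_smult ::
    "('a, 'r) ring_scheme \<Rightarrow> ('a, 'm, 's) module_scheme \<Rightarrow> 'a set \<Rightarrow> 'm set \<Rightarrow> 'm set" where
  "ideal_smult R M I N = module_span R M {a \<odot>\<^bsub>M\<^esub> x |a x. a \<in> I \<and> x \<in> N}"

definition linear_maps ::
    "('a, 'r) ring_scheme \<Rightarrow> ('a, 'm, 's) module_scheme \<Rightarrow> ('a, 'n, 't) module_scheme
      \<Rightarrow> ('m \<Rightarrow> 'n) set" where
  "linear_maps R M N =
    {f \<in> hom (add_monoid M) (add_monoid N).
      \<forall>a \<in> carrier R. \<forall>x \<in> carrier M. f (a \<odot>\<^bsub>M\<^esub> x) = a \<odot>\<^bsub>N\<^esub> f x}"

definition restrict_scalars :: "('c \<Rightarrow> 'e) \<Rightarrow> ('e, 's) ring_scheme \<Rightarrow> ('c, 'e) module" where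
  "restrict_scalars \<phi> S =
    \<lparr>carrier = carrier S, mult = (\<otimes>\<^bsub>S\<^esub>), one = \<one>\<^bsub>S\<^esub>,
     zero = \<zero>\<^bsub>S\<^esub>, add = (\<oplus>\<^bsub>S\<^esub>),
     smult = (\<lambda>c s. \<phi> c \<otimes>\<^bsub>S\<^esub> s)\<rparr>"

definition free_module :: "('a, 'r) ring_scheme \<Rightarrow> nat \<Rightarrow> ('a, nat \<Rightarrow> 'a) module" where
  "free_module R n =
    \<lparr>carrier = {..<n} \<rightarrow>\<^sub>E carrier R,
     mult = (\<lambda>x y. \<lambda>i\<in>{..<n}. x i \<otimes>\<^bsub>R\<^esub> y i),
     one = (\<lambda>i\<in>{..<n}. \<one>\<^bsub>R\<^esub>),
     zero = (\<lambda>i\<in>{..<n}. \<zero>\<^bsub>R\<^esub>),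
     add = (\<lambda>x y. \<lambda>i\<in>{..<n}. x i \<oplus>\<^bsub>R\<^esub> y i),
     smult = (\<lambda>a x. \<lambda>i\<in>{..<n}. a \<otimes>\<^bsub>R\<^esub> x i)\<rparr>"

definition finitely_presented ::
    "('a, 'r) ring_scheme \<Rightarrow> ('a, 'm, 's) module_scheme \<Rightarrow> bool" where
  "finitely_presented R M \<longleftrightarrow>
    (\<exists>n. \<exists>f \<in> linear_maps R (free_module R n) M.
      f ` carrier (free_module R n) = carrier M \<and>
      fin_gen_submodule R (free_module R n) (a_kernel (free_module R n) M f))"

definition coherent_ring :: "('a, 'r) ring_scheme \<Rightarrow> bool" where
  "coherent_ring R \<longleftrightarrow> cring R \<and>
    (\<forall>I. fin_gen_ideal R I \<longrightarrow>
      finitely_presented R ((restrict_scalars (\<lambda>x. x) R)\<lparr>carrier := I\<rparr>))"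

text \<open>
  HOL cannot quantify over types inside a formula. The modules \<open>M\<close> below live on the type
  \<open>(nat \<Rightarrow> 'a) set\<close>; no generality is lost, since a finitely generated module is isomorphic
  to a quotient of some \<open>free_module R n\<close>, whose elements are cosets of that type.
\<close>

definition APf :: "('a, 'r) ring_scheme \<Rightarrow> 'a set \<Rightarrow> bool" where
  "APf R J \<longleftrightarrow>
    (\<forall>M :: ('a, (nat \<Rightarrow> 'a) set) module. \<forall>N.
      module R M \<and> fin_gen_submodule R M (carrier M) \<and> fin_gen_submodule R M N \<longrightarrow>
      (\<forall>n>0. \<exists>k>0.
        ideal_smult R M (ideal_power R J k) (carrier M) \<inter> N
          \<subseteq> ideal_smult R M (ideal_power R J n) N))"


section \<open>Tensor products and flatness\<close>

text \<open>
  \<open>pair_ring M N\<close> is the free abelian group on the pairs \<open>(x, y)\<close>, multiplied by the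
  bilinear extension of \<open>(x, y) (x', y') = (x x', y y')\<close>. The tensor product is its
  quotient by the subgroup of bilinearity relations. If \<open>M\<close> and \<open>N\<close> are algebras, this
  subgroup is an ideal and the quotient carries the multiplication of the tensor product of
  algebras; if they are merely modules, \<open>mult\<close> and \<open>one\<close> are junk and
  only the module structure is meaningful.
\<close>

definition pair_ring ::
    "('a, 'm, 's) module_scheme \<Rightarrow> ('a, 'n, 't) module_scheme \<Rightarrow> (('m \<times> 'n) \<Rightarrow>\<^sub>0 int) ring" where
  "pair_ring M N =
    \<lparr>carrier = {t. Poly_Mapping.keys t \<subseteq> carrier M \<times> carrier N},
     mult = (\<lambda>s t. frag_extend
       (\<lambda>(x, y). frag_extend (\<lambda>(x', y'). frag_of (x \<otimes>\<^bsub>M\<^esub> x', y \<otimes>\<^bsub>N\<^esub> y')) t) s),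
     one = frag_of (\<one>\<^bsub>M\<^esub>, \<one>\<^bsub>N\<^esub>),
     zero = 0,
     add = (+)\<rparr>"

definition tensor_relations ::
    "('a, 'r) ring_scheme \<Rightarrow> ('a, 'm, 's) module_scheme \<Rightarrow> ('a, 'n, 't) module_scheme
      \<Rightarrow> (('m \<times> 'n) \<Rightarrow>\<^sub>0 int) set" where
  "tensor_relations R M N = generate (add_monoid (pair_ring M N))
    ({frag_of (x \<oplus>\<^bsub>M\<^esub> x', y) - frag_of (x, y) - frag_of (x', y) |x x' y.
        x \<in> carrier M \<and> x' \<in> carrier M \<and> y \<in> carrier N} \<union>
     {frag_of (x, y \<oplus>\<^bsub>N\<^esub> y') - frag_of (x, y) - frag_of (x, y') |x y y'.
        x \<in> carrier M \<and> y \<in> carrier N \<and> y' \<in> carrier N} \<union>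
     {frag_of (a \<odot>\<^bsub>M\<^esub> x, y) - frag_of (x, a \<odot>\<^bsub>N\<^esub> y) |a x y.
        a \<in> carrier R \<and> x \<in> carrier M \<and> y \<in> carrier N})"

definition tensor_class ::
    "('a, 'r) ring_scheme \<Rightarrow> ('a, 'm, 's) module_scheme \<Rightarrow> ('a, 'n, 't) module_scheme
      \<Rightarrow> (('m \<times> 'n) \<Rightarrow>\<^sub>0 int) \<Rightarrow> (('m \<times> 'n) \<Rightarrow>\<^sub>0 int) set" where
  "tensor_class R M N t = tensor_relations R M N +>\<^bsub>pair_ring M N\<^esub> t"

definition pure_tensor ::
    "('a, 'r) ring_scheme \<Rightarrow> ('a, 'm, 's) module_scheme \<Rightarrow> ('a, 'n, 't) module_scheme
      \<Rightarrow> 'm \<Rightarrow> 'n \<Rightarrow> (('m \<times> 'n) \<Rightarrow>\<^sub>0 int) set" where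
  "pure_tensor R M N x y = tensor_class R M N (frag_of (x, y))"

text \<open>
  \<open>tensor_map R M N f g\<close> is the map \<open>f \<otimes> g\<close> with target \<open>M \<otimes> N\<close>; the union is
  over the representatives of a class and all members agree when \<open>f\<close> and \<open>g\<close> are linear.
\<close>

definition tensor_map ::
    "('a, 'r) ring_scheme \<Rightarrow> ('a, 'm, 's) module_scheme \<Rightarrow> ('a, 'n, 't) module_scheme
      \<Rightarrow> ('k \<Rightarrow> 'm) \<Rightarrow> ('l \<Rightarrow> 'n) \<Rightarrow> (('k \<times> 'l) \<Rightarrow>\<^sub>0 int) set \<Rightarrow> (('m \<times> 'n) \<Rightarrow>\<^sub>0 int) set" where
  "tensor_map R M N f g X =
    (\<Union>t\<in>X. tensor_class R M N (frag_extend (\<lambda>(x, y). frag_of (f x, g y)) t))"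

definition tensor_product ::
    "('a, 'r) ring_scheme \<Rightarrow> ('a, 'm, 's) module_scheme \<Rightarrow> ('a, 'n, 't) module_scheme
      \<Rightarrow> ('a, (('m \<times> 'n) \<Rightarrow>\<^sub>0 int) set) module" where
  "tensor_product R M N =
    (let Q = pair_ring M N Quot tensor_relations R M N in
      \<lparr>carrier = carrier Q, mult = (\<otimes>\<^bsub>Q\<^esub>), one = \<one>\<^bsub>Q\<^esub>,
       zero = \<zero>\<^bsub>Q\<^esub>, add = (\<oplus>\<^bsub>Q\<^esub>),
       smult = (\<lambda>a. tensor_map R M N (\<lambda>x. a \<odot>\<^bsub>M\<^esub> x) (\<lambda>y. y))\<rparr>)"

text \<open>
  \<open>flat TYPE('u) R M\<close> tests flatness against the injections between modules on the type
  \<open>'u\<close>. In a conclusion, \<open>'u\<close> is left arbitrary.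
\<close>

definition flat :: "'u itself \<Rightarrow> ('a, 'r) ring_scheme \<Rightarrow> ('a, 'm, 's) module_scheme \<Rightarrow> bool" where
  "flat U R M \<longleftrightarrow> module R M \<and>
    (\<forall>N' :: ('a, 'u) module. \<forall>N :: ('a, 'u) module. \<forall>f \<in> linear_maps R N' N.
      module R N' \<and> module R N \<and> inj_on f (carrier N') \<longrightarrow>
      inj_on (tensor_map R M N (\<lambda>x. x) f) (carrier (tensor_product R M N')))"

text \<open>
  Modules and test modules range over the type \<open>(nat \<Rightarrow> 'a) set\<close>, which accommodates a copy
  of every finitely generated module. As a hypothesis this is formally weaker than, and in
  fact equivalent to, the condition for modules on all types: flatness over all
  cyclic modules, tested on ideals, already forces \<open>x \<in> x\<^sup>2 R\<close> for every \<open>x\<close>.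
\<close>

definition absolutely_flat :: "('a, 'r) ring_scheme \<Rightarrow> bool" where
  "absolutely_flat R \<longleftrightarrow> cring R \<and>
    (\<forall>M :: ('a, (nat \<Rightarrow> 'a) set) module.
      module R M \<longrightarrow> flat TYPE((nat \<Rightarrow> 'a) set) R M)"


section \<open>Preadic topologies\<close>

definition topological_ring :: "('a, 'r) ring_scheme \<Rightarrow> 'a topology \<Rightarrow> bool" where
  "topological_ring R T \<longleftrightarrow> cring R \<and> topspace T = carrier R \<and>
    continuous_map (prod_topology T T) T (\<lambda>(x, y). x \<oplus>\<^bsub>R\<^esub> y) \<and>
    continuous_map T T (\<lambda>x. \<ominus>\<^bsub>R\<^esub> x) \<and>
    continuous_map (prod_topology T T) T (\<lambda>(x, y). x \<otimes>\<^bsub>R\<^esub> y)"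

definition ideal_of_definition ::
    "('a, 'r) ring_scheme \<Rightarrow> 'a topology \<Rightarrow> 'a set \<Rightarrow> bool" where
  "ideal_of_definition R T J \<longleftrightarrow> ideal J R \<and>
    (\<forall>n. \<exists>U. openin T U \<and> \<zero>\<^bsub>R\<^esub> \<in> U \<and> U \<subseteq> ideal_power R J n) \<and>
    (\<forall>U. openin T U \<and> \<zero>\<^bsub>R\<^esub> \<in> U \<longrightarrow> (\<exists>n. ideal_power R J n \<subseteq> U))"

definition preadic_ring :: "('a, 'r) ring_scheme \<Rightarrow> 'a topology \<Rightarrow> bool" where
  "preadic_ring R T \<longleftrightarrow> topological_ring R T \<and> (\<exists>J. ideal_of_definition R T J)"

definition preadic_topological_algebra ::
    "('a, 'r) ring_scheme \<Rightarrow> 'a topology \<Rightarrow> ('a, 'b, 's) module_scheme \<Rightarrow> 'b topology \<Rightarrow> bool" where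
  "preadic_topological_algebra A TA B TB \<longleftrightarrow>
    algebra A B \<and> preadic_ring B TB \<and> continuous_map TA TB (\<lambda>a. a \<odot>\<^bsub>B\<^esub> \<one>\<^bsub>B\<^esub>)"


section \<open>The completed tensor product\<close>

text \<open>The inverse limit of the rings \<open>R / I\<^sup>n\<close>, as compatible sequences of cosets.\<close>

definition adic_completion :: "('a, 'r) ring_scheme \<Rightarrow> 'a set \<Rightarrow> (nat \<Rightarrow> 'a set) ring" where
  "adic_completion R I =
    (let Q = (\<lambda>n. R Quot ideal_power R I n) in
      \<lparr>carrier = {s. (\<forall>n. s n \<in> carrier (Q n)) \<and>
         (\<forall>m n. m \<le> n \<longrightarrow> (\<Union>x\<in>s n. ideal_power R I m +>\<^bsub>R\<^esub> x) = s m)},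
       mult = (\<lambda>s t n. s n \<otimes>\<^bsub>Q n\<^esub> t n),
       one = (\<lambda>n. \<one>\<^bsub>Q n\<^esub>),
       zero = (\<lambda>n. \<zero>\<^bsub>Q n\<^esub>),
       add = (\<lambda>s t n. s n \<oplus>\<^bsub>Q n\<^esub> t n)\<rparr>)"

definition to_completion :: "('a, 'r) ring_scheme \<Rightarrow> 'a set \<Rightarrow> 'a \<Rightarrow> (nat \<Rightarrow> 'a set)" where
  "to_completion R I x = (\<lambda>n. ideal_power R I n +>\<^bsub>R\<^esub> x)"

definition tensor_ideal ::
    "('a, 'r) ring_scheme \<Rightarrow> ('a, 'b, 's) module_scheme \<Rightarrow> ('a, 'c, 't) module_scheme
      \<Rightarrow> 'b set \<Rightarrow> 'c set \<Rightarrow> (('b \<times> 'c) \<Rightarrow>\<^sub>0 int) set set" where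
  "tensor_ideal A B C \<mm> \<nn> =
    tensor_map A B C (\<lambda>x. x) (\<lambda>y. y) ` carrier (tensor_product A (B\<lparr>carrier := \<mm>\<rparr>) C)
    <+>\<^bsub>tensor_product A B C\<^esub>
    tensor_map A B C (\<lambda>x. x) (\<lambda>y. y) ` carrier (tensor_product A B (C\<lparr>carrier := \<nn>\<rparr>))"

text \<open>
  The topology of the tensor product is the preadic one defined by \<open>tensor_ideal\<close>, so its
  separated completion is the inverse limit of the quotients by the powers of that ideal.
\<close>

definition completed_tensor ::
    "('a, 'r) ring_scheme \<Rightarrow> ('a, 'b, 's) module_scheme \<Rightarrow> ('a, 'c, 't) module_scheme
      \<Rightarrow> 'b set \<Rightarrow> 'c set \<Rightarrow> (nat \<Rightarrow> (('b \<times> 'c) \<Rightarrow>\<^sub>0 int) set set) ring" where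
  "completed_tensor A B C \<mm> \<nn> =
    adic_completion (tensor_product A B C) (tensor_ideal A B C \<mm> \<nn>)"

definition tensor_to_completed ::
    "('a, 'r) ring_scheme \<Rightarrow> ('a, 'b, 's) module_scheme \<Rightarrow> ('a, 'c, 't) module_scheme
      \<Rightarrow> 'b set \<Rightarrow> 'c set \<Rightarrow> (('b \<times> 'c) \<Rightarrow>\<^sub>0 int) set \<Rightarrow> (nat \<Rightarrow> (('b \<times> 'c) \<Rightarrow>\<^sub>0 int) set set)" where
  "tensor_to_completed A B C \<mm> \<nn> =
    to_completion (tensor_product A B C) (tensor_ideal A B C \<mm> \<nn>)"

definition completed_tensor_module ::
    "('a, 'r) ring_scheme \<Rightarrow> ('a, 'b, 's) module_scheme \<Rightarrow> ('a, 'c, 't) module_scheme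
      \<Rightarrow> 'b set \<Rightarrow> 'c set \<Rightarrow> ('c, nat \<Rightarrow> (('b \<times> 'c) \<Rightarrow>\<^sub>0 int) set set) module" where
  "completed_tensor_module A B C \<mm> \<nn> =
    restrict_scalars (\<lambda>c. tensor_to_completed A B C \<mm> \<nn> (pure_tensor A B C \<one>\<^bsub>B\<^esub> c))
      (completed_tensor A B C \<mm> \<nn>)"

end

(*
  A module M over R has trivial relations if every relation sum a_s m_s = 0 comes from relations
  in R; this gives flatness.  Let sum c_s e_s = 0 with c_s in C and e_s in E, and let K be the
  module of relations of (c_s) over C, finitely generated since C is coherent.  All B / m^N are flat
  over A, so modulo a high power of r the vector e lifts to a combination of elements of K:
  this is where (APf) for n enters.  Hence e lies in the closure of the submodule KE of a free
  E-module, and (APf) for rE, applied to KE + Ee, gives (1 - a) e in KE for some a in rE.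
  As 1 - a is a unit of the complete ring E, the vector e lies in KE.
*)
theory Submission
  imports Defs "HOL-Algebra.Free_Abelian_Groups"
begin

section \<open>Finite sums\<close>

text \<open>A tensor is a coset of formal sums and an element of \<open>E\<close> a sequence of
  cosets, so exact sequences and quotient modules are avoided: flatness becomes a statement about
  coefficients, taken modulo a submodule \<open>H\<close>, which treats \<open>B / \<mm>^N\<close>
  without leaving \<open>B\<close>. The bridge is that a vanishing tensor has a finite certificate:
  finitely many instances of linearity. These are relations in \<open>B\<close>, so they can be
  solved simultaneously. The obstacle in \<open>E\<close> is convergence. Modulo every power of
  \<open>\<rr>\<close> there are coefficients expressing \<open>e\<close> by relations over
  \<open>C\<close>, but those for different powers need not be compatible. The second use of (APf)
  turns a single approximation, of an order \<kappa> fixed in advance, into an exact equation. It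
  needs congruence in the inverse limit to mean congruence modulo powers of \<open>\<rr>E\<close>,
  and finite generation of \<open>\<mm>\<close> and \<open>\<nn>\<close> is what provides this. The
  precision required of the relation is an even number \<open>2M\<close>: a pure tensor in the
  expansion of \<open>\<rr>^(2M)\<close> has its first factor in \<open>\<mm>^M\<close> or its
  second in \<open>\<nn>^M\<close>, and these two cases are handled separately.\<close>

lemma (in abelian_monoid) finsum_swap:
  assumes "finite I" "finite J" "\<And>i j. i \<in> I \<Longrightarrow> j \<in> J \<Longrightarrow> f i j \<in> carrier G"
  shows "(\<Oplus>i\<in>I. \<Oplus>j\<in>J. f i j) = (\<Oplus>j\<in>J. \<Oplus>i\<in>I. f i j)"
  using assms(1,3)
proof (induction I rule: finite_induct)
  case (insert x F)
  have "(\<Oplus>i\<in>insert x F. \<Oplus>j\<in>J. f i j) = (\<Oplus>j\<in>J. f x j) \<oplus> (\<Oplus>i\<in>F. \<Oplus>j\<in>J. f i j)"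
    by (rule finsum_insert) (use insert in \<open>auto intro!: finsum_closed\<close>)
  also have "\<dots> = (\<Oplus>j\<in>J. f x j) \<oplus> (\<Oplus>j\<in>J. \<Oplus>i\<in>F. f i j)"
    using insert by simp
  also have "\<dots> = (\<Oplus>j\<in>J. f x j \<oplus> (\<Oplus>i\<in>F. f i j))"
    by (rule finsum_addf [symmetric]) (use insert in \<open>auto intro!: finsum_closed\<close>)
  also have "\<dots> = (\<Oplus>j\<in>J. \<Oplus>i\<in>insert x F. f i j)"
    by (rule finsum_cong') (use insert in \<open>auto intro!: finsum_closed\<close>)
  finally show ?case .
qed simp

lemma (in abelian_monoid) finsum_mono_zero:
  assumes "finite B" "A \<subseteq> B" "f \<in> A \<rightarrow> carrier G" "\<And>i. i \<in> B - A \<Longrightarrow> f i = \<zero>"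
  shows "finsum G f B = finsum G f A"
proof (rule add.finprod_mono_neutral_cong_right)
  show "f \<in> B \<rightarrow> carrier G"
  proof
    show "f i \<in> carrier G" if "i \<in> B" for i
      using assms(3,4) that by (cases "i \<in> A") auto
  qed
qed (use assms in auto)

lemma (in abelian_monoid) finsum_zero_eqI:
  assumes "\<And>i. i \<in> B \<Longrightarrow> f i = \<zero>"
  shows "finsum G f B = \<zero>"
  by (rule add.finprod_one_eqI) (use assms in auto)

lemma (in abelian_monoid) finsum_delta:
  assumes "finite B" "i \<in> B" "f i \<in> carrier G" "\<And>j. j \<in> B \<Longrightarrow> j \<noteq> i \<Longrightarrow> f j = \<zero>"
  shows "finsum G f B = f i"
proof -
  have "finsum G f B = finsum G f {i}"
    by (rule finsum_mono_zero) (use assms in auto)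
  then show ?thesis using assms by simp
qed

lemma (in abelian_group) a_inv_zero: "\<ominus> \<zero> = \<zero>"
  by (rule minus_equality [OF l_zero [OF zero_closed] zero_closed zero_closed])

lemma (in abelian_group) finsum_minus:
  assumes "finite I" "f \<in> I \<rightarrow> carrier G"
  shows "(\<Oplus>i\<in>I. \<ominus> f i) = \<ominus> (\<Oplus>i\<in>I. f i)"
  using assms
proof (induction I rule: finite_induct)
  case (insert x F)
  then have "f x \<in> carrier G" "f \<in> F \<rightarrow> carrier G" by auto
  with insert show ?case
    by (auto simp: minus_add Pi_def)
next
  case empty
  show ?case by (simp only: finsum_empty a_inv_zero)
qed

text \<open>The additivity relations of the tensor product have the form \<open>p - q - r\<close>;
  this evaluates their images under homomorphisms.\<close>

lemma (in abelian_group) add_diff_diff: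
  assumes "x \<in> carrier G" "y \<in> carrier G"
  shows "(x \<oplus> y) \<ominus> x \<ominus> y = \<zero>"
proof -
  have "(x \<oplus> y) \<ominus> x = y"
    using assms by (simp add: minus_eq a_comm[of x y] a_assoc r_neg)
  then show ?thesis using assms by (simp add: minus_eq r_neg)
qed

lemma (in module) smult_finsum_ldistr:
  assumes "finite I" "x \<in> carrier M" "f \<in> I \<rightarrow> carrier R"
  shows "(\<Oplus>\<^bsub>R\<^esub>i\<in>I. f i) \<odot>\<^bsub>M\<^esub> x = (\<Oplus>\<^bsub>M\<^esub>i\<in>I. f i \<odot>\<^bsub>M\<^esub> x)"
  using assms(1,3)
  by (induction I rule: finite_induct) (use assms(2) in \<open>auto simp: smult_l_distr Pi_def\<close>)

text \<open>Asks only for closure under zero and addition, so submodules, ideals and the additive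
  span \<open>pspan\<close> are all instances.\<close>

lemma (in abelian_monoid) finsum_mem:
  assumes "finite I" "\<zero> \<in> H" "\<And>x y. x \<in> H \<Longrightarrow> y \<in> H \<Longrightarrow> x \<oplus> y \<in> H" "H \<subseteq> carrier G"
    "\<And>i. i \<in> I \<Longrightarrow> f i \<in> H"
  shows "finsum G f I \<in> H"
  using assms(1,5)
proof (induction I rule: finite_induct)
  case (insert x F)
  then have "finsum G f (insert x F) = f x \<oplus> finsum G f F"
    using assms(4) by (intro finsum_insert) auto
  then show ?case using insert assms by auto
qed (use assms in auto)


section \<open>The tensor product of modules as an abelian group\<close>

locale module_pair = M?: module R M + N?: module R N for R and M and N
begin

abbreviation "T \<equiv> tensor_product R M N"
abbreviation "rels \<equiv> tensor_relations R M N"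
abbreviation "cls \<equiv> tensor_class R M N"
abbreviation "pt \<equiv> pure_tensor R M N"

text \<open>Names the set under \<open>generate\<close> in \<open>tensor_relations\<close>: a
  homomorphism kills \<open>rels\<close> as soon as it kills these three families.\<close>

definition "gens =
    ({frag_of (x \<oplus>\<^bsub>M\<^esub> x', y) - frag_of (x, y) - frag_of (x', y) |x x' y.
        x \<in> carrier M \<and> x' \<in> carrier M \<and> y \<in> carrier N} \<union>
     {frag_of (x, y \<oplus>\<^bsub>N\<^esub> y') - frag_of (x, y) - frag_of (x, y') |x y y'.
        x \<in> carrier M \<and> y \<in> carrier N \<and> y' \<in> carrier N} \<union>
     {frag_of (a \<odot>\<^bsub>M\<^esub> x, y) - frag_of (x, a \<odot>\<^bsub>N\<^esub> y) |a x y.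
        a \<in> carrier R \<and> x \<in> carrier M \<and> y \<in> carrier N})"

lemma rels_eq: "rels = generate (add_monoid (pair_ring M N)) gens"
  by (simp only: tensor_relations_def gens_def)

text \<open>Identifies the additive group with the free abelian group of the library, which brings
  its universal property and the rule that inverses are negatives.\<close>

lemma pair_add_monoid: "add_monoid (pair_ring M N) = free_Abelian_group (carrier M \<times> carrier N)"
  by (simp add: pair_ring_def free_Abelian_group_def)

lemma pair_simps [simp]:
  "t \<in> carrier (pair_ring M N) \<longleftrightarrow> Poly_Mapping.keys t \<subseteq> carrier M \<times> carrier N"
  "\<zero>\<^bsub>pair_ring M N\<^esub> = 0" "s \<oplus>\<^bsub>pair_ring M N\<^esub> t = s + t"
  by (simp_all add: pair_ring_def)

sublocale P: abelian_group "pair_ring M N"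
proof -
  interpret F: comm_group "free_Abelian_group (carrier M \<times> carrier N)"
    by (rule abelian_free_Abelian_group)
  show "abelian_group (pair_ring M N)"
    by unfold_locales (use F.comm_monoid_axioms F.comm_group_axioms pair_add_monoid in
      \<open>auto simp: comm_group_def group_def monoid_def comm_monoid_def intro: F.comm_group_axioms\<close>)
qed


lemma gens_carrier: "gens \<subseteq> carrier (pair_ring M N)"
proof
  fix t assume "t \<in> gens"
  then show "t \<in> carrier (pair_ring M N)"
    unfolding gens_def
    by (elim UnE CollectE exE conjE)
      (auto dest!: subsetD[OF keys_diff])
qed

sublocale Q: abelian_subgroup rels "pair_ring M N"
proof (rule abelian_subgroupI3)
  show "additive_subgroup rels (pair_ring M N)"
    unfolding rels_eq
    by (intro additive_subgroup.intro P.a_group [THEN group.generate_is_subgroup]) 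
      (use gens_carrier in simp)
qed (rule P.abelian_group_axioms)

lemma T_add: "X \<oplus>\<^bsub>T\<^esub> Y = X <+>\<^bsub>pair_ring M N\<^esub> Y"
  and T_zero: "\<zero>\<^bsub>T\<^esub> = rels"
  and T_carrier: "carrier T = a_rcosets\<^bsub>pair_ring M N\<^esub> rels"
  by (simp_all add: tensor_product_def FactRing_def Let_def)

lemma T_add_monoid: "add_monoid T = \<lparr>carrier = a_rcosets\<^bsub>pair_ring M N\<^esub> rels,
    mult = set_add (pair_ring M N), one = rels, \<dots> = undefined\<rparr>"
  by (simp add: tensor_product_def FactRing_def Let_def)

text \<open>\<open>add_monoid T\<close> agrees with the factor group of the library except for the
  extension slot of the record, so the laws are transferred one at a time.\<close>

sublocale T: abelian_group T
proof -
  have "comm_group \<lparr>carrier = a_rcosets\<^bsub>pair_ring M N\<^esub> rels,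
    mult = set_add (pair_ring M N), one = rels\<rparr>"
    using Q.a_factorgroup_is_comm_group by (simp add: A_FactGroup_def')
  then interpret G: comm_group "\<lparr>carrier = a_rcosets\<^bsub>pair_ring M N\<^esub> rels,
    mult = set_add (pair_ring M N), one = rels\<rparr>" .
  have "comm_group (add_monoid T)"
    unfolding T_add_monoid
  proof (rule comm_groupI, goal_cases)
    case 1 then show ?case using G.m_closed by simp
  next
    case 2 then show ?case using G.one_closed by simp
  next
    case 3 then show ?case using G.m_assoc by simp
  next
    case 4 then show ?case using G.m_comm by simp
  next
    case 5 then show ?case using G.l_one by simp
  next
    case 6 then show ?case using G.l_inv G.inv_closed by fastforce
  qed
  then show "abelian_group T"
    by (simp add: abelian_group_def abelian_group_axioms_def abelian_monoid_def comm_group_def)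
qed

section \<open>Cosets and pure tensors\<close>

lemma cls_closed [simp, intro]:
  "Poly_Mapping.keys t \<subseteq> carrier M \<times> carrier N \<Longrightarrow> cls t \<in> carrier T"
  by (simp add: T_carrier tensor_class_def P.a_rcosetsI Q.a_subset)

lemma cls_add:
  assumes "Poly_Mapping.keys s \<subseteq> carrier M \<times> carrier N"
    "Poly_Mapping.keys t \<subseteq> carrier M \<times> carrier N"
  shows "cls (s + t) = cls s \<oplus>\<^bsub>T\<^esub> cls t"
  using Q.a_rcos_sum[of s t] assms by (simp add: T_add tensor_class_def)

lemma cls_surj:
  assumes "X \<in> carrier T"
  obtains t where "Poly_Mapping.keys t \<subseteq> carrier M \<times> carrier N" "X = cls t"
  using assms by (auto simp: T_carrier A_RCOSETS_def' tensor_class_def)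

lemma cls_eq_iff:
  assumes "Poly_Mapping.keys s \<subseteq> carrier M \<times> carrier N"
    "Poly_Mapping.keys t \<subseteq> carrier M \<times> carrier N"
  shows "cls s = cls t \<longleftrightarrow> s - t \<in> rels"
proof -
  have m: "\<ominus>\<^bsub>pair_ring M N\<^esub> t = - t"
    by (rule P.minus_equality) (use assms in \<open>auto simp: keys_minus\<close>)
  have "cls s = cls t \<longleftrightarrow> s \<in> rels +>\<^bsub>pair_ring M N\<^esub> t"
    unfolding tensor_class_def
    using Q.a_repr_independence' Q.a_rcos_self assms by (metis pair_simps(1))
  also have "\<dots> \<longleftrightarrow> s - t \<in> rels"
    using Q.a_rcos_module[of t s] assms m P.abelian_group_axioms by simp
  finally show ?thesis .
qed

lemma cls_0 [simp]: "cls 0 = \<zero>\<^bsub>T\<^esub>"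
  using Q.a_subset by (simp add: tensor_class_def T_zero a_r_coset_def' )

lemma cls_zero_iff:
  assumes "Poly_Mapping.keys s \<subseteq> carrier M \<times> carrier N"
  shows "cls s = \<zero>\<^bsub>T\<^esub> \<longleftrightarrow> s \<in> rels"
  using cls_eq_iff[OF assms, of 0] by simp

lemma cls_minus:
  assumes "Poly_Mapping.keys s \<subseteq> carrier M \<times> carrier N"
  shows "cls (- s) = \<ominus>\<^bsub>T\<^esub> cls s"
proof -
  have "cls (- s) \<oplus>\<^bsub>T\<^esub> cls s = cls (- s + s)"
    by (rule cls_add [symmetric]) (use assms in \<open>auto simp: keys_minus\<close>)
  then show ?thesis
    using assms by (intro T.minus_equality [symmetric]) (auto simp: keys_minus)
qed

lemma cls_diff:
  assumes "Poly_Mapping.keys s \<subseteq> carrier M \<times> carrier N"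
    "Poly_Mapping.keys t \<subseteq> carrier M \<times> carrier N"
  shows "cls (s - t) = cls s \<ominus>\<^bsub>T\<^esub> cls t"
  using cls_add[of s "- t"] cls_minus[of t] assms by (simp add: keys_minus T.minus_eq)

lemma pt_closed [simp, intro]:
  "x \<in> carrier M \<Longrightarrow> y \<in> carrier N \<Longrightarrow> pt x y \<in> carrier T"
  by (simp add: pure_tensor_def)

lemma gens_rels: "g \<in> gens \<Longrightarrow> g \<in> rels"
  by (simp add: rels_eq generate.incl)

lemma pt_eq_by_gen:
  assumes "s - t \<in> gens" "Poly_Mapping.keys s \<subseteq> carrier M \<times> carrier N"
    "Poly_Mapping.keys t \<subseteq> carrier M \<times> carrier N"
  shows "cls s = cls t"
  using assms gens_rels by (simp add: cls_eq_iff)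

lemma pt_add_l:
  assumes "x \<in> carrier M" "x' \<in> carrier M" "y \<in> carrier N"
  shows "pt (x \<oplus>\<^bsub>M\<^esub> x') y = pt x y \<oplus>\<^bsub>T\<^esub> pt x' y"
proof -
  have "cls (frag_of (x \<oplus>\<^bsub>M\<^esub> x', y)) = cls (frag_of (x, y) + frag_of (x', y))"
    by (rule pt_eq_by_gen) (use assms keys_add[of "frag_of (x,y)" "frag_of (x',y)"] in
      \<open>auto simp: gens_def diff_diff_eq [symmetric] simp del: diff_diff_eq\<close>)
  then show ?thesis using assms by (simp add: pure_tensor_def cls_add)
qed

lemma pt_add_r:
  assumes "x \<in> carrier M" "y \<in> carrier N" "y' \<in> carrier N"
  shows "pt x (y \<oplus>\<^bsub>N\<^esub> y') = pt x y \<oplus>\<^bsub>T\<^esub> pt x y'"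
proof -
  have "cls (frag_of (x, y \<oplus>\<^bsub>N\<^esub> y')) = cls (frag_of (x, y) + frag_of (x, y'))"
    by (rule pt_eq_by_gen) (use assms keys_add[of "frag_of (x,y)" "frag_of (x,y')"] in
      \<open>auto simp: gens_def diff_diff_eq [symmetric] simp del: diff_diff_eq\<close>)
  then show ?thesis using assms by (simp add: pure_tensor_def cls_add)
qed

lemma pt_smult:
  assumes "a \<in> carrier R" "x \<in> carrier M" "y \<in> carrier N"
  shows "pt (a \<odot>\<^bsub>M\<^esub> x) y = pt x (a \<odot>\<^bsub>N\<^esub> y)"
  unfolding pure_tensor_def
  by (rule pt_eq_by_gen) (use assms in \<open>auto simp: gens_def\<close>)

lemma pt_zero_l [simp]: "y \<in> carrier N \<Longrightarrow> pt \<zero>\<^bsub>M\<^esub> y = \<zero>\<^bsub>T\<^esub>"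
  using pt_add_l[of "\<zero>\<^bsub>M\<^esub>" "\<zero>\<^bsub>M\<^esub>" y] by (simp add: T.add.l_cancel_one')

lemma pt_zero_r [simp]: "x \<in> carrier M \<Longrightarrow> pt x \<zero>\<^bsub>N\<^esub> = \<zero>\<^bsub>T\<^esub>"
  using pt_add_r[of x "\<zero>\<^bsub>N\<^esub>" "\<zero>\<^bsub>N\<^esub>"] by (simp add: T.add.l_cancel_one')

lemma pt_minus_r: "x \<in> carrier M \<Longrightarrow> y \<in> carrier N \<Longrightarrow> pt x (\<ominus>\<^bsub>N\<^esub> y) = \<ominus>\<^bsub>T\<^esub> pt x y"
  using pt_add_r[of x "\<ominus>\<^bsub>N\<^esub> y" y] by (intro T.minus_equality [symmetric]) (auto simp: N.M.l_neg)

lemma pt_finsum_r: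
  assumes "finite I" "x \<in> carrier M" "f \<in> I \<rightarrow> carrier N"
  shows "pt x (\<Oplus>\<^bsub>N\<^esub>i\<in>I. f i) = (\<Oplus>\<^bsub>T\<^esub>i\<in>I. pt x (f i))"
  using assms(1,3)
  by (induction I rule: finite_induct) (use assms(2) in \<open>auto simp: pt_add_r Pi_def\<close>)

lemma pt_finsum_l:
  assumes "finite I" "y \<in> carrier N" "f \<in> I \<rightarrow> carrier M"
  shows "pt (\<Oplus>\<^bsub>M\<^esub>i\<in>I. f i) y = (\<Oplus>\<^bsub>T\<^esub>i\<in>I. pt (f i) y)"
  using assms(1,3)
  by (induction I rule: finite_induct) (use assms(2) in \<open>auto simp: pt_add_l Pi_def\<close>)

text \<open>Grouping by the first factor, elements are the sums \<open>tsum S c\<close>; this form can be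
  enlarged to any bigger finite \<open>S\<close>, so that several tensors share their first factors.\<close>

definition tsum :: "'c set \<Rightarrow> ('c \<Rightarrow> 'e) \<Rightarrow> ('c \<times> 'e \<Rightarrow>\<^sub>0 int) set" where
  "tsum S c = (\<Oplus>\<^bsub>T\<^esub>b\<in>S. pt b (c b))"

lemma tsum_closed [simp, intro]:
  "S \<subseteq> carrier M \<Longrightarrow> c \<in> S \<rightarrow> carrier N \<Longrightarrow> tsum S c \<in> carrier T"
  unfolding tsum_def by (rule T.finsum_closed) auto

lemma tsum_add:
  assumes "S \<subseteq> carrier M" "c \<in> S \<rightarrow> carrier N" "d \<in> S \<rightarrow> carrier N"
  shows "tsum S (\<lambda>b. c b \<oplus>\<^bsub>N\<^esub> d b) = tsum S c \<oplus>\<^bsub>T\<^esub> tsum S d"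
proof -
  have "tsum S (\<lambda>b. c b \<oplus>\<^bsub>N\<^esub> d b) = (\<Oplus>\<^bsub>T\<^esub>b\<in>S. pt b (c b) \<oplus>\<^bsub>T\<^esub> pt b (d b))"
    unfolding tsum_def using assms by (intro T.finsum_cong') (auto simp: Pi_def pt_add_r)
  also have "\<dots> = tsum S c \<oplus>\<^bsub>T\<^esub> tsum S d"
    unfolding tsum_def using assms by (intro T.finsum_addf) auto
  finally show ?thesis .
qed

lemma tsum_minus:
  assumes "finite S" "S \<subseteq> carrier M" "c \<in> S \<rightarrow> carrier N"
  shows "tsum S (\<lambda>b. \<ominus>\<^bsub>N\<^esub> c b) = \<ominus>\<^bsub>T\<^esub> tsum S c"
proof -
  have "tsum S (\<lambda>b. \<ominus>\<^bsub>N\<^esub> c b) = (\<Oplus>\<^bsub>T\<^esub>b\<in>S. \<ominus>\<^bsub>T\<^esub> pt b (c b))"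
    unfolding tsum_def using assms by (intro T.finsum_cong') (auto intro!: pt_minus_r)
  also have "\<dots> = \<ominus>\<^bsub>T\<^esub> tsum S c"
    unfolding tsum_def using assms by (intro T.finsum_minus) auto
  finally show ?thesis .
qed

lemma tsum_enlarge:
  assumes "finite S'" "S \<subseteq> S'" "S' \<subseteq> carrier M" "c \<in> S \<rightarrow> carrier N"
  shows "tsum S' (\<lambda>b. if b \<in> S then c b else \<zero>\<^bsub>N\<^esub>) = tsum S c"
proof -
  have "tsum S' (\<lambda>b. if b \<in> S then c b else \<zero>\<^bsub>N\<^esub>)
      = (\<Oplus>\<^bsub>T\<^esub>b\<in>S. pt b (if b \<in> S then c b else \<zero>\<^bsub>N\<^esub>))"
    unfolding tsum_def using assms by (intro T.finsum_mono_zero) (auto simp: Pi_def subset_iff)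
  also have "\<dots> = tsum S c"
    unfolding tsum_def using assms by (intro T.finsum_cong') (auto simp: Pi_def subset_iff)
  finally show ?thesis .
qed

lemma tsum_single: "x \<in> carrier M \<Longrightarrow> y \<in> carrier N \<Longrightarrow> tsum {x} (\<lambda>_. y) = pt x y"
  by (simp add: tsum_def)

text \<open>Induction over the free abelian group. The difference of two representations is formed
  over the union of their index sets, where coefficients at the same first factor are
  subtracted.\<close>

lemma tsum_induct_rep:
  assumes "Poly_Mapping.keys t \<subseteq> carrier M \<times> carrier N"
  shows "\<exists>S c. finite S \<and> S \<subseteq> carrier M \<and> c \<in> S \<rightarrow> carrier N \<and> cls t = tsum S c"
  using assms
proof (induction t rule: free_Abelian_group_induct[where S = "carrier M \<times> carrier N", case_names keys zero diff one])
  case keys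
  show ?case by (rule assms)
next
  case zero
  show ?case by (rule exI[of _ "{}"]) (simp add: tsum_def)
next
  case (one p)
  then show ?case
    by (intro exI[of _ "{fst p}"] exI[of _ "\<lambda>_. snd p"]) (auto simp: tsum_single pure_tensor_def)
next
  case (diff s t)
  then obtain S c S' c' where *: "finite S" "S \<subseteq> carrier M" "c \<in> S \<rightarrow> carrier N" "cls s = tsum S c"
    "finite S'" "S' \<subseteq> carrier M" "c' \<in> S' \<rightarrow> carrier N" "cls t = tsum S' c'"
    by blast
  let ?U = "S \<union> S'"
  let ?c = "\<lambda>b. if b \<in> S then c b else \<zero>\<^bsub>N\<^esub>" and ?c' = "\<lambda>b. if b \<in> S' then c' b else \<zero>\<^bsub>N\<^esub>"
  have cc: "?c \<in> ?U \<rightarrow> carrier N" "?c' \<in> ?U \<rightarrow> carrier N" using * by auto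
  have "cls (s - t) = cls s \<ominus>\<^bsub>T\<^esub> cls t" using diff by (simp add: cls_diff)
  also have "\<dots> = tsum ?U ?c \<oplus>\<^bsub>T\<^esub> \<ominus>\<^bsub>T\<^esub> tsum ?U ?c'"
    using * by (simp add: T.minus_eq tsum_enlarge)
  also have "\<dots> = tsum ?U ?c \<oplus>\<^bsub>T\<^esub> tsum ?U (\<lambda>b. \<ominus>\<^bsub>N\<^esub> ?c' b)"
    by (subst tsum_minus) (use *(1,2,5,6) cc in blast)+
  also have "\<dots> = tsum ?U (\<lambda>b. ?c b \<oplus>\<^bsub>N\<^esub> \<ominus>\<^bsub>N\<^esub> ?c' b)"
    by (subst tsum_add) (use *(1,2,5,6) cc in \<open>auto simp: Pi_def\<close>)
  finally have "cls (s - t) = tsum ?U (\<lambda>b. ?c b \<oplus>\<^bsub>N\<^esub> \<ominus>\<^bsub>N\<^esub> ?c' b)" .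
  moreover have "finite ?U" "?U \<subseteq> carrier M" "(\<lambda>b. ?c b \<oplus>\<^bsub>N\<^esub> \<ominus>\<^bsub>N\<^esub> ?c' b) \<in> ?U \<rightarrow> carrier N"
    using *(1,2,5,6) cc by (blast, blast, simp add: Pi_def)
  ultimately show ?case by (intro exI conjI)
qed


lemma tsum_rep:
  assumes "X \<in> carrier T"
  obtains S c where "finite S" "S \<subseteq> carrier M" "c \<in> S \<rightarrow> carrier N" "X = tsum S c"
  using assms tsum_induct_rep by (metis cls_surj)

text \<open>A lift to the free abelian group, needed because vanishing is decided there, by
  membership in \<open>rels\<close>.\<close>

lemma tsum_cls:
  assumes "finite S" "S \<subseteq> carrier M" "c \<in> S \<rightarrow> carrier N"
  shows "tsum S c = cls (\<Sum>b\<in>S. frag_of (b, c b)) \<and>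
    Poly_Mapping.keys (\<Sum>b\<in>S. frag_of (b, c b)) \<subseteq> carrier M \<times> carrier N"
  using assms
proof (induction S rule: finite_induct)
  case (insert x F)
  then have *: "tsum F c = cls (\<Sum>b\<in>F. frag_of (b, c b))"
    "Poly_Mapping.keys (\<Sum>b\<in>F. frag_of (b, c b)) \<subseteq> carrier M \<times> carrier N" "c \<in> F \<rightarrow> carrier N"
    by auto
  have "tsum (insert x F) c = pt x (c x) \<oplus>\<^bsub>T\<^esub> tsum F c"
    using insert unfolding tsum_def by (intro T.finsum_insert) auto
  then show ?case
    using insert * keys_add[of "frag_of (x, c x)" "\<Sum>b\<in>F. frag_of (b, c b)"]
    by (auto simp: cls_add pure_tensor_def)
qed (simp add: tsum_def)

text \<open>A tensor vanishes by finitely many of the defining relations, so a functional on \<open>M\<close> that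
  is linear only where these relations need it still kills the tensor.\<close>

lemma rels_local:
  assumes "t \<in> rels"
    and \<Phi>: "\<And>a. a \<in> carrier M \<rightarrow> carrier R \<Longrightarrow>
      \<Phi> a \<in> hom (free_Abelian_group (carrier M \<times> carrier N)) (add_monoid N)"
    and \<Phi>_of: "\<And>a x y. a \<in> carrier M \<rightarrow> carrier R \<Longrightarrow> x \<in> carrier M \<Longrightarrow> y \<in> carrier N \<Longrightarrow>
      \<Phi> a (frag_of (x, y)) = a x \<odot>\<^bsub>N\<^esub> y"
  shows "\<exists>P Q. finite P \<and> finite Q \<and> P \<subseteq> carrier M \<times> carrier M \<and> Q \<subseteq> carrier R \<times> carrier M \<and>
    (\<forall>a\<in>carrier M \<rightarrow> carrier R. (\<forall>(x, y)\<in>P. a (x \<oplus>\<^bsub>M\<^esub> y) = a x \<oplus>\<^bsub>R\<^esub> a y) \<and>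
      (\<forall>(r, x)\<in>Q. a (r \<odot>\<^bsub>M\<^esub> x) = r \<otimes>\<^bsub>R\<^esub> a x) \<longrightarrow> \<Phi> a t = \<zero>\<^bsub>N\<^esub>)"
    (is "?P t")
proof -
  let ?F = "free_Abelian_group (carrier M \<times> carrier N)"
  have hom: "group_hom ?F (add_monoid N) (\<Phi> a)" if "a \<in> carrier M \<rightarrow> carrier R" for a
    using \<Phi>[OF that] by (simp add: group_hom_def group_hom_axioms_def N.M.a_group)
  have F: "\<Phi> a (s + t) = \<Phi> a s \<oplus>\<^bsub>N\<^esub> \<Phi> a t" "\<Phi> a (- s) = \<ominus>\<^bsub>N\<^esub> \<Phi> a s" "\<Phi> a s \<in> carrier N"
    if "a \<in> carrier M \<rightarrow> carrier R" "Poly_Mapping.keys s \<subseteq> carrier M \<times> carrier N"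
      "Poly_Mapping.keys t \<subseteq> carrier M \<times> carrier N" for a s t
    using group_hom.hom_mult[OF hom, of a s t] group_hom.hom_inv[OF hom, of a s] that
      group_hom.hom_closed[OF hom, of a s]
    by (auto simp: a_inv_def)
  have F0: "\<Phi> a 0 = \<zero>\<^bsub>N\<^esub>" if "a \<in> carrier M \<rightarrow> carrier R" for a
    using group_hom.hom_one[OF hom[OF that]] by simp
  have Fd: "\<Phi> a (s - t) = \<Phi> a s \<ominus>\<^bsub>N\<^esub> \<Phi> a t"
    if "a \<in> carrier M \<rightarrow> carrier R" "Poly_Mapping.keys s \<subseteq> carrier M \<times> carrier N"
      "Poly_Mapping.keys t \<subseteq> carrier M \<times> carrier N" for a s t
    using F(1)[of a s "- t"] F(2)[of a t 0] that by (simp add: N.M.minus_eq)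
  have Fdd: "\<Phi> a (frag_of p - frag_of q - frag_of r) = \<Phi> a (frag_of p) \<ominus>\<^bsub>N\<^esub> \<Phi> a (frag_of q) \<ominus>\<^bsub>N\<^esub> \<Phi> a (frag_of r)"
    if "a \<in> carrier M \<rightarrow> carrier R" "{p, q, r} \<subseteq> carrier M \<times> carrier N" for a p q r
    using that keys_diff[of "frag_of p" "frag_of q"]
      Fd[OF that(1), of "frag_of p - frag_of q" "frag_of r"] Fd[OF that(1), of "frag_of p" "frag_of q"]
    by auto
  \<comment> \<open>Additivity in the first factor contributes one pair to \<open>P\<close>,
    balancedness one pair to \<open>Q\<close>. Additivity in the second factor contributes nothing,
    since it is respected by every \<open>a\<close>, linear or not.\<close>
  have gen: "?P g" if "g \<in> gens" for g
    using that unfolding gens_def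
  proof (elim UnE CollectE exE conjE)
    fix x x' y assume g: "g = frag_of (x \<oplus>\<^bsub>M\<^esub> x', y) - frag_of (x, y) - frag_of (x', y)"
      and c: "x \<in> carrier M" "x' \<in> carrier M" "y \<in> carrier N"
    have "\<Phi> a g = \<zero>\<^bsub>N\<^esub>" if a: "a \<in> carrier M \<rightarrow> carrier R" "a (x \<oplus>\<^bsub>M\<^esub> x') = a x \<oplus>\<^bsub>R\<^esub> a x'" for a
    proof -
      have "\<Phi> a g = a (x \<oplus>\<^bsub>M\<^esub> x') \<odot>\<^bsub>N\<^esub> y \<ominus>\<^bsub>N\<^esub> a x \<odot>\<^bsub>N\<^esub> y \<ominus>\<^bsub>N\<^esub> a x' \<odot>\<^bsub>N\<^esub> y"
        using c a(1) unfolding g by (subst Fdd) (auto simp: \<Phi>_of)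
      moreover have "a x \<in> carrier R" "a x' \<in> carrier R" using a c by auto
      ultimately show ?thesis
        using a(2) c by (simp add: N.smult_l_distr N.M.add_diff_diff)
    qed
    then show ?thesis using c
      by (intro exI[of _ "{(x, x')}"] exI[of _ "{}"]) auto
  next
    fix x y y' assume g: "g = frag_of (x, y \<oplus>\<^bsub>N\<^esub> y') - frag_of (x, y) - frag_of (x, y')"
      and c: "x \<in> carrier M" "y \<in> carrier N" "y' \<in> carrier N"
    have "\<Phi> a g = \<zero>\<^bsub>N\<^esub>" if a: "a \<in> carrier M \<rightarrow> carrier R" for a
    proof -
      have "\<Phi> a g = a x \<odot>\<^bsub>N\<^esub> (y \<oplus>\<^bsub>N\<^esub> y') \<ominus>\<^bsub>N\<^esub> a x \<odot>\<^bsub>N\<^esub> y \<ominus>\<^bsub>N\<^esub> a x \<odot>\<^bsub>N\<^esub> y'"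
        using c a unfolding g by (subst Fdd) (auto simp: \<Phi>_of)
      moreover have "a x \<in> carrier R" using a c by auto
      ultimately show ?thesis
        using c by (simp add: N.smult_r_distr N.M.add_diff_diff)
    qed
    then show ?thesis by (intro exI[of _ "{}"]) auto
  next
    fix r x y assume g: "g = frag_of (r \<odot>\<^bsub>M\<^esub> x, y) - frag_of (x, r \<odot>\<^bsub>N\<^esub> y)"
      and c: "r \<in> carrier R" "x \<in> carrier M" "y \<in> carrier N"
    have "\<Phi> a g = \<zero>\<^bsub>N\<^esub>" if a: "a \<in> carrier M \<rightarrow> carrier R" "a (r \<odot>\<^bsub>M\<^esub> x) = r \<otimes>\<^bsub>R\<^esub> a x" for a
    proof -
      have ax: "a x \<in> carrier R" using a c by auto
      have "\<Phi> a g = a (r \<odot>\<^bsub>M\<^esub> x) \<odot>\<^bsub>N\<^esub> y \<ominus>\<^bsub>N\<^esub> a x \<odot>\<^bsub>N\<^esub> (r \<odot>\<^bsub>N\<^esub> y)"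
        using c a unfolding g by (auto simp: Fd \<Phi>_of)
      also have "\<dots> = \<zero>\<^bsub>N\<^esub>"
        using a(2) c ax by (simp add: N.smult_assoc1 [symmetric] M.R.m_comm N.M.r_neg N.M.minus_eq)
      finally show ?thesis .
    qed
    then show ?thesis using c
      by (intro exI[of _ "{}"] exI[of _ "{(r, x)}"]) auto
  qed
  have keys: "Poly_Mapping.keys g \<subseteq> carrier M \<times> carrier N" if "g \<in> rels" for g
    using Q.a_subset that pair_simps(1) by blast
  from assms(1) show ?thesis
    unfolding rels_eq
  proof (induction t rule: generate.induct)
    case one
    then show ?case using F0 by (intro exI[of _ "{}"]) (auto simp: pair_add_monoid)
  next
    case (incl h)
    then show ?case by (rule gen)
  next
    case (inv h)
    then have "Poly_Mapping.keys h \<subseteq> carrier M \<times> carrier N" using gens_rels keys by blast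
    then have k: "Poly_Mapping.keys h \<subseteq> carrier M \<times> carrier N" .
    then have e: "inv\<^bsub>add_monoid (pair_ring M N)\<^esub> h = - h"
      unfolding pair_add_monoid by (rule inv_free_Abelian_group)
    have "\<Phi> a (- h) = \<zero>\<^bsub>N\<^esub>" if "a \<in> carrier M \<rightarrow> carrier R" "\<Phi> a h = \<zero>\<^bsub>N\<^esub>" for a
      using F(2)[OF that(1) k k] that(2) N.M.a_inv_zero by metis
    moreover obtain P Q where "finite P" "finite Q" "P \<subseteq> carrier M \<times> carrier M" "Q \<subseteq> carrier R \<times> carrier M"
      "\<forall>a\<in>carrier M \<rightarrow> carrier R. (\<forall>(x, y)\<in>P. a (x \<oplus>\<^bsub>M\<^esub> y) = a x \<oplus>\<^bsub>R\<^esub> a y) \<and>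
        (\<forall>(r, x)\<in>Q. a (r \<odot>\<^bsub>M\<^esub> x) = r \<otimes>\<^bsub>R\<^esub> a x) \<longrightarrow> \<Phi> a h = \<zero>\<^bsub>N\<^esub>"
      using gen[OF inv] by (elim exE conjE)
    ultimately show ?case
      unfolding e by (intro exI[of _ P] exI[of _ Q] conjI ballI impI) auto
  next
    case (eng h1 h2)
    have k: "Poly_Mapping.keys h1 \<subseteq> carrier M \<times> carrier N" "Poly_Mapping.keys h2 \<subseteq> carrier M \<times> carrier N"
      using eng.hyps keys unfolding rels_eq by blast+
    obtain P1 Q1 where *: "finite P1" "finite Q1" "P1 \<subseteq> carrier M \<times> carrier M" "Q1 \<subseteq> carrier R \<times> carrier M"
      "\<forall>a\<in>carrier M \<rightarrow> carrier R. (\<forall>(x, y)\<in>P1. a (x \<oplus>\<^bsub>M\<^esub> y) = a x \<oplus>\<^bsub>R\<^esub> a y) \<and>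
        (\<forall>(r, x)\<in>Q1. a (r \<odot>\<^bsub>M\<^esub> x) = r \<otimes>\<^bsub>R\<^esub> a x) \<longrightarrow> \<Phi> a h1 = \<zero>\<^bsub>N\<^esub>"
      using eng.IH(1) by (elim exE conjE)
    obtain P2 Q2 where **: "finite P2" "finite Q2" "P2 \<subseteq> carrier M \<times> carrier M" "Q2 \<subseteq> carrier R \<times> carrier M"
      "\<forall>a\<in>carrier M \<rightarrow> carrier R. (\<forall>(x, y)\<in>P2. a (x \<oplus>\<^bsub>M\<^esub> y) = a x \<oplus>\<^bsub>R\<^esub> a y) \<and>
        (\<forall>(r, x)\<in>Q2. a (r \<odot>\<^bsub>M\<^esub> x) = r \<otimes>\<^bsub>R\<^esub> a x) \<longrightarrow> \<Phi> a h2 = \<zero>\<^bsub>N\<^esub>"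
      using eng.IH(2) by (elim exE conjE)
    \<comment> \<open>A sum of two relations inherits the requirements of both, so finiteness
      survives the induction.\<close>
    show ?case
    proof (intro exI[of _ "P1 \<union> P2"] exI[of _ "Q1 \<union> Q2"] conjI ballI impI)
      fix a assume a: "a \<in> carrier M \<rightarrow> carrier R"
        and "(\<forall>(x, y)\<in>P1 \<union> P2. a (x \<oplus>\<^bsub>M\<^esub> y) = a x \<oplus>\<^bsub>R\<^esub> a y) \<and>
          (\<forall>(r, x)\<in>Q1 \<union> Q2. a (r \<odot>\<^bsub>M\<^esub> x) = r \<otimes>\<^bsub>R\<^esub> a x)"
      then have "\<Phi> a h1 = \<zero>\<^bsub>N\<^esub>" "\<Phi> a h2 = \<zero>\<^bsub>N\<^esub>"
        using *(5) **(5) a by blast+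
      then show "\<Phi> a (h1 \<otimes>\<^bsub>add_monoid (pair_ring M N)\<^esub> h2) = \<zero>\<^bsub>N\<^esub>"
        using F(1)[OF a k] by (simp add: pair_add_monoid)
    qed (use *(1-4) **(1-4) in auto)
  qed
qed

text \<open>The functionals asked for by \<open>rels_local\<close> exist for every function
  \<open>a\<close> on \<open>M\<close>, by freeness: extend \<open>(x, y) \<mapsto> a x y\<close> to
  formal sums. On a tensor in the form \<open>tsum\<close> they take the value that appears
  here.\<close>

lemma tsum_zero_local:
  assumes S: "finite S" "S \<subseteq> carrier M" "c \<in> S \<rightarrow> carrier N" and z: "tsum S c = \<zero>\<^bsub>T\<^esub>"
  shows "\<exists>P Q. finite P \<and> finite Q \<and> P \<subseteq> carrier M \<times> carrier M \<and> Q \<subseteq> carrier R \<times> carrier M \<and>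
    (\<forall>a\<in>carrier M \<rightarrow> carrier R. (\<forall>(x, y)\<in>P. a (x \<oplus>\<^bsub>M\<^esub> y) = a x \<oplus>\<^bsub>R\<^esub> a y) \<and>
      (\<forall>(r, x)\<in>Q. a (r \<odot>\<^bsub>M\<^esub> x) = r \<otimes>\<^bsub>R\<^esub> a x) \<longrightarrow> (\<Oplus>\<^bsub>N\<^esub>b\<in>S. a b \<odot>\<^bsub>N\<^esub> c b) = \<zero>\<^bsub>N\<^esub>)"
proof -
  let ?F = "free_Abelian_group (carrier M \<times> carrier N)"
  have "\<exists>h. h \<in> hom ?F (add_monoid N) \<and> (\<forall>x\<in>carrier M. \<forall>y\<in>carrier N. h (frag_of (x, y)) = a x \<odot>\<^bsub>N\<^esub> y)"
    if a: "a \<in> carrier M \<rightarrow> carrier R" for a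
  proof -
    obtain h where "h \<in> hom ?F (add_monoid N)"
      "\<And>p. p \<in> carrier M \<times> carrier N \<Longrightarrow> h (frag_of p) = (\<lambda>(x, y). a x \<odot>\<^bsub>N\<^esub> y) p"
      by (rule comm_group.free_Abelian_group_universal[OF N.M.a_comm_group, of "\<lambda>(x, y). a x \<odot>\<^bsub>N\<^esub> y" "carrier M \<times> carrier N"])
        (use a in \<open>auto simp: Pi_def image_subset_iff\<close>)
    then show ?thesis by (intro exI[of _ h]) auto
  qed
  then obtain \<Phi> where \<Phi>: "\<And>a. a \<in> carrier M \<rightarrow> carrier R \<Longrightarrow> \<Phi> a \<in> hom ?F (add_monoid N)"
    "\<And>a x y. a \<in> carrier M \<rightarrow> carrier R \<Longrightarrow> x \<in> carrier M \<Longrightarrow> y \<in> carrier N \<Longrightarrow>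
      \<Phi> a (frag_of (x, y)) = a x \<odot>\<^bsub>N\<^esub> y"
    by metis
  let ?t = "\<Sum>b\<in>S. frag_of (b, c b)"
  have t: "tsum S c = cls ?t" "Poly_Mapping.keys ?t \<subseteq> carrier M \<times> carrier N"
    using tsum_cls[OF S] by blast+
  have "?t \<in> rels" using cls_zero_iff[OF t(2)] t(1) z by metis
  then have "\<exists>P Q. finite P \<and> finite Q \<and> P \<subseteq> carrier M \<times> carrier M \<and> Q \<subseteq> carrier R \<times> carrier M \<and>
    (\<forall>a\<in>carrier M \<rightarrow> carrier R. (\<forall>(x, y)\<in>P. a (x \<oplus>\<^bsub>M\<^esub> y) = a x \<oplus>\<^bsub>R\<^esub> a y) \<and>
      (\<forall>(r, x)\<in>Q. a (r \<odot>\<^bsub>M\<^esub> x) = r \<otimes>\<^bsub>R\<^esub> a x) \<longrightarrow> \<Phi> a ?t = \<zero>\<^bsub>N\<^esub>)"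
    by (rule rels_local) (rule \<Phi>; assumption)+
  then
  obtain P Q where PQ: "finite P" "finite Q" "P \<subseteq> carrier M \<times> carrier M" "Q \<subseteq> carrier R \<times> carrier M"
    "\<forall>a\<in>carrier M \<rightarrow> carrier R. (\<forall>(x, y)\<in>P. a (x \<oplus>\<^bsub>M\<^esub> y) = a x \<oplus>\<^bsub>R\<^esub> a y) \<and>
      (\<forall>(r, x)\<in>Q. a (r \<odot>\<^bsub>M\<^esub> x) = r \<otimes>\<^bsub>R\<^esub> a x) \<longrightarrow> \<Phi> a ?t = \<zero>\<^bsub>N\<^esub>"
    by (elim exE conjE)
  have "\<Phi> a ?t = (\<Oplus>\<^bsub>N\<^esub>b\<in>S. a b \<odot>\<^bsub>N\<^esub> c b)" if a: "a \<in> carrier M \<rightarrow> carrier R" for a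
  proof -
    interpret h: group_hom ?F "add_monoid N" "\<Phi> a"
      using \<Phi>(1)[OF a] by (simp add: group_hom_def group_hom_axioms_def N.M.a_group)
    show ?thesis
      using S
    proof (induction S rule: finite_induct)
      case empty
      show ?case using h.hom_one by simp
    next
      case (insert x F)
      have "Poly_Mapping.keys (\<Sum>b\<in>F. frag_of (b, c b)) \<subseteq> carrier M \<times> carrier N"
        using tsum_cls[of F c] insert by auto
      then have "\<Phi> a (frag_of (x, c x) + (\<Sum>b\<in>F. frag_of (b, c b)))
          = \<Phi> a (frag_of (x, c x)) \<oplus>\<^bsub>N\<^esub> \<Phi> a (\<Sum>b\<in>F. frag_of (b, c b))"
        using h.hom_mult[of "frag_of (x, c x)" "\<Sum>b\<in>F. frag_of (b, c b)"] insert.prems by auto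
      moreover have "(\<Oplus>\<^bsub>N\<^esub>b\<in>insert x F. a b \<odot>\<^bsub>N\<^esub> c b) = a x \<odot>\<^bsub>N\<^esub> c x \<oplus>\<^bsub>N\<^esub> (\<Oplus>\<^bsub>N\<^esub>b\<in>F. a b \<odot>\<^bsub>N\<^esub> c b)"
        by (rule N.M.finsum_insert) (use insert a in \<open>auto simp: Pi_def subset_iff\<close>)
      ultimately show ?case
        using insert \<Phi>(2)[OF a] by auto
    qed
  qed
  note * = this
  show ?thesis
  proof (intro exI[of _ P] exI[of _ Q] conjI ballI impI)
    fix a assume a: "a \<in> carrier M \<rightarrow> carrier R" and lin: "(\<forall>(x, y)\<in>P. a (x \<oplus>\<^bsub>M\<^esub> y) = a x \<oplus>\<^bsub>R\<^esub> a y) \<and>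
      (\<forall>(r, x)\<in>Q. a (r \<odot>\<^bsub>M\<^esub> x) = r \<otimes>\<^bsub>R\<^esub> a x)"
    have "\<Phi> a ?t = \<zero>\<^bsub>N\<^esub>" by (rule PQ(5)[rule_format, OF a]) (use lin in blast)+
    then show "(\<Oplus>\<^bsub>N\<^esub>b\<in>S. a b \<odot>\<^bsub>N\<^esub> c b) = \<zero>\<^bsub>N\<^esub>" using *[OF a] by (rule trans[OF sym, rotated])
  qed (rule PQ)+
qed

end

section \<open>Trivial relations and flatness\<close>

text \<open>The equational criterion for flatness, relative to a submodule \<open>H\<close>: it expresses
  flatness of \<open>M / H\<close> without forming the quotient.\<close>

definition trivial_relations ::
    "('a, 'r) ring_scheme \<Rightarrow> ('a, 'm, 's) module_scheme \<Rightarrow> 'm set \<Rightarrow> bool" where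
  "trivial_relations R M H \<longleftrightarrow>
    (\<forall>(q::nat) \<rho> m. (\<forall>s. \<rho> s \<in> carrier R) \<longrightarrow> (\<forall>s. m s \<in> carrier M) \<longrightarrow>
      (\<Oplus>\<^bsub>M\<^esub>s\<in>{..<q}. \<rho> s \<odot>\<^bsub>M\<^esub> m s) \<in> H \<longrightarrow>
      (\<exists>(r::nat) w g. (\<forall>u. w u \<in> carrier M) \<and> (\<forall>s u. g s u \<in> carrier R) \<and>
        (\<forall>s<q. m s \<ominus>\<^bsub>M\<^esub> (\<Oplus>\<^bsub>M\<^esub>u\<in>{..<r}. g s u \<odot>\<^bsub>M\<^esub> w u) \<in> H) \<and>
        (\<forall>u<r. (\<Oplus>\<^bsub>R\<^esub>s\<in>{..<q}. \<rho> s \<otimes>\<^bsub>R\<^esub> g s u) = \<zero>\<^bsub>R\<^esub>)))"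

lemma trivial_relationsD:
  fixes q :: nat
  assumes "trivial_relations R M H" "\<And>s. \<rho> s \<in> carrier R" "\<And>s. m s \<in> carrier M"
    "(\<Oplus>\<^bsub>M\<^esub>s\<in>{..<q}. \<rho> s \<odot>\<^bsub>M\<^esub> m s) \<in> H"
  obtains r :: nat and w g where "\<And>u. w u \<in> carrier M" "\<And>s u. g s u \<in> carrier R"
    "\<And>s. s < q \<Longrightarrow> m s \<ominus>\<^bsub>M\<^esub> (\<Oplus>\<^bsub>M\<^esub>u\<in>{..<r}. g s u \<odot>\<^bsub>M\<^esub> w u) \<in> H"
    "\<And>u. u < r \<Longrightarrow> (\<Oplus>\<^bsub>R\<^esub>s\<in>{..<q}. \<rho> s \<otimes>\<^bsub>R\<^esub> g s u) = \<zero>\<^bsub>R\<^esub>"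
proof -
  note ex = assms(1)[unfolded trivial_relations_def, rule_format, OF assms(2-4)]
  from ex obtain r :: nat and w g where *: "\<forall>u. w u \<in> carrier M" "\<forall>s u. g s u \<in> carrier R"
    "\<forall>s<q. m s \<ominus>\<^bsub>M\<^esub> (\<Oplus>\<^bsub>M\<^esub>u\<in>{..<r}. g s u \<odot>\<^bsub>M\<^esub> w u) \<in> H"
    "\<forall>u<r. (\<Oplus>\<^bsub>R\<^esub>s\<in>{..<q}. \<rho> s \<otimes>\<^bsub>R\<^esub> g s u) = \<zero>\<^bsub>R\<^esub>"
    by (elim exE conjE)
  show ?thesis by (rule that[of w g r]) (use * in blast)+
qed

text \<open>Associativity of the product of a row, a matrix and a column; it composes two changes of
  generators.\<close>

lemma (in cring) sum_prod_assoc: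
  assumes "finite I" "finite J" "\<And>i. i \<in> I \<Longrightarrow> k i \<in> carrier R"
    "\<And>i j. i \<in> I \<Longrightarrow> j \<in> J \<Longrightarrow> a i j \<in> carrier R" "\<And>j. j \<in> J \<Longrightarrow> g j \<in> carrier R"
  shows "(\<Oplus>i\<in>I. k i \<otimes> (\<Oplus>j\<in>J. a i j \<otimes> g j)) = (\<Oplus>j\<in>J. (\<Oplus>i\<in>I. k i \<otimes> a i j) \<otimes> g j)"
proof -
  have "(\<Oplus>i\<in>I. k i \<otimes> (\<Oplus>j\<in>J. a i j \<otimes> g j)) = (\<Oplus>i\<in>I. \<Oplus>j\<in>J. k i \<otimes> a i j \<otimes> g j)"
    using assms by (intro finsum_cong') (auto simp: finsum_rdistr m_assoc Pi_def intro!: finsum_cong' finsum_closed)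
  also have "\<dots> = (\<Oplus>j\<in>J. \<Oplus>i\<in>I. k i \<otimes> a i j \<otimes> g j)"
    using assms by (intro finsum_swap) auto
  also have "\<dots> = (\<Oplus>j\<in>J. (\<Oplus>i\<in>I. k i \<otimes> a i j) \<otimes> g j)"
    using assms by (intro finsum_cong') (auto simp: finsum_ldistr Pi_def intro!: finsum_closed)
  finally show ?thesis .
qed

section \<open>Linear combinations modulo a submodule\<close>

context module
begin

lemma smult_sum_assoc:
  assumes "finite I" "finite J" "\<And>i. i \<in> I \<Longrightarrow> k i \<in> carrier R"
    "\<And>i j. i \<in> I \<Longrightarrow> j \<in> J \<Longrightarrow> a i j \<in> carrier R" "\<And>j. j \<in> J \<Longrightarrow> w j \<in> carrier M"
  shows "(\<Oplus>\<^bsub>M\<^esub>i\<in>I. k i \<odot>\<^bsub>M\<^esub> (\<Oplus>\<^bsub>M\<^esub>j\<in>J. a i j \<odot>\<^bsub>M\<^esub> w j)) = (\<Oplus>\<^bsub>M\<^esub>j\<in>J. (\<Oplus>\<^bsub>R\<^esub>i\<in>I. k i \<otimes>\<^bsub>R\<^esub> a i j) \<odot>\<^bsub>M\<^esub> w j)"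
proof -
  have "(\<Oplus>\<^bsub>M\<^esub>i\<in>I. k i \<odot>\<^bsub>M\<^esub> (\<Oplus>\<^bsub>M\<^esub>j\<in>J. a i j \<odot>\<^bsub>M\<^esub> w j)) = (\<Oplus>\<^bsub>M\<^esub>i\<in>I. \<Oplus>\<^bsub>M\<^esub>j\<in>J. (k i \<otimes>\<^bsub>R\<^esub> a i j) \<odot>\<^bsub>M\<^esub> w j)"
    using assms by (intro M.finsum_cong') (auto simp: finsum_smult_ldistr smult_assoc1 Pi_def intro!: M.finsum_cong' M.finsum_closed)
  also have "\<dots> = (\<Oplus>\<^bsub>M\<^esub>j\<in>J. \<Oplus>\<^bsub>M\<^esub>i\<in>I. (k i \<otimes>\<^bsub>R\<^esub> a i j) \<odot>\<^bsub>M\<^esub> w j)"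
    using assms by (intro M.finsum_swap) auto
  also have "\<dots> = (\<Oplus>\<^bsub>M\<^esub>j\<in>J. (\<Oplus>\<^bsub>R\<^esub>i\<in>I. k i \<otimes>\<^bsub>R\<^esub> a i j) \<odot>\<^bsub>M\<^esub> w j)"
    using assms by (intro M.finsum_cong') (auto simp: smult_finsum_ldistr Pi_def intro!: M.finsum_closed)
  finally show ?thesis .
qed

lemma smult_diff: "r \<in> carrier R \<Longrightarrow> x \<in> carrier M \<Longrightarrow> y \<in> carrier M \<Longrightarrow>
    r \<odot>\<^bsub>M\<^esub> (x \<ominus>\<^bsub>M\<^esub> y) = r \<odot>\<^bsub>M\<^esub> x \<ominus>\<^bsub>M\<^esub> r \<odot>\<^bsub>M\<^esub> y"
  by (simp add: M.minus_eq smult_r_distr smult_r_minus)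

lemma sum_diff:
  assumes "finite I" "f \<in> I \<rightarrow> carrier M" "g \<in> I \<rightarrow> carrier M"
  shows "(\<Oplus>\<^bsub>M\<^esub>i\<in>I. f i \<ominus>\<^bsub>M\<^esub> g i) = (\<Oplus>\<^bsub>M\<^esub>i\<in>I. f i) \<ominus>\<^bsub>M\<^esub> (\<Oplus>\<^bsub>M\<^esub>i\<in>I. g i)"
  using assms by (simp add: M.minus_eq M.finsum_addf M.finsum_minus Pi_def)

lemma submodule_finsum:
  assumes "submodule H R M" "finite I" "\<And>i. i \<in> I \<Longrightarrow> f i \<in> H"
  shows "(\<Oplus>\<^bsub>M\<^esub>i\<in>I. f i) \<in> H"
proof (rule M.finsum_mem)
  show "\<zero>\<^bsub>M\<^esub> \<in> H" using assms(1) by (metis submodule.axioms(1) subgroup.one_closed monoid.simps(2))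
qed (use assms submoduleE[OF assms(1)] in auto)

lemma submodule_zero:
  assumes "submodule H R M"
  shows "\<zero>\<^bsub>M\<^esub> \<in> H"
  using submodule_finsum[OF assms, of "{}"] by simp

lemma submodule_diff:
  assumes "submodule H R M" "x \<in> H" "y \<in> H"
  shows "x \<ominus>\<^bsub>M\<^esub> y \<in> H"
  using submoduleE[OF assms(1)] assms by (simp add: M.minus_eq)

text \<open>Congruence modulo \<open>H\<close> passes to linear combinations; this replaces
  computing in the quotient \<open>M / H\<close>.\<close>

lemma submodule_sum_smult_diff:
  assumes H: "submodule H R M" and I: "finite I" and k: "\<And>i. i \<in> I \<Longrightarrow> k i \<in> carrier R"
    and xy: "\<And>i. i \<in> I \<Longrightarrow> x i \<in> carrier M" "\<And>i. i \<in> I \<Longrightarrow> y i \<in> carrier M"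
      "\<And>i. i \<in> I \<Longrightarrow> x i \<ominus>\<^bsub>M\<^esub> y i \<in> H"
  shows "(\<Oplus>\<^bsub>M\<^esub>i\<in>I. k i \<odot>\<^bsub>M\<^esub> x i) \<ominus>\<^bsub>M\<^esub> (\<Oplus>\<^bsub>M\<^esub>i\<in>I. k i \<odot>\<^bsub>M\<^esub> y i) \<in> H"
proof -
  have "(\<Oplus>\<^bsub>M\<^esub>i\<in>I. k i \<odot>\<^bsub>M\<^esub> (x i \<ominus>\<^bsub>M\<^esub> y i)) \<in> H"
    using k xy submoduleE(4)[OF H] by (intro submodule_finsum[OF H I]) auto
  also have "(\<Oplus>\<^bsub>M\<^esub>i\<in>I. k i \<odot>\<^bsub>M\<^esub> (x i \<ominus>\<^bsub>M\<^esub> y i)) = (\<Oplus>\<^bsub>M\<^esub>i\<in>I. k i \<odot>\<^bsub>M\<^esub> x i \<ominus>\<^bsub>M\<^esub> k i \<odot>\<^bsub>M\<^esub> y i)"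
    using k xy by (intro M.finsum_cong') (auto simp: smult_diff)
  also have "\<dots> = (\<Oplus>\<^bsub>M\<^esub>i\<in>I. k i \<odot>\<^bsub>M\<^esub> x i) \<ominus>\<^bsub>M\<^esub> (\<Oplus>\<^bsub>M\<^esub>i\<in>I. k i \<odot>\<^bsub>M\<^esub> y i)"
    using k xy I by (intro sum_diff) auto
  finally show ?thesis .
qed

lemma diff_trans:
  assumes "x \<in> carrier M" "y \<in> carrier M" "z \<in> carrier M"
  shows "x \<ominus>\<^bsub>M\<^esub> z = (x \<ominus>\<^bsub>M\<^esub> y) \<oplus>\<^bsub>M\<^esub> (y \<ominus>\<^bsub>M\<^esub> z)"
  using assms by (simp add: M.minus_eq M.a_assoc) (metis M.a_inv_closed M.a_assoc M.l_neg M.l_zero)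

text \<open>The relations in \<open>K\<close> are solved one after another. Once \<open>S\<close> is
  expressed through \<open>w\<close> modulo \<open>H\<close>, the next relation becomes a single
  relation between the \<open>w u\<close>. Solving it replaces \<open>a\<close> by a product
  \<open>a g\<close>, and the relations already solved are preserved because they annihilate
  \<open>a\<close> from the left.\<close>

lemma trivial_relations_simultaneous:
  assumes tr: "trivial_relations R M H" and H: "submodule H R M"
    and S: "finite S" "S \<subseteq> carrier M" and K: "finite K"
    and k: "\<And>k x. k \<in> K \<Longrightarrow> k x \<in> carrier R"
    and rel: "\<And>k. k \<in> K \<Longrightarrow> (\<Oplus>\<^bsub>M\<^esub>x\<in>S. k x \<odot>\<^bsub>M\<^esub> x) \<in> H"
  shows "\<exists>(r::nat) w a. (\<forall>u. w u \<in> carrier M) \<and> (\<forall>x u. a x u \<in> carrier R) \<and>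
    (\<forall>x\<in>S. x \<ominus>\<^bsub>M\<^esub> (\<Oplus>\<^bsub>M\<^esub>u\<in>{..<r}. a x u \<odot>\<^bsub>M\<^esub> w u) \<in> H) \<and>
    (\<forall>k\<in>K. \<forall>u<r. (\<Oplus>\<^bsub>R\<^esub>x\<in>S. k x \<otimes>\<^bsub>R\<^esub> a x u) = \<zero>\<^bsub>R\<^esub>)"
  using K k rel
proof (induction K rule: finite_induct)
  case empty
  obtain h where h: "bij_betw h {..<card S} S"
    using ex_bij_betw_nat_finite[OF S(1)] by (auto simp: atLeast0LessThan)
  \<comment> \<open>No relation yet: the generators are the elements of \<open>S\<close> themselves
    and \<open>a\<close> is the identity matrix. Padding with zero makes \<open>w\<close>
    total.\<close>
  define w where "w = (\<lambda>u. if u < card S then h u else \<zero>\<^bsub>M\<^esub>)"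
  define a where "a = (\<lambda>x u. if x = h u then \<one>\<^bsub>R\<^esub> else \<zero>\<^bsub>R\<^esub>)"
  have hS: "h u \<in> S" if "u < card S" for u using h that by (auto simp: bij_betw_def)
  have w: "w u \<in> carrier M" for u using hS S by (auto simp: w_def)
  have "x \<ominus>\<^bsub>M\<^esub> (\<Oplus>\<^bsub>M\<^esub>u\<in>{..<card S}. a x u \<odot>\<^bsub>M\<^esub> w u) \<in> H" if x: "x \<in> S" for x
  proof -
    have "x \<in> h ` {..<card S}" using h x by (simp add: bij_betw_def)
    then obtain v where v: "v < card S" "h v = x" by auto
    have "(\<Oplus>\<^bsub>M\<^esub>u\<in>{..<card S}. a x u \<odot>\<^bsub>M\<^esub> w u) = a x v \<odot>\<^bsub>M\<^esub> w v"
    proof (rule M.finsum_delta)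
      fix u assume "u \<in> {..<card S}" "u \<noteq> v"
      then have "h u \<noteq> x" using h v by (auto simp: bij_betw_def inj_on_def)
      then show "a x u \<odot>\<^bsub>M\<^esub> w u = \<zero>\<^bsub>M\<^esub>" using w by (auto simp: a_def)
    qed (use v w in \<open>auto simp: a_def\<close>)
    also have "\<dots> = x" using v S x by (auto simp: a_def w_def)
    finally show ?thesis using S x submodule_zero[OF H] by (auto simp: M.r_neg M.minus_eq)
  qed
  moreover have "\<forall>x u. a x u \<in> carrier R" by (simp add: a_def)
  ultimately show ?case using w by (intro exI[of _ "card S"] exI[of _ w] exI[of _ a]) auto
next
  case (insert k K)
  have "\<exists>(r::nat) w a. (\<forall>u. w u \<in> carrier M) \<and> (\<forall>x u. a x u \<in> carrier R) \<and>
    (\<forall>x\<in>S. x \<ominus>\<^bsub>M\<^esub> (\<Oplus>\<^bsub>M\<^esub>u\<in>{..<r}. a x u \<odot>\<^bsub>M\<^esub> w u) \<in> H) \<and>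
    (\<forall>k\<in>K. \<forall>u<r. (\<Oplus>\<^bsub>R\<^esub>x\<in>S. k x \<otimes>\<^bsub>R\<^esub> a x u) = \<zero>\<^bsub>R\<^esub>)"
    by (rule insert.IH) (use insert.prems in blast)+
  then obtain r :: nat and w a where w0: "\<forall>u. w u \<in> carrier M" and a0: "\<forall>x u. a x u \<in> carrier R"
    and wa0: "\<forall>x\<in>S. x \<ominus>\<^bsub>M\<^esub> (\<Oplus>\<^bsub>M\<^esub>u\<in>{..<r}. a x u \<odot>\<^bsub>M\<^esub> w u) \<in> H"
    and aK0: "\<forall>k\<in>K. \<forall>u<r. (\<Oplus>\<^bsub>R\<^esub>x\<in>S. k x \<otimes>\<^bsub>R\<^esub> a x u) = \<zero>\<^bsub>R\<^esub>"
    by (elim exE conjE)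
  have w: "\<And>u. w u \<in> carrier M" and a: "\<And>x u. a x u \<in> carrier R"
    and wa: "\<And>x. x \<in> S \<Longrightarrow> x \<ominus>\<^bsub>M\<^esub> (\<Oplus>\<^bsub>M\<^esub>u\<in>{..<r}. a x u \<odot>\<^bsub>M\<^esub> w u) \<in> H"
    and aK: "\<And>k u. k \<in> K \<Longrightarrow> u < r \<Longrightarrow> (\<Oplus>\<^bsub>R\<^esub>x\<in>S. k x \<otimes>\<^bsub>R\<^esub> a x u) = \<zero>\<^bsub>R\<^esub>"
    using w0 a0 wa0 aK0 by blast+
  have kc: "k x \<in> carrier R" for x using insert by blast
  have SM: "x \<in> carrier M" if "x \<in> S" for x using S that by auto
  \<comment> \<open>Coefficients of the new relation \<open>k\<close> after the elements of
    \<open>S\<close> have been replaced by their expressions in \<open>w\<close>.\<close>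
  define \<rho> where "\<rho> = (\<lambda>u. \<Oplus>\<^bsub>R\<^esub>x\<in>S. k x \<otimes>\<^bsub>R\<^esub> a x u)"
  have \<rho>: "\<rho> u \<in> carrier R" for u unfolding \<rho>_def using kc a by (intro R.finsum_closed) auto
  let ?y = "\<lambda>x. \<Oplus>\<^bsub>M\<^esub>u\<in>{..<r}. a x u \<odot>\<^bsub>M\<^esub> w u"
  have yc: "?y x \<in> carrier M" for x using a w by (intro M.finsum_closed) auto
  have "(\<Oplus>\<^bsub>M\<^esub>u\<in>{..<r}. \<rho> u \<odot>\<^bsub>M\<^esub> w u) = (\<Oplus>\<^bsub>M\<^esub>x\<in>S. k x \<odot>\<^bsub>M\<^esub> ?y x)"
    unfolding \<rho>_def using kc a w S by (intro smult_sum_assoc [symmetric]) auto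
  moreover have "\<dots> \<in> H"
  proof -
    let ?X = "\<Oplus>\<^bsub>M\<^esub>x\<in>S. k x \<odot>\<^bsub>M\<^esub> x" and ?Y = "\<Oplus>\<^bsub>M\<^esub>x\<in>S. k x \<odot>\<^bsub>M\<^esub> ?y x"
    have c: "?X \<in> carrier M" "?Y \<in> carrier M" using kc SM yc by (auto intro!: M.finsum_closed)
    have "?X \<ominus>\<^bsub>M\<^esub> ?Y \<in> H"
      using kc SM yc wa S by (intro submodule_sum_smult_diff[OF H]) auto
    moreover have "?X \<in> H" using insert by blast
    ultimately have "?X \<ominus>\<^bsub>M\<^esub> (?X \<ominus>\<^bsub>M\<^esub> ?Y) \<in> H" by (rule submodule_diff[OF H, rotated])
    also have "?X \<ominus>\<^bsub>M\<^esub> (?X \<ominus>\<^bsub>M\<^esub> ?Y) = ?Y"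
      using c by (simp add: M.minus_eq M.minus_add M.minus_minus M.a_assoc [symmetric] M.r_neg)
    finally show ?thesis .
  qed
  ultimately have \<rho>H: "(\<Oplus>\<^bsub>M\<^esub>u\<in>{..<r}. \<rho> u \<odot>\<^bsub>M\<^esub> w u) \<in> H" by simp
  obtain r' :: nat and w' g where w': "\<And>u. w' u \<in> carrier M" and g: "\<And>s u. g s u \<in> carrier R"
    and wg: "\<And>s. s < r \<Longrightarrow> w s \<ominus>\<^bsub>M\<^esub> (\<Oplus>\<^bsub>M\<^esub>u\<in>{..<r'}. g s u \<odot>\<^bsub>M\<^esub> w' u) \<in> H"
    and \<rho>g: "\<And>u. u < r' \<Longrightarrow> (\<Oplus>\<^bsub>R\<^esub>s\<in>{..<r}. \<rho> s \<otimes>\<^bsub>R\<^esub> g s u) = \<zero>\<^bsub>R\<^esub>"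
    by (rule trivial_relationsD[OF tr \<rho> w \<rho>H]) (rule that, assumption+)
  \<comment> \<open>The old and the new change of generators, composed.\<close>
  define b where "b = (\<lambda>x v. \<Oplus>\<^bsub>R\<^esub>u\<in>{..<r}. a x u \<otimes>\<^bsub>R\<^esub> g u v)"
  have b: "b x v \<in> carrier R" for x v unfolding b_def using a g by (intro R.finsum_closed) auto
  have "x \<ominus>\<^bsub>M\<^esub> (\<Oplus>\<^bsub>M\<^esub>v\<in>{..<r'}. b x v \<odot>\<^bsub>M\<^esub> w' v) \<in> H" if x: "x \<in> S" for x
  proof -
    let ?z = "\<lambda>s. \<Oplus>\<^bsub>M\<^esub>u\<in>{..<r'}. g s u \<odot>\<^bsub>M\<^esub> w' u"
    have zc: "?z s \<in> carrier M" for s using g w' by (intro M.finsum_closed) auto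
    have e: "(\<Oplus>\<^bsub>M\<^esub>v\<in>{..<r'}. b x v \<odot>\<^bsub>M\<^esub> w' v) = (\<Oplus>\<^bsub>M\<^esub>u\<in>{..<r}. a x u \<odot>\<^bsub>M\<^esub> ?z u)"
      unfolding b_def using a g w' by (intro smult_sum_assoc [symmetric]) auto
    have "?y x \<ominus>\<^bsub>M\<^esub> (\<Oplus>\<^bsub>M\<^esub>u\<in>{..<r}. a x u \<odot>\<^bsub>M\<^esub> ?z u) \<in> H"
      using a w zc wg by (intro submodule_sum_smult_diff[OF H]) auto
    moreover have "(\<Oplus>\<^bsub>M\<^esub>u\<in>{..<r}. a x u \<odot>\<^bsub>M\<^esub> ?z u) \<in> carrier M"
      using a zc by (intro M.finsum_closed) auto
    ultimately show ?thesis
      unfolding e using wa[OF x] submoduleE(5)[OF H] yc SM[OF x]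
      by (subst diff_trans[of x "?y x"]) auto
  qed
  moreover have "(\<Oplus>\<^bsub>R\<^esub>x\<in>S. k' x \<otimes>\<^bsub>R\<^esub> b x v) = \<zero>\<^bsub>R\<^esub>" if k': "k' \<in> insert k K" and v: "v < r'" for k' v
  proof -
    have k'c: "k' x \<in> carrier R" for x using insert.prems k' by blast
    have "(\<Oplus>\<^bsub>R\<^esub>x\<in>S. k' x \<otimes>\<^bsub>R\<^esub> b x v) = (\<Oplus>\<^bsub>R\<^esub>u\<in>{..<r}. (\<Oplus>\<^bsub>R\<^esub>x\<in>S. k' x \<otimes>\<^bsub>R\<^esub> a x u) \<otimes>\<^bsub>R\<^esub> g u v)"
      unfolding b_def using k'c a g S by (intro R.sum_prod_assoc) auto
    also have "\<dots> = \<zero>\<^bsub>R\<^esub>"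
    \<comment> \<open>The new relation dies by the choice of \<open>g\<close>, the older ones
      because they already vanish against \<open>a\<close>.\<close>
    proof (cases "k' = k")
      case True
      then show ?thesis using \<rho>g[OF v] unfolding \<rho>_def by simp
    next
      case False
      then show ?thesis using aK k' g by (intro R.finsum_zero_eqI) auto
    qed
    finally show ?thesis .
  qed
  ultimately show ?case using w' b
    by (intro exI[of _ r'] exI[of _ w'] exI[of _ b]) auto
qed

text \<open>Summing delta functions encodes a relation with three terms as a coefficient function,
  and stays correct when some of \<open>x\<close>, \<open>y\<close>, \<open>z\<close>
  coincide.\<close>

lemma smult_sum_delta3:
  assumes S: "finite S" "S \<subseteq> carrier M" and "x \<in> S" "y \<in> S" "z \<in> S"
    and r: "p \<in> carrier R" "q \<in> carrier R" "r \<in> carrier R"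
  shows "(\<Oplus>\<^bsub>M\<^esub>v\<in>S. ((if v = x then p else \<zero>\<^bsub>R\<^esub>) \<oplus>\<^bsub>R\<^esub>
      ((if v = y then q else \<zero>\<^bsub>R\<^esub>) \<oplus>\<^bsub>R\<^esub> (if v = z then r else \<zero>\<^bsub>R\<^esub>))) \<odot>\<^bsub>M\<^esub> v)
    = p \<odot>\<^bsub>M\<^esub> x \<oplus>\<^bsub>M\<^esub> (q \<odot>\<^bsub>M\<^esub> y \<oplus>\<^bsub>M\<^esub> r \<odot>\<^bsub>M\<^esub> z)"
proof -
  let ?d = "\<lambda>x p v. (if v = x then p else \<zero>\<^bsub>R\<^esub>) \<odot>\<^bsub>M\<^esub> v"
  have c: "?d x p v \<in> carrier M" if "p \<in> carrier R" "v \<in> S" for x p v using that S by auto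
  have d: "(\<Oplus>\<^bsub>M\<^esub>v\<in>S. ?d x p v) = p \<odot>\<^bsub>M\<^esub> x" if "p \<in> carrier R" "x \<in> S" for x p
    using that S by (subst M.finsum_delta[of _ x]) auto
  have "(\<Oplus>\<^bsub>M\<^esub>v\<in>S. ((if v = x then p else \<zero>\<^bsub>R\<^esub>) \<oplus>\<^bsub>R\<^esub>
      ((if v = y then q else \<zero>\<^bsub>R\<^esub>) \<oplus>\<^bsub>R\<^esub> (if v = z then r else \<zero>\<^bsub>R\<^esub>))) \<odot>\<^bsub>M\<^esub> v)
    = (\<Oplus>\<^bsub>M\<^esub>v\<in>S. ?d x p v \<oplus>\<^bsub>M\<^esub> (?d y q v \<oplus>\<^bsub>M\<^esub> ?d z r v))"
    using S r by (intro M.finsum_cong') (auto simp: smult_l_distr subset_iff)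
  also have "\<dots> = (\<Oplus>\<^bsub>M\<^esub>v\<in>S. ?d x p v) \<oplus>\<^bsub>M\<^esub> ((\<Oplus>\<^bsub>M\<^esub>v\<in>S. ?d y q v) \<oplus>\<^bsub>M\<^esub> (\<Oplus>\<^bsub>M\<^esub>v\<in>S. ?d z r v))"
    using c r by (subst M.finsum_addf; (subst M.finsum_addf)?) (auto simp: Pi_def)
  finally show ?thesis using d assms by simp
qed

end

text \<open>Counterpart of \<open>smult_sum_delta3\<close> that evaluates coordinates
  \<open>f\<close> where the former evaluates the elements themselves.\<close>

lemma (in cring) sum_delta3:
  assumes S: "finite S" and "x \<in> S" "y \<in> S" "z \<in> S"
    and r: "p \<in> carrier R" "q \<in> carrier R" "r \<in> carrier R" and f: "\<And>v. f v \<in> carrier R"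
  shows "(\<Oplus>v\<in>S. ((if v = x then p else \<zero>) \<oplus> ((if v = y then q else \<zero>) \<oplus>
      (if v = z then r else \<zero>))) \<otimes> f v) = p \<otimes> f x \<oplus> (q \<otimes> f y \<oplus> r \<otimes> f z)"
proof -
  let ?d = "\<lambda>x p v. (if v = x then p else \<zero>) \<otimes> f v"
  have c: "?d x p v \<in> carrier R" if "p \<in> carrier R" "v \<in> S" for x p v using that f by auto
  have d: "(\<Oplus>v\<in>S. ?d x p v) = p \<otimes> f x" if "p \<in> carrier R" "x \<in> S" for x p
    using that S f by (subst finsum_delta[of _ x]) auto
  have "(\<Oplus>v\<in>S. ((if v = x then p else \<zero>) \<oplus> ((if v = y then q else \<zero>) \<oplus>
      (if v = z then r else \<zero>))) \<otimes> f v) = (\<Oplus>v\<in>S. ?d x p v \<oplus> (?d y q v \<oplus> ?d z r v))"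
    using S r f by (intro finsum_cong') (auto simp: l_distr)
  also have "\<dots> = (\<Oplus>v\<in>S. ?d x p v) \<oplus> ((\<Oplus>v\<in>S. ?d y q v) \<oplus> (\<Oplus>v\<in>S. ?d z r v))"
    using c r by (subst finsum_addf; (subst finsum_addf)?) (auto simp: Pi_def)
  finally show ?thesis using d assms by simp
qed

section \<open>Vanishing tensors in terms of coefficients\<close>

context module_pair
begin

text \<open>The finitely many instances of linearity supplied by \<open>tsum_zero_local\<close> are
  relations between elements of \<open>M\<close>. Solving all of them at once modulo
  \<open>H\<close> yields coordinates \<open>a _ u\<close> that satisfy the same instances, so each
  of them kills the tensor. The further relations \<open>x = 0\<close> modulo \<open>H\<close>, for
  \<open>x\<close> in both \<open>S\<close> and \<open>H\<close>, force the coordinates of such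
  \<open>x\<close> to be exactly zero.\<close>

lemma tsum_zero_trivial:
  assumes tr: "trivial_relations R M H" and H: "submodule H R M"
    and S: "finite S" "S \<subseteq> carrier M" "c \<in> S \<rightarrow> carrier N" and z: "tsum S c = \<zero>\<^bsub>T\<^esub>"
  obtains r :: nat and w a where "\<And>u. w u \<in> carrier M" "\<And>x u. a x u \<in> carrier R"
    "\<And>x. x \<in> S \<Longrightarrow> x \<ominus>\<^bsub>M\<^esub> (\<Oplus>\<^bsub>M\<^esub>u\<in>{..<r}. a x u \<odot>\<^bsub>M\<^esub> w u) \<in> H"
    "\<And>x u. x \<in> S \<Longrightarrow> x \<in> H \<Longrightarrow> u < r \<Longrightarrow> a x u = \<zero>\<^bsub>R\<^esub>"
    "\<And>u. u < r \<Longrightarrow> (\<Oplus>\<^bsub>N\<^esub>x\<in>S. a x u \<odot>\<^bsub>N\<^esub> c x) = \<zero>\<^bsub>N\<^esub>"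
proof -
  obtain P Q where PQ: "finite P" "finite Q" "P \<subseteq> carrier M \<times> carrier M" "Q \<subseteq> carrier R \<times> carrier M"
    and van: "\<forall>a\<in>carrier M \<rightarrow> carrier R. (\<forall>(x, y)\<in>P. a (x \<oplus>\<^bsub>M\<^esub> y) = a x \<oplus>\<^bsub>R\<^esub> a y) \<and>
      (\<forall>(r, x)\<in>Q. a (r \<odot>\<^bsub>M\<^esub> x) = r \<otimes>\<^bsub>R\<^esub> a x) \<longrightarrow> (\<Oplus>\<^bsub>N\<^esub>b\<in>S. a b \<odot>\<^bsub>N\<^esub> c b) = \<zero>\<^bsub>N\<^esub>"
    using tsum_zero_local[OF S z] by (elim exE conjE)
  \<comment> \<open>\<open>S\<close> enlarged by every element of \<open>M\<close> that occurs in a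
    required instance of linearity.\<close>
  define S' where "S' = S \<union> (\<lambda>(x, y). x \<oplus>\<^bsub>M\<^esub> y) ` P \<union> fst ` P \<union> snd ` P \<union>
    (\<lambda>(r, x). r \<odot>\<^bsub>M\<^esub> x) ` Q \<union> snd ` Q"
  have S': "finite S'" "S' \<subseteq> carrier M"
    using S PQ by (auto simp: S'_def)
  define \<delta> where "\<delta> = (\<lambda>(x::'c) p y q z r v. (if v = x then p else \<zero>\<^bsub>R\<^esub>) \<oplus>\<^bsub>R\<^esub>
      ((if v = y then q else \<zero>\<^bsub>R\<^esub>) \<oplus>\<^bsub>R\<^esub> (if v = z then r else \<zero>\<^bsub>R\<^esub>)))"
  have \<delta>: "\<delta> x p y q z r v \<in> carrier R"
    if "p \<in> carrier R" "q \<in> carrier R" "r \<in> carrier R" for x y z p q r v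
    using that by (simp add: \<delta>_def)
  have M\<delta>: "(\<Oplus>\<^bsub>M\<^esub>v\<in>S'. \<delta> x p y q z r v \<odot>\<^bsub>M\<^esub> v) = p \<odot>\<^bsub>M\<^esub> x \<oplus>\<^bsub>M\<^esub> (q \<odot>\<^bsub>M\<^esub> y \<oplus>\<^bsub>M\<^esub> r \<odot>\<^bsub>M\<^esub> z)"
    if "x \<in> S'" "y \<in> S'" "z \<in> S'" "p \<in> carrier R" "q \<in> carrier R" "r \<in> carrier R" for x y z p q r
    unfolding \<delta>_def by (rule M.smult_sum_delta3) (use S' that in auto)
  have R\<delta>: "(\<Oplus>\<^bsub>R\<^esub>v\<in>S'. \<delta> x p y q z r v \<otimes>\<^bsub>R\<^esub> f v) = p \<otimes>\<^bsub>R\<^esub> f x \<oplus>\<^bsub>R\<^esub> (q \<otimes>\<^bsub>R\<^esub> f y \<oplus>\<^bsub>R\<^esub> r \<otimes>\<^bsub>R\<^esub> f z)"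
    if "x \<in> S'" "y \<in> S'" "z \<in> S'" "p \<in> carrier R" "q \<in> carrier R" "r \<in> carrier R"
      "\<And>v. f v \<in> carrier R" for x y z p q r f
    unfolding \<delta>_def by (rule M.R.sum_delta3) (use S' that in auto)
  \<comment> \<open>Coefficient functions of the relations
    \<open>1 (x + y) + (-1) x + (-1) y = 0\<close>, \<open>1 (r x) + (-r) x = 0\<close> and
    \<open>x = 0\<close>; the remaining slots get coefficient zero.\<close>
  define KP where "KP = (\<lambda>x y. \<delta> (x \<oplus>\<^bsub>M\<^esub> y) \<one>\<^bsub>R\<^esub> x (\<ominus>\<^bsub>R\<^esub> \<one>\<^bsub>R\<^esub>) y (\<ominus>\<^bsub>R\<^esub> \<one>\<^bsub>R\<^esub>))"
  define KQ where "KQ = (\<lambda>r x. \<delta> (r \<odot>\<^bsub>M\<^esub> x) \<one>\<^bsub>R\<^esub> x (\<ominus>\<^bsub>R\<^esub> r) x \<zero>\<^bsub>R\<^esub>)"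
  define KZ where "KZ = (\<lambda>x. \<delta> x \<one>\<^bsub>R\<^esub> x \<zero>\<^bsub>R\<^esub> x \<zero>\<^bsub>R\<^esub>)"
  define K where "K = (\<lambda>(x, y). KP x y) ` P \<union> (\<lambda>(r, x). KQ r x) ` Q \<union> KZ ` (S \<inter> H)"
  have PS: "x \<in> S'" "y \<in> S'" "x \<oplus>\<^bsub>M\<^esub> y \<in> S'" if "(x, y) \<in> P" for x y
    using imageI[OF that, of fst] imageI[OF that, of snd] imageI[OF that, of "\<lambda>(x, y). x \<oplus>\<^bsub>M\<^esub> y"]
    by (simp_all add: S'_def)
  have QS: "x \<in> S'" "r \<odot>\<^bsub>M\<^esub> x \<in> S'" if "(r, x) \<in> Q" for r x
    using imageI[OF that, of snd] imageI[OF that, of "\<lambda>(r, x). r \<odot>\<^bsub>M\<^esub> x"]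
    by (simp_all add: S'_def)
  have fin: "finite K" using PQ S by (simp add: K_def)
  have KR: "k x \<in> carrier R" if "k \<in> K" for k x
    using that PQ by (auto simp: K_def KP_def KQ_def KZ_def \<delta> subset_iff)
  \<comment> \<open>The first two families vanish in \<open>M\<close> itself; the third holds only
    modulo \<open>H\<close>.\<close>
  have rel: "(\<Oplus>\<^bsub>M\<^esub>z\<in>S'. k z \<odot>\<^bsub>M\<^esub> z) \<in> H" if "k \<in> K" for k
  proof -
    consider x y where "k = KP x y" "(x, y) \<in> P" | r x where "k = KQ r x" "(r, x) \<in> Q"
      | x where "k = KZ x" "x \<in> S" "x \<in> H"
      using \<open>k \<in> K\<close> by (auto simp: K_def)
    then show ?thesis
    proof cases
      case (1 x y)
      then have c: "x \<in> carrier M" "y \<in> carrier M" using PQ by auto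
      have "(\<Oplus>\<^bsub>M\<^esub>z\<in>S'. k z \<odot>\<^bsub>M\<^esub> z) = (x \<oplus>\<^bsub>M\<^esub> y) \<oplus>\<^bsub>M\<^esub> (\<ominus>\<^bsub>M\<^esub> x \<oplus>\<^bsub>M\<^esub> \<ominus>\<^bsub>M\<^esub> y)"
        unfolding 1(1) KP_def using PS[OF 1(2)] c by (simp add: M\<delta> M.smult_l_minus)
      also have "\<dots> = \<zero>\<^bsub>M\<^esub>" using c by (simp add: M.M.minus_add [symmetric] M.M.r_neg)
      finally show ?thesis using M.submodule_zero[OF H] by simp
    next
      case (2 r x)
      then have c: "r \<in> carrier R" "x \<in> carrier M" using PQ by auto
      have "(\<Oplus>\<^bsub>M\<^esub>z\<in>S'. k z \<odot>\<^bsub>M\<^esub> z) = r \<odot>\<^bsub>M\<^esub> x \<oplus>\<^bsub>M\<^esub> \<ominus>\<^bsub>M\<^esub> (r \<odot>\<^bsub>M\<^esub> x)"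
        unfolding 2(1) KQ_def using QS[OF 2(2)] c by (simp add: M\<delta> M.smult_l_minus)
      also have "\<dots> = \<zero>\<^bsub>M\<^esub>" using c by (simp add: M.M.r_neg)
      finally show ?thesis using M.submodule_zero[OF H] by simp
    next
      case (3 x)
      then have "x \<in> S'" "x \<in> carrier M" using S by (auto simp: S'_def)
      then have "(\<Oplus>\<^bsub>M\<^esub>z\<in>S'. k z \<odot>\<^bsub>M\<^esub> z) = x"
        unfolding 3(1) KZ_def by (simp add: M\<delta>)
      then show ?thesis using 3 by simp
    qed
  qed
  have "\<exists>(r::nat) w a. (\<forall>u. w u \<in> carrier M) \<and> (\<forall>x u. a x u \<in> carrier R) \<and>
    (\<forall>x\<in>S'. x \<ominus>\<^bsub>M\<^esub> (\<Oplus>\<^bsub>M\<^esub>u\<in>{..<r}. a x u \<odot>\<^bsub>M\<^esub> w u) \<in> H) \<and>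
    (\<forall>k\<in>K. \<forall>u<r. (\<Oplus>\<^bsub>R\<^esub>x\<in>S'. k x \<otimes>\<^bsub>R\<^esub> a x u) = \<zero>\<^bsub>R\<^esub>)"
    by (rule M.trivial_relations_simultaneous[OF tr H S' fin]) (rule KR rel; assumption)+
  then obtain r :: nat and w a where w: "\<forall>u. w u \<in> carrier M" and a: "\<forall>x u. a x u \<in> carrier R"
    and wa: "\<forall>x\<in>S'. x \<ominus>\<^bsub>M\<^esub> (\<Oplus>\<^bsub>M\<^esub>u\<in>{..<r}. a x u \<odot>\<^bsub>M\<^esub> w u) \<in> H"
    and aK: "\<forall>k\<in>K. \<forall>u<r. (\<Oplus>\<^bsub>R\<^esub>x\<in>S'. k x \<otimes>\<^bsub>R\<^esub> a x u) = \<zero>\<^bsub>R\<^esub>"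
    by (elim exE conjE)
  \<comment> \<open>The solved relations read backwards: that \<open>KP\<close> and
    \<open>KQ\<close> annihilate \<open>a _ u\<close> is its linearity at the recorded
    places.\<close>
  have lin: "(\<forall>(x, y)\<in>P. a (x \<oplus>\<^bsub>M\<^esub> y) u = a x u \<oplus>\<^bsub>R\<^esub> a y u) \<and>
      (\<forall>(r, x)\<in>Q. a (r \<odot>\<^bsub>M\<^esub> x) u = r \<otimes>\<^bsub>R\<^esub> a x u)" if u: "u < r" for u
  proof (intro conjI ballI; clarify)
    fix x y assume xy: "(x, y) \<in> P"
    then have "KP x y \<in> K" by (auto simp: K_def)
    then have "(\<Oplus>\<^bsub>R\<^esub>v\<in>S'. KP x y v \<otimes>\<^bsub>R\<^esub> a v u) = \<zero>\<^bsub>R\<^esub>" using aK u by blast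
    then have "a (x \<oplus>\<^bsub>M\<^esub> y) u \<oplus>\<^bsub>R\<^esub> \<ominus>\<^bsub>R\<^esub> (a x u \<oplus>\<^bsub>R\<^esub> a y u) = \<zero>\<^bsub>R\<^esub>"
      using PS[OF xy] a unfolding KP_def by (simp add: R\<delta> M.R.l_minus M.R.minus_add)
    then show "a (x \<oplus>\<^bsub>M\<^esub> y) u = a x u \<oplus>\<^bsub>R\<^esub> a y u"
      using a M.R.minus_equality[of "a (x \<oplus>\<^bsub>M\<^esub> y) u" "\<ominus>\<^bsub>R\<^esub> (a x u \<oplus>\<^bsub>R\<^esub> a y u)"]
      by (simp add: M.R.minus_minus)
  next
    fix s x assume xy: "(s, x) \<in> Q"
    then have s: "s \<in> carrier R" using PQ by auto
    from xy have "KQ s x \<in> K" by (auto simp: K_def)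
    then have "(\<Oplus>\<^bsub>R\<^esub>v\<in>S'. KQ s x v \<otimes>\<^bsub>R\<^esub> a v u) = \<zero>\<^bsub>R\<^esub>" using aK u by blast
    then have "a (s \<odot>\<^bsub>M\<^esub> x) u \<oplus>\<^bsub>R\<^esub> \<ominus>\<^bsub>R\<^esub> (s \<otimes>\<^bsub>R\<^esub> a x u) = \<zero>\<^bsub>R\<^esub>"
      using QS[OF xy] a s unfolding KQ_def by (simp add: R\<delta> M.R.l_minus)
    then show "a (s \<odot>\<^bsub>M\<^esub> x) u = s \<otimes>\<^bsub>R\<^esub> a x u"
      using a s M.R.minus_equality[of "a (s \<odot>\<^bsub>M\<^esub> x) u" "\<ominus>\<^bsub>R\<^esub> (s \<otimes>\<^bsub>R\<^esub> a x u)"]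
      by (simp add: M.R.minus_minus)
  qed
  show ?thesis
  proof (rule that[of w a r])
    show "x \<ominus>\<^bsub>M\<^esub> (\<Oplus>\<^bsub>M\<^esub>u\<in>{..<r}. a x u \<odot>\<^bsub>M\<^esub> w u) \<in> H" if "x \<in> S" for x
      using wa that by (auto simp: S'_def)
    show "a x u = \<zero>\<^bsub>R\<^esub>" if x: "x \<in> S" "x \<in> H" and u: "u < r" for x u
    proof -
      have "KZ x \<in> K" using x by (auto simp: K_def)
      then have "(\<Oplus>\<^bsub>R\<^esub>z\<in>S'. KZ x z \<otimes>\<^bsub>R\<^esub> a z u) = \<zero>\<^bsub>R\<^esub>" using aK u by blast
      moreover have "x \<in> S'" using x by (simp add: S'_def)
      ultimately show ?thesis using a unfolding KZ_def by (simp add: R\<delta>)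
    qed
    show "(\<Oplus>\<^bsub>N\<^esub>x\<in>S. a x u \<odot>\<^bsub>N\<^esub> c x) = \<zero>\<^bsub>N\<^esub>" if u: "u < r" for u
      by (rule van[rule_format, of "\<lambda>x. a x u"]) (use a lin[OF u] in auto)
  qed (use w a in auto)
qed

text \<open>Substitutes an expression of each first factor in the generators \<open>w\<close> and
  moves the scalars across the tensor sign. The vectors \<open>y x\<close> are remainders: zero in
  the flatness criterion, elements of \<open>\<mm>^M\<close> when working modulo that power.\<close>

lemma tsum_factor:
  assumes S: "finite S" "S \<subseteq> carrier M" "c \<in> S \<rightarrow> carrier N"
    and wa: "\<And>u. w u \<in> carrier M" "\<And>x u. a x u \<in> carrier R"
    and y: "\<And>x. x \<in> S \<Longrightarrow> y x \<in> carrier M"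
      "\<And>x. x \<in> S \<Longrightarrow> x = y x \<oplus>\<^bsub>M\<^esub> (\<Oplus>\<^bsub>M\<^esub>u\<in>{..<r::nat}. a x u \<odot>\<^bsub>M\<^esub> w u)"
  shows "tsum S c = (\<Oplus>\<^bsub>T\<^esub>x\<in>S. pt (y x) (c x)) \<oplus>\<^bsub>T\<^esub>
    (\<Oplus>\<^bsub>T\<^esub>u\<in>{..<r}. pt (w u) (\<Oplus>\<^bsub>N\<^esub>x\<in>S. a x u \<odot>\<^bsub>N\<^esub> c x))"
proof -
  have cN: "c x \<in> carrier N" if "x \<in> S" for x using S that by auto
  have p: "pt x (c x) = pt (y x) (c x) \<oplus>\<^bsub>T\<^esub> (\<Oplus>\<^bsub>T\<^esub>u\<in>{..<r}. pt (w u) (a x u \<odot>\<^bsub>N\<^esub> c x))"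
    if x: "x \<in> S" for x
  proof -
    let ?s = "\<Oplus>\<^bsub>M\<^esub>u\<in>{..<r}. a x u \<odot>\<^bsub>M\<^esub> w u"
    have s: "?s \<in> carrier M" using wa by (intro M.M.finsum_closed) auto
    have "pt x (c x) = pt (y x \<oplus>\<^bsub>M\<^esub> ?s) (c x)" using y(2)[OF x] by simp
    also have "\<dots> = pt (y x) (c x) \<oplus>\<^bsub>T\<^esub> pt ?s (c x)" using s x y(1) cN by (intro pt_add_l) auto
    also have "pt ?s (c x) = (\<Oplus>\<^bsub>T\<^esub>u\<in>{..<r}. pt (a x u \<odot>\<^bsub>M\<^esub> w u) (c x))"
      using wa x cN by (intro pt_finsum_l) auto
    also have "\<dots> = (\<Oplus>\<^bsub>T\<^esub>u\<in>{..<r}. pt (w u) (a x u \<odot>\<^bsub>N\<^esub> c x))"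
      using wa x cN by (intro T.finsum_cong') (auto simp: pt_smult)
    finally show ?thesis .
  qed
  have "tsum S c = (\<Oplus>\<^bsub>T\<^esub>x\<in>S. pt (y x) (c x) \<oplus>\<^bsub>T\<^esub> (\<Oplus>\<^bsub>T\<^esub>u\<in>{..<r}. pt (w u) (a x u \<odot>\<^bsub>N\<^esub> c x)))"
    unfolding tsum_def using p wa y(1) cN by (intro T.finsum_cong') (auto intro!: T.finsum_closed)
  also have "\<dots> = (\<Oplus>\<^bsub>T\<^esub>x\<in>S. pt (y x) (c x)) \<oplus>\<^bsub>T\<^esub>
      (\<Oplus>\<^bsub>T\<^esub>x\<in>S. \<Oplus>\<^bsub>T\<^esub>u\<in>{..<r}. pt (w u) (a x u \<odot>\<^bsub>N\<^esub> c x))"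
    using wa y(1) cN by (intro T.finsum_addf) (auto intro!: T.finsum_closed)
  also have "(\<Oplus>\<^bsub>T\<^esub>x\<in>S. \<Oplus>\<^bsub>T\<^esub>u\<in>{..<r}. pt (w u) (a x u \<odot>\<^bsub>N\<^esub> c x)) =
      (\<Oplus>\<^bsub>T\<^esub>u\<in>{..<r}. \<Oplus>\<^bsub>T\<^esub>x\<in>S. pt (w u) (a x u \<odot>\<^bsub>N\<^esub> c x))"
    using wa cN S by (intro T.finsum_swap) auto
  also have "\<dots> = (\<Oplus>\<^bsub>T\<^esub>u\<in>{..<r}. pt (w u) (\<Oplus>\<^bsub>N\<^esub>x\<in>S. a x u \<odot>\<^bsub>N\<^esub> c x))"
    using wa cN S by (intro T.finsum_cong') (auto simp: pt_finsum_r Pi_def intro!: N.M.finsum_closed)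
  finally show ?thesis .
qed

end

lemma (in abelian_group) diff_eq_zeroD:
  assumes "x \<in> carrier G" "y \<in> carrier G" "x \<ominus> y = \<zero>"
  shows "x = y"
  using assms minus_equality[of x "\<ominus> y"] by (simp add: minus_eq minus_minus)

section \<open>Linear maps and their tensor products\<close>

lemma linear_mapsD:
  assumes "f \<in> linear_maps R M N"
  shows "x \<in> carrier M \<Longrightarrow> f x \<in> carrier N"
    and "x \<in> carrier M \<Longrightarrow> y \<in> carrier M \<Longrightarrow> f (x \<oplus>\<^bsub>M\<^esub> y) = f x \<oplus>\<^bsub>N\<^esub> f y"
    and "a \<in> carrier R \<Longrightarrow> x \<in> carrier M \<Longrightarrow> f (a \<odot>\<^bsub>M\<^esub> x) = a \<odot>\<^bsub>N\<^esub> f x"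
  using assms by (auto simp: linear_maps_def hom_def)

lemma linear_maps_zero:
  assumes "f \<in> linear_maps R M N" "module R M" "module R N"
  shows "f \<zero>\<^bsub>M\<^esub> = \<zero>\<^bsub>N\<^esub>"
proof -
  interpret M: module R M by fact
  interpret N: module R N by fact
  have "f \<zero>\<^bsub>M\<^esub> \<oplus>\<^bsub>N\<^esub> f \<zero>\<^bsub>M\<^esub> = f \<zero>\<^bsub>M\<^esub>"
    using linear_mapsD(2)[OF assms(1), of "\<zero>\<^bsub>M\<^esub>" "\<zero>\<^bsub>M\<^esub>"] by simp
  then show ?thesis
    using linear_mapsD(1)[OF assms(1), of "\<zero>\<^bsub>M\<^esub>"] by simp
qed

lemma linear_maps_finsum:
  assumes f: "f \<in> linear_maps R M N" and M: "module R M" and N: "module R N"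
    and I: "finite I" "g \<in> I \<rightarrow> carrier M"
  shows "f (\<Oplus>\<^bsub>M\<^esub>i\<in>I. g i) = (\<Oplus>\<^bsub>N\<^esub>i\<in>I. f (g i))"
proof -
  interpret M: module R M by fact
  interpret N: module R N by fact
  show ?thesis
    using I
  proof (induction I rule: finite_induct)
    case empty
    show ?case using linear_maps_zero[OF f M N] by simp
  next
    case (insert x F)
    then show ?case
      using linear_mapsD(1,2)[OF f] by (simp add: Pi_def)
  qed
qed

locale tensor_hom = K: module_pair R K L + T: module_pair R M N for R K L M N +
  fixes f g
  assumes f: "f \<in> linear_maps R K M" and g: "g \<in> linear_maps R L N"
begin

abbreviation "fext \<equiv> frag_extend (\<lambda>(x, y). frag_of (f x, g y))"

lemma keys_fext:
  assumes "Poly_Mapping.keys t \<subseteq> carrier K \<times> carrier L"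
  shows "Poly_Mapping.keys (fext t) \<subseteq> carrier M \<times> carrier N"
proof
  fix p assume "p \<in> Poly_Mapping.keys (fext t)"
  then obtain x where "x \<in> Poly_Mapping.keys t"
    "p \<in> Poly_Mapping.keys ((\<lambda>(x, y). frag_of (f x, g y)) x)"
    using keys_frag_extend[of "\<lambda>(x, y). frag_of (f x, g y)" t] by blast
  then show "p \<in> carrier M \<times> carrier N"
    using assms linear_mapsD(1)[OF f] linear_mapsD(1)[OF g] by (cases x) auto
qed

lemma fext_gens: "t \<in> K.gens \<Longrightarrow> fext t \<in> T.gens"
proof -
  note fg = linear_mapsD[OF f] linear_mapsD[OF g]
  assume "t \<in> K.gens"
  then consider x x' y where "t = frag_of (x \<oplus>\<^bsub>K\<^esub> x', y) - frag_of (x, y) - frag_of (x', y)"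
      "x \<in> carrier K" "x' \<in> carrier K" "y \<in> carrier L"
    | x y y' where "t = frag_of (x, y \<oplus>\<^bsub>L\<^esub> y') - frag_of (x, y) - frag_of (x, y')"
      "x \<in> carrier K" "y \<in> carrier L" "y' \<in> carrier L"
    | a x y where "t = frag_of (a \<odot>\<^bsub>K\<^esub> x, y) - frag_of (x, a \<odot>\<^bsub>L\<^esub> y)"
      "a \<in> carrier R" "x \<in> carrier K" "y \<in> carrier L"
    unfolding K.gens_def by blast
  then show ?thesis
  proof cases
    case (1 x x' y)
    have "fext t = frag_of (f x \<oplus>\<^bsub>M\<^esub> f x', g y) - frag_of (f x, g y) - frag_of (f x', g y)"
      using 1 fg by (simp add: frag_extend_diff)
    then show ?thesis using 1 fg unfolding T.gens_def by blast
  next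
    case (2 x y y')
    have "fext t = frag_of (f x, g y \<oplus>\<^bsub>N\<^esub> g y') - frag_of (f x, g y) - frag_of (f x, g y')"
      using 2 fg by (simp add: frag_extend_diff)
    then show ?thesis using 2 fg unfolding T.gens_def by blast
  next
    case (3 a x y)
    have "fext t = frag_of (a \<odot>\<^bsub>M\<^esub> f x, g y) - frag_of (f x, a \<odot>\<^bsub>N\<^esub> g y)"
      using 3 fg by (simp add: frag_extend_diff)
    then show ?thesis using 3 fg unfolding T.gens_def by blast
  qed
qed

lemma fext_rels: "t \<in> K.rels \<Longrightarrow> fext t \<in> T.rels"
  unfolding K.rels_eq
proof (induction t rule: generate.induct)
  case one
  show ?case using T.Q.zero_closed by (simp add: K.pair_add_monoid)
next
  case (incl h)
  then show ?case using T.gens_rels fext_gens by blast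
next
  case (inv h)
  have k: "Poly_Mapping.keys h \<subseteq> carrier K \<times> carrier L"
    using inv K.gens_carrier by (simp add: subset_iff)
  have e: "inv\<^bsub>add_monoid (pair_ring K L)\<^esub> h = - h"
    unfolding K.pair_add_monoid by (rule inv_free_Abelian_group) (rule k)
  have r: "fext h \<in> T.rels" using inv T.gens_rels fext_gens by blast
  then have "\<ominus>\<^bsub>pair_ring M N\<^esub> fext h \<in> T.rels" by (rule T.Q.a_inv_closed)
  moreover have "\<ominus>\<^bsub>pair_ring M N\<^esub> fext h = - fext h"
    by (rule T.P.minus_equality) (use keys_fext[OF k] in auto)
  ultimately show ?case unfolding e by (simp add: frag_extend_minus)
next
  case (eng h1 h2)
  have "fext h1 \<oplus>\<^bsub>pair_ring M N\<^esub> fext h2 \<in> T.rels"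
    using eng.IH by (rule T.Q.a_closed)
  then show ?case by (simp add: K.pair_add_monoid frag_extend_add)
qed

text \<open>Since \<open>fext\<close> sends relations to relations, all members of the union in
  \<open>tensor_map\<close> are one and the same coset, and the union is that coset.\<close>

lemma tensor_map_cls:
  assumes "Poly_Mapping.keys t \<subseteq> carrier K \<times> carrier L"
  shows "tensor_map R M N f g (K.cls t) = T.cls (fext t)"
proof -
  have mem: "s \<in> K.cls t \<longleftrightarrow> (\<exists>h\<in>K.rels. s = h + t)" for s
    by (auto simp: tensor_class_def a_r_coset_def')
  have kr: "Poly_Mapping.keys h \<subseteq> carrier K \<times> carrier L" if "h \<in> K.rels" for h
    using K.Q.a_subset that K.pair_simps(1) by blast
  have "T.cls (fext s) = T.cls (fext t)" if s: "s \<in> K.cls t" for s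
  proof -
    obtain h where h: "h \<in> K.rels" "s = h + t" using s mem by blast
    have "Poly_Mapping.keys s \<subseteq> carrier K \<times> carrier L"
      using h(2) kr[OF h(1)] assms keys_add[of h t] by auto
    moreover have "fext s - fext t \<in> T.rels"
      using fext_rels[OF h(1)] h(2) by (simp add: frag_extend_add)
    ultimately show ?thesis
      using T.cls_eq_iff keys_fext assms by blast
  qed
  moreover have "t \<in> K.cls t" 
    using mem[of t] K.Q.zero_closed by (intro mem[THEN iffD2] bexI[of _ 0]) auto
  ultimately show ?thesis
    unfolding tensor_map_def by blast
qed

lemma tensor_map_closed:
  assumes "X \<in> carrier K.T"
  shows "tensor_map R M N f g X \<in> carrier T.T"
proof -
  obtain t where "Poly_Mapping.keys t \<subseteq> carrier K \<times> carrier L" "X = K.cls t"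
    by (rule K.cls_surj[OF assms])
  then show ?thesis using tensor_map_cls keys_fext by auto
qed

lemma tensor_map_add:
  assumes "X \<in> carrier K.T" "Y \<in> carrier K.T"
  shows "tensor_map R M N f g (X \<oplus>\<^bsub>K.T\<^esub> Y) = tensor_map R M N f g X \<oplus>\<^bsub>T.T\<^esub> tensor_map R M N f g Y"
proof -
  obtain s where s: "Poly_Mapping.keys s \<subseteq> carrier K \<times> carrier L" "X = K.cls s"
    by (rule K.cls_surj[OF assms(1)])
  obtain t where t: "Poly_Mapping.keys t \<subseteq> carrier K \<times> carrier L" "Y = K.cls t"
    by (rule K.cls_surj[OF assms(2)])
  have "Poly_Mapping.keys (s + t) \<subseteq> carrier K \<times> carrier L"
    using s t keys_add[of s t] by auto
  then show ?thesis
    using s t by (simp add: K.cls_add [symmetric] tensor_map_cls frag_extend_add T.cls_add keys_fext)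
qed

lemma tensor_map_zero: "tensor_map R M N f g \<zero>\<^bsub>K.T\<^esub> = \<zero>\<^bsub>T.T\<^esub>"
  using tensor_map_cls[of 0] by simp

lemma tensor_map_hom: "abelian_group_hom K.T T.T (tensor_map R M N f g)"
  by (rule abelian_group_homI)
    (use tensor_map_closed tensor_map_add in \<open>auto simp: group_hom_def group_hom_axioms_def hom_def K.T.a_group T.T.a_group
      K.T.abelian_group_axioms T.T.abelian_group_axioms\<close>)

lemma tensor_map_pt:
  assumes "x \<in> carrier K" "y \<in> carrier L"
  shows "tensor_map R M N f g (K.pt x y) = T.pt (f x) (g y)"
  unfolding pure_tensor_def using assms by (simp add: tensor_map_cls)

lemma tensor_map_tsum:
  assumes "finite S" "S \<subseteq> carrier K" "c \<in> S \<rightarrow> carrier L"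
  shows "tensor_map R M N f g (K.tsum S c) = (\<Oplus>\<^bsub>T.T\<^esub>x\<in>S. T.pt (f x) (g (c x)))"
  using assms
proof (induction S rule: finite_induct)
  case empty
  show ?case by (simp add: K.tsum_def tensor_map_zero)
next
  case (insert x S)
  note fg = linear_mapsD(1)[OF f] linear_mapsD(1)[OF g]
  have "K.tsum (insert x S) c = K.pt x (c x) \<oplus>\<^bsub>K.T\<^esub> K.tsum S c"
    unfolding K.tsum_def using insert by (intro K.T.finsum_insert) auto
  moreover have "(\<Oplus>\<^bsub>T.T\<^esub>x\<in>insert x S. T.pt (f x) (g (c x))) =
      T.pt (f x) (g (c x)) \<oplus>\<^bsub>T.T\<^esub> (\<Oplus>\<^bsub>T.T\<^esub>x\<in>S. T.pt (f x) (g (c x)))"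
    using insert fg by (intro T.T.finsum_insert) (auto simp: Pi_def subset_iff)
  ultimately show ?case
    using insert by (simp add: tensor_map_add tensor_map_pt K.tsum_closed Pi_def)
qed

end

lemma id_linear_maps: "module R M \<Longrightarrow> (\<lambda>x. x) \<in> linear_maps R M M"
  by (simp add: linear_maps_def hom_def)

text \<open>For a tensor with coefficients \<open>c\<close> killed by \<open>1 \<otimes> f\<close>,
  the equations obtained from \<open>tsum_zero_trivial\<close> in \<open>N\<close> are images under
  \<open>f\<close> of equations in \<open>N'\<close>, and injectivity of \<open>f\<close> brings
  them back. Everything is expressed by elements, so the type \<open>'u\<close> of the test modules
  can be arbitrary.\<close>

theorem flat_if_trivial_relations:
  assumes M: "module R M" and tr: "trivial_relations R M {\<zero>\<^bsub>M\<^esub>}"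
  shows "flat U R M"
  unfolding flat_def
proof (intro conjI allI ballI impI M)
  fix N' N :: "('a, 'u) module" and f
  assume f: "f \<in> linear_maps R N' N" and "module R N' \<and> module R N \<and> inj_on f (carrier N')"
  then have N': "module R N'" and N: "module R N" and inj: "inj_on f (carrier N')" by auto
  interpret h: tensor_hom R M N' M N "\<lambda>x. x" f
    by (intro tensor_hom.intro module_pair.intro tensor_hom_axioms.intro M N N' f id_linear_maps)
  interpret hom: abelian_group_hom h.K.T h.T.T "tensor_map R M N (\<lambda>x. x) f"
    by (rule h.tensor_map_hom)
  have f0: "f \<zero>\<^bsub>N'\<^esub> = \<zero>\<^bsub>N\<^esub>" by (rule linear_maps_zero[OF f N' N])
  have sub: "submodule {\<zero>\<^bsub>M\<^esub>} R M"
    by (rule h.K.M.submoduleI) (auto simp: h.K.M.M.a_inv_zero)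
  have ker: "X = \<zero>\<^bsub>h.K.T\<^esub>" if X: "X \<in> carrier h.K.T" "tensor_map R M N (\<lambda>x. x) f X = \<zero>\<^bsub>h.T.T\<^esub>" for X
  proof -
    obtain S c where S: "finite S" "S \<subseteq> carrier M" "c \<in> S \<rightarrow> carrier N'" and Xc: "X = h.K.tsum S c"
      by (rule h.K.tsum_rep[OF X(1)])
    have fc: "(\<lambda>x. f (c x)) \<in> S \<rightarrow> carrier N" using S linear_mapsD(1)[OF f] by auto
    have cN: "c x \<in> carrier N'" if "x \<in> S" for x using S that by auto
    have "h.T.tsum S (\<lambda>x. f (c x)) = \<zero>\<^bsub>h.T.T\<^esub>"
      using X(2) S unfolding Xc by (simp add: h.tensor_map_tsum h.T.tsum_def)
    then obtain r :: nat and w a where w: "\<And>u. w u \<in> carrier M" and a: "\<And>x u. a x u \<in> carrier R"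
      and wa: "\<And>x. x \<in> S \<Longrightarrow> x \<ominus>\<^bsub>M\<^esub> (\<Oplus>\<^bsub>M\<^esub>u\<in>{..<r}. a x u \<odot>\<^bsub>M\<^esub> w u) \<in> {\<zero>\<^bsub>M\<^esub>}"
      and ac: "\<And>u. u < r \<Longrightarrow> (\<Oplus>\<^bsub>N\<^esub>x\<in>S. a x u \<odot>\<^bsub>N\<^esub> f (c x)) = \<zero>\<^bsub>N\<^esub>"
      by (rule h.T.tsum_zero_trivial[OF tr sub S(1,2) fc]) (rule that, assumption+)
    have x: "x = \<zero>\<^bsub>M\<^esub> \<oplus>\<^bsub>M\<^esub> (\<Oplus>\<^bsub>M\<^esub>u\<in>{..<r}. a x u \<odot>\<^bsub>M\<^esub> w u)" if "x \<in> S" for x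
    proof -
      have sc: "(\<Oplus>\<^bsub>M\<^esub>u\<in>{..<r}. a x u \<odot>\<^bsub>M\<^esub> w u) \<in> carrier M" using a w by (intro h.K.M.M.finsum_closed) auto
      then have "x = (\<Oplus>\<^bsub>M\<^esub>u\<in>{..<r}. a x u \<odot>\<^bsub>M\<^esub> w u)"
        by (rule h.K.M.M.diff_eq_zeroD[OF subsetD[OF S(2) that] _ singletonD[OF wa[OF that]]])
      then show ?thesis by (subst h.K.M.M.l_zero[OF sc])
    qed
    have z: "(\<Oplus>\<^bsub>N'\<^esub>x\<in>S. a x u \<odot>\<^bsub>N'\<^esub> c x) = \<zero>\<^bsub>N'\<^esub>" if u: "u < r" for u
    proof -
      have "f (\<Oplus>\<^bsub>N'\<^esub>x\<in>S. a x u \<odot>\<^bsub>N'\<^esub> c x) = (\<Oplus>\<^bsub>N\<^esub>x\<in>S. f (a x u \<odot>\<^bsub>N'\<^esub> c x))"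
        using S a cN by (intro linear_maps_finsum[OF f N' N]) auto
      also have "\<dots> = (\<Oplus>\<^bsub>N\<^esub>x\<in>S. a x u \<odot>\<^bsub>N\<^esub> f (c x))"
        using a cN linear_mapsD[OF f] by (intro h.T.N.M.finsum_cong') auto
      also have "\<dots> = f \<zero>\<^bsub>N'\<^esub>" using ac[OF u] f0 by simp
      finally show ?thesis
        using inj_onD[OF inj] a cN by (auto intro!: h.K.N.M.finsum_closed)
    qed
    have "X = (\<Oplus>\<^bsub>h.K.T\<^esub>x\<in>S. h.K.pt \<zero>\<^bsub>M\<^esub> (c x)) \<oplus>\<^bsub>h.K.T\<^esub>
      (\<Oplus>\<^bsub>h.K.T\<^esub>u\<in>{..<r}. h.K.pt (w u) (\<Oplus>\<^bsub>N'\<^esub>x\<in>S. a x u \<odot>\<^bsub>N'\<^esub> c x))"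
      unfolding Xc using S w a x by (intro h.K.tsum_factor) auto
    also have "(\<Oplus>\<^bsub>h.K.T\<^esub>x\<in>S. h.K.pt \<zero>\<^bsub>M\<^esub> (c x)) = \<zero>\<^bsub>h.K.T\<^esub>"
      using cN by (intro h.K.T.finsum_zero_eqI) auto
    also have "(\<Oplus>\<^bsub>h.K.T\<^esub>u\<in>{..<r}. h.K.pt (w u) (\<Oplus>\<^bsub>N'\<^esub>x\<in>S. a x u \<odot>\<^bsub>N'\<^esub> c x)) = \<zero>\<^bsub>h.K.T\<^esub>"
      using z w by (intro h.K.T.finsum_zero_eqI) auto
    finally show ?thesis by simp
  qed
  show "inj_on (tensor_map R M N (\<lambda>x. x) f) (carrier h.K.T)"
  proof (rule inj_onI)
    fix X Y assume X: "X \<in> carrier h.K.T" and Y: "Y \<in> carrier h.K.T"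
      and e: "tensor_map R M N (\<lambda>x. x) f X = tensor_map R M N (\<lambda>x. x) f Y"
    have "tensor_map R M N (\<lambda>x. x) f (X \<oplus>\<^bsub>h.K.T\<^esub> \<ominus>\<^bsub>h.K.T\<^esub> Y) = \<zero>\<^bsub>h.T.T\<^esub>"
      using X Y e by (simp add: h.T.T.r_neg)
    then have "X \<oplus>\<^bsub>h.K.T\<^esub> \<ominus>\<^bsub>h.K.T\<^esub> Y = \<zero>\<^bsub>h.K.T\<^esub>" using X Y by (intro ker) auto
    then show "X = Y"
      using X Y h.K.T.minus_equality[of X "\<ominus>\<^bsub>h.K.T\<^esub> Y"] by (simp add: h.K.T.minus_minus)
  qed
qed

section \<open>Absolutely flat rings\<close>

text \<open>A finitely generated ideal of a von Neumann regular ring is generated by an idempotent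
  \<open>e\<close>, which fixes every generator. Adjoining a generator \<open>r\<close> enlarges
  \<open>e\<close> to \<open>e + y (r - r e)\<close>, where \<open>y\<close> is a quasi-inverse of
  \<open>r - r e\<close>.\<close>

lemma (in cring) von_neumann_regular_local_unit:
  fixes q :: nat
  assumes vnr: "\<And>x. x \<in> carrier R \<Longrightarrow> \<exists>y\<in>carrier R. x = x \<otimes> x \<otimes> y"
    and \<rho>: "\<And>s. \<rho> s \<in> carrier R"
  shows "\<exists>u. (\<forall>s. u s \<in> carrier R) \<and> (\<forall>v<q. (\<Oplus>s\<in>{..<q}. u s \<otimes> \<rho> s) \<otimes> \<rho> v = \<rho> v)"
proof (induction q)
  case 0
  show ?case by (rule exI[of _ "\<lambda>_. \<zero>"]) simp
next
  case (Suc q)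
  then obtain u where u: "\<And>s. u s \<in> carrier R"
    and e: "\<And>v. v < q \<Longrightarrow> (\<Oplus>s\<in>{..<q}. u s \<otimes> \<rho> s) \<otimes> \<rho> v = \<rho> v" by blast
  define e where "e = (\<Oplus>s\<in>{..<q}. u s \<otimes> \<rho> s)"
  have ec: "e \<in> carrier R" unfolding e_def using u \<rho> by (intro finsum_closed) auto
  let ?r = "\<rho> q"
  have rc: "?r \<in> carrier R" by (rule \<rho>)
  \<comment> \<open>Each summand of \<open>e\<close> is a multiple of some \<open>\<rho> s\<close>,
    which \<open>e\<close> fixes.\<close>
  have ee: "e \<otimes> e = e"
  proof -
    have "e \<otimes> e = e \<otimes> (\<Oplus>s\<in>{..<q}. u s \<otimes> \<rho> s)" by (simp only: e_def)
    also have "\<dots> = (\<Oplus>s\<in>{..<q}. e \<otimes> (u s \<otimes> \<rho> s))"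
      using u \<rho> ec by (intro finsum_rdistr) auto
    also have "\<dots> = (\<Oplus>s\<in>{..<q}. u s \<otimes> \<rho> s)"
      using u \<rho> ec e[folded e_def] by (intro finsum_cong') (auto simp: m_lcomm[of e])
    finally show ?thesis by (simp add: e_def)
  qed
  \<comment> \<open>Regularity is applied to the part of \<open>\<rho> q\<close> not yet reached by
    \<open>e\<close>. That part is orthogonal to \<open>e\<close>, so the old generators stay
    fixed.\<close>
  obtain y where y: "y \<in> carrier R"
    and vy: "?r \<ominus> ?r \<otimes> e = (?r \<ominus> ?r \<otimes> e) \<otimes> (?r \<ominus> ?r \<otimes> e) \<otimes> y"
    using vnr[of "?r \<ominus> ?r \<otimes> e"] rc ec by auto
  \<comment> \<open>Coefficients presenting the new idempotent as a combination of the
    \<open>\<rho> s\<close>: the old ones are multiplied by \<open>1 - r y\<close>, and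
    \<open>y\<close> is the new one.\<close>
  define u' where "u' = (\<lambda>s. if s < q then u s \<ominus> ?r \<otimes> y \<otimes> u s else y)"
  have u': "u' s \<in> carrier R" for s using u rc y by (simp add: u'_def)
  define e' where "e' = (e \<ominus> ?r \<otimes> y \<otimes> e) \<oplus> y \<otimes> ?r"
  have sum: "(\<Oplus>s\<in>{..<Suc q}. u' s \<otimes> \<rho> s) = e'"
  proof -
    have "(\<Oplus>s\<in>{..<Suc q}. u' s \<otimes> \<rho> s) = u' q \<otimes> \<rho> q \<oplus> (\<Oplus>s\<in>{..<q}. u' s \<otimes> \<rho> s)"
      unfolding lessThan_Suc using u' \<rho> by (intro finsum_insert) auto
    also have "(\<Oplus>s\<in>{..<q}. u' s \<otimes> \<rho> s) = (\<Oplus>s\<in>{..<q}. (\<one> \<ominus> ?r \<otimes> y) \<otimes> (u s \<otimes> \<rho> s))"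
    proof (rule finsum_cong')
      fix s assume "s \<in> {..<q}"
      then have "u' s \<otimes> \<rho> s = (u s \<ominus> ?r \<otimes> y \<otimes> u s) \<otimes> \<rho> s" by (simp add: u'_def)
      also have "\<dots> = (\<one> \<ominus> ?r \<otimes> y) \<otimes> (u s \<otimes> \<rho> s)" using u \<rho>[of s] rc y by algebra
      finally show "u' s \<otimes> \<rho> s = (\<one> \<ominus> ?r \<otimes> y) \<otimes> (u s \<otimes> \<rho> s)" .
    qed (use u \<rho> rc y in auto)
    also have "\<dots> = (\<one> \<ominus> ?r \<otimes> y) \<otimes> e"
      unfolding e_def using u \<rho> rc y by (intro finsum_rdistr [symmetric]) auto
    also have "u' q \<otimes> \<rho> q \<oplus> (\<one> \<ominus> ?r \<otimes> y) \<otimes> e = e'"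
      unfolding e'_def u'_def using rc y ec by simp algebra
    finally show ?thesis .
  qed
  have "e' \<otimes> \<rho> v = \<rho> v" if "v < Suc q" for v
  proof (cases "v = q")
    case True
    have "(?r \<ominus> ?r \<otimes> e) \<otimes> (?r \<ominus> ?r \<otimes> e) \<otimes> y
        = y \<otimes> ?r \<otimes> ?r \<ominus> y \<otimes> ?r \<otimes> ?r \<otimes> e \<ominus> y \<otimes> ?r \<otimes> ?r \<otimes> e \<oplus> y \<otimes> ?r \<otimes> ?r \<otimes> (e \<otimes> e)"
      using rc ec y by algebra
    also have "\<dots> = y \<otimes> ?r \<otimes> ?r \<ominus> y \<otimes> ?r \<otimes> ?r \<otimes> e" unfolding ee using rc ec y by algebra
    finally have *: "?r \<ominus> ?r \<otimes> e = y \<otimes> ?r \<otimes> ?r \<ominus> y \<otimes> ?r \<otimes> ?r \<otimes> e" using vy by simp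
    have "e' \<otimes> ?r = (y \<otimes> ?r \<otimes> ?r \<ominus> y \<otimes> ?r \<otimes> ?r \<otimes> e) \<oplus> ?r \<otimes> e"
      unfolding e'_def using rc ec y by algebra
    also have "\<dots> = ?r" unfolding *[symmetric] using rc ec by algebra
    finally show ?thesis using True by simp
  next
    case False
    then have ev: "e \<otimes> \<rho> v = \<rho> v" using that e[of v] by (simp add: e_def)
    have "e' \<otimes> \<rho> v = e \<otimes> \<rho> v \<ominus> ?r \<otimes> y \<otimes> (e \<otimes> \<rho> v) \<oplus> y \<otimes> ?r \<otimes> \<rho> v"
      unfolding e'_def using rc ec y \<rho>[of v] by algebra
    also have "\<dots> = \<rho> v" unfolding ev using rc y \<rho>[of v] by algebra
    finally show ?thesis .
  qed
  then show ?case using u' sum by (intro exI[of _ u']) simp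
qed

text \<open>With \<open>e\<close> the local unit of the \<open>\<rho> s\<close>, the matrix
  \<open>g = 1 - u \<rho>\<close> removes the relation: the row \<open>\<rho>\<close> annihilates it
  because \<open>e\<close> fixes the \<open>\<rho> s\<close>, and the vector \<open>m\<close>
  differs from \<open>g m\<close> by multiples of the relation itself, which lies in
  \<open>H\<close>. As \<open>H\<close> is arbitrary, all quotients of \<open>M\<close> are
  covered.\<close>

theorem (in module) von_neumann_regular_trivial_relations:
  assumes vnr: "\<And>x. x \<in> carrier R \<Longrightarrow> \<exists>y\<in>carrier R. x = x \<otimes>\<^bsub>R\<^esub> x \<otimes>\<^bsub>R\<^esub> y"
    and H: "submodule H R M"
  shows "trivial_relations R M H"
  unfolding trivial_relations_def
proof (intro allI impI)
  fix q :: nat and \<rho> m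
  assume \<rho>: "\<forall>s. \<rho> s \<in> carrier R" and m: "\<forall>s. m s \<in> carrier M"
    and rel: "(\<Oplus>\<^bsub>M\<^esub>s\<in>{..<q}. \<rho> s \<odot>\<^bsub>M\<^esub> m s) \<in> H"
  obtain u where u: "\<And>s. u s \<in> carrier R"
    and e: "\<And>v. v < q \<Longrightarrow> (\<Oplus>\<^bsub>R\<^esub>s\<in>{..<q}. u s \<otimes>\<^bsub>R\<^esub> \<rho> s) \<otimes>\<^bsub>R\<^esub> \<rho> v = \<rho> v"
    using R.von_neumann_regular_local_unit[OF vnr, of \<rho> q] \<rho> by blast
  define g where "g = (\<lambda>s t. (if t = s then \<one>\<^bsub>R\<^esub> else \<zero>\<^bsub>R\<^esub>) \<ominus>\<^bsub>R\<^esub> u s \<otimes>\<^bsub>R\<^esub> \<rho> t)"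
  have g: "g s t \<in> carrier R" for s t using u \<rho> by (simp add: g_def)
  let ?X = "\<Oplus>\<^bsub>M\<^esub>s\<in>{..<q}. \<rho> s \<odot>\<^bsub>M\<^esub> m s"
  have X: "?X \<in> carrier M" using \<rho> m by (intro M.finsum_closed) auto
  have 1: "m s \<ominus>\<^bsub>M\<^esub> (\<Oplus>\<^bsub>M\<^esub>t\<in>{..<q}. g s t \<odot>\<^bsub>M\<^esub> m t) \<in> H" if s: "s < q" for s
  proof -
    have "(\<Oplus>\<^bsub>M\<^esub>t\<in>{..<q}. g s t \<odot>\<^bsub>M\<^esub> m t) =
        (\<Oplus>\<^bsub>M\<^esub>t\<in>{..<q}. (if t = s then \<one>\<^bsub>R\<^esub> else \<zero>\<^bsub>R\<^esub>) \<odot>\<^bsub>M\<^esub> m t \<ominus>\<^bsub>M\<^esub> u s \<odot>\<^bsub>M\<^esub> (\<rho> t \<odot>\<^bsub>M\<^esub> m t))"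
      using u \<rho> m by (intro M.finsum_cong')
        (auto simp: g_def R.minus_eq M.minus_eq smult_l_distr smult_l_minus smult_assoc1)
    also have "\<dots> = (\<Oplus>\<^bsub>M\<^esub>t\<in>{..<q}. (if t = s then \<one>\<^bsub>R\<^esub> else \<zero>\<^bsub>R\<^esub>) \<odot>\<^bsub>M\<^esub> m t) \<ominus>\<^bsub>M\<^esub>
        (\<Oplus>\<^bsub>M\<^esub>t\<in>{..<q}. u s \<odot>\<^bsub>M\<^esub> (\<rho> t \<odot>\<^bsub>M\<^esub> m t))"
      using u \<rho> m by (intro sum_diff) auto
    also have "(\<Oplus>\<^bsub>M\<^esub>t\<in>{..<q}. (if t = s then \<one>\<^bsub>R\<^esub> else \<zero>\<^bsub>R\<^esub>) \<odot>\<^bsub>M\<^esub> m t) = m s"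
      using s m by (subst M.finsum_delta[of _ s]) auto
    also have "(\<Oplus>\<^bsub>M\<^esub>t\<in>{..<q}. u s \<odot>\<^bsub>M\<^esub> (\<rho> t \<odot>\<^bsub>M\<^esub> m t)) = u s \<odot>\<^bsub>M\<^esub> ?X"
      using u \<rho> m by (intro finsum_smult_ldistr [symmetric]) auto
    also have "m s \<ominus>\<^bsub>M\<^esub> (m s \<ominus>\<^bsub>M\<^esub> u s \<odot>\<^bsub>M\<^esub> ?X) = u s \<odot>\<^bsub>M\<^esub> ?X"
      using m u X by (simp add: M.minus_eq M.minus_add M.minus_minus M.a_assoc [symmetric] M.r_neg)
    finally have "m s \<ominus>\<^bsub>M\<^esub> (\<Oplus>\<^bsub>M\<^esub>t\<in>{..<q}. g s t \<odot>\<^bsub>M\<^esub> m t) = u s \<odot>\<^bsub>M\<^esub> ?X" by simp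
    then show ?thesis using submoduleE(4)[OF H] u rel by simp
  qed
  have 2: "(\<Oplus>\<^bsub>R\<^esub>s\<in>{..<q}. \<rho> s \<otimes>\<^bsub>R\<^esub> g s t) = \<zero>\<^bsub>R\<^esub>" if t: "t < q" for t
  proof -
    let ?E = "\<Oplus>\<^bsub>R\<^esub>s\<in>{..<q}. u s \<otimes>\<^bsub>R\<^esub> \<rho> s"
    have E: "?E \<in> carrier R" using u \<rho> by (intro R.finsum_closed) auto
    have "(\<Oplus>\<^bsub>R\<^esub>s\<in>{..<q}. \<rho> s \<otimes>\<^bsub>R\<^esub> g s t) =
        (\<Oplus>\<^bsub>R\<^esub>s\<in>{..<q}. \<rho> s \<otimes>\<^bsub>R\<^esub> (if t = s then \<one>\<^bsub>R\<^esub> else \<zero>\<^bsub>R\<^esub>) \<oplus>\<^bsub>R\<^esub> (\<ominus>\<^bsub>R\<^esub> \<rho> t) \<otimes>\<^bsub>R\<^esub> (u s \<otimes>\<^bsub>R\<^esub> \<rho> s))"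
    proof (rule R.finsum_cong')
      fix s
      have c: "(if t = s then \<one>\<^bsub>R\<^esub> else \<zero>\<^bsub>R\<^esub>) \<in> carrier R" "\<rho> s \<in> carrier R" "\<rho> t \<in> carrier R" "u s \<in> carrier R"
        using u \<rho> by auto
      show "\<rho> s \<otimes>\<^bsub>R\<^esub> g s t = \<rho> s \<otimes>\<^bsub>R\<^esub> (if t = s then \<one>\<^bsub>R\<^esub> else \<zero>\<^bsub>R\<^esub>) \<oplus>\<^bsub>R\<^esub> (\<ominus>\<^bsub>R\<^esub> \<rho> t) \<otimes>\<^bsub>R\<^esub> (u s \<otimes>\<^bsub>R\<^esub> \<rho> s)"
        unfolding g_def using c
        by (simp only: R.minus_eq R.r_distr R.r_minus R.l_minus R.m_closed R.a_inv_closed R.m_ac)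
    qed (use u \<rho> in auto)
    also have "\<dots> = (\<Oplus>\<^bsub>R\<^esub>s\<in>{..<q}. \<rho> s \<otimes>\<^bsub>R\<^esub> (if t = s then \<one>\<^bsub>R\<^esub> else \<zero>\<^bsub>R\<^esub>)) \<oplus>\<^bsub>R\<^esub>
        (\<Oplus>\<^bsub>R\<^esub>s\<in>{..<q}. (\<ominus>\<^bsub>R\<^esub> \<rho> t) \<otimes>\<^bsub>R\<^esub> (u s \<otimes>\<^bsub>R\<^esub> \<rho> s))"
      using u \<rho> by (intro R.finsum_addf) auto
    also have "(\<Oplus>\<^bsub>R\<^esub>s\<in>{..<q}. \<rho> s \<otimes>\<^bsub>R\<^esub> (if t = s then \<one>\<^bsub>R\<^esub> else \<zero>\<^bsub>R\<^esub>)) = \<rho> t"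
      using t \<rho> by (subst R.finsum_delta[of _ t]) auto
    also have "(\<Oplus>\<^bsub>R\<^esub>s\<in>{..<q}. (\<ominus>\<^bsub>R\<^esub> \<rho> t) \<otimes>\<^bsub>R\<^esub> (u s \<otimes>\<^bsub>R\<^esub> \<rho> s)) = (\<ominus>\<^bsub>R\<^esub> \<rho> t) \<otimes>\<^bsub>R\<^esub> ?E"
      using u \<rho> by (intro R.finsum_rdistr [symmetric]) auto
    also have "(\<ominus>\<^bsub>R\<^esub> \<rho> t) \<otimes>\<^bsub>R\<^esub> ?E = \<ominus>\<^bsub>R\<^esub> (?E \<otimes>\<^bsub>R\<^esub> \<rho> t)"
      using E \<rho> by (simp add: R.l_minus R.m_comm)
    also have "\<dots> = \<ominus>\<^bsub>R\<^esub> \<rho> t" using e[OF t] by simp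
    finally show ?thesis using \<rho> by (simp add: R.r_neg)
  qed
  show "\<exists>(r::nat) w g. (\<forall>u. w u \<in> carrier M) \<and> (\<forall>s u. g s u \<in> carrier R) \<and>
        (\<forall>s<q. m s \<ominus>\<^bsub>M\<^esub> (\<Oplus>\<^bsub>M\<^esub>u\<in>{..<r}. g s u \<odot>\<^bsub>M\<^esub> w u) \<in> H) \<and>
        (\<forall>u<r. (\<Oplus>\<^bsub>R\<^esub>s\<in>{..<q}. \<rho> s \<otimes>\<^bsub>R\<^esub> g s u) = \<zero>\<^bsub>R\<^esub>)"
    using 1 2 m g by (intro exI[of _ q] exI[of _ m] exI[of _ g]) auto
qed

text \<open>The half of the universal property needed to detect a nonzero pure tensor: a balanced
  biadditive map extends to the free abelian group and kills the relations.\<close>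

lemma (in module_pair) rels_universal:
  assumes G: "abelian_group G"
    and closed: "\<And>x y. x \<in> carrier M \<Longrightarrow> y \<in> carrier N \<Longrightarrow> \<beta> x y \<in> carrier G"
    and add_l: "\<And>x x' y. x \<in> carrier M \<Longrightarrow> x' \<in> carrier M \<Longrightarrow> y \<in> carrier N \<Longrightarrow>
      \<beta> (x \<oplus>\<^bsub>M\<^esub> x') y = \<beta> x y \<oplus>\<^bsub>G\<^esub> \<beta> x' y"
    and add_r: "\<And>x y y'. x \<in> carrier M \<Longrightarrow> y \<in> carrier N \<Longrightarrow> y' \<in> carrier N \<Longrightarrow>
      \<beta> x (y \<oplus>\<^bsub>N\<^esub> y') = \<beta> x y \<oplus>\<^bsub>G\<^esub> \<beta> x y'"
    and bal: "\<And>a x y. a \<in> carrier R \<Longrightarrow> x \<in> carrier M \<Longrightarrow> y \<in> carrier N \<Longrightarrow>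
      \<beta> (a \<odot>\<^bsub>M\<^esub> x) y = \<beta> x (a \<odot>\<^bsub>N\<^esub> y)"
    and x: "x \<in> carrier M" and y: "y \<in> carrier N" and z: "pt x y = \<zero>\<^bsub>T\<^esub>"
  shows "\<beta> x y = \<zero>\<^bsub>G\<^esub>"
proof -
  interpret G: abelian_group G by fact
  let ?F = "free_Abelian_group (carrier M \<times> carrier N)"
  obtain h where h: "h \<in> hom ?F (add_monoid G)"
    and h_of': "\<And>p. p \<in> carrier M \<times> carrier N \<Longrightarrow> h (frag_of p) = (\<lambda>(x, y). \<beta> x y) p"
    by (rule comm_group.free_Abelian_group_universal[OF G.a_comm_group,
          of "\<lambda>(x, y). \<beta> x y" "carrier M \<times> carrier N"])
      (use closed in auto)
  have h_of: "h (frag_of (x, y)) = \<beta> x y" if "x \<in> carrier M" "y \<in> carrier N" for x y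
    using h_of'[of "(x, y)"] that by simp
  interpret h: group_hom ?F "add_monoid G" h
    using h by (simp add: group_hom_def group_hom_axioms_def G.a_group)
  have hd: "h (s - t) = h s \<ominus>\<^bsub>G\<^esub> h t" "h s \<in> carrier G"
    if "Poly_Mapping.keys s \<subseteq> carrier M \<times> carrier N" "Poly_Mapping.keys t \<subseteq> carrier M \<times> carrier N" for s t
    using h.hom_mult[of s "- t"] h.hom_inv[of t] h.hom_closed[of s] that
    by (auto simp: a_inv_def G.minus_eq)
  have hdd: "h (frag_of p - frag_of q - frag_of r) = h (frag_of p) \<ominus>\<^bsub>G\<^esub> h (frag_of q) \<ominus>\<^bsub>G\<^esub> h (frag_of r)"
    if "{p, q, r} \<subseteq> carrier M \<times> carrier N" for p q r
    using that keys_diff[of "frag_of p" "frag_of q"]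
      hd[of "frag_of p - frag_of q" "frag_of r"] hd[of "frag_of p" "frag_of q"]
    by auto
  have gen: "h g = \<zero>\<^bsub>G\<^esub>" if "g \<in> gens" for g
    using that unfolding gens_def
  proof (elim UnE CollectE exE conjE)
    fix x x' y assume "g = frag_of (x \<oplus>\<^bsub>M\<^esub> x', y) - frag_of (x, y) - frag_of (x', y)"
      "x \<in> carrier M" "x' \<in> carrier M" "y \<in> carrier N"
    then show ?thesis by (simp add: hdd h_of add_l closed G.add_diff_diff)
  next
    fix x y y' assume "g = frag_of (x, y \<oplus>\<^bsub>N\<^esub> y') - frag_of (x, y) - frag_of (x, y')"
      "x \<in> carrier M" "y \<in> carrier N" "y' \<in> carrier N"
    then show ?thesis by (simp add: hdd h_of add_r closed G.add_diff_diff)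
  next
    fix a x y assume "g = frag_of (a \<odot>\<^bsub>M\<^esub> x, y) - frag_of (x, a \<odot>\<^bsub>N\<^esub> y)"
      "a \<in> carrier R" "x \<in> carrier M" "y \<in> carrier N"
    then show ?thesis by (simp add: hd h_of bal closed G.minus_eq G.r_neg)
  qed
  have hz: "h t = \<zero>\<^bsub>G\<^esub>" if "t \<in> rels" for t
    using that unfolding rels_eq pair_add_monoid
  proof (induction t rule: generate.induct)
    case one
    show ?case using h.hom_one by simp
  next
    case (incl g)
    then show ?case by (rule gen)
  next
    case (inv g)
    have "g \<in> carrier ?F" using inv gens_carrier by (simp add: subset_iff)
    then have "h (inv\<^bsub>?F\<^esub> g) = \<ominus>\<^bsub>G\<^esub> h g" by (simp only: h.hom_inv a_inv_def)
    then show ?case using gen[OF inv] by (simp only: G.a_inv_zero)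
  next
    case (eng s t)
    have "s \<in> rels" "t \<in> rels" using eng.hyps unfolding rels_eq pair_add_monoid by auto
    then have "s \<in> carrier ?F" "t \<in> carrier ?F"
      using subsetD[OF Q.a_subset, of s] subsetD[OF Q.a_subset, of t] by simp_all
    then have "h (s \<otimes>\<^bsub>?F\<^esub> t) = h s \<oplus>\<^bsub>G\<^esub> h t" using h.hom_mult by simp
    then show ?case using eng.IH by simp
  qed
  have "frag_of (x, y) \<in> rels"
    by (rule iffD1[OF cls_zero_iff z[unfolded pure_tensor_def]]) (use x y in simp)
  then show ?thesis using hz h_of[OF x y] by simp
qed

text \<open>With \<open>q\<close> taking values in sets of sequences, this carries modules and their quotients to the type
  on which \<open>absolutely_flat\<close> and \<open>APf\<close> test; \<open>mult\<close> and \<open>one\<close> are junk.\<close>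

definition image_module ::
    "('a, 'm, 's) module_scheme \<Rightarrow> ('m \<Rightarrow> 'n) \<Rightarrow> ('a, 'n) module" where
  "image_module M q =
    \<lparr>carrier = q ` carrier M, monoid.mult = undefined, one = undefined, ring.zero = q \<zero>\<^bsub>M\<^esub>,
     ring.add = (\<lambda>X Y. q (inv_into (carrier M) q X \<oplus>\<^bsub>M\<^esub> inv_into (carrier M) q Y)),
     smult = (\<lambda>a X. q (a \<odot>\<^bsub>M\<^esub> inv_into (carrier M) q X))\<rparr>"

text \<open>If the fibres of \<open>q\<close> form a congruence, the representatives chosen by
  \<open>inv_into\<close> are immaterial. This covers both an injective recoding and the passage to
  cosets.\<close>

locale module_congruence = module R M for R and M +
  fixes q
  assumes q_add: "\<And>x x' y y'. x \<in> carrier M \<Longrightarrow> x' \<in> carrier M \<Longrightarrow> y \<in> carrier M \<Longrightarrow> y' \<in> carrier M \<Longrightarrow>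
      q x = q x' \<Longrightarrow> q y = q y' \<Longrightarrow> q (x \<oplus>\<^bsub>M\<^esub> y) = q (x' \<oplus>\<^bsub>M\<^esub> y')"
    and q_smult: "\<And>a x x'. a \<in> carrier R \<Longrightarrow> x \<in> carrier M \<Longrightarrow> x' \<in> carrier M \<Longrightarrow>
      q x = q x' \<Longrightarrow> q (a \<odot>\<^bsub>M\<^esub> x) = q (a \<odot>\<^bsub>M\<^esub> x')"
begin

abbreviation "I \<equiv> image_module M q"

lemma image_simps:
  "carrier I = q ` carrier M" "\<zero>\<^bsub>I\<^esub> = q \<zero>\<^bsub>M\<^esub>"
  "x \<in> carrier M \<Longrightarrow> y \<in> carrier M \<Longrightarrow> q x \<oplus>\<^bsub>I\<^esub> q y = q (x \<oplus>\<^bsub>M\<^esub> y)"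
  "a \<in> carrier R \<Longrightarrow> x \<in> carrier M \<Longrightarrow> a \<odot>\<^bsub>I\<^esub> q x = q (a \<odot>\<^bsub>M\<^esub> x)"
  by (auto simp: image_module_def f_inv_into_f inv_into_into intro!: q_add q_smult)

lemma image_module: "module R I"
proof (rule moduleI)
  show "abelian_group I"
  proof (rule abelian_groupI)
    fix X assume "X \<in> carrier I"
    then obtain x where "x \<in> carrier M" "X = q x" by (auto simp: image_simps)
    then show "\<exists>Y\<in>carrier I. Y \<oplus>\<^bsub>I\<^esub> X = \<zero>\<^bsub>I\<^esub>"
      by (intro bexI[of _ "q (\<ominus>\<^bsub>M\<^esub> x)"]) (auto simp: image_simps M.l_neg)
  qed (auto simp: image_simps M.a_assoc M.a_comm M.a_lcomm)
qed (auto simp: image_simps smult_l_distr smult_r_distr smult_assoc1 R.is_cring)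

end

lemma (in cring) self_module: "module R (restrict_scalars (\<lambda>x. x) R)"
  by (rule moduleI)
    (auto simp: restrict_scalars_def l_distr r_distr m_assoc is_cring
      intro!: abelian_groupI a_assoc a_comm bexI[of _ "\<ominus> _"] l_neg)

text \<open>The classical argument: with \<open>I = (x)\<close>, the tensor
  \<open>1 \<otimes> x\<close> in \<open>R / I \<otimes> I\<close> becomes
  \<open>x \<otimes> 1 = 0\<close> in \<open>R / I \<otimes> R\<close>. Flatness of
  \<open>R / I\<close> makes it zero already, and since multiplication maps
  \<open>R / I \<otimes> I\<close> to \<open>R / J\<close> with \<open>J = (x^2)\<close>, the
  element \<open>x\<close> lies in \<open>J\<close>.\<close>

theorem absolutely_flat_regular:
  fixes R :: "('a, 'r) ring_scheme" (structure)
  assumes af: "absolutely_flat R" and x: "x \<in> carrier R"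
  shows "\<exists>y\<in>carrier R. x = x \<otimes>\<^bsub>R\<^esub> x \<otimes>\<^bsub>R\<^esub> y"
proof -
  interpret cring R using af by (simp add: absolutely_flat_def)
  let ?A = "restrict_scalars (\<lambda>x. x) R :: ('a, 'a) module"
  have A: "carrier ?A = carrier R" "\<zero>\<^bsub>?A\<^esub> = \<zero>" "a \<oplus>\<^bsub>?A\<^esub> b = a \<oplus> b" "a \<odot>\<^bsub>?A\<^esub> b = a \<otimes> b" for a b
    by (simp_all add: restrict_scalars_def)
  define I where "I = PIdl x"
  define J where "J = PIdl (x \<otimes> x)"
  interpret I: ideal I R unfolding I_def by (rule cgenideal_ideal[OF x])
  interpret J: ideal J R unfolding J_def using x by (intro cgenideal_ideal) simp
  \<comment> \<open>Constant sequences recode \<open>R\<close> and its quotient by \<open>I\<close>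
    on the type \<open>(nat \<Rightarrow> 'a) set\<close>: \<open>q0\<close> is injective, and two
    elements of \<open>R\<close> have the same image under \<open>q1\<close> when they are congruent
    modulo \<open>I\<close>.\<close>
  define q0 :: "'a \<Rightarrow> (nat \<Rightarrow> 'a) set" where "q0 = (\<lambda>a. {\<lambda>_. a})"
  define q1 :: "'a \<Rightarrow> (nat \<Rightarrow> 'a) set" where "q1 = (\<lambda>a. (\<lambda>b _. b) ` (I +> a))"
  have q0: "q0 a = q0 b \<longleftrightarrow> a = b" for a b by (auto simp: q0_def fun_eq_iff)
  have inj: "inj (\<lambda>b (_::nat). b)" by (auto simp: inj_def fun_eq_iff)
  have q1: "q1 a = q1 b \<longleftrightarrow> a \<ominus> b \<in> I" if "a \<in> carrier R" "b \<in> carrier R" for a b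
  proof -
    have "q1 a = q1 b \<longleftrightarrow> I +> a = I +> b"
      unfolding q1_def by (rule inj_image_eq_iff[OF inj])
    also have "\<dots> \<longleftrightarrow> a \<ominus> b \<in> I" using that by (rule quotient_eq_iff_same_a_r_cos [OF I.is_ideal, symmetric])
    finally show ?thesis .
  qed
  interpret N: module_congruence R ?A q0
    by (intro module_congruence.intro self_module module_congruence_axioms.intro) (auto simp: A q0)
  interpret M: module_congruence R ?A q1
  proof (intro module_congruence.intro self_module module_congruence_axioms.intro)
    fix a a' b b' assume *: "a \<in> carrier ?A" "a' \<in> carrier ?A" "b \<in> carrier ?A" "b' \<in> carrier ?A"
      "q1 a = q1 a'" "q1 b = q1 b'"
    then have "(a \<ominus> a') \<oplus> (b \<ominus> b') \<in> I" by (simp add: A q1)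
    also have "(a \<ominus> a') \<oplus> (b \<ominus> b') = (a \<oplus> b) \<ominus> (a' \<oplus> b')" using * unfolding A by algebra
    finally show "q1 (a \<oplus>\<^bsub>?A\<^esub> b) = q1 (a' \<oplus>\<^bsub>?A\<^esub> b')" using * by (simp add: A q1)
  next
    fix r a a' assume *: "r \<in> carrier R" "a \<in> carrier ?A" "a' \<in> carrier ?A" "q1 a = q1 a'"
    then have "r \<otimes> (a \<ominus> a') \<in> I" by (simp add: A q1 I.I_l_closed)
    also have "r \<otimes> (a \<ominus> a') = r \<otimes> a \<ominus> r \<otimes> a'" using * unfolding A by algebra
    finally show "q1 (r \<odot>\<^bsub>?A\<^esub> a) = q1 (r \<odot>\<^bsub>?A\<^esub> a')" using * by (simp add: A q1)
  qed
  let ?M = "image_module ?A q1" and ?N = "image_module ?A q0"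
  let ?N' = "?N\<lparr>carrier := q0 ` I\<rparr>"
  interpret NN: module R ?N by (rule N.image_module)
  have Isub: "I \<subseteq> carrier R" by (rule I.a_subset)
  have "submodule (q0 ` I) R ?N"
  proof (rule NN.submoduleI)
    fix X assume "X \<in> q0 ` I"
    then obtain a where a: "a \<in> I" "X = q0 a" by blast
    have "\<ominus>\<^bsub>?N\<^esub> X = q0 (\<ominus> a)"
      using a Isub by (intro NN.M.minus_equality) (auto simp: N.image_simps A l_neg)
    then show "\<ominus>\<^bsub>?N\<^esub> X \<in> q0 ` I" using a by auto
  qed (use Isub in \<open>auto simp: N.image_simps A I.I_l_closed\<close>)
  then have N': "module R ?N'" by (rule submodule.submodule_is_module) (rule N.image_module)
  have N's: "carrier ?N' = q0 ` I" "X \<oplus>\<^bsub>?N'\<^esub> Y = X \<oplus>\<^bsub>?N\<^esub> Y" "r \<odot>\<^bsub>?N'\<^esub> X = r \<odot>\<^bsub>?N\<^esub> X" for X Y r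
    by simp_all
  have id: "(\<lambda>x. x) \<in> linear_maps R ?N' ?N"
    using Isub by (auto simp: linear_maps_def hom_def N.image_simps A)
  interpret h: tensor_hom R ?M ?N' ?M ?N "\<lambda>x. x" "\<lambda>x. x"
    by (intro tensor_hom.intro module_pair.intro tensor_hom_axioms.intro M.image_module N.image_module N' id
        id_linear_maps)
  have inj: "inj_on (tensor_map R ?M ?N (\<lambda>x. x) (\<lambda>x. x)) (carrier h.K.T)"
  proof -
    have "flat TYPE((nat \<Rightarrow> 'a) set) R ?M"
      using af M.image_module by (simp add: absolutely_flat_def)
    then show ?thesis
      by (rule flat_def[THEN iffD1, THEN conjunct2, rule_format, OF _ id])
        (use N' N.image_module in simp)
  qed
  have xI: "x \<in> I" unfolding I_def by (rule cgenideal_self[OF x])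
  have c: "q1 \<one> \<in> carrier ?M" "q0 x \<in> carrier ?N'" "q0 \<one> \<in> carrier ?N" "q1 x \<in> carrier ?M"
    using x xI by (auto simp: M.image_simps N.image_simps A)
  have qx: "q1 x = \<zero>\<^bsub>?M\<^esub>" using x xI by (simp add: M.image_simps A q1 minus_eq)
  \<comment> \<open>The scalar \<open>x\<close> is moved to the first factor, where it annihilates
    the class of \<open>1\<close>.\<close>
  have "q0 x = x \<odot>\<^bsub>?N\<^esub> q0 \<one>" using x by (simp add: N.image_simps A)
  then have "h.T.pt (q1 \<one>) (q0 x) = h.T.pt (q1 \<one>) (x \<odot>\<^bsub>?N\<^esub> q0 \<one>)" by simp
  also have "h.T.pt (q1 \<one>) (x \<odot>\<^bsub>?N\<^esub> q0 \<one>) = h.T.pt (x \<odot>\<^bsub>?M\<^esub> q1 \<one>) (q0 \<one>)"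
    using c x by (intro h.T.pt_smult [symmetric]) auto
  also have "x \<odot>\<^bsub>?M\<^esub> q1 \<one> = \<zero>\<^bsub>?M\<^esub>" using x qx by (simp add: M.image_simps A)
  also have "h.T.pt \<zero>\<^bsub>?M\<^esub> (q0 \<one>) = \<zero>\<^bsub>h.T.T\<^esub>" using c by (intro h.T.pt_zero_l) auto
  also have "\<dots> = tensor_map R ?M ?N (\<lambda>x. x) (\<lambda>x. x) \<zero>\<^bsub>h.K.T\<^esub>" by (rule h.tensor_map_zero [symmetric])
  finally have "tensor_map R ?M ?N (\<lambda>x. x) (\<lambda>x. x) (h.K.pt (q1 \<one>) (q0 x)) =
      tensor_map R ?M ?N (\<lambda>x. x) (\<lambda>x. x) \<zero>\<^bsub>h.K.T\<^esub>"
    using c by (subst h.tensor_map_pt) auto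
  then have z: "h.K.pt (q1 \<one>) (q0 x) = \<zero>\<^bsub>h.K.T\<^esub>"
    by (rule inj_onD[OF inj _ h.K.pt_closed[OF c(1,2)] h.K.T.zero_closed])
  \<comment> \<open>A section of \<open>q1\<close>; its values are controlled only modulo
    \<open>I\<close>.\<close>
  define s where "s = inv_into (carrier R) q1"
  have s: "s (q1 a) \<in> carrier R" "s (q1 a) \<ominus> a \<in> I" if "a \<in> carrier R" for a
  proof -
    show sa: "s (q1 a) \<in> carrier R" using that by (simp add: s_def inv_into_into)
    have "q1 (s (q1 a)) = q1 a" using that by (simp add: s_def f_inv_into_f)
    then show "s (q1 a) \<ominus> a \<in> I" using q1 sa that by simp
  qed
  \<comment> \<open>The reason why multiplication from \<open>R / I\<close> and \<open>I\<close> to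
    \<open>R / J\<close> does not depend on the representative.\<close>
  have mulJ: "a \<otimes> b \<in> J" if ab: "a \<in> I" "b \<in> I" for a b
  proof -
    obtain u where u: "a = u \<otimes> x" "u \<in> carrier R"
      using ab(1) unfolding I_def cgenideal_def by (elim CollectE exE conjE)
    obtain v where v: "b = v \<otimes> x" "v \<in> carrier R"
      using ab(2) unfolding I_def cgenideal_def by (elim CollectE exE conjE)
    note uv = u v
    then have "a \<otimes> b = (u \<otimes> v) \<otimes> (x \<otimes> x)" using x by (simp add: m_ac)
    then show ?thesis unfolding J_def cgenideal_def by (intro CollectI exI[of _ "u \<otimes> v"]) (use uv in simp)
  qed
  let ?G = "R Quot J"
  interpret G: ring ?G by (rule J.quotient_is_ring)
  define t where "t = (\<lambda>Y::(nat \<Rightarrow> 'a) set. the_elem Y 0)"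
  have t: "t (q0 a) = a" for a by (simp add: t_def q0_def)
  define \<beta> where "\<beta> = (\<lambda>X Y. J +> (s X \<otimes> t Y))"
  have Jeq: "J +> a = J +> b" if "a \<in> carrier R" "b \<in> carrier R" "a \<ominus> b \<in> J" for a b
    using quotient_eq_iff_same_a_r_cos [OF J.is_ideal that(1,2)] that(3) by simp
  have Gadd: "(J +> a) \<oplus>\<^bsub>?G\<^esub> (J +> b) = J +> (a \<oplus> b)" if "a \<in> carrier R" "b \<in> carrier R" for a b
    using that by (simp add: FactRing_def J.a_rcos_sum)
  have "\<beta> (q1 \<one>) (q0 x) = \<zero>\<^bsub>?G\<^esub>"
  proof (rule h.K.rels_universal[where \<beta> = \<beta>, OF G.abelian_group_axioms _ _ _ _ c(1,2) z])
    show "\<beta> X Y \<in> carrier ?G" if XY: "X \<in> carrier ?M" "Y \<in> carrier ?N'" for X Y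
    proof -
      obtain a b where "a \<in> carrier R" "X = q1 a" "b \<in> I" "Y = q0 b"
        using XY by (auto simp: M.image_simps A)
      then show ?thesis using s Isub unfolding \<beta>_def t
        by (auto simp: FactRing_def t subset_iff intro!: a_rcosetsI[OF J.a_subset])
    qed
    show "\<beta> (X \<oplus>\<^bsub>?M\<^esub> X') Y = \<beta> X Y \<oplus>\<^bsub>?G\<^esub> \<beta> X' Y"
      if XY: "X \<in> carrier ?M" "X' \<in> carrier ?M" "Y \<in> carrier ?N'" for X X' Y
    proof -
      obtain a a' b where ab: "a \<in> carrier R" "X = q1 a" "a' \<in> carrier R" "X' = q1 a'" "b \<in> I" "Y = q0 b"
        using XY by (auto simp: M.image_simps A)
      have b: "b \<in> carrier R" using ab Isub by auto
      let ?a = "s (q1 a)" and ?a' = "s (q1 a')" and ?s = "s (q1 (a \<oplus> a'))"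
      have sc: "?a \<in> carrier R" "?a' \<in> carrier R" "?s \<in> carrier R" using s ab by auto
      have "(?s \<ominus> (a \<oplus> a')) \<ominus> ((?a \<ominus> a) \<oplus> (?a' \<ominus> a')) \<in> I"
        unfolding minus_eq[of "_ \<ominus> _"] using s ab by (intro I.a_closed I.a_inv_closed) auto
      also have "(?s \<ominus> (a \<oplus> a')) \<ominus> ((?a \<ominus> a) \<oplus> (?a' \<ominus> a')) = ?s \<ominus> (?a \<oplus> ?a')"
        using ab sc by algebra
      finally have "(?s \<ominus> (?a \<oplus> ?a')) \<otimes> b \<in> J" by (rule mulJ) (use ab in simp)
      also have "(?s \<ominus> (?a \<oplus> ?a')) \<otimes> b = ?s \<otimes> b \<ominus> (?a \<otimes> b \<oplus> ?a' \<otimes> b)"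
        using sc b by algebra
      finally have "J +> (?s \<otimes> b) = J +> (?a \<otimes> b \<oplus> ?a' \<otimes> b)"
        using sc b by (intro Jeq) auto
      then show ?thesis
        using ab sc b by (simp add: \<beta>_def t M.image_simps A Gadd)
    qed
    show "\<beta> X (Y \<oplus>\<^bsub>?N'\<^esub> Y') = \<beta> X Y \<oplus>\<^bsub>?G\<^esub> \<beta> X Y'"
      if XY: "X \<in> carrier ?M" "Y \<in> carrier ?N'" "Y' \<in> carrier ?N'" for X Y Y'
    proof -
      obtain a b b' where ab: "a \<in> carrier R" "X = q1 a" "b \<in> I" "Y = q0 b" "b' \<in> I" "Y' = q0 b'"
        using XY by (auto simp: M.image_simps A)
      have b: "b \<in> carrier R" "b' \<in> carrier R" using ab Isub by auto
      show ?thesis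
        using ab b s by (simp add: \<beta>_def t N.image_simps A Gadd r_distr)
    qed
    show "\<beta> (r \<odot>\<^bsub>?M\<^esub> X) Y = \<beta> X (r \<odot>\<^bsub>?N'\<^esub> Y)"
      if XY: "r \<in> carrier R" "X \<in> carrier ?M" "Y \<in> carrier ?N'" for r X Y
    proof -
      obtain a b where ab: "a \<in> carrier R" "X = q1 a" "b \<in> I" "Y = q0 b"
        using XY by (auto simp: M.image_simps A)
      have b: "b \<in> carrier R" using ab Isub by auto
      let ?a = "s (q1 a)" and ?s = "s (q1 (r \<otimes> a))"
      have sc: "?a \<in> carrier R" "?s \<in> carrier R" using s ab XY by auto
      have "(?s \<ominus> r \<otimes> a) \<ominus> r \<otimes> (?a \<ominus> a) \<in> I"
        unfolding minus_eq[of "_ \<ominus> _"] using s ab XY by (intro I.a_closed I.a_inv_closed I.I_l_closed) auto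
      also have "(?s \<ominus> r \<otimes> a) \<ominus> r \<otimes> (?a \<ominus> a) = ?s \<ominus> r \<otimes> ?a"
        using ab sc XY by algebra
      finally have "(?s \<ominus> r \<otimes> ?a) \<otimes> b \<in> J" by (rule mulJ) (use ab in simp)
      also have "(?s \<ominus> r \<otimes> ?a) \<otimes> b = ?s \<otimes> b \<ominus> ?a \<otimes> (r \<otimes> b)"
        using sc b XY by algebra
      finally have "J +> (?s \<otimes> b) = J +> (?a \<otimes> (r \<otimes> b))"
        using sc b XY by (intro Jeq) auto
      then show ?thesis
        using ab sc b XY by (simp add: \<beta>_def t M.image_simps N.image_simps A)
    qed
  qed
  \<comment> \<open>The representative of the class of \<open>1\<close> need not be
    \<open>1\<close>, but it differs from it by an element of \<open>I\<close>, whose product with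
    \<open>x\<close> lies in \<open>J\<close>.\<close>
  then have "J +> (s (q1 \<one>) \<otimes> x) = J +> \<zero>"
    using J.a_subset by (simp add: \<beta>_def t FactRing_def)
  then have 1: "s (q1 \<one>) \<otimes> x \<ominus> \<zero> \<in> J"
    using quotient_eq_iff_same_a_r_cos [OF J.is_ideal, of "s (q1 \<one>) \<otimes> x" \<zero>] s x by simp
  have 2: "(s (q1 \<one>) \<ominus> \<one>) \<otimes> x \<in> J" using mulJ s(2)[of \<one>] xI by simp
  have "(s (q1 \<one>) \<otimes> x \<ominus> \<zero>) \<oplus> \<ominus> ((s (q1 \<one>) \<ominus> \<one>) \<otimes> x) \<in> J"
    using 1 2 by (intro J.a_closed J.a_inv_closed)
  also have "(s (q1 \<one>) \<otimes> x \<ominus> \<zero>) \<oplus> \<ominus> ((s (q1 \<one>) \<ominus> \<one>) \<otimes> x) = x"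
    using s(1)[of \<one>] x one_closed by algebra
  finally obtain y where y: "x = y \<otimes> (x \<otimes> x)" "y \<in> carrier R"
    unfolding J_def cgenideal_def by (elim CollectE exE conjE)
  have "y \<otimes> (x \<otimes> x) = x \<otimes> x \<otimes> y" using y(2) x by (intro m_comm) auto
  then show ?thesis using y(2) by (intro bexI[of _ y] trans[OF y(1)])
qed

section \<open>Finitely generated submodules\<close>

lemma (in abelian_monoid) finsum_lessThan_add:
  fixes m n :: nat
  assumes "\<And>i. f i \<in> carrier G"
  shows "(\<Oplus>i\<in>{..<m + n}. f i) = (\<Oplus>i\<in>{..<m}. f i) \<oplus> (\<Oplus>i\<in>{..<n}. f (m + i))"
proof (induction n)
  case (Suc n)
  have "(\<Oplus>i\<in>{..<m + Suc n}. f i) = f (m + n) \<oplus> (\<Oplus>i\<in>{..<m + n}. f i)"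
    using assms by (simp add: lessThan_Suc)
  also have "\<dots> = (\<Oplus>i\<in>{..<m}. f i) \<oplus> (f (m + n) \<oplus> (\<Oplus>i\<in>{..<n}. f (m + i)))"
    unfolding Suc.IH using assms by (intro a_lcomm) (auto intro!: finsum_closed)
  also have "f (m + n) \<oplus> (\<Oplus>i\<in>{..<n}. f (m + i)) = (\<Oplus>i\<in>{..<Suc n}. f (m + i))"
    using assms by (simp add: lessThan_Suc)
  finally show ?case .
qed (use assms in simp)

context module
begin

text \<open>Coefficients are confined to an ideal \<open>I\<close> so that one argument serves both
  the span, with \<open>I = carrier R\<close>, and the product of an ideal with a submodule.\<close>

lemma combinations_submodule:
  fixes m :: nat
  assumes I: "ideal I R" and h: "\<And>t. t < m \<Longrightarrow> h t \<in> carrier M"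
  shows "submodule {\<Oplus>\<^bsub>M\<^esub>t\<in>{..<m}. y t \<odot>\<^bsub>M\<^esub> h t |y. \<forall>t. y t \<in> I} R M"
proof -
  interpret I: ideal I R by fact
  have c: "y t \<odot>\<^bsub>M\<^esub> h t \<in> carrier M" if "\<forall>t. y t \<in> I" "t < m" for y t
    using that h I.Icarr by auto
  show ?thesis
  proof (rule submoduleI)
    show "{\<Oplus>\<^bsub>M\<^esub>t\<in>{..<m}. y t \<odot>\<^bsub>M\<^esub> h t |y. \<forall>t. y t \<in> I} \<subseteq> carrier M"
      using c by (auto intro!: M.finsum_closed)
  next
    have "(\<Oplus>\<^bsub>M\<^esub>t\<in>{..<m}. \<zero>\<^bsub>R\<^esub> \<odot>\<^bsub>M\<^esub> h t) = \<zero>\<^bsub>M\<^esub>" using h by (intro M.finsum_zero_eqI) auto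
    then show "\<zero>\<^bsub>M\<^esub> \<in> {\<Oplus>\<^bsub>M\<^esub>t\<in>{..<m}. y t \<odot>\<^bsub>M\<^esub> h t |y. \<forall>t. y t \<in> I}"
      by (intro CollectI exI[of _ "\<lambda>_. \<zero>\<^bsub>R\<^esub>"]) auto
  next
    fix a assume "a \<in> {\<Oplus>\<^bsub>M\<^esub>t\<in>{..<m}. y t \<odot>\<^bsub>M\<^esub> h t |y. \<forall>t. y t \<in> I}"
    then obtain y where y: "\<forall>t. y t \<in> I" and a: "a = (\<Oplus>\<^bsub>M\<^esub>t\<in>{..<m}. y t \<odot>\<^bsub>M\<^esub> h t)" by blast
    have "\<ominus>\<^bsub>M\<^esub> a = (\<Oplus>\<^bsub>M\<^esub>t\<in>{..<m}. \<ominus>\<^bsub>M\<^esub> (y t \<odot>\<^bsub>M\<^esub> h t))"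
      unfolding a using c y by (intro M.finsum_minus [symmetric]) auto
    also have "\<dots> = (\<Oplus>\<^bsub>M\<^esub>t\<in>{..<m}. (\<ominus>\<^bsub>R\<^esub> y t) \<odot>\<^bsub>M\<^esub> h t)"
      using c y h I.Icarr by (intro M.finsum_cong') (auto simp: smult_l_minus)
    finally show "\<ominus>\<^bsub>M\<^esub> a \<in> {\<Oplus>\<^bsub>M\<^esub>t\<in>{..<m}. y t \<odot>\<^bsub>M\<^esub> h t |y. \<forall>t. y t \<in> I}"
      using y by (intro CollectI exI[of _ "\<lambda>t. \<ominus>\<^bsub>R\<^esub> y t"]) auto
  next
    fix a b assume "a \<in> {\<Oplus>\<^bsub>M\<^esub>t\<in>{..<m}. y t \<odot>\<^bsub>M\<^esub> h t |y. \<forall>t. y t \<in> I}"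
      "b \<in> {\<Oplus>\<^bsub>M\<^esub>t\<in>{..<m}. y t \<odot>\<^bsub>M\<^esub> h t |y. \<forall>t. y t \<in> I}"
    then obtain y z where y: "\<forall>t. y t \<in> I" and a: "a = (\<Oplus>\<^bsub>M\<^esub>t\<in>{..<m}. y t \<odot>\<^bsub>M\<^esub> h t)"
      and z: "\<forall>t. z t \<in> I" and b: "b = (\<Oplus>\<^bsub>M\<^esub>t\<in>{..<m}. z t \<odot>\<^bsub>M\<^esub> h t)" by blast
    have "a \<oplus>\<^bsub>M\<^esub> b = (\<Oplus>\<^bsub>M\<^esub>t\<in>{..<m}. y t \<odot>\<^bsub>M\<^esub> h t \<oplus>\<^bsub>M\<^esub> z t \<odot>\<^bsub>M\<^esub> h t)"
      unfolding a b using c y z by (intro M.finsum_addf [symmetric]) auto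
    also have "\<dots> = (\<Oplus>\<^bsub>M\<^esub>t\<in>{..<m}. (y t \<oplus>\<^bsub>R\<^esub> z t) \<odot>\<^bsub>M\<^esub> h t)"
      using c y z h I.Icarr by (intro M.finsum_cong') (auto simp: smult_l_distr)
    finally show "a \<oplus>\<^bsub>M\<^esub> b \<in> {\<Oplus>\<^bsub>M\<^esub>t\<in>{..<m}. y t \<odot>\<^bsub>M\<^esub> h t |y. \<forall>t. y t \<in> I}"
      using y z by (intro CollectI exI[of _ "\<lambda>t. y t \<oplus>\<^bsub>R\<^esub> z t"]) auto
  next
    fix r a assume r: "r \<in> carrier R" and "a \<in> {\<Oplus>\<^bsub>M\<^esub>t\<in>{..<m}. y t \<odot>\<^bsub>M\<^esub> h t |y. \<forall>t. y t \<in> I}"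
    then obtain y where y: "\<forall>t. y t \<in> I" and a: "a = (\<Oplus>\<^bsub>M\<^esub>t\<in>{..<m}. y t \<odot>\<^bsub>M\<^esub> h t)" by blast
    have "r \<odot>\<^bsub>M\<^esub> a = (\<Oplus>\<^bsub>M\<^esub>t\<in>{..<m}. r \<odot>\<^bsub>M\<^esub> (y t \<odot>\<^bsub>M\<^esub> h t))"
      unfolding a using c y r by (intro finsum_smult_ldistr) auto
    also have "\<dots> = (\<Oplus>\<^bsub>M\<^esub>t\<in>{..<m}. (r \<otimes>\<^bsub>R\<^esub> y t) \<odot>\<^bsub>M\<^esub> h t)"
      using c y h r I.Icarr by (intro M.finsum_cong') (auto simp: smult_assoc1)
    finally show "r \<odot>\<^bsub>M\<^esub> a \<in> {\<Oplus>\<^bsub>M\<^esub>t\<in>{..<m}. y t \<odot>\<^bsub>M\<^esub> h t |y. \<forall>t. y t \<in> I}"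
      using y r I.I_l_closed by (intro CollectI exI[of _ "\<lambda>t. r \<otimes>\<^bsub>R\<^esub> y t"]) auto
  qed
qed

lemma module_span_least:
  assumes "submodule H R M" "S \<subseteq> H"
  shows "module_span R M S \<subseteq> H"
  using assms by (auto simp: module_span_def)

lemma module_span_superset: "S \<subseteq> module_span R M S"
  by (auto simp: module_span_def)

lemma module_span_finite:
  fixes m :: nat
  assumes h: "\<And>t. t < m \<Longrightarrow> h t \<in> carrier M"
  shows "module_span R M (h ` {..<m}) = {\<Oplus>\<^bsub>M\<^esub>t\<in>{..<m}. y t \<odot>\<^bsub>M\<^esub> h t |y. \<forall>t. y t \<in> carrier R}"
    (is "_ = ?C")
proof
  show "module_span R M (h ` {..<m}) \<subseteq> ?C"
  proof (rule module_span_least)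
    show "submodule ?C R M" by (rule combinations_submodule[OF R.oneideal h])
    show "h ` {..<m} \<subseteq> ?C"
    proof clarify
      fix s assume s: "s < m"
      have "(\<Oplus>\<^bsub>M\<^esub>t\<in>{..<m}. (if t = s then \<one>\<^bsub>R\<^esub> else \<zero>\<^bsub>R\<^esub>) \<odot>\<^bsub>M\<^esub> h t) = h s"
        using s h by (subst M.finsum_delta[of _ s]) auto
      then show "\<exists>y. h s = (\<Oplus>\<^bsub>M\<^esub>t\<in>{..<m}. y t \<odot>\<^bsub>M\<^esub> h t) \<and> (\<forall>t. y t \<in> carrier R)"
        by (intro exI[of _ "\<lambda>t. if t = s then \<one>\<^bsub>R\<^esub> else \<zero>\<^bsub>R\<^esub>"]) auto
    qed
  qed
  show "?C \<subseteq> module_span R M (h ` {..<m})"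
    unfolding module_span_def
  proof (clarify)
    fix y :: "nat \<Rightarrow> 'a" and H assume y: "\<forall>t. y t \<in> carrier R" and H: "submodule H R M" "h ` {..<m} \<subseteq> H"
    show "(\<Oplus>\<^bsub>M\<^esub>t\<in>{..<m}. y t \<odot>\<^bsub>M\<^esub> h t) \<in> H"
      using y H submoduleE(4)[OF H(1)] by (intro submodule_finsum[OF H(1)]) auto
  qed
qed

text \<open>The ideal absorbs the coefficients of the elements of the submodule, so one coefficient
  in \<open>I\<close> per generator suffices. In this form (APf) becomes a statement about
  coefficients.\<close>

lemma ideal_smult_finite:
  fixes m :: nat
  assumes I: "ideal I R" and h: "\<And>t. t < m \<Longrightarrow> h t \<in> carrier M"
  shows "ideal_smult R M I (module_span R M (h ` {..<m})) =
    {\<Oplus>\<^bsub>M\<^esub>t\<in>{..<m}. y t \<odot>\<^bsub>M\<^esub> h t |y. \<forall>t. y t \<in> I}" (is "_ = ?C")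
proof
  interpret I: ideal I R by fact
  have sp: "module_span R M (h ` {..<m}) = {\<Oplus>\<^bsub>M\<^esub>t\<in>{..<m}. y t \<odot>\<^bsub>M\<^esub> h t |y. \<forall>t. y t \<in> carrier R}"
    by (rule module_span_finite[OF h])
  show "ideal_smult R M I (module_span R M (h ` {..<m})) \<subseteq> ?C"
    unfolding ideal_smult_def
  proof (rule module_span_least)
    show "submodule ?C R M" by (rule combinations_submodule[OF I h])
    show "{a \<odot>\<^bsub>M\<^esub> x |a x. a \<in> I \<and> x \<in> module_span R M (h ` {..<m})} \<subseteq> ?C"
    proof clarify
      fix a x assume a: "a \<in> I" and "x \<in> module_span R M (h ` {..<m})"
      then obtain y where x: "x = (\<Oplus>\<^bsub>M\<^esub>t\<in>{..<m}. y t \<odot>\<^bsub>M\<^esub> h t)" and y: "\<forall>t. y t \<in> carrier R"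
        unfolding sp by (elim CollectE exE conjE)
      have "a \<odot>\<^bsub>M\<^esub> x = (\<Oplus>\<^bsub>M\<^esub>t\<in>{..<m}. a \<odot>\<^bsub>M\<^esub> (y t \<odot>\<^bsub>M\<^esub> h t))"
        unfolding x using h y I.Icarr[OF a] by (intro finsum_smult_ldistr) auto
      also have "\<dots> = (\<Oplus>\<^bsub>M\<^esub>t\<in>{..<m}. (a \<otimes>\<^bsub>R\<^esub> y t) \<odot>\<^bsub>M\<^esub> h t)"
        using y h I.Icarr[OF a] by (intro M.finsum_cong') (auto simp: smult_assoc1)
      finally show "\<exists>y. a \<odot>\<^bsub>M\<^esub> x = (\<Oplus>\<^bsub>M\<^esub>t\<in>{..<m}. y t \<odot>\<^bsub>M\<^esub> h t) \<and> (\<forall>t. y t \<in> I)"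
        using y a I.I_r_closed by (intro exI[of _ "\<lambda>t. a \<otimes>\<^bsub>R\<^esub> y t"]) auto
    qed
  qed
  show "?C \<subseteq> ideal_smult R M I (module_span R M (h ` {..<m}))"
    unfolding ideal_smult_def
  proof
    fix x assume "x \<in> ?C"
    then obtain y where x: "x = (\<Oplus>\<^bsub>M\<^esub>t\<in>{..<m}. y t \<odot>\<^bsub>M\<^esub> h t)" and y: "\<forall>t. y t \<in> I" by (elim CollectE exE conjE)
    show "x \<in> module_span R M {a \<odot>\<^bsub>M\<^esub> x |a x. a \<in> I \<and> x \<in> module_span R M (h ` {..<m})}"
      unfolding module_span_def[of R M "{a \<odot>\<^bsub>M\<^esub> x |a x. a \<in> I \<and> x \<in> module_span R M (h ` {..<m})}"]
    proof (rule InterI, elim CollectE conjE)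
      fix H assume H: "submodule H R M"
        "{a \<odot>\<^bsub>M\<^esub> x |a x. a \<in> I \<and> x \<in> module_span R M (h ` {..<m})} \<subseteq> H"
      show "x \<in> H"
        unfolding x
      proof (rule submodule_finsum[OF H(1)])
        fix t assume "t \<in> {..<m}"
        then have "h t \<in> module_span R M (h ` {..<m})"
          by (intro subsetD[OF module_span_superset] imageI)
        then show "y t \<odot>\<^bsub>M\<^esub> h t \<in> H" using y by (intro subsetD[OF H(2)] CollectI exI conjI refl) auto
      qed simp
    qed
  qed
qed

end

text \<open>The ring is treated as a module over itself, where the span of finitely many elements is
  already known; that span is an ideal containing the generators.\<close>

lemma (in cring) genideal_finite:
  fixes m :: nat
  assumes h: "\<And>t. t < m \<Longrightarrow> h t \<in> carrier R" and x: "x \<in> Idl (h ` {..<m})"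
  shows "\<exists>y. (\<forall>t. y t \<in> carrier R) \<and> x = (\<Oplus>t\<in>{..<m}. y t \<otimes> h t)"
proof -
  let ?S = "restrict_scalars (\<lambda>x. x) R"
  interpret S: module R ?S by (rule self_module)
  have S: "carrier ?S = carrier R" "\<zero>\<^bsub>?S\<^esub> = \<zero>" "a \<oplus>\<^bsub>?S\<^esub> b = a \<oplus> b" "a \<odot>\<^bsub>?S\<^esub> b = a \<otimes> b" for a b
    by (simp_all add: restrict_scalars_def)
  have fs: "finsum ?S f A = finsum R f A" for f and A :: "nat set"
    by (simp add: finsum_def finprod_def S restrict_scalars_def)
  let ?C = "{\<Oplus>t\<in>{..<m}. y t \<otimes> h t |y. \<forall>t. y t \<in> carrier R}"
  have C: "?C = module_span R ?S (h ` {..<m})"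
    using S.module_span_finite[of m h] h by (simp add: S fs)
  have sub: "submodule ?C R ?S"
    using S.combinations_submodule[OF oneideal, of m h] h by (simp add: S fs)
  have "ideal ?C R"
  proof (rule idealI)
    show "subgroup ?C (add_monoid R)"
      using submodule.axioms(1)[OF sub] by (simp add: subgroup_def S restrict_scalars_def m_inv_def)
    show "x \<otimes> a \<in> ?C" if "a \<in> ?C" "x \<in> carrier R" for a x
      using S.submoduleE(4)[OF sub that(2,1)] by (simp add: S)
    show "a \<otimes> x \<in> ?C" if "a \<in> ?C" "x \<in> carrier R" for a x
    proof -
      have "a \<in> carrier R" using subsetD[OF S.submoduleE(1)[OF sub] that(1)] by (simp add: S)
      then have "a \<otimes> x = x \<otimes> a" using that(2) by (rule m_comm)
      then show ?thesis using S.submoduleE(4)[OF sub that(2,1)] by (simp add: S)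
    qed
  qed (rule ring_axioms)
  moreover have "h ` {..<m} \<subseteq> ?C" unfolding C by (rule S.module_span_superset)
  ultimately have "Idl (h ` {..<m}) \<subseteq> ?C" by (rule genideal_minimal)
  then show ?thesis using x by blast
qed

section \<open>Free modules\<close>

lemma free_module_simps:
  "carrier (free_module R n) = {..<n} \<rightarrow>\<^sub>E carrier R"
  "\<zero>\<^bsub>free_module R n\<^esub> = (\<lambda>i\<in>{..<n}. \<zero>\<^bsub>R\<^esub>)"
  "x \<oplus>\<^bsub>free_module R n\<^esub> y = (\<lambda>i\<in>{..<n}. x i \<oplus>\<^bsub>R\<^esub> y i)"
  "a \<odot>\<^bsub>free_module R n\<^esub> x = (\<lambda>i\<in>{..<n}. a \<otimes>\<^bsub>R\<^esub> x i)"
  by (simp_all add: free_module_def)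

lemma (in cring) free_module: "module R (free_module R n)"
proof (rule moduleI)
  show "abelian_group (free_module R n)"
  proof (rule abelian_groupI)
    fix x assume x: "x \<in> carrier (free_module R n)"
    show "\<exists>y\<in>carrier (free_module R n). y \<oplus>\<^bsub>free_module R n\<^esub> x = \<zero>\<^bsub>free_module R n\<^esub>"
      using x by (intro bexI[of _ "\<lambda>i\<in>{..<n}. \<ominus> x i"]) (auto simp: free_module_simps PiE_iff l_neg)
    show "\<zero>\<^bsub>free_module R n\<^esub> \<oplus>\<^bsub>free_module R n\<^esub> x = x"
      using x by (auto simp: free_module_simps PiE_iff extensional_def fun_eq_iff)
  qed (auto simp: free_module_simps PiE_iff a_assoc a_comm a_lcomm fun_eq_iff intro!: a_comm)
  show "\<one> \<odot>\<^bsub>free_module R n\<^esub> x = x" if "x \<in> carrier (free_module R n)" for x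
    using that by (auto simp: free_module_simps PiE_iff extensional_def fun_eq_iff)
qed (auto simp: free_module_simps PiE_iff l_distr r_distr m_assoc is_cring fun_eq_iff)

lemma (in cring) free_module_finsum:
  assumes "finite I" "\<And>i. i \<in> I \<Longrightarrow> g i \<in> carrier (free_module R n)" "j < n"
  shows "(\<Oplus>\<^bsub>free_module R n\<^esub>i\<in>I. g i) j = (\<Oplus>i\<in>I. g i j)"
proof -
  interpret F: module R "free_module R n" by (rule free_module)
  show ?thesis
    using assms(1,2)
  proof (induction I rule: finite_induct)
    case empty
    show ?case using assms(3) by (simp add: free_module_simps)
  next
    case (insert x A)
    have "(\<Oplus>\<^bsub>free_module R n\<^esub>i\<in>insert x A. g i) = g x \<oplus>\<^bsub>free_module R n\<^esub> (\<Oplus>\<^bsub>free_module R n\<^esub>i\<in>A. g i)"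
      using insert by (intro F.M.finsum_insert) auto
    moreover have "(\<Oplus>i\<in>insert x A. g i j) = g x j \<oplus> (\<Oplus>i\<in>A. g i j)"
      using insert assms(3) by (intro finsum_insert) (auto simp: free_module_simps PiE_iff)
    ultimately show ?case using insert assms(3) by (simp add: free_module_simps(3))
  qed
qed

definition unit_vector :: "('a, 'r) ring_scheme \<Rightarrow> nat \<Rightarrow> nat \<Rightarrow> nat \<Rightarrow> 'a" where
  "unit_vector R n i = (\<lambda>j\<in>{..<n}. if i = j then \<one>\<^bsub>R\<^esub> else \<zero>\<^bsub>R\<^esub>)"

lemma (in cring) unit_vector_closed [simp]: "unit_vector R n i \<in> carrier (free_module R n)"
  by (auto simp: unit_vector_def free_module_simps)

lemma (in cring) free_module_eqI:
  assumes "x \<in> carrier (free_module R n)" "y \<in> carrier (free_module R n)" "\<And>j. j < n \<Longrightarrow> x j = y j"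
  shows "x = y"
  using assms by (auto simp: free_module_simps PiE_iff intro: extensionalityI)

text \<open>The coefficients \<open>y\<close> may differ from \<open>x\<close> beyond
  \<open>n\<close>: there \<open>x\<close> is \<open>undefined\<close> and need not lie in the ring,
  while total coefficient functions with values in the ring are wanted later.\<close>

lemma (in cring) free_module_expand:
  assumes x: "x \<in> carrier (free_module R n)" and y: "\<And>i. i < n \<Longrightarrow> y i = x i"
  shows "x = (\<Oplus>\<^bsub>free_module R n\<^esub>i\<in>{..<n}. y i \<odot>\<^bsub>free_module R n\<^esub> unit_vector R n i)"
proof -
  interpret F: module R "free_module R n" by (rule free_module)
  have yc: "y i \<in> carrier R" if "i < n" for i using x y that by (auto simp: free_module_simps PiE_iff)
  have c: "y i \<odot>\<^bsub>free_module R n\<^esub> unit_vector R n i \<in> carrier (free_module R n)" if "i < n" for i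
    using yc that by simp
  show ?thesis
  proof (rule free_module_eqI[OF x])
    show "(\<Oplus>\<^bsub>free_module R n\<^esub>i\<in>{..<n}. y i \<odot>\<^bsub>free_module R n\<^esub> unit_vector R n i) \<in> carrier (free_module R n)"
      using c by (intro F.M.finsum_closed) auto
    fix j assume j: "j < n"
    have "(\<Oplus>\<^bsub>free_module R n\<^esub>i\<in>{..<n}. y i \<odot>\<^bsub>free_module R n\<^esub> unit_vector R n i) j
        = (\<Oplus>i\<in>{..<n}. (y i \<odot>\<^bsub>free_module R n\<^esub> unit_vector R n i) j)"
      using c j by (intro free_module_finsum) auto
    also have "\<dots> = (y j \<odot>\<^bsub>free_module R n\<^esub> unit_vector R n j) j"
      using j yc by (intro finsum_delta) (auto simp: free_module_simps unit_vector_def)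
    also have "\<dots> = x j" using j yc y by (simp add: free_module_simps unit_vector_def)
    finally show "x j = (\<Oplus>\<^bsub>free_module R n\<^esub>i\<in>{..<n}. y i \<odot>\<^bsub>free_module R n\<^esub> unit_vector R n i) j" by simp
  qed
qed

text \<open>Coherence offers some presentation of the ideal generated by the \<open>c s\<close>, not
  necessarily one by these generators. Comparing the two sets of generators, as in Schanuel's lemma,
  yields the relations of \<open>c\<close>: those saying that \<open>c s\<close> is recovered after
  rewriting it in the other generators and back, and the translated relations
  \<open>\<kappa>\<close> of the presentation.\<close>

theorem coherent_relations:
  fixes R (structure) and q :: nat
  assumes coh: "coherent_ring R" and c: "\<And>s. c s \<in> carrier R"
  obtains p :: nat and k where "\<And>j s. k j s \<in> carrier R"
    "\<And>j. j < p \<Longrightarrow> (\<Oplus>s\<in>{..<q}. c s \<otimes> k j s) = \<zero>"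
    "\<And>x. (\<And>s. x s \<in> carrier R) \<Longrightarrow> (\<Oplus>s\<in>{..<q}. c s \<otimes> x s) = \<zero> \<Longrightarrow>
      \<exists>y. (\<forall>j. y j \<in> carrier R) \<and> (\<forall>s<q. x s = (\<Oplus>j\<in>{..<p}. y j \<otimes> k j s))"
proof -
  interpret cring R using coh by (simp add: coherent_ring_def)
  define I where "I = Idl (c ` {..<q})"
  have cI: "c ` {..<q} \<subseteq> I" unfolding I_def using c by (intro genideal_self) auto
  interpret I: ideal I R unfolding I_def using c by (intro genideal_ideal) auto
  let ?S = "restrict_scalars (\<lambda>x. x) R"
  interpret S: module R ?S by (rule self_module)
  have S: "carrier ?S = carrier R" "\<zero>\<^bsub>?S\<^esub> = \<zero>" "a \<oplus>\<^bsub>?S\<^esub> b = a \<oplus> b" "a \<odot>\<^bsub>?S\<^esub> b = a \<otimes> b" for a b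
    by (simp_all add: restrict_scalars_def)
  have fs: "finsum ?S f A = finsum R f A" for f and A :: "nat set"
    by (simp add: finsum_def finprod_def S restrict_scalars_def)
  have "fin_gen_ideal R I"
    unfolding fin_gen_ideal_def I_def using c by (intro exI[of _ "c ` {..<q}"]) auto
  then have "finitely_presented R (?S\<lparr>carrier := I\<rparr>)"
    using coh by (simp add: coherent_ring_def)
  then obtain n f where f: "f \<in> linear_maps R (free_module R n) (?S\<lparr>carrier := I\<rparr>)"
    and surj: "f ` carrier (free_module R n) = I"
    and fg: "fin_gen_submodule R (free_module R n) (a_kernel (free_module R n) (?S\<lparr>carrier := I\<rparr>) f)"
    unfolding finitely_presented_def by auto
  let ?F = "free_module R n"
  interpret F: module R ?F by (rule free_module)
  have f': "f \<in> linear_maps R ?F ?S"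
    using f I.a_subset unfolding linear_maps_def hom_def by (auto simp: S Pi_def)
  obtain K0 where K0: "finite K0" "K0 \<subseteq> carrier ?F"
    "a_kernel ?F (?S\<lparr>carrier := I\<rparr>) f = module_span R ?F K0"
    using fg by (auto simp: fin_gen_submodule_def)
  obtain \<kappa> and m :: nat where \<kappa>: "K0 = \<kappa> ` {..<m}"
    using finite_imp_nat_seg_image_inj_on[OF K0(1)] by (metis lessThan_def)
  have \<kappa>c: "\<kappa> t \<in> carrier ?F" if "t < m" for t using K0(2) \<kappa> that by auto
  have \<kappa>R: "\<kappa> t j \<in> carrier R" if "t < m" "j < n" for t j
    using \<kappa>c[OF that(1)] that(2) by (auto simp: free_module_simps PiE_iff)
  have sp: "module_span R ?F K0 = {\<Oplus>\<^bsub>?F\<^esub>t\<in>{..<m}. y t \<odot>\<^bsub>?F\<^esub> \<kappa> t |y. \<forall>t. y t \<in> carrier R}"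
    unfolding \<kappa> by (rule F.module_span_finite[OF \<kappa>c])
  have kernel: "x \<in> module_span R ?F K0 \<longleftrightarrow> x \<in> carrier ?F \<and> f x = \<zero>" for x
    unfolding K0(3)[symmetric] by (simp add: a_kernel_def' S)
  \<comment> \<open>The generators of the ideal that belong to the given presentation.\<close>
  define d where "d = (\<lambda>j. f (unit_vector R n j))"
  have dI: "d j \<in> I" for j using surj unit_vector_closed unfolding d_def by blast
  have dR: "d j \<in> carrier R" for j using dI I.Icarr by blast
  have fd: "f z = (\<Oplus>j\<in>{..<n}. z j \<otimes> d j)" if z: "z \<in> carrier ?F" for z
  proof -
    have zc: "z j \<in> carrier R" if "j < n" for j using z that by (auto simp: free_module_simps PiE_iff)
    have "f z = f (\<Oplus>\<^bsub>?F\<^esub>j\<in>{..<n}. z j \<odot>\<^bsub>?F\<^esub> unit_vector R n j)"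
      using free_module_expand[OF z, of z] by simp
    also have "\<dots> = (\<Oplus>\<^bsub>?S\<^esub>j\<in>{..<n}. f (z j \<odot>\<^bsub>?F\<^esub> unit_vector R n j))"
      using zc by (intro linear_maps_finsum[OF f' free_module self_module]) auto
    also have "\<dots> = (\<Oplus>j\<in>{..<n}. z j \<otimes> d j)"
      unfolding fs d_def using zc linear_mapsD(3)[OF f'] dR
      by (intro finsum_cong') (auto simp: S d_def)
    finally show ?thesis .
  qed
  have "\<exists>v. (\<forall>s. v s \<in> carrier R) \<and> d j = (\<Oplus>s\<in>{..<q}. v s \<otimes> c s)" for j
    using dI[of j] c unfolding I_def by (intro genideal_finite) auto
  then obtain v where v: "\<And>j s. v j s \<in> carrier R" and dv: "\<And>j. d j = (\<Oplus>s\<in>{..<q}. v j s \<otimes> c s)"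
    by metis
  have "\<exists>z. z \<in> carrier ?F \<and> f z = c s" if "s < q" for s
  proof -
    have "c s \<in> f ` carrier ?F" using surj cI that by auto
    then show ?thesis by auto
  qed
  then obtain z where z: "\<And>s. s < q \<Longrightarrow> z s \<in> carrier ?F" and fz: "\<And>s. s < q \<Longrightarrow> f (z s) = c s"
    by metis
  have zR: "z s j \<in> carrier R" if "s < q" "j < n" for s j
    using z[OF that(1)] that(2) by (auto simp: free_module_simps PiE_iff)
  define \<delta> where "\<delta> = (\<lambda>s i :: nat. if s = i then \<one> else \<zero>)"
  have \<delta>: "\<delta> s i \<in> carrier R" for s i by (simp add: \<delta>_def)
  \<comment> \<open>Turns coordinates with respect to the \<open>d j\<close> into coordinates with
    respect to the \<open>c s\<close>.\<close>
  define G where "G = (\<lambda>a i. \<Oplus>j\<in>{..<n}. a j \<otimes> v j i)"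
  have G: "G a i \<in> carrier R" if "\<And>j. j < n \<Longrightarrow> a j \<in> carrier R" for a i
    unfolding G_def using that v by (intro finsum_closed) auto
  have cG: "(\<Oplus>i\<in>{..<q}. c i \<otimes> G a i) = (\<Oplus>j\<in>{..<n}. a j \<otimes> d j)"
    if a: "\<And>j. j < n \<Longrightarrow> a j \<in> carrier R" for a
  proof -
    have "(\<Oplus>i\<in>{..<q}. c i \<otimes> G a i) = (\<Oplus>i\<in>{..<q}. \<Oplus>j\<in>{..<n}. a j \<otimes> (v j i \<otimes> c i))"
    proof (rule finsum_cong')
      fix i
      have "c i \<otimes> G a i = (\<Oplus>j\<in>{..<n}. c i \<otimes> (a j \<otimes> v j i))"
        unfolding G_def using a v c by (intro finsum_rdistr) auto
      also have "\<dots> = (\<Oplus>j\<in>{..<n}. a j \<otimes> (v j i \<otimes> c i))"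
        using a v c by (intro finsum_cong') (auto simp: m_ac)
      finally show "c i \<otimes> G a i = (\<Oplus>j\<in>{..<n}. a j \<otimes> (v j i \<otimes> c i))" .
    qed (use a v c in \<open>auto intro!: finsum_closed\<close>)
    also have "\<dots> = (\<Oplus>j\<in>{..<n}. \<Oplus>i\<in>{..<q}. a j \<otimes> (v j i \<otimes> c i))"
      using a v c by (intro finsum_swap) auto
    also have "\<dots> = (\<Oplus>j\<in>{..<n}. a j \<otimes> d j)"
    proof (rule finsum_cong')
      fix j assume "j \<in> {..<n}"
      then show "(\<Oplus>i\<in>{..<q}. a j \<otimes> (v j i \<otimes> c i)) = a j \<otimes> d j"
        unfolding dv using a v c by (intro finsum_rdistr [symmetric]) auto
    qed (use a dR in auto)
    finally show ?thesis .
  qed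
  \<comment> \<open>The coordinates of \<open>c s\<close> minus those found by the round trip
    through the \<open>d j\<close>. Both give the same element of the ideal, so \<open>W s\<close>
    is a relation.\<close>
  define W where "W = (\<lambda>s i. \<delta> s i \<ominus> G (z s) i)"
  have W: "W s i \<in> carrier R" if "s < q" for s i
    unfolding W_def using \<delta> G zR that by simp
  have cW: "(\<Oplus>i\<in>{..<q}. c i \<otimes> W s i) = \<zero>" if s: "s < q" for s
  proof -
    have Gz: "G (z s) i \<in> carrier R" for i using G zR s by simp
    have "(\<Oplus>i\<in>{..<q}. c i \<otimes> W s i) = (\<Oplus>i\<in>{..<q}. c i \<otimes> \<delta> s i \<oplus> \<ominus> (c i \<otimes> G (z s) i))"
      unfolding W_def using c Gz \<delta> by (intro finsum_cong') (auto simp: minus_eq r_distr r_minus)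
    also have "\<dots> = (\<Oplus>i\<in>{..<q}. c i \<otimes> \<delta> s i) \<oplus> (\<Oplus>i\<in>{..<q}. \<ominus> (c i \<otimes> G (z s) i))"
      using c Gz \<delta> by (intro finsum_addf) auto
    also have "(\<Oplus>i\<in>{..<q}. \<ominus> (c i \<otimes> G (z s) i)) = \<ominus> (\<Oplus>i\<in>{..<q}. c i \<otimes> G (z s) i)"
      using c Gz by (intro finsum_minus) auto
    also have "(\<Oplus>i\<in>{..<q}. c i \<otimes> G (z s) i) = c s"
      using cG[of "z s"] zR s fd[OF z[OF s]] fz[OF s] by simp
    also have "(\<Oplus>i\<in>{..<q}. c i \<otimes> \<delta> s i) = c s"
      using c s by (subst finsum_delta[of _ s]) (auto simp: \<delta>_def)
    finally show ?thesis using c by (simp add: r_neg)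
  qed
  have cK: "(\<Oplus>i\<in>{..<q}. c i \<otimes> G (\<kappa> t) i) = \<zero>" if t: "t < m" for t
  proof -
    have "\<kappa> t \<in> module_span R ?F K0" by (rule subsetD[OF F.module_span_superset]) (use \<kappa> t in simp)
    then have "f (\<kappa> t) = \<zero>" using kernel by blast
    then show ?thesis using cG[of "\<kappa> t"] \<kappa>R t fd[OF \<kappa>c[OF t]] by simp
  qed
  \<comment> \<open>The \<open>q\<close> round-trip relations come first, then the \<open>m\<close>
    relations of the presentation, and zero beyond them.\<close>
  define k where "k = (\<lambda>j i. if j < q then W j i else if j < q + m then G (\<kappa> (j - q)) i else \<zero>)"
  show ?thesis
  proof (rule that[of k "q + m"])
    show kc: "k j i \<in> carrier R" for j i
      unfolding k_def using W G \<kappa>R by auto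
    show "(\<Oplus>s\<in>{..<q}. c s \<otimes> k j s) = \<zero>" if "j < q + m" for j
    proof (cases "j < q")
      case True
      then show ?thesis using cW[of j] by (simp add: k_def)
    next
      case False
      then show ?thesis using cK[of "j - q"] that by (simp add: k_def)
    qed
    fix x assume x: "\<And>s. x s \<in> carrier R" and rel: "(\<Oplus>s\<in>{..<q}. c s \<otimes> x s) = \<zero>"
    \<comment> \<open>Lifts the value of \<open>x\<close> to the free module. As \<open>x\<close> is
      a relation, \<open>Z\<close> is in the kernel of \<open>f\<close>; and \<open>x\<close> is the
      combination of the \<open>W s\<close> with coefficients \<open>x s\<close>, plus
      \<open>G Z\<close>, which is a combination of the translated kernel generators.\<close>
    define Z where "Z = (\<Oplus>\<^bsub>?F\<^esub>s\<in>{..<q}. x s \<odot>\<^bsub>?F\<^esub> z s)"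
    have Zc: "Z \<in> carrier ?F" unfolding Z_def using x z by (intro F.M.finsum_closed) auto
    have "f Z = (\<Oplus>\<^bsub>?S\<^esub>s\<in>{..<q}. f (x s \<odot>\<^bsub>?F\<^esub> z s))"
      unfolding Z_def using x z by (intro linear_maps_finsum[OF f' free_module self_module]) auto
    also have "\<dots> = (\<Oplus>s\<in>{..<q}. c s \<otimes> x s)"
      unfolding fs using x z linear_mapsD(3)[OF f'] fz c
      by (intro finsum_cong') (auto simp: S m_comm)
    finally have "Z \<in> module_span R ?F K0" using rel kernel Zc by simp
    then obtain y where Zy: "Z = (\<Oplus>\<^bsub>?F\<^esub>t\<in>{..<m}. y t \<odot>\<^bsub>?F\<^esub> \<kappa> t)" and y0: "\<forall>t. y t \<in> carrier R"
      unfolding sp by (elim CollectE exE conjE)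
    have y: "y t \<in> carrier R" for t using y0 by blast
    have Zj1: "Z j = (\<Oplus>s\<in>{..<q}. x s \<otimes> z s j)" if j: "j < n" for j
    proof -
      have "Z j = (\<Oplus>s\<in>{..<q}. (x s \<odot>\<^bsub>?F\<^esub> z s) j)"
        unfolding Z_def using x z j by (intro free_module_finsum) auto
      also have "\<dots> = (\<Oplus>s\<in>{..<q}. x s \<otimes> z s j)"
        using x zR j by (intro finsum_cong') (auto simp: free_module_simps)
      finally show ?thesis .
    qed
    have Zj2: "Z j = (\<Oplus>t\<in>{..<m}. y t \<otimes> \<kappa> t j)" if j: "j < n" for j
    proof -
      have "Z j = (\<Oplus>t\<in>{..<m}. (y t \<odot>\<^bsub>?F\<^esub> \<kappa> t) j)"
        unfolding Zy using y \<kappa>c j by (intro free_module_finsum) auto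
      also have "\<dots> = (\<Oplus>t\<in>{..<m}. y t \<otimes> \<kappa> t j)"
        using y \<kappa>R j by (intro finsum_cong') (auto simp: free_module_simps)
      finally show ?thesis .
    qed
    have GZ: "G Z i = (\<Oplus>s\<in>{..<q}. x s \<otimes> G (z s) i)" "G Z i = (\<Oplus>t\<in>{..<m}. y t \<otimes> G (\<kappa> t) i)" for i
    proof -
      have "G Z i = (\<Oplus>j\<in>{..<n}. (\<Oplus>s\<in>{..<q}. x s \<otimes> z s j) \<otimes> v j i)"
        unfolding G_def using Zj1 x zR v by (intro finsum_cong') (auto intro!: finsum_closed)
      also have "\<dots> = (\<Oplus>s\<in>{..<q}. x s \<otimes> G (z s) i)"
        unfolding G_def using x zR v by (intro sum_prod_assoc [symmetric]) auto
      finally show "G Z i = (\<Oplus>s\<in>{..<q}. x s \<otimes> G (z s) i)" .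
      have "G Z i = (\<Oplus>j\<in>{..<n}. (\<Oplus>t\<in>{..<m}. y t \<otimes> \<kappa> t j) \<otimes> v j i)"
        unfolding G_def using Zj2 y \<kappa>R v by (intro finsum_cong') (auto intro!: finsum_closed)
      also have "\<dots> = (\<Oplus>t\<in>{..<m}. y t \<otimes> G (\<kappa> t) i)"
        unfolding G_def using y \<kappa>R v by (intro sum_prod_assoc [symmetric]) auto
      finally show "G Z i = (\<Oplus>t\<in>{..<m}. y t \<otimes> G (\<kappa> t) i)" .
    qed
    define y' where "y' = (\<lambda>j. if j < q then x j else y (j - q))"
    have y': "y' j \<in> carrier R" for j using x y by (simp add: y'_def)
    have "x i = (\<Oplus>j\<in>{..<q + m}. y' j \<otimes> k j i)" if i: "i < q" for i
    proof -
      have Gzc: "G (z s) i \<in> carrier R" if "s < q" for s using G zR that by simp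
      have G\<kappa>c: "G (\<kappa> t) i \<in> carrier R" if "t < m" for t using G \<kappa>R that by simp
      have GZc: "G Z i \<in> carrier R" unfolding GZ(1) using x Gzc by (intro finsum_closed) auto
      have "(\<Oplus>j\<in>{..<q + m}. y' j \<otimes> k j i) =
          (\<Oplus>j\<in>{..<q}. y' j \<otimes> k j i) \<oplus> (\<Oplus>t\<in>{..<m}. y' (q + t) \<otimes> k (q + t) i)"
        using y' kc by (intro finsum_lessThan_add) auto
      also have "(\<Oplus>t\<in>{..<m}. y' (q + t) \<otimes> k (q + t) i) = (\<Oplus>t\<in>{..<m}. y t \<otimes> G (\<kappa> t) i)"
        using y G\<kappa>c by (intro finsum_cong') (auto simp: y'_def k_def)
      also have "\<dots> = G Z i" using GZ(2) by simp
      also have "(\<Oplus>j\<in>{..<q}. y' j \<otimes> k j i) = (\<Oplus>s\<in>{..<q}. x s \<otimes> \<delta> s i \<oplus> \<ominus> (x s \<otimes> G (z s) i))"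
        using x Gzc \<delta> by (intro finsum_cong') (auto simp: y'_def k_def W_def minus_eq r_distr r_minus)
      also have "\<dots> = (\<Oplus>s\<in>{..<q}. x s \<otimes> \<delta> s i) \<oplus> (\<Oplus>s\<in>{..<q}. \<ominus> (x s \<otimes> G (z s) i))"
        using x Gzc \<delta> by (intro finsum_addf) auto
      also have "(\<Oplus>s\<in>{..<q}. \<ominus> (x s \<otimes> G (z s) i)) = \<ominus> G Z i"
        unfolding GZ(1) using x Gzc by (intro finsum_minus) auto
      also have "(\<Oplus>s\<in>{..<q}. x s \<otimes> \<delta> s i) = x i"
        using x i by (subst finsum_delta[of _ i]) (auto simp: \<delta>_def)
      also have "x i \<oplus> \<ominus> G Z i \<oplus> G Z i = x i"
        using x GZc by (simp add: a_assoc l_neg)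
      finally show ?thesis by simp
    qed
    then show "\<exists>y. (\<forall>j. y j \<in> carrier R) \<and> (\<forall>s<q. x s = (\<Oplus>j\<in>{..<q + m}. y j \<otimes> k j s))"
      using y' by (intro exI[of _ y']) auto
  qed
qed

section \<open>The weak Artin property for submodules of free modules\<close>

lemma (in cring) ideal_power_ideal:
  assumes "ideal J R"
  shows "ideal (ideal_power R J n) R"
proof (induction n)
  case 0
  show ?case by (simp add: nat_pow_def ideals_set_def oneideal)
next
  case (Suc n)
  then show ?case using ideal_prod_is_ideal[OF Suc assms] by (simp add: nat_pow_def ideals_set_def)
qed

text \<open>(APf) is applied to the free module of rank \<open>p\<close> and its submodule generated
  by the \<open>q\<close> vectors \<open>v j\<close>, and then read on coefficients.\<close>

theorem APf_relations:
  fixes R :: "('a, 'r) ring_scheme" (structure) and p q :: nat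
  assumes R: "cring R" and J: "ideal J R" and ap: "APf R J"
    and v: "\<And>j i. v j i \<in> carrier R" and n: "n > 0"
  obtains k where "k > 0" "\<And>t. (\<And>j. t j \<in> carrier R) \<Longrightarrow>
    (\<And>i. i < p \<Longrightarrow> (\<Oplus>j\<in>{..<q}. t j \<otimes> v j i) \<in> ideal_power R J k) \<Longrightarrow>
    \<exists>t'. (\<forall>j. t' j \<in> ideal_power R J n) \<and>
      (\<forall>i<p. (\<Oplus>j\<in>{..<q}. t j \<otimes> v j i) = (\<Oplus>j\<in>{..<q}. t' j \<otimes> v j i))"
proof -
  interpret cring R by fact
  let ?F = "free_module R p"
  interpret F: module R ?F by (rule free_module)
  \<comment> \<open>Singletons carry the free module to the test type without identifying any
    elements.\<close>
  define h :: "(nat \<Rightarrow> 'a) \<Rightarrow> (nat \<Rightarrow> 'a) set" where "h = (\<lambda>x. {x})"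
  have inj: "h x = h y \<longleftrightarrow> x = y" for x y by (simp add: h_def)
  interpret h: module_congruence R ?F h
    by (intro module_congruence.intro free_module module_congruence_axioms.intro) (auto simp: inj)
  let ?M = "image_module ?F h"
  interpret M: module R ?M by (rule h.image_module)
  have hl: "h \<in> linear_maps R ?F ?M" 
    by (auto simp: linear_maps_def hom_def h.image_simps)
  have hsum: "h (\<Oplus>\<^bsub>?F\<^esub>i\<in>{..<m}. y i \<odot>\<^bsub>?F\<^esub> g i) = (\<Oplus>\<^bsub>?M\<^esub>i\<in>{..<m}. y i \<odot>\<^bsub>?M\<^esub> h (g i))"
    if "\<And>i. i < m \<Longrightarrow> y i \<in> carrier R" "\<And>i. i < m \<Longrightarrow> g i \<in> carrier ?F" for y g and m :: nat
  proof -
    have "h (\<Oplus>\<^bsub>?F\<^esub>i\<in>{..<m}. y i \<odot>\<^bsub>?F\<^esub> g i) = (\<Oplus>\<^bsub>?M\<^esub>i\<in>{..<m}. h (y i \<odot>\<^bsub>?F\<^esub> g i))"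
      using that by (intro linear_maps_finsum[OF hl free_module h.image_module]) auto
    also have "\<dots> = (\<Oplus>\<^bsub>?M\<^esub>i\<in>{..<m}. y i \<odot>\<^bsub>?M\<^esub> h (g i))"
      using that linear_mapsD[OF hl] by (intro M.M.finsum_cong') auto
    finally show ?thesis .
  qed
  define e where "e = (\<lambda>i. h (unit_vector R p i))"
  have e: "e i \<in> carrier ?M" for i by (simp add: e_def h.image_simps)
  define w where "w = (\<lambda>j. h (\<lambda>i\<in>{..<p}. v j i))"
  have vF: "(\<lambda>i\<in>{..<p}. v j i) \<in> carrier ?F" for j using v by (auto simp: free_module_simps)
  have w: "w j \<in> carrier ?M" for j using vF by (simp add: w_def h.image_simps)
  have span_e: "h x = (\<Oplus>\<^bsub>?M\<^esub>i\<in>{..<p}. y i \<odot>\<^bsub>?M\<^esub> e i)"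
    if x: "x \<in> carrier ?F" and y: "\<And>i. i < p \<Longrightarrow> y i = x i" for x y
  proof -
    have "y i \<in> carrier R" if "i < p" for i using x y that by (auto simp: free_module_simps PiE_iff)
    then show ?thesis
      unfolding e_def using free_module_expand[OF x y] by (subst hsum [symmetric]) auto
  qed
  have carr: "module_span R ?M (e ` {..<p}) = carrier ?M"
  proof
    show "module_span R ?M (e ` {..<p}) \<subseteq> carrier ?M"
      using e by (intro M.module_span_least M.carrier_is_submodule) auto
    show "carrier ?M \<subseteq> module_span R ?M (e ` {..<p})"
    proof
      fix X assume "X \<in> carrier ?M"
      then obtain x where x: "x \<in> carrier ?F" "X = h x" by (auto simp: h.image_simps)
      define y where "y = (\<lambda>i. if i < p then x i else \<zero>)"
      have "\<forall>i. y i \<in> carrier R" using x by (auto simp: y_def free_module_simps PiE_iff)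
      moreover have "X = (\<Oplus>\<^bsub>?M\<^esub>i\<in>{..<p}. y i \<odot>\<^bsub>?M\<^esub> e i)"
        using span_e[OF x(1), of y] x(2) by (simp add: y_def)
      ultimately show "X \<in> module_span R ?M (e ` {..<p})"
        unfolding M.module_span_finite[OF e] by blast
    qed
  qed
  let ?N = "module_span R ?M (w ` {..<q})"
  have "fin_gen_submodule R ?M (carrier ?M)"
    unfolding fin_gen_submodule_def using carr e by (intro exI[of _ "e ` {..<p}"]) auto
  moreover have "fin_gen_submodule R ?M ?N"
    unfolding fin_gen_submodule_def using w by (intro exI[of _ "w ` {..<q}"]) auto
  ultimately obtain k where k: "k > 0"
    and sub: "ideal_smult R ?M (ideal_power R J k) (carrier ?M) \<inter> ?N \<subseteq> ideal_smult R ?M (ideal_power R J n) ?N"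
    using ap n h.image_module unfolding APf_def by blast
  show ?thesis
  proof (rule that[OF k])
    fix t assume t: "\<And>j. t j \<in> carrier R"
      and tk: "\<And>i. i < p \<Longrightarrow> (\<Oplus>j\<in>{..<q}. t j \<otimes> v j i) \<in> ideal_power R J k"
    interpret Jk: ideal "ideal_power R J k" R by (rule ideal_power_ideal[OF J])
    interpret Jn: ideal "ideal_power R J n" R by (rule ideal_power_ideal[OF J])
    have ev: "(\<Oplus>\<^bsub>?F\<^esub>j\<in>{..<q}. t j \<odot>\<^bsub>?F\<^esub> (\<lambda>i\<in>{..<p}. v j i)) i = (\<Oplus>j\<in>{..<q}. t j \<otimes> v j i)"
      if t: "\<And>j. t j \<in> carrier R" and i: "i < p" for t i
    proof -
      have "(\<Oplus>\<^bsub>?F\<^esub>j\<in>{..<q}. t j \<odot>\<^bsub>?F\<^esub> (\<lambda>i\<in>{..<p}. v j i)) i = (\<Oplus>j\<in>{..<q}. (t j \<odot>\<^bsub>?F\<^esub> (\<lambda>i\<in>{..<p}. v j i)) i)"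
        using t vF i by (intro free_module_finsum) auto
      also have "\<dots> = (\<Oplus>j\<in>{..<q}. t j \<otimes> v j i)"
        using t v i by (intro finsum_cong') (auto simp: free_module_simps)
      finally show ?thesis .
    qed
    let ?x = "\<Oplus>\<^bsub>?F\<^esub>j\<in>{..<q}. t j \<odot>\<^bsub>?F\<^esub> (\<lambda>i\<in>{..<p}. v j i)"
    have xc: "?x \<in> carrier ?F" using t vF by (intro F.M.finsum_closed) auto
    have hx: "h ?x = (\<Oplus>\<^bsub>?M\<^esub>j\<in>{..<q}. t j \<odot>\<^bsub>?M\<^esub> w j)"
      unfolding w_def using t vF by (intro hsum) auto
    have "h ?x \<in> ?N"
      unfolding M.module_span_finite[OF w] hx using t by blast
    \<comment> \<open>Coordinates in \<open>J^k\<close> mean membership in \<open>J^k\<close> times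
      the module, because the unit vectors generate it.\<close>
    moreover have "h ?x \<in> ideal_smult R ?M (ideal_power R J k) (carrier ?M)"
    proof -
      define y where "y = (\<lambda>i. if i < p then ?x i else \<zero>)"
      have "h ?x = (\<Oplus>\<^bsub>?M\<^esub>i\<in>{..<p}. y i \<odot>\<^bsub>?M\<^esub> e i)"
        using span_e[OF xc, of y] by (simp add: y_def)
      moreover have "\<forall>i. y i \<in> ideal_power R J k"
        using tk ev[where t = t, OF t] by (auto simp: y_def)
      ultimately show ?thesis
        unfolding carr[symmetric] M.ideal_smult_finite[OF Jk.is_ideal e] by blast
    qed
    ultimately have "h ?x \<in> ideal_smult R ?M (ideal_power R J n) ?N" using sub by blast
    then obtain t' where hx': "h ?x = (\<Oplus>\<^bsub>?M\<^esub>j\<in>{..<q}. t' j \<odot>\<^bsub>?M\<^esub> w j)"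
      and t': "\<forall>j. t' j \<in> ideal_power R J n"
      unfolding M.ideal_smult_finite[OF Jn.is_ideal w] by (elim CollectE exE conjE)
    have t'c: "t' j \<in> carrier R" for j using t' Jn.Icarr by blast
    have "h ?x = h (\<Oplus>\<^bsub>?F\<^esub>j\<in>{..<q}. t' j \<odot>\<^bsub>?F\<^esub> (\<lambda>i\<in>{..<p}. v j i))"
      unfolding hx' w_def using t'c vF by (intro hsum [symmetric]) auto
    then have "?x = (\<Oplus>\<^bsub>?F\<^esub>j\<in>{..<q}. t' j \<odot>\<^bsub>?F\<^esub> (\<lambda>i\<in>{..<p}. v j i))" by (simp only: inj)
    then have "\<forall>i<p. (\<Oplus>j\<in>{..<q}. t j \<otimes> v j i) = (\<Oplus>j\<in>{..<q}. t' j \<otimes> v j i)"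
      using ev[where t = t, OF t] ev[where t = t', OF t'c] by simp
    with t' show "\<exists>t'. (\<forall>j. t' j \<in> ideal_power R J n) \<and>
      (\<forall>i<p. (\<Oplus>j\<in>{..<q}. t j \<otimes> v j i) = (\<Oplus>j\<in>{..<q}. t' j \<otimes> v j i))" by blast
  qed
qed

section \<open>The adic completion\<close>

lemma (in cring) ideal_power_Suc: "ideal_power R I (Suc n) = ideal_power R I n \<cdot> I"
  and ideal_power_0: "ideal_power R I 0 = carrier R"
  by (simp_all add: nat_pow_def ideals_set_def)

lemma (in cring) ideal_power_1:
  assumes "ideal I R"
  shows "ideal_power R I (Suc 0) = I"
proof -
  interpret I: ideal I R by fact
  have "carrier R \<cdot> I \<subseteq> I" using ideal_prod_inter[OF oneideal assms] by blast
  moreover have "i \<in> carrier R \<cdot> I" if "i \<in> I" for i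
    using ideal_prod.prod[of \<one> "carrier R" i I R] that I.Icarr by simp
  ultimately have "carrier R \<cdot> I = I" by blast
  then show ?thesis by (simp only: ideal_power_Suc ideal_power_0)
qed

lemma (in cring) ideal_power_mono:
  assumes "ideal I R" "m \<le> n"
  shows "ideal_power R I n \<subseteq> ideal_power R I m"
  using assms(2)
proof (induction n rule: dec_induct)
  case (step n)
  have "ideal_power R I (Suc n) \<subseteq> ideal_power R I n"
    unfolding ideal_power_Suc using ideal_prod_inter[OF ideal_power_ideal[OF assms(1)] assms(1)] by blast
  with step show ?case by blast
qed simp

text \<open>Keeping the coefficients in \<open>J\<close> is the point: with \<open>J\<close> a power
  of \<open>I\<close> it trades one exponent for a combination of the generators of
  \<open>I\<close>.\<close>

lemma (in cring) ideal_prod_genideal_finite: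
  fixes l :: nat
  assumes J: "ideal J R" and g: "\<And>s. g s \<in> carrier R" and x: "x \<in> J \<cdot> (Idl (g ` {..<l}))"
  shows "\<exists>t. (\<forall>s. t s \<in> J) \<and> x = (\<Oplus>s\<in>{..<l}. g s \<otimes> t s)"
proof -
  interpret J: ideal J R by fact
  show ?thesis
    using x
  proof (induction x rule: ideal_prod.induct)
    case (prod i j)
    obtain y where y: "\<forall>t. y t \<in> carrier R" and j: "j = (\<Oplus>s\<in>{..<l}. y s \<otimes> g s)"
      using genideal_finite[of l g j] g prod(2) by auto
    have i: "i \<in> carrier R" using prod(1) J.Icarr by blast
    have "i \<otimes> j = (\<Oplus>s\<in>{..<l}. i \<otimes> (y s \<otimes> g s))"
      unfolding j using i y g by (intro finsum_rdistr) auto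
    also have "\<dots> = (\<Oplus>s\<in>{..<l}. g s \<otimes> (i \<otimes> y s))"
      using i y g by (intro finsum_cong') (auto simp: m_ac)
    finally show ?case
      using prod(1) y J.I_r_closed by (intro exI[of _ "\<lambda>s. i \<otimes> y s"]) auto
  next
    case (sum s1 s2)
    then obtain t1 t2 where t: "\<forall>s. t1 s \<in> J" "s1 = (\<Oplus>s\<in>{..<l}. g s \<otimes> t1 s)"
      "\<forall>s. t2 s \<in> J" "s2 = (\<Oplus>s\<in>{..<l}. g s \<otimes> t2 s)" by blast
    then have tc: "t1 s \<in> carrier R" "t2 s \<in> carrier R" for s using J.Icarr by blast+
    have "s1 \<oplus> s2 = (\<Oplus>s\<in>{..<l}. g s \<otimes> t1 s \<oplus> g s \<otimes> t2 s)"
      unfolding t(2,4) using tc g by (intro finsum_addf [symmetric]) auto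
    also have "\<dots> = (\<Oplus>s\<in>{..<l}. g s \<otimes> (t1 s \<oplus> t2 s))"
      using tc g by (intro finsum_cong') (auto simp: r_distr)
    finally show ?case using t by (intro exI[of _ "\<lambda>s. t1 s \<oplus> t2 s"]) auto
  qed
qed

section \<open>Elements of the completion as limits of sequences in the ring\<close>

locale adic = cring R + I: ideal I R for I and R (structure)
begin

abbreviation "P \<equiv> ideal_power R I"
abbreviation "E \<equiv> adic_completion R I"

sublocale P: ideal "P n" R for n
  by (rule ideal_power_ideal[OF I.is_ideal])

lemma P_mono: "m \<le> n \<Longrightarrow> x \<in> P n \<Longrightarrow> x \<in> P m"
  using ideal_power_mono[OF I.is_ideal] by blast

lemma P_diff: "x \<in> P n \<Longrightarrow> y \<in> P n \<Longrightarrow> x \<ominus> y \<in> P n"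
  by (simp add: minus_eq)

lemma coset_eq: "x \<in> carrier R \<Longrightarrow> y \<in> carrier R \<Longrightarrow> P n +> x = P n +> y \<longleftrightarrow> x \<ominus> y \<in> P n"
  by (rule quotient_eq_iff_same_a_r_cos [OF P.is_ideal, symmetric])

text \<open>Representatives of compatible sequences of cosets: the \<open>n\<close>-th term matters
  modulo \<open>I^n\<close> only, and in particular the term of index 0 is an arbitrary element of
  the ring.\<close>

definition coherent_seq :: "(nat \<Rightarrow> 'a) \<Rightarrow> bool" where
  "coherent_seq x \<longleftrightarrow> (\<forall>n. x n \<in> carrier R) \<and> (\<forall>m n. m \<le> n \<longrightarrow> x n \<ominus> x m \<in> P m)"

definition limit :: "(nat \<Rightarrow> 'a) \<Rightarrow> nat \<Rightarrow> 'a set" where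
  "limit x = (\<lambda>n. P n +> x n)"

lemma coherent_seqD:
  "coherent_seq x \<Longrightarrow> x n \<in> carrier R"
  "coherent_seq x \<Longrightarrow> m \<le> n \<Longrightarrow> x n \<ominus> x m \<in> P m"
  by (auto simp: coherent_seq_def)

lemma coherent_seq_stepI:
  assumes x: "\<And>n. x n \<in> carrier R" and step: "\<And>n. x (Suc n) \<ominus> x n \<in> P n"
  shows "coherent_seq x"
proof -
  have "x n \<ominus> x m \<in> P m" if "m \<le> n" for m n
    using that
  proof (induction n rule: dec_induct)
    case base
    then show ?case using x by (simp add: minus_eq r_neg)
  next
    case (step n)
    have "(x (Suc n) \<ominus> x n) \<oplus> (x n \<ominus> x m) \<in> P m"
      using P_mono[OF step.hyps(1) assms(2)] step.IH by simp
    also have "(x (Suc n) \<ominus> x n) \<oplus> (x n \<ominus> x m) = x (Suc n) \<ominus> x m"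
      using x[of n] x[of m] x[of "Suc n"] by algebra
    finally show ?case .
  qed
  then show ?thesis using x by (simp add: coherent_seq_def)
qed

lemma coset_add: "x \<in> carrier R \<Longrightarrow> y \<in> carrier R \<Longrightarrow>
    (P n +> x) \<oplus>\<^bsub>R Quot P n\<^esub> (P n +> y) = P n +> (x \<oplus> y)"
  by (simp add: FactRing_def P.a_rcos_sum)

lemma coset_mult: "x \<in> carrier R \<Longrightarrow> y \<in> carrier R \<Longrightarrow>
    (P n +> x) \<otimes>\<^bsub>R Quot P n\<^esub> (P n +> y) = P n +> (x \<otimes> y)"
  by (simp add: FactRing_def P.rcoset_mult_add)

text \<open>The union is the transition map from \<open>R / I^n\<close> to \<open>R / I^m\<close> in
  the definition of the completion, evaluated on a representative.\<close>

lemma coset_union: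
  assumes "m \<le> n" "x \<in> carrier R"
  shows "(\<Union>y\<in>P n +> x. P m +> y) = P m +> x"
proof -
  have "P m +> y = P m +> x" if y: "y \<in> P n +> x" for y
  proof -
    have yc: "y \<in> carrier R" using P.a_elemrcos_carrier[OF assms(2) y] .
    have "y \<ominus> x \<in> P n"
      using P.a_rcos_module_imp[OF assms(2) y] by (simp add: minus_eq)
    then show ?thesis using coset_eq yc assms P_mono by blast
  qed
  moreover have "x \<in> P n +> x" using P.a_rcos_self[OF assms(2)] .
  ultimately show ?thesis by blast
qed

lemma E_carrier: "s \<in> carrier E \<longleftrightarrow> (\<exists>x. coherent_seq x \<and> s = limit x)"
proof
  assume s: "s \<in> carrier E"
  have "\<exists>y\<in>carrier R. s n = P n +> y" for n
    using s by (auto simp: adic_completion_def Let_def FactRing_def A_RCOSETS_def')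
  then obtain x where x: "\<And>n. x n \<in> carrier R" and sx: "\<And>n. s n = P n +> x n" by metis
  have "x n \<ominus> x m \<in> P m" if mn: "m \<le> n" for m n
  proof -
    have "(\<Union>y\<in>s n. P m +> y) = s m"
      using s mn by (simp add: adic_completion_def Let_def)
    then have "P m +> x n = P m +> x m"
      unfolding sx using coset_union[OF mn x] by simp
    then show ?thesis using coset_eq x by blast
  qed
  then have "coherent_seq x" using x by (simp add: coherent_seq_def)
  then show "\<exists>x. coherent_seq x \<and> s = limit x"
    using sx by (intro exI[of _ x]) (auto simp: limit_def)
next
  assume "\<exists>x. coherent_seq x \<and> s = limit x"
  then obtain x where x: "coherent_seq x" "s = limit x" by blast
  have "(\<Union>y\<in>limit x n. P m +> y) = limit x m" if "m \<le> n" for m n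
    unfolding limit_def coset_union[OF that coherent_seqD(1)[OF x(1)]]
    using coset_eq coherent_seqD[OF x(1)] that by blast
  moreover have "limit x n \<in> carrier (R Quot P n)" for n
    using coherent_seqD(1)[OF x(1)] by (auto simp: limit_def FactRing_def intro!: a_rcosetsI[OF P.a_subset])
  ultimately show "s \<in> carrier E" using x(2) by (simp add: adic_completion_def Let_def)
qed

lemma limit_eq:
  "coherent_seq x \<Longrightarrow> coherent_seq y \<Longrightarrow> limit x = limit y \<longleftrightarrow> (\<forall>n. x n \<ominus> y n \<in> P n)"
  by (simp add: limit_def fun_eq_iff coset_eq coherent_seqD)

lemma coherent_const: "a \<in> carrier R \<Longrightarrow> coherent_seq (\<lambda>_. a)"
  by (simp add: coherent_seq_def minus_eq r_neg)

lemma coherent_add: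
  assumes "coherent_seq x" "coherent_seq y"
  shows "coherent_seq (\<lambda>n. x n \<oplus> y n)"
  unfolding coherent_seq_def
proof (intro conjI allI impI)
  fix m n :: nat assume mn: "m \<le> n"
  note c = coherent_seqD[OF assms(1)] coherent_seqD[OF assms(2)]
  have "(x n \<ominus> x m) \<oplus> (y n \<ominus> y m) \<in> P m" using c(2,4)[OF mn] by simp
  also have "(x n \<ominus> x m) \<oplus> (y n \<ominus> y m) = (x n \<oplus> y n) \<ominus> (x m \<oplus> y m)"
    using c(1)[of n] c(1)[of m] c(3)[of n] c(3)[of m] by algebra
  finally show "(x n \<oplus> y n) \<ominus> (x m \<oplus> y m) \<in> P m" .
qed (use assms coherent_seqD in auto)

lemma coherent_mult:
  assumes "coherent_seq x" "coherent_seq y"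
  shows "coherent_seq (\<lambda>n. x n \<otimes> y n)"
  unfolding coherent_seq_def
proof (intro conjI allI impI)
  fix m n :: nat assume mn: "m \<le> n"
  note c = coherent_seqD[OF assms(1)] coherent_seqD[OF assms(2)]
  have "x n \<otimes> (y n \<ominus> y m) \<oplus> (x n \<ominus> x m) \<otimes> y m \<in> P m"
    using c(2,4)[OF mn] c(1,3) by (intro P.a_closed P.I_l_closed P.I_r_closed)
  also have "x n \<otimes> (y n \<ominus> y m) \<oplus> (x n \<ominus> x m) \<otimes> y m = x n \<otimes> y n \<ominus> x m \<otimes> y m"
    using c(1)[of n] c(1)[of m] c(3)[of n] c(3)[of m] by algebra
  finally show "x n \<otimes> y n \<ominus> x m \<otimes> y m \<in> P m" .
qed (use assms coherent_seqD in auto)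

lemma coherent_minus:
  assumes "coherent_seq x"
  shows "coherent_seq (\<lambda>n. \<ominus> x n)"
  using coherent_mult[OF coherent_const[of "\<ominus> \<one>"] assms] coherent_seqD(1)[OF assms]
  by (simp add: l_minus)

lemma limit_ops:
  "coherent_seq x \<Longrightarrow> coherent_seq y \<Longrightarrow> limit x \<oplus>\<^bsub>E\<^esub> limit y = limit (\<lambda>n. x n \<oplus> y n)"
  "coherent_seq x \<Longrightarrow> coherent_seq y \<Longrightarrow> limit x \<otimes>\<^bsub>E\<^esub> limit y = limit (\<lambda>n. x n \<otimes> y n)"
  "\<zero>\<^bsub>E\<^esub> = limit (\<lambda>_. \<zero>)"
  "\<one>\<^bsub>E\<^esub> = limit (\<lambda>_. \<one>)"
proof -
  show "\<zero>\<^bsub>E\<^esub> = limit (\<lambda>_. \<zero>)"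
    using a_coset_add_zero[OF P.a_subset]
    by (simp add: limit_def adic_completion_def Let_def FactRing_def)
qed (simp_all add: limit_def adic_completion_def Let_def coset_add coset_mult coherent_seqD,
    simp add: FactRing_def)

lemma E_cases:
  assumes "s \<in> carrier E"
  obtains x where "coherent_seq x" "s = limit x"
  using assms E_carrier by blast

lemma limit_closed [simp]: "coherent_seq x \<Longrightarrow> limit x \<in> carrier E"
  using E_carrier by blast

lemmas coherent_intros = coherent_const coherent_add coherent_mult coherent_minus

lemma limit_cong: "(\<And>n. x n = y n) \<Longrightarrow> limit x = limit y"
  by (simp add: limit_def)

lemma E_abelian_group: "abelian_group E"
proof (rule abelian_groupI)
  fix s t assume "s \<in> carrier E" "t \<in> carrier E"
  then obtain x y where *: "coherent_seq x" "s = limit x" "coherent_seq y" "t = limit y"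
    by (elim E_cases)
  show "s \<oplus>\<^bsub>E\<^esub> t \<in> carrier E" using * by (simp add: limit_ops coherent_intros)
  show "s \<oplus>\<^bsub>E\<^esub> t = t \<oplus>\<^bsub>E\<^esub> s"
    using * by (auto simp: limit_ops coherent_intros coherent_seqD intro!: limit_cong a_comm)
next
  fix s t u assume "s \<in> carrier E" "t \<in> carrier E" "u \<in> carrier E"
  then obtain x y z where *: "coherent_seq x" "s = limit x" "coherent_seq y" "t = limit y"
    "coherent_seq z" "u = limit z"
    by (elim E_cases)
  then show "s \<oplus>\<^bsub>E\<^esub> t \<oplus>\<^bsub>E\<^esub> u = s \<oplus>\<^bsub>E\<^esub> (t \<oplus>\<^bsub>E\<^esub> u)"
    by (auto simp: limit_ops coherent_intros coherent_seqD intro!: limit_cong a_assoc)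
next
  fix s assume "s \<in> carrier E"
  then obtain x where *: "coherent_seq x" "s = limit x" by (elim E_cases)
  show "\<zero>\<^bsub>E\<^esub> \<oplus>\<^bsub>E\<^esub> s = s"
    using * by (auto simp: limit_ops coherent_intros coherent_seqD intro!: limit_cong)
  show "\<exists>t\<in>carrier E. t \<oplus>\<^bsub>E\<^esub> s = \<zero>\<^bsub>E\<^esub>"
    using * by (intro bexI[of _ "limit (\<lambda>n. \<ominus> x n)"])
      (auto simp: limit_ops coherent_intros coherent_seqD l_neg intro!: limit_cong)
qed (simp add: limit_ops coherent_intros)

lemma E_cring: "cring E"
proof (rule cringI[OF E_abelian_group])
  show "comm_monoid E"
  proof (rule comm_monoidI)
    fix s t assume "s \<in> carrier E" "t \<in> carrier E"
    then obtain x y where *: "coherent_seq x" "s = limit x" "coherent_seq y" "t = limit y"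
      by (elim E_cases)
    show "s \<otimes>\<^bsub>E\<^esub> t \<in> carrier E" using * by (simp add: limit_ops coherent_intros)
    show "s \<otimes>\<^bsub>E\<^esub> t = t \<otimes>\<^bsub>E\<^esub> s"
      using * by (auto simp: limit_ops coherent_intros coherent_seqD intro!: limit_cong m_comm)
  next
    fix s t u assume "s \<in> carrier E" "t \<in> carrier E" "u \<in> carrier E"
    then obtain x y z where *: "coherent_seq x" "s = limit x" "coherent_seq y" "t = limit y"
      "coherent_seq z" "u = limit z"
      by (elim E_cases)
    then show "s \<otimes>\<^bsub>E\<^esub> t \<otimes>\<^bsub>E\<^esub> u = s \<otimes>\<^bsub>E\<^esub> (t \<otimes>\<^bsub>E\<^esub> u)"
      by (auto simp: limit_ops coherent_intros coherent_seqD intro!: limit_cong m_assoc)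
  next
    fix s assume "s \<in> carrier E"
    then obtain x where *: "coherent_seq x" "s = limit x" by (elim E_cases)
    then show "\<one>\<^bsub>E\<^esub> \<otimes>\<^bsub>E\<^esub> s = s"
      by (auto simp: limit_ops coherent_intros coherent_seqD intro!: limit_cong)
  qed (simp add: limit_ops coherent_intros)
next
  fix s t u assume "s \<in> carrier E" "t \<in> carrier E" "u \<in> carrier E"
  then obtain x y z where *: "coherent_seq x" "s = limit x" "coherent_seq y" "t = limit y"
    "coherent_seq z" "u = limit z"
    by (elim E_cases)
  then show "(s \<oplus>\<^bsub>E\<^esub> t) \<otimes>\<^bsub>E\<^esub> u = s \<otimes>\<^bsub>E\<^esub> u \<oplus>\<^bsub>E\<^esub> t \<otimes>\<^bsub>E\<^esub> u"
    by (auto simp: limit_ops coherent_intros coherent_seqD intro!: limit_cong l_distr)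
qed

sublocale E: cring E by (rule E_cring)

lemma limit_minus: "coherent_seq x \<Longrightarrow> \<ominus>\<^bsub>E\<^esub> limit x = limit (\<lambda>n. \<ominus> x n)"
  by (rule E.minus_equality)
    (auto simp: limit_ops coherent_intros coherent_seqD l_neg intro!: limit_cong)

abbreviation "\<iota> \<equiv> to_completion R I"

lemma \<iota>_limit: "\<iota> a = limit (\<lambda>_. a)"
  by (simp add: to_completion_def limit_def)

lemma \<iota>_closed [simp]: "a \<in> carrier R \<Longrightarrow> \<iota> a \<in> carrier E"
  by (simp add: \<iota>_limit coherent_intros)

lemma \<iota>_hom: "\<iota> \<in> ring_hom R E"
  by (rule ring_hom_memI) (simp_all add: \<iota>_limit limit_ops coherent_intros)

lemma finsum_limit:
  assumes "finite S" "\<And>i. i \<in> S \<Longrightarrow> coherent_seq (x i)"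
  shows "coherent_seq (\<lambda>n. \<Oplus>i\<in>S. x i n)" "(\<Oplus>\<^bsub>E\<^esub>i\<in>S. limit (x i)) = limit (\<lambda>n. \<Oplus>i\<in>S. x i n)"
proof -
  have "coherent_seq (\<lambda>n. \<Oplus>i\<in>S. x i n) \<and> (\<Oplus>\<^bsub>E\<^esub>i\<in>S. limit (x i)) = limit (\<lambda>n. \<Oplus>i\<in>S. x i n)"
    using assms
  proof (induction S rule: finite_induct)
    case empty
    show ?case by (simp add: coherent_const limit_ops)
  next
    case (insert i F)
    have "(\<Oplus>i\<in>insert i F. x i n) = x i n \<oplus> (\<Oplus>i\<in>F. x i n)" for n
      using insert coherent_seqD(1) by (intro finsum_insert) auto
    moreover have "(\<Oplus>\<^bsub>E\<^esub>i\<in>insert i F. limit (x i)) = limit (x i) \<oplus>\<^bsub>E\<^esub> (\<Oplus>\<^bsub>E\<^esub>i\<in>F. limit (x i))"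
      using insert by (intro E.finsum_insert) auto
    ultimately show ?case using insert by (simp add: limit_ops coherent_add)
  qed
  then show "coherent_seq (\<lambda>n. \<Oplus>i\<in>S. x i n)"
    "(\<Oplus>\<^bsub>E\<^esub>i\<in>S. limit (x i)) = limit (\<lambda>n. \<Oplus>i\<in>S. x i n)" by auto
qed

text \<open>The extension of \<open>I\<close> to the completion; for the tensor ideal it is
  \<open>\<rr>E\<close>.\<close>

definition J where "J = Idl\<^bsub>E\<^esub> (\<iota> ` I)"

lemma \<iota>_J: "a \<in> I \<Longrightarrow> \<iota> a \<in> J"
  unfolding J_def using I.Icarr by (intro subsetD[OF E.genideal_self]) auto

sublocale J: ideal J E
  unfolding J_def using I.Icarr by (intro E.genideal_ideal) auto

text \<open>Sequences whose term of index 1 lies in \<open>I\<close> form an ideal, the kernel of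
  \<open>E \<rightarrow> R / I\<close>, and it contains the image of \<open>I\<close>. Index 1 is
  the first at which a term is determined modulo \<open>I\<close>.\<close>

lemma J_imp:
  assumes "limit x \<in> J" "coherent_seq x"
  shows "x (Suc 0) \<in> I"
proof -
  let ?K = "{limit x |x. coherent_seq x \<and> x (Suc 0) \<in> I}"
  have "ideal ?K E"
  proof (rule idealI)
    show "subgroup ?K (add_monoid E)"
    proof (rule E.a_group [THEN group.subgroupI])
      show "?K \<noteq> {}" using coherent_const[of \<zero>] I.zero_closed by auto
      show "inv\<^bsub>add_monoid E\<^esub> a \<in> ?K" if "a \<in> ?K" for a
      proof -
        obtain x where x: "coherent_seq x" "x (Suc 0) \<in> I" "a = limit x" using \<open>a \<in> ?K\<close> by blast
        have "inv\<^bsub>add_monoid E\<^esub> a = limit (\<lambda>n. \<ominus> x n)"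
          unfolding x(3) a_inv_def[symmetric] by (rule limit_minus[OF x(1)])
        then show ?thesis using x coherent_minus[OF x(1)] by auto
      qed
      show "a \<otimes>\<^bsub>add_monoid E\<^esub> b \<in> ?K" if "a \<in> ?K" "b \<in> ?K" for a b
      proof -
        obtain x where x: "coherent_seq x" "x (Suc 0) \<in> I" "a = limit x" using \<open>a \<in> ?K\<close> by blast
        obtain y where y: "coherent_seq y" "y (Suc 0) \<in> I" "b = limit y" using \<open>b \<in> ?K\<close> by blast
        have "a \<otimes>\<^bsub>add_monoid E\<^esub> b = limit (\<lambda>n. x n \<oplus> y n)" using x y by (simp add: limit_ops)
        then show ?thesis using x y coherent_add[OF x(1) y(1)] by auto
      qed
    qed auto
    show 1: "b \<otimes>\<^bsub>E\<^esub> a \<in> ?K" if "a \<in> ?K" "b \<in> carrier E" for a b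
    proof -
      obtain x where x: "coherent_seq x" "x (Suc 0) \<in> I" "a = limit x" using \<open>a \<in> ?K\<close> by blast
      obtain y where y: "coherent_seq y" "b = limit y" using \<open>b \<in> carrier E\<close> by (elim E_cases)
      have "b \<otimes>\<^bsub>E\<^esub> a = limit (\<lambda>n. y n \<otimes> x n)" using x y by (simp add: limit_ops)
      moreover have "y (Suc 0) \<otimes> x (Suc 0) \<in> I" using x(2) coherent_seqD(1)[OF y(1)] by (rule I.I_l_closed)
      ultimately show ?thesis using coherent_mult[OF y(1) x(1)] by auto
    qed
    show "a \<otimes>\<^bsub>E\<^esub> b \<in> ?K" if "a \<in> ?K" "b \<in> carrier E" for a b
    proof -
      have "a \<in> carrier E" using \<open>a \<in> ?K\<close> by auto
      then have "a \<otimes>\<^bsub>E\<^esub> b = b \<otimes>\<^bsub>E\<^esub> a" using \<open>b \<in> carrier E\<close> by (rule E.m_comm)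
      then show ?thesis using 1[OF \<open>a \<in> ?K\<close> \<open>b \<in> carrier E\<close>] by simp
    qed
  qed (rule E.ring_axioms)
  moreover have "\<iota> ` I \<subseteq> ?K"
    unfolding \<iota>_limit using coherent_const I.Icarr by blast
  ultimately have "J \<subseteq> ?K" unfolding J_def by (rule E.genideal_minimal)
  then obtain y where y: "coherent_seq y" "y (Suc 0) \<in> I" "limit x = limit y" using assms by blast
  have "x (Suc 0) \<ominus> y (Suc 0) \<in> I"
    using limit_eq[OF assms(2) y(1)] y(3) ideal_power_1[OF I.is_ideal] by blast
  then have "(x (Suc 0) \<ominus> y (Suc 0)) \<oplus> y (Suc 0) \<in> I" using y(2) by simp
  also have "(x (Suc 0) \<ominus> y (Suc 0)) \<oplus> y (Suc 0) = x (Suc 0)"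
    using coherent_seqD(1)[OF assms(2), of "Suc 0"] coherent_seqD(1)[OF y(1), of "Suc 0"] by algebra
  finally show ?thesis .
qed

text \<open>Partial sums of the geometric series: passing from \<open>u\<close> to
  \<open>1 + x u\<close> multiplies the error \<open>1 - u (1 - x)\<close> by
  \<open>x\<close>.\<close>

lemma approx_inverse:
  assumes "x \<in> I"
  shows "\<exists>u\<in>carrier R. \<one> \<ominus> u \<otimes> (\<one> \<ominus> x) \<in> P n"
proof (induction n)
  case 0
  show ?case using I.Icarr[OF assms] by (intro bexI[of _ \<zero>]) (auto simp: ideals_set_def)
next
  case (Suc n)
  then obtain u where u: "u \<in> carrier R" "\<one> \<ominus> u \<otimes> (\<one> \<ominus> x) \<in> P n" by blast
  have xc: "x \<in> carrier R" using assms I.Icarr by blast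
  have "(\<one> \<ominus> u \<otimes> (\<one> \<ominus> x)) \<otimes> x \<in> P (Suc n)"
    unfolding ideal_power_Suc using u(2) assms by (rule ideal_prod.prod)
  also have "(\<one> \<ominus> u \<otimes> (\<one> \<ominus> x)) \<otimes> x = \<one> \<ominus> (\<one> \<oplus> x \<otimes> u) \<otimes> (\<one> \<ominus> x)"
    using xc u(1) one_closed by algebra
  finally show ?case using xc u(1) by (intro bexI[of _ "\<one> \<oplus> x \<otimes> u"]) auto
qed

text \<open>Inverses of \<open>1 - x n\<close> modulo \<open>I^n\<close> are chosen separately for
  each \<open>n\<close>. They still form a coherent sequence, because an inverse modulo
  \<open>I^m\<close> is unique modulo \<open>I^m\<close>.\<close>

lemma one_minus_J_unit:
  assumes "a \<in> J"
  shows "\<exists>b\<in>carrier E. b \<otimes>\<^bsub>E\<^esub> (\<one>\<^bsub>E\<^esub> \<ominus>\<^bsub>E\<^esub> a) = \<one>\<^bsub>E\<^esub>"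
proof -
  obtain x where x: "coherent_seq x" "a = limit x" using J.Icarr[OF assms] by (elim E_cases)
  have xc: "x n \<in> carrier R" for n by (rule coherent_seqD(1)[OF x(1)])
  have x1: "x (Suc 0) \<in> I" using assms x J_imp by blast
  have xI: "x (Suc n) \<in> I" for n
  proof -
    have "x (Suc n) \<ominus> x (Suc 0) \<in> I"
      using coherent_seqD(2)[OF x(1), of "Suc 0" "Suc n"] ideal_power_1[OF I.is_ideal] by simp
    then have "(x (Suc n) \<ominus> x (Suc 0)) \<oplus> x (Suc 0) \<in> I" using x1 by simp
    also have "(x (Suc n) \<ominus> x (Suc 0)) \<oplus> x (Suc 0) = x (Suc n)"
      using xc[of "Suc n"] xc[of "Suc 0"] by algebra
    finally show ?thesis .
  qed
  have "\<exists>u\<in>carrier R. \<one> \<ominus> u \<otimes> (\<one> \<ominus> x n) \<in> P n" for n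
  \<comment> \<open>\<open>x 0\<close> need not lie in \<open>I\<close>, but modulo
    \<open>I^0\<close>, the whole ring, there is nothing to prove.\<close>
  proof (cases n)
    case 0
    then show ?thesis using xc by (intro bexI[of _ \<zero>]) (auto simp: ideals_set_def)
  next
    case (Suc k)
    show ?thesis unfolding Suc by (rule approx_inverse[OF xI])
  qed
  then obtain u where u: "\<And>n. u n \<in> carrier R" and ux: "\<And>n. \<one> \<ominus> u n \<otimes> (\<one> \<ominus> x n) \<in> P n" by metis
  have "coherent_seq u"
    unfolding coherent_seq_def
  proof (intro conjI allI impI u)
    fix m n :: nat assume mn: "m \<le> n"
    \<comment> \<open>Uniqueness of inverses as an identity: \<open>u n - u m\<close> is a
      combination of the two errors and of \<open>x n - x m\<close>.\<close>
    have 1: "u n \<otimes> (\<one> \<ominus> u m \<otimes> (\<one> \<ominus> x m)) \<in> P m" using ux u by (intro P.I_l_closed)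
    have 2: "u m \<otimes> (\<one> \<ominus> u n \<otimes> (\<one> \<ominus> x n)) \<in> P m" using P_mono[OF mn ux] u by (intro P.I_l_closed)
    have 3: "u n \<otimes> u m \<otimes> (x n \<ominus> x m) \<in> P m" using coherent_seqD(2)[OF x(1) mn] u by (intro P.I_l_closed) auto
    have "(u n \<otimes> (\<one> \<ominus> u m \<otimes> (\<one> \<ominus> x m)) \<ominus> u m \<otimes> (\<one> \<ominus> u n \<otimes> (\<one> \<ominus> x n))) \<oplus> u n \<otimes> u m \<otimes> (x n \<ominus> x m) \<in> P m"
      by (rule P.a_closed[OF P_diff[OF 1 2] 3])
    also have "(u n \<otimes> (\<one> \<ominus> u m \<otimes> (\<one> \<ominus> x m)) \<ominus> u m \<otimes> (\<one> \<ominus> u n \<otimes> (\<one> \<ominus> x n))) \<oplus> u n \<otimes> u m \<otimes> (x n \<ominus> x m)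
        = u n \<ominus> u m"
      using u[of n] u[of m] xc[of n] xc[of m] one_closed by algebra
    finally show "u n \<ominus> u m \<in> P m" .
  qed
  moreover have "limit u \<otimes>\<^bsub>E\<^esub> (\<one>\<^bsub>E\<^esub> \<ominus>\<^bsub>E\<^esub> a) = \<one>\<^bsub>E\<^esub>"
  proof -
    have c: "coherent_seq (\<lambda>n. u n \<otimes> (\<one> \<oplus> \<ominus> x n))"
      using calculation x(1) by (intro coherent_intros) auto
    have "limit u \<otimes>\<^bsub>E\<^esub> (\<one>\<^bsub>E\<^esub> \<ominus>\<^bsub>E\<^esub> a) = limit (\<lambda>n. u n \<otimes> (\<one> \<oplus> \<ominus> x n))"
      using calculation x by (simp add: E.minus_eq limit_minus limit_ops coherent_intros)
    also have "\<dots> = limit (\<lambda>_. \<one>)"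
    proof (rule limit_eq[OF c coherent_const, THEN iffD2, rule_format])
      fix n
      have "\<ominus> (\<one> \<ominus> u n \<otimes> (\<one> \<ominus> x n)) \<in> P n" using ux by simp
      also have "\<ominus> (\<one> \<ominus> u n \<otimes> (\<one> \<ominus> x n)) = u n \<otimes> (\<one> \<oplus> \<ominus> x n) \<ominus> \<one>"
        using u[of n] xc[of n] one_closed by algebra
      finally show "u n \<otimes> (\<one> \<oplus> \<ominus> x n) \<ominus> \<one> \<in> P n" .
    qed simp
    finally show ?thesis by (simp add: limit_ops)
  qed
  ultimately show ?thesis by (intro bexI[of _ "limit u"]) auto
qed

text \<open>For a finitely generated ideal, the elements of the completion vanishing modulo \<open>I\<^sup>h\<close> lie in
  \<open>(IE)\<^sup>h\<close>: the increments of a coherent sequence are combinations of the generators whose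
  coefficients again add up to coherent sequences.\<close>

lemma kernel_in_power:
  fixes l :: nat
  assumes gens: "I = Idl (g ` {..<l})" and g: "\<And>s. g s \<in> carrier R"
    and x: "coherent_seq x" "x h \<in> P h"
  shows "limit x \<in> ideal_power E J h"
  using x
proof (induction h arbitrary: x)
  case 0
  then show ?case by (simp add: ideals_set_def)
next
  case (Suc h)
  note xc = coherent_seqD[OF Suc.prems(1)]
  have gI: "g s \<in> I" if "s < l" for s
    unfolding gens using genideal_self[of "g ` {..<l}"] g that by auto
  \<comment> \<open>Increments of the sequence, started at index \<open>h + 1\<close> so that all of
    them lie in \<open>I^(h + 1)\<close>; their partial sums return the terms of \<open>x\<close>
    from there on.\<close>
  define c where "c = (\<lambda>j. if j = 0 then x (Suc h) else x (Suc h + j) \<ominus> x (h + j))"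
  \<comment> \<open>Truncated subtraction gives \<open>c 0\<close> and \<open>c 1\<close> the same
    exponent \<open>h + 1\<close>.\<close>
  have cP: "c j \<in> P (Suc (h + (j - 1)))" for j
  proof (cases j)
    case 0
    then show ?thesis using Suc.prems(2) by (simp add: c_def)
  next
    case (Suc i)
    then show ?thesis using xc(2)[of "h + j" "Suc h + j"] by (simp add: c_def)
  qed
  have "\<exists>t. (\<forall>s. t s \<in> P (h + (j - 1))) \<and> c j = (\<Oplus>s\<in>{..<l}. g s \<otimes> t s)" for j
    using cP[of j] unfolding ideal_power_Suc 
    by (subst (asm) gens, intro ideal_prod_genideal_finite) (auto intro: P.is_ideal g simp: gens[symmetric])
  then obtain t where t: "\<And>j s. t j s \<in> P (h + (j - 1))"
    and ct: "\<And>j. c j = (\<Oplus>s\<in>{..<l}. g s \<otimes> t j s)" by metis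
  have tc: "t j s \<in> carrier R" for j s using t P.Icarr by blast
  \<comment> \<open>The delay by \<open>h\<close> aligns exponents with indices: from index
    \<open>h\<close> on, the step from \<open>y s n\<close> to the next term adds a coefficient in
    \<open>I^n\<close>, and up to index \<open>h\<close> only \<open>t 0 s\<close> is
    present.\<close>
  define y where "y = (\<lambda>s n. \<Oplus>j\<in>{..n - h}. t j s)"
  have yc: "y s n \<in> carrier R" for s n unfolding y_def using tc by (intro finsum_closed) auto
  have y: "coherent_seq (y s)" for s
  proof (rule coherent_seq_stepI[OF yc])
    fix n
    show "y s (Suc n) \<ominus> y s n \<in> P n"
    proof (cases "n < h")
      case True
      then have "y s (Suc n) = y s n" by (simp add: y_def)
      then show ?thesis using yc by (simp add: minus_eq r_neg)
    next
      case False
      then obtain i where i: "n = h + i" by (metis le_iff_add not_less)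
      have "y s (Suc n) = t (Suc i) s \<oplus> y s n"
        unfolding y_def i using tc by (simp add: Suc_diff_le)
      moreover have "t (Suc i) s \<in> P n" using t[of "Suc i" s] i by simp
      ultimately show ?thesis
        using yc tc by (simp add: minus_eq a_assoc r_neg)
    qed
  qed
  have sum: "(\<Oplus>s\<in>{..<l}. g s \<otimes> y s (h + i)) = x (Suc h + i)" for i
  proof -
    have "(\<Oplus>s\<in>{..<l}. g s \<otimes> y s (h + i)) = (\<Oplus>s\<in>{..<l}. \<Oplus>j\<in>{..i}. g s \<otimes> t j s)"
      unfolding y_def using g tc by (intro finsum_cong') (auto simp: finsum_rdistr Pi_def intro!: finsum_closed)
    also have "\<dots> = (\<Oplus>j\<in>{..i}. \<Oplus>s\<in>{..<l}. g s \<otimes> t j s)"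
      using g tc by (intro finsum_swap) auto
    also have "\<dots> = (\<Oplus>j\<in>{..i}. c j)" by (simp only: ct)
    also have "\<dots> = x (Suc h + i)"
    proof (induction i)
      case 0
      show ?case using xc(1) by (simp add: c_def)
    next
      case (Suc i)
      have "c j \<in> carrier R" for j using xc(1) by (simp add: c_def)
      then have "(\<Oplus>j\<in>{..Suc i}. c j) = c (Suc i) \<oplus> x (Suc h + i)"
        using Suc by simp
      also have "c (Suc i) \<oplus> x (Suc h + i) = x (Suc h + Suc i)"
        using xc(1) by (simp add: c_def minus_eq a_assoc l_neg)
      finally show ?case .
    qed
    finally show ?thesis .
  qed
  have s0: "y s n = t 0 s" if "n \<le> h" for s n using that tc by (simp add: y_def)
  have "limit (y s) \<in> ideal_power E J h" for s
    using t[of 0 s] by (intro Suc.IH[OF y]) (simp add: s0)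
  then have in_pow: "\<iota> (g s) \<otimes>\<^bsub>E\<^esub> limit (y s) \<in> ideal_power E J (Suc h)" if "s < l" for s
    unfolding E.ideal_power_Suc using \<iota>_J[OF gI[OF that]] y g
    by (subst E.m_comm) (auto intro: ideal_prod.prod)
  have prod: "\<iota> (g s) \<otimes>\<^bsub>E\<^esub> limit (y s) = limit (\<lambda>n. g s \<otimes> y s n)" for s
    using y g by (simp add: \<iota>_limit limit_ops coherent_const)
  have coh: "coherent_seq (\<lambda>n. g s \<otimes> y s n)" for s
    by (intro coherent_intros y g)
  interpret K: ideal "ideal_power E J (Suc h)" E by (rule E.ideal_power_ideal[OF J.is_ideal])
  have "limit x = limit (\<lambda>n. \<Oplus>s\<in>{..<l}. g s \<otimes> y s n)"
  proof (rule limit_eq[THEN iffD2, rule_format])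
    show "coherent_seq (\<lambda>n. \<Oplus>s\<in>{..<l}. g s \<otimes> y s n)" by (rule finsum_limit(1)) (auto intro: coh)
    fix n
    \<comment> \<open>The combination need not return \<open>x n\<close> itself but a later term of
      \<open>x\<close>, which is congruent to it modulo \<open>I^n\<close>.\<close>
    have "\<exists>k\<ge>n. (\<Oplus>s\<in>{..<l}. g s \<otimes> y s n) = x k"
    proof (cases "n \<le> h")
      case True
      have "(\<Oplus>s\<in>{..<l}. g s \<otimes> y s n) = (\<Oplus>s\<in>{..<l}. g s \<otimes> y s (h + 0))"
        using True s0[of h] s0[OF True] by simp
      also have "\<dots> = x (Suc h)" using sum[of 0] by simp
      finally show ?thesis using True by (intro exI[of _ "Suc h"]) auto
    next
      case False
      then obtain i where i: "n = h + i" by (metis le_iff_add nat_le_linear)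
      show ?thesis using sum[of i] unfolding i by (intro exI[of _ "Suc h + i"]) auto
    qed
    then obtain k where k: "n \<le> k" "(\<Oplus>s\<in>{..<l}. g s \<otimes> y s n) = x k" by blast
    have "\<ominus> (x k \<ominus> x n) \<in> P n" using xc(2)[OF k(1)] by simp
    also have "\<ominus> (x k \<ominus> x n) = x n \<ominus> x k" using xc(1)[of k] xc(1)[of n] by algebra
    finally show "x n \<ominus> (\<Oplus>s\<in>{..<l}. g s \<otimes> y s n) \<in> P n" using k(2) by simp
  qed (rule Suc.prems(1))
  also have "\<dots> = (\<Oplus>\<^bsub>E\<^esub>s\<in>{..<l}. limit (\<lambda>n. g s \<otimes> y s n))"
    using coh by (intro finsum_limit(2)[symmetric]) auto
  also have "\<dots> \<in> ideal_power E J (Suc h)"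
  proof (rule E.finsum_mem[OF _ K.zero_closed K.a_closed K.a_subset])
    show "limit (\<lambda>n. g s \<otimes> y s n) \<in> ideal_power E J (Suc h)" if "s \<in> {..<l}" for s
      unfolding prod[symmetric] by (rule in_pow) (use that in simp)
  qed simp
  finally show ?case .
qed

end

section \<open>The tensor product of algebras\<close>

lemma frag_extend_fun_diff: "frag_extend (\<lambda>p. f p - g p) s = frag_extend f s - frag_extend g s"
  using subset_UNIV
  by (induction s rule: frag_induction) (auto simp: frag_extend_diff)

locale algebra_pair = BB: cring B + CC: cring C + B?: algebra A B + C?: algebra A C
  for A :: "('a, 'r) ring_scheme" and B :: "('a, 'c, 's) module_scheme"
    and C :: "('a, 'e, 't) module_scheme"
begin

sublocale module_pair A B C
  by (intro module_pair.intro B.module C.module)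

text \<open>The product of \<open>pair_ring\<close> with projections in place of a case distinction
  on pairs, which suits the rules for \<open>frag_extend\<close>.\<close>

definition pair_mult :: "('c \<times> 'e \<Rightarrow>\<^sub>0 int) \<Rightarrow> ('c \<times> 'e \<Rightarrow>\<^sub>0 int) \<Rightarrow> ('c \<times> 'e \<Rightarrow>\<^sub>0 int)" where
  "pair_mult s t = frag_extend (\<lambda>p. frag_extend
    (\<lambda>q. frag_of (fst p \<otimes>\<^bsub>B\<^esub> fst q, snd p \<otimes>\<^bsub>C\<^esub> snd q)) t) s"

lemma pair_ring_mult: "s \<otimes>\<^bsub>pair_ring B C\<^esub> t = pair_mult s t"
  by (simp add: pair_ring_def pair_mult_def case_prod_unfold)

lemma pair_ring_one: "\<one>\<^bsub>pair_ring B C\<^esub> = frag_of (\<one>\<^bsub>B\<^esub>, \<one>\<^bsub>C\<^esub>)"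
  by (simp add: pair_ring_def)

lemma pair_mult_simps:
  "pair_mult 0 t = 0" "pair_mult s 0 = 0"
  "pair_mult (s - s') t = pair_mult s t - pair_mult s' t"
  "pair_mult s (t - t') = pair_mult s t - pair_mult s t'"
  "pair_mult (s + s') t = pair_mult s t + pair_mult s' t"
  "pair_mult (frag_of (b, c)) (frag_of (b', c')) = frag_of (b \<otimes>\<^bsub>B\<^esub> b', c \<otimes>\<^bsub>C\<^esub> c')"
  by (simp_all add: pair_mult_def frag_extend_diff frag_extend_fun_diff frag_extend_add frag_extend_eq_0)

abbreviation "BC \<equiv> carrier B \<times> carrier C"

lemma pair_mult_closed:
  assumes "Poly_Mapping.keys s \<subseteq> BC" "Poly_Mapping.keys t \<subseteq> BC"
  shows "Poly_Mapping.keys (pair_mult s t) \<subseteq> BC"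
proof
  fix r assume "r \<in> Poly_Mapping.keys (pair_mult s t)"
  then obtain p where p: "p \<in> Poly_Mapping.keys s"
    "r \<in> Poly_Mapping.keys (frag_extend (\<lambda>q. frag_of (fst p \<otimes>\<^bsub>B\<^esub> fst q, snd p \<otimes>\<^bsub>C\<^esub> snd q)) t)"
    unfolding pair_mult_def using subsetD[OF keys_frag_extend] by fast
  then obtain q where q: "q \<in> Poly_Mapping.keys t"
    "r \<in> Poly_Mapping.keys (frag_of (fst p \<otimes>\<^bsub>B\<^esub> fst q, snd p \<otimes>\<^bsub>C\<^esub> snd q))"
    using subsetD[OF keys_frag_extend] by fast
  have "p \<in> BC" "q \<in> BC" using p(1) q(1) assms by auto
  then show "r \<in> BC" using q(2) by auto
qed

lemma pair_mult_comm:
  assumes "Poly_Mapping.keys s \<subseteq> BC" "Poly_Mapping.keys t \<subseteq> BC"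
  shows "pair_mult s t = pair_mult t s"
  using assms(1)
proof (induction s rule: frag_induction)
  case (one p)
  show ?case
    using assms(2)
  proof (induction t rule: frag_induction)
    case (one q)
    then show ?case using \<open>p \<in> BC\<close> BB.m_comm CC.m_comm
      by (cases p; cases q) (auto simp: pair_mult_simps)
  qed (simp_all add: pair_mult_simps)
qed (simp_all add: pair_mult_simps)

lemma pair_mult_assoc:
  assumes "Poly_Mapping.keys s \<subseteq> BC" "Poly_Mapping.keys t \<subseteq> BC" "Poly_Mapping.keys u \<subseteq> BC"
  shows "pair_mult (pair_mult s t) u = pair_mult s (pair_mult t u)"
  using assms(1)
proof (induction s rule: frag_induction)
  case (one p)
  show ?case
    using assms(2)
  proof (induction t rule: frag_induction)
    case (one q)
    show ?case
      using assms(3)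
    proof (induction u rule: frag_induction)
      case (one r)
      then show ?case using \<open>p \<in> BC\<close> \<open>q \<in> BC\<close>
        by (cases p; cases q; cases r) (auto simp: pair_mult_simps BB.m_assoc CC.m_assoc)
    qed (simp_all add: pair_mult_simps)
  qed (simp_all add: pair_mult_simps)
qed (simp_all add: pair_mult_simps)

lemma pair_mult_one:
  assumes "Poly_Mapping.keys s \<subseteq> BC"
  shows "pair_mult (frag_of (\<one>\<^bsub>B\<^esub>, \<one>\<^bsub>C\<^esub>)) s = s"
  using assms
proof (induction s rule: frag_induction)
  case (one p)
  then show ?case by (cases p) (simp add: pair_mult_simps)
qed (simp_all add: pair_mult_simps)

lemma pair_cring: "cring (pair_ring B C)"
proof (rule cringI[OF P.abelian_group_axioms])
  show "comm_monoid (pair_ring B C)"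
  proof (rule comm_monoidI)
    fix x y z assume "x \<in> carrier (pair_ring B C)" "y \<in> carrier (pair_ring B C)" "z \<in> carrier (pair_ring B C)"
    then show "x \<otimes>\<^bsub>pair_ring B C\<^esub> y \<otimes>\<^bsub>pair_ring B C\<^esub> z = x \<otimes>\<^bsub>pair_ring B C\<^esub> (y \<otimes>\<^bsub>pair_ring B C\<^esub> z)"
      by (simp add: pair_ring_mult pair_mult_assoc)
  next
    fix x y assume "x \<in> carrier (pair_ring B C)" "y \<in> carrier (pair_ring B C)"
    then show "x \<otimes>\<^bsub>pair_ring B C\<^esub> y = y \<otimes>\<^bsub>pair_ring B C\<^esub> x"
      by (simp add: pair_ring_mult pair_mult_comm)
  qed (simp_all add: pair_ring_mult pair_ring_one pair_mult_closed pair_mult_one)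
qed (simp add: pair_ring_mult pair_mult_simps)

lemma rels_diff:
  assumes "s \<in> rels" "t \<in> rels"
  shows "s - t \<in> rels"
proof -
  have k: "Poly_Mapping.keys t \<subseteq> BC" using subsetD[OF Q.a_subset assms(2)] by simp
  have "\<ominus>\<^bsub>pair_ring B C\<^esub> t = - t"
    by (rule P.minus_equality) (use k in auto)
  then show ?thesis using Q.a_closed[OF assms(1) Q.a_inv_closed[OF assms(2)]] by simp
qed

lemma rels_zero: "0 \<in> rels"
  using Q.zero_closed by simp

text \<open>Multiplying by a basis element sends each family of relations to itself; for the
  balanced family this uses that scalars of \<open>A\<close> pass through products. Biadditivity
  then makes \<open>rels\<close> an ideal.\<close>

lemma pair_mult_gens:
  assumes "(b, c) \<in> BC" "g \<in> gens"
  shows "pair_mult (frag_of (b, c)) g \<in> gens"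
proof -
  have bc: "b \<in> carrier B" "c \<in> carrier C" using assms(1) by auto
  from assms(2) consider x x' y where "g = frag_of (x \<oplus>\<^bsub>B\<^esub> x', y) - frag_of (x, y) - frag_of (x', y)"
      "x \<in> carrier B" "x' \<in> carrier B" "y \<in> carrier C"
    | x y y' where "g = frag_of (x, y \<oplus>\<^bsub>C\<^esub> y') - frag_of (x, y) - frag_of (x, y')"
      "x \<in> carrier B" "y \<in> carrier C" "y' \<in> carrier C"
    | a x y where "g = frag_of (a \<odot>\<^bsub>B\<^esub> x, y) - frag_of (x, a \<odot>\<^bsub>C\<^esub> y)"
      "a \<in> carrier A" "x \<in> carrier B" "y \<in> carrier C"
    unfolding gens_def by blast
  then show ?thesis
  proof cases
    case (1 x x' y)
    have "pair_mult (frag_of (b, c)) g = frag_of (b \<otimes>\<^bsub>B\<^esub> x \<oplus>\<^bsub>B\<^esub> b \<otimes>\<^bsub>B\<^esub> x', c \<otimes>\<^bsub>C\<^esub> y) -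
        frag_of (b \<otimes>\<^bsub>B\<^esub> x, c \<otimes>\<^bsub>C\<^esub> y) - frag_of (b \<otimes>\<^bsub>B\<^esub> x', c \<otimes>\<^bsub>C\<^esub> y)"
      using 1 bc by (simp add: pair_mult_simps BB.r_distr)
    moreover have "b \<otimes>\<^bsub>B\<^esub> x \<in> carrier B" "b \<otimes>\<^bsub>B\<^esub> x' \<in> carrier B" "c \<otimes>\<^bsub>C\<^esub> y \<in> carrier C" using 1 bc by auto
    ultimately show ?thesis unfolding gens_def by blast
  next
    case (2 x y y')
    have "pair_mult (frag_of (b, c)) g = frag_of (b \<otimes>\<^bsub>B\<^esub> x, c \<otimes>\<^bsub>C\<^esub> y \<oplus>\<^bsub>C\<^esub> c \<otimes>\<^bsub>C\<^esub> y') -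
        frag_of (b \<otimes>\<^bsub>B\<^esub> x, c \<otimes>\<^bsub>C\<^esub> y) - frag_of (b \<otimes>\<^bsub>B\<^esub> x, c \<otimes>\<^bsub>C\<^esub> y')"
      using 2 bc by (simp add: pair_mult_simps CC.r_distr)
    moreover have "b \<otimes>\<^bsub>B\<^esub> x \<in> carrier B" "c \<otimes>\<^bsub>C\<^esub> y' \<in> carrier C" "c \<otimes>\<^bsub>C\<^esub> y \<in> carrier C" using 2 bc by auto
    ultimately show ?thesis unfolding gens_def by blast
  next
    case (3 a x y)
    have 1: "b \<otimes>\<^bsub>B\<^esub> (a \<odot>\<^bsub>B\<^esub> x) = a \<odot>\<^bsub>B\<^esub> (b \<otimes>\<^bsub>B\<^esub> x)"
    proof -
      have "b \<otimes>\<^bsub>B\<^esub> (a \<odot>\<^bsub>B\<^esub> x) = (a \<odot>\<^bsub>B\<^esub> x) \<otimes>\<^bsub>B\<^esub> b" using 3 bc by (intro BB.m_comm) auto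
      also have "\<dots> = a \<odot>\<^bsub>B\<^esub> (x \<otimes>\<^bsub>B\<^esub> b)" using 3 bc by (intro B.smult_assoc2) auto
      also have "x \<otimes>\<^bsub>B\<^esub> b = b \<otimes>\<^bsub>B\<^esub> x" using 3 bc by (intro BB.m_comm) auto
      finally show ?thesis .
    qed
    have 2: "c \<otimes>\<^bsub>C\<^esub> (a \<odot>\<^bsub>C\<^esub> y) = a \<odot>\<^bsub>C\<^esub> (c \<otimes>\<^bsub>C\<^esub> y)"
    proof -
      have "c \<otimes>\<^bsub>C\<^esub> (a \<odot>\<^bsub>C\<^esub> y) = (a \<odot>\<^bsub>C\<^esub> y) \<otimes>\<^bsub>C\<^esub> c" using 3 bc by (intro CC.m_comm) auto
      also have "\<dots> = a \<odot>\<^bsub>C\<^esub> (y \<otimes>\<^bsub>C\<^esub> c)" using 3 bc by (intro C.smult_assoc2) auto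
      also have "y \<otimes>\<^bsub>C\<^esub> c = c \<otimes>\<^bsub>C\<^esub> y" using 3 bc by (intro CC.m_comm) auto
      finally show ?thesis .
    qed
    have "pair_mult (frag_of (b, c)) g = frag_of (a \<odot>\<^bsub>B\<^esub> (b \<otimes>\<^bsub>B\<^esub> x), c \<otimes>\<^bsub>C\<^esub> y) -
        frag_of (b \<otimes>\<^bsub>B\<^esub> x, a \<odot>\<^bsub>C\<^esub> (c \<otimes>\<^bsub>C\<^esub> y))"
      unfolding 3(1) by (simp add: pair_mult_simps 1 2)
    moreover have "b \<otimes>\<^bsub>B\<^esub> x \<in> carrier B" "c \<otimes>\<^bsub>C\<^esub> y \<in> carrier C" using 3 bc by auto
    ultimately show ?thesis using 3(2) unfolding gens_def by blast
  qed
qed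

lemma pair_mult_rels:
  assumes s: "Poly_Mapping.keys s \<subseteq> BC" and t: "t \<in> rels"
  shows "pair_mult s t \<in> rels"
  using s
proof (induction s rule: frag_induction)
  case zero
  show ?case by (simp add: pair_mult_simps rels_zero)
next
  case (one p)
  obtain b c where p: "p = (b, c)" by (cases p)
  show ?case
    using t unfolding p rels_eq pair_add_monoid
  proof (induction t rule: generate.induct)
    case one
    show ?case using rels_zero[unfolded rels_eq pair_add_monoid] by (simp add: pair_mult_simps)
  next
    case (incl g)
    then show ?case using pair_mult_gens one p by (simp add: generate.incl)
  next
    case (inv g)
    have "g \<in> carrier (free_Abelian_group BC)" using inv gens_carrier by (simp add: subset_iff)
    then have e: "inv\<^bsub>free_Abelian_group BC\<^esub> g = 0 - g" by simp
    have "0 - pair_mult (frag_of (b, c)) g \<in> rels"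
      using pair_mult_gens[of b c g] inv one p by (intro rels_diff rels_zero gens_rels) auto
    then show ?case unfolding e by (simp only: pair_mult_simps rels_eq pair_add_monoid)
  next
    case (eng g h)
    have "pair_mult (frag_of (b, c)) g - (0 - pair_mult (frag_of (b, c)) h) \<in> rels"
      using eng.IH by (intro rels_diff rels_zero) (simp_all only: rels_eq pair_add_monoid)
    moreover have "pair_mult (frag_of (b, c)) (g - (0 - h)) =
        pair_mult (frag_of (b, c)) g - (0 - pair_mult (frag_of (b, c)) h)"
      by (simp only: pair_mult_simps)
    moreover have "g \<otimes>\<^bsub>free_Abelian_group BC\<^esub> h = g - (0 - h)" by simp
    ultimately show ?case by (simp only: rels_eq pair_add_monoid)
  qed
next
  case (diff a b)
  then show ?case by (simp only: pair_mult_simps rels_diff)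
qed

lemma rels_ideal: "ideal rels (pair_ring B C)"
proof -
  interpret F: cring "pair_ring B C" by (rule pair_cring)
  show ?thesis
  proof (rule idealI[OF F.ring_axioms Q.a_subgroup])
    fix a x assume a: "a \<in> rels" and x: "x \<in> carrier (pair_ring B C)"
    show 1: "x \<otimes>\<^bsub>pair_ring B C\<^esub> a \<in> rels"
      using a x by (simp add: pair_ring_mult pair_mult_rels)
    have "a \<otimes>\<^bsub>pair_ring B C\<^esub> x = x \<otimes>\<^bsub>pair_ring B C\<^esub> a"
      using subsetD[OF Q.a_subset a] x by (rule F.m_comm)
    then show "a \<otimes>\<^bsub>pair_ring B C\<^esub> x \<in> rels" using 1 by simp
  qed
qed

lemma T_cring: "cring T"
proof -
  interpret I: ideal rels "pair_ring B C" by (rule rels_ideal)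
  interpret K: cring "pair_ring B C Quot rels" by (rule I.quotient_is_cring[OF pair_cring])
  have e: "carrier T = carrier (pair_ring B C Quot rels)"
    "\<And>x y. x \<otimes>\<^bsub>T\<^esub> y = x \<otimes>\<^bsub>pair_ring B C Quot rels\<^esub> y"
    "\<And>x y. x \<oplus>\<^bsub>T\<^esub> y = x \<oplus>\<^bsub>pair_ring B C Quot rels\<^esub> y"
    "\<one>\<^bsub>T\<^esub> = \<one>\<^bsub>pair_ring B C Quot rels\<^esub>"
    by (simp_all add: tensor_product_def Let_def)
  show ?thesis
  proof (rule cringI[OF T.abelian_group_axioms])
    show "comm_monoid T"
    proof (rule comm_monoidI)
      show "x \<otimes>\<^bsub>T\<^esub> y \<otimes>\<^bsub>T\<^esub> z = x \<otimes>\<^bsub>T\<^esub> (y \<otimes>\<^bsub>T\<^esub> z)"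
        if "x \<in> carrier T" "y \<in> carrier T" "z \<in> carrier T" for x y z
        using that unfolding e by (rule K.m_assoc)
      show "x \<otimes>\<^bsub>T\<^esub> y = y \<otimes>\<^bsub>T\<^esub> x" if "x \<in> carrier T" "y \<in> carrier T" for x y
        using that unfolding e by (rule K.m_comm)
    qed (simp_all add: e)
  qed (simp add: e K.l_distr)
qed

sublocale T: cring T by (rule T_cring)

lemma cls_mult:
  assumes "Poly_Mapping.keys s \<subseteq> BC" "Poly_Mapping.keys t \<subseteq> BC"
  shows "cls s \<otimes>\<^bsub>T\<^esub> cls t = cls (pair_mult s t)"
proof -
  interpret I: ideal rels "pair_ring B C" by (rule rels_ideal)
  show ?thesis
    using I.rcoset_mult_add[of s t] assms
    by (simp add: tensor_product_def Let_def FactRing_def tensor_class_def pair_ring_mult)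
qed

lemma pt_mult:
  assumes "x \<in> carrier B" "x' \<in> carrier B" "y \<in> carrier C" "y' \<in> carrier C"
  shows "pt x y \<otimes>\<^bsub>T\<^esub> pt x' y' = pt (x \<otimes>\<^bsub>B\<^esub> x') (y \<otimes>\<^bsub>C\<^esub> y')"
  unfolding pure_tensor_def using assms by (simp add: cls_mult pair_mult_simps)

lemma T_one: "\<one>\<^bsub>T\<^esub> = pt \<one>\<^bsub>B\<^esub> \<one>\<^bsub>C\<^esub>"
  by (simp add: tensor_product_def Let_def FactRing_def pure_tensor_def tensor_class_def pair_ring_one)

text \<open>Elements coming from \<open>C\<close> act on the second factors alone, so the set of
  first factors is not disturbed.\<close>

lemma tsum_mult:
  assumes S: "finite S" "S \<subseteq> carrier B" "c \<in> S \<rightarrow> carrier C" and d: "d \<in> carrier C"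
  shows "pt \<one>\<^bsub>B\<^esub> d \<otimes>\<^bsub>T\<^esub> tsum S c = tsum S (\<lambda>b. d \<otimes>\<^bsub>C\<^esub> c b)"
proof -
  have cb: "c b \<in> carrier C" "b \<in> carrier B" if "b \<in> S" for b using S that by auto
  have "pt \<one>\<^bsub>B\<^esub> d \<otimes>\<^bsub>T\<^esub> tsum S c = (\<Oplus>\<^bsub>T\<^esub>b\<in>S. pt \<one>\<^bsub>B\<^esub> d \<otimes>\<^bsub>T\<^esub> pt b (c b))"
    unfolding tsum_def using S(1) d cb by (intro T.finsum_rdistr) auto
  also have "\<dots> = tsum S (\<lambda>b. d \<otimes>\<^bsub>C\<^esub> c b)"
    unfolding tsum_def using d cb by (intro T.finsum_cong') (auto simp: pt_mult)
  finally show ?thesis .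
qed

text \<open>Ideals of \<open>T\<close> are described through sets of pairs whose pure tensors span
  them additively, so that products and powers of ideals reduce to products of pairs.\<close>

inductive_set pspan :: "('c \<times> 'e) set \<Rightarrow> ('c \<times> 'e \<Rightarrow>\<^sub>0 int) set set" for Z where
  zero: "\<zero>\<^bsub>T\<^esub> \<in> pspan Z"
| pure: "(b, c) \<in> Z \<Longrightarrow> pt b c \<in> pspan Z"
| add: "X \<in> pspan Z \<Longrightarrow> Y \<in> pspan Z \<Longrightarrow> X \<oplus>\<^bsub>T\<^esub> Y \<in> pspan Z"

lemma pspan_closed:
  assumes "X \<in> pspan Z" "Z \<subseteq> BC"
  shows "X \<in> carrier T"
  using assms(1) by (induction X rule: pspan.induct) (use assms(2) in auto)

lemma pspan_mono:
  assumes "X \<in> pspan Z" "Z \<subseteq> Z'"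
  shows "X \<in> pspan Z'"
  using assms(1) by (induction X rule: pspan.induct) (use assms(2) in \<open>auto intro: pspan.intros\<close>)

lemma pspan_finsum:
  assumes "finite S" "\<And>i. i \<in> S \<Longrightarrow> F i \<in> pspan Z" "Z \<subseteq> BC"
  shows "(\<Oplus>\<^bsub>T\<^esub>i\<in>S. F i) \<in> pspan Z"
  by (rule T.finsum_mem[OF assms(1) pspan.zero pspan.add _ assms(2)])
    (use pspan_closed assms(3) in auto)

lemma pspan_carrier: "pspan BC = carrier T"
proof
  show "pspan BC \<subseteq> carrier T" using pspan_closed by auto
  show "carrier T \<subseteq> pspan BC"
  proof
    fix X assume "X \<in> carrier T"
    then obtain S c where S: "finite S" "S \<subseteq> carrier B" "c \<in> S \<rightarrow> carrier C" "X = tsum S c"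
      by (rule tsum_rep)
    show "X \<in> pspan BC"
      unfolding S(4) tsum_def by (rule pspan_finsum[OF S(1)]) (use S in \<open>auto intro!: pspan.pure\<close>)
  qed
qed

lemma pspan_mult:
  assumes X: "X \<in> pspan Z" and Y: "Y \<in> pspan Z'" and Z: "Z \<subseteq> BC" "Z' \<subseteq> BC"
    and m: "\<And>b c b' c'. (b, c) \<in> Z \<Longrightarrow> (b', c') \<in> Z' \<Longrightarrow> (b \<otimes>\<^bsub>B\<^esub> b', c \<otimes>\<^bsub>C\<^esub> c') \<in> Z''"
  shows "X \<otimes>\<^bsub>T\<^esub> Y \<in> pspan Z''"
  using X
proof (induction X rule: pspan.induct)
  case zero
  then show ?case using pspan_closed[OF Y Z(2)] by (simp add: pspan.zero)
next
  case (pure b c)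
  have bc: "b \<in> carrier B" "c \<in> carrier C" using pure Z by auto
  show ?case
    using Y
  proof (induction Y rule: pspan.induct)
    case zero
    show ?case using bc by (simp add: pspan.zero)
  next
    case (pure b' c')
    have "b' \<in> carrier B" "c' \<in> carrier C" using pure Z by auto
    then have "pt b c \<otimes>\<^bsub>T\<^esub> pt b' c' = pt (b \<otimes>\<^bsub>B\<^esub> b') (c \<otimes>\<^bsub>C\<^esub> c')" using bc by (simp add: pt_mult)
    then show ?case using m[OF \<open>(b, c) \<in> Z\<close> pure] by (simp add: pspan.pure)
  next
    case (add X Y)
    have "pt b c \<otimes>\<^bsub>T\<^esub> (X \<oplus>\<^bsub>T\<^esub> Y) = pt b c \<otimes>\<^bsub>T\<^esub> X \<oplus>\<^bsub>T\<^esub> pt b c \<otimes>\<^bsub>T\<^esub> Y"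
      using add pspan_closed[OF _ Z(2)] bc by (intro T.r_distr) auto
    then show ?case using add.IH by (simp add: pspan.add)
  qed
next
  case (add X1 X2)
  have "(X1 \<oplus>\<^bsub>T\<^esub> X2) \<otimes>\<^bsub>T\<^esub> Y = X1 \<otimes>\<^bsub>T\<^esub> Y \<oplus>\<^bsub>T\<^esub> X2 \<otimes>\<^bsub>T\<^esub> Y"
    using add pspan_closed[OF _ Z(1)] pspan_closed[OF Y Z(2)] by (intro T.l_distr) auto
  then show ?case using add.IH by (simp add: pspan.add)
qed

lemma pspan_ideal:
  assumes Z: "Z \<subseteq> BC"
    and m: "\<And>b c b' c'. (b, c) \<in> BC \<Longrightarrow> (b', c') \<in> Z \<Longrightarrow> (b \<otimes>\<^bsub>B\<^esub> b', c \<otimes>\<^bsub>C\<^esub> c') \<in> Z"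
  shows "ideal (pspan Z) T"
proof (rule idealI[OF T.ring_axioms])
  show 1: "x \<otimes>\<^bsub>T\<^esub> a \<in> pspan Z" if "a \<in> pspan Z" "x \<in> carrier T" for a x
    using pspan_mult[OF _ that(1) _ Z m] that(2) unfolding pspan_carrier[symmetric] by blast
  show "a \<otimes>\<^bsub>T\<^esub> x \<in> pspan Z" if "a \<in> pspan Z" "x \<in> carrier T" for a x
    using 1[OF that] T.m_comm[OF pspan_closed[OF that(1) Z] that(2)] by simp
  show "subgroup (pspan Z) (add_monoid T)"
  proof (rule group.subgroupI[OF T.a_group])
    show "pspan Z \<subseteq> carrier (add_monoid T)" using pspan_closed Z by auto
    show "pspan Z \<noteq> {}" using pspan.zero by blast
    show "inv\<^bsub>add_monoid T\<^esub> a \<in> pspan Z" if "a \<in> pspan Z" for a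
    proof -
      \<comment> \<open>Negation is not among the rules of \<open>pspan\<close>; it is obtained as
        multiplication by \<open>-1\<close>.\<close>
      have "(\<ominus>\<^bsub>T\<^esub> \<one>\<^bsub>T\<^esub>) \<otimes>\<^bsub>T\<^esub> a = \<ominus>\<^bsub>T\<^esub> a"
        using pspan_closed[OF that Z] by (simp add: T.l_minus)
      then show ?thesis using 1[OF that, of "\<ominus>\<^bsub>T\<^esub> \<one>\<^bsub>T\<^esub>"] by (simp add: a_inv_def)
    qed
    show "a \<otimes>\<^bsub>add_monoid T\<^esub> b \<in> pspan Z" if "a \<in> pspan Z" "b \<in> pspan Z" for a b
      using pspan.add[OF that] by simp
  qed
qed

text \<open>Grouping by first factors keeps the alternative: if \<open>b\<close> is outside
  \<open>I\<close>, every coefficient collected at \<open>b\<close> lies in the ideal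
  \<open>J\<close>, and so does their sum.\<close>

lemma pspan_tsum:
  assumes "X \<in> pspan {(b, c) \<in> BC. b \<in> I \<or> c \<in> J}" and J: "ideal J C"
  shows "\<exists>S d. finite S \<and> S \<subseteq> carrier B \<and> d \<in> S \<rightarrow> carrier C \<and> X = tsum S d \<and> (\<forall>b\<in>S. b \<in> I \<or> d b \<in> J)"
  using assms(1)
proof (induction X rule: pspan.induct)
  case zero
  show ?case by (rule exI[of _ "{}"]) (simp add: tsum_def)
next
  case (pure b c)
  then show ?case by (intro exI[of _ "{b}"] exI[of _ "\<lambda>_. c"]) (auto simp: tsum_single)
next
  case (add X Y)
  interpret J: ideal J C by (rule J)
  obtain S d where S: "finite S" "S \<subseteq> carrier B" "d \<in> S \<rightarrow> carrier C" "X = tsum S d" "\<forall>b\<in>S. b \<in> I \<or> d b \<in> J"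
    using add.IH(1) by (elim exE conjE)
  obtain S' d' where S': "finite S'" "S' \<subseteq> carrier B" "d' \<in> S' \<rightarrow> carrier C" "Y = tsum S' d'" "\<forall>b\<in>S'. b \<in> I \<or> d' b \<in> J"
    using add.IH(2) by (elim exE conjE)
  let ?U = "S \<union> S'"
  let ?d = "\<lambda>b. if b \<in> S then d b else \<zero>\<^bsub>C\<^esub>" and ?d' = "\<lambda>b. if b \<in> S' then d' b else \<zero>\<^bsub>C\<^esub>"
  have U: "finite ?U" "?U \<subseteq> carrier B" and dU: "?d \<in> ?U \<rightarrow> carrier C" "?d' \<in> ?U \<rightarrow> carrier C"
    using S(1-3) S'(1-3) by auto
  have "X = tsum ?U ?d"
    unfolding S(4) by (rule tsum_enlarge [symmetric, OF U(1) _ U(2) S(3)]) blast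
  moreover have "Y = tsum ?U ?d'"
    unfolding S'(4) by (rule tsum_enlarge [symmetric, OF U(1) _ U(2) S'(3)]) blast
  ultimately have "X \<oplus>\<^bsub>T\<^esub> Y = tsum ?U (\<lambda>b. ?d b \<oplus>\<^bsub>C\<^esub> ?d' b)"
    using tsum_add[OF U(2) dU] by simp
  moreover have "(\<lambda>b. ?d b \<oplus>\<^bsub>C\<^esub> ?d' b) \<in> ?U \<rightarrow> carrier C"
  proof (rule funcsetI)
    fix b assume "b \<in> ?U"
    then have "?d b \<in> carrier C" "?d' b \<in> carrier C" using dU by (auto simp: Pi_def)
    then show "?d b \<oplus>\<^bsub>C\<^esub> ?d' b \<in> carrier C" by (rule CC.a_closed)
  qed
  moreover have "b \<in> I \<or> ?d b \<oplus>\<^bsub>C\<^esub> ?d' b \<in> J" if b: "b \<in> ?U" for b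
  proof (cases "b \<in> I")
    case False
    then have "?d b \<in> J" "?d' b \<in> J" using S(5) S'(5) J.zero_closed by auto
    then show ?thesis using J.a_closed by blast
  qed simp
  ultimately show ?case using U
    by (intro exI[where x = ?U] exI[where x = "\<lambda>b. ?d b \<oplus>\<^bsub>C\<^esub> ?d' b"] conjI ballI)
qed

end

lemma (in algebra) ideal_submodule:
  assumes "ideal I M"
  shows "submodule I R M"
proof -
  interpret I: ideal I M by fact
  show ?thesis
  proof (rule submoduleI[OF I.a_subset I.zero_closed I.a_inv_closed I.a_closed])
    show "a \<odot>\<^bsub>M\<^esub> x \<in> I" if "a \<in> carrier R" "x \<in> I" for a x
    proof -
      have x: "x \<in> carrier M" using that(2) by (rule I.Icarr)
      have "(a \<odot>\<^bsub>M\<^esub> \<one>\<^bsub>M\<^esub>) \<otimes>\<^bsub>M\<^esub> x = a \<odot>\<^bsub>M\<^esub> x" using that x by (simp add: smult_assoc2)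
      then show ?thesis using I.I_l_closed[OF that(2), of "a \<odot>\<^bsub>M\<^esub> \<one>\<^bsub>M\<^esub>"] that by simp
    qed
  qed
qed

lemma (in abelian_group) add_diff_cancel:
  assumes "x \<in> carrier G" "y \<in> carrier G"
  shows "x \<oplus> (y \<ominus> x) = y"
proof -
  have "x \<oplus> (y \<ominus> x) = y \<oplus> (x \<ominus> x)" unfolding minus_eq using assms by (intro a_lcomm) auto
  then show ?thesis using assms by (simp add: minus_eq r_neg)
qed

section \<open>The ideal \<open>\<rr>\<close> and its powers\<close>

locale algebra_pair_ideals = algebra_pair A B C + m: ideal \<mm> B + n: ideal \<nn> C
  for A and B and C and \<mm> and \<nn>
begin

abbreviation "\<rr> \<equiv> tensor_ideal A B C \<mm> \<nn>"

text \<open>Pure tensors over these pairs span the sum of the images of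
  \<open>\<mm>^i \<otimes> \<nn>^j\<close> with \<open>i + j = k\<close>, the terms of the expansion
  of \<open>\<rr>^k\<close>.\<close>

definition bifiltration :: "nat \<Rightarrow> ('c \<times> 'e) set" where
  "bifiltration k = {(b, c). \<exists>i j. i + j = k \<and> b \<in> ideal_power B \<mm> i \<and> c \<in> ideal_power C \<nn> j}"

sublocale mp: ideal "ideal_power B \<mm> k" B for k
  by (rule BB.ideal_power_ideal[OF m.is_ideal])

sublocale np: ideal "ideal_power C \<nn> k" C for k
  by (rule CC.ideal_power_ideal[OF n.is_ideal])

lemma bifiltration_carrier: "bifiltration k \<subseteq> BC"
  using mp.Icarr np.Icarr by (auto simp: bifiltration_def)

text \<open>The definition uses tensor products of the ideals themselves, which are groups other
  than \<open>T\<close>; their images in \<open>T\<close> consist of the sums of pure tensors with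
  one factor in the ideal.\<close>

lemma tensor_ideal_pspan: "\<rr> = pspan {(b, c) \<in> BC. b \<in> \<mm> \<or> c \<in> \<nn>}"
proof -
  let ?Zm = "{(b, c) \<in> BC. b \<in> \<mm>}" and ?Zn = "{(b, c) \<in> BC. c \<in> \<nn>}"
  have Bm: "module A (B\<lparr>carrier := \<mm>\<rparr>)"
    by (rule submodule.submodule_is_module[OF B.ideal_submodule[OF m.is_ideal] B.module])
  have Cn: "module A (C\<lparr>carrier := \<nn>\<rparr>)"
    by (rule submodule.submodule_is_module[OF C.ideal_submodule[OF n.is_ideal] C.module])
  have lm: "(\<lambda>x. x) \<in> linear_maps A (B\<lparr>carrier := \<mm>\<rparr>) B"
    using m.a_subset by (auto simp: linear_maps_def hom_def)
  have ln: "(\<lambda>x. x) \<in> linear_maps A (C\<lparr>carrier := \<nn>\<rparr>) C"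
    using n.a_subset by (auto simp: linear_maps_def hom_def)
  interpret h: tensor_hom A "B\<lparr>carrier := \<mm>\<rparr>" C B C "\<lambda>x. x" "\<lambda>x. x"
    by (intro tensor_hom.intro module_pair.intro tensor_hom_axioms.intro Bm B.module C.module lm id_linear_maps)
  interpret k: tensor_hom A B "C\<lparr>carrier := \<nn>\<rparr>" B C "\<lambda>x. x" "\<lambda>x. x"
    by (intro tensor_hom.intro module_pair.intro tensor_hom_axioms.intro Cn B.module C.module ln id_linear_maps)
  have 1: "tensor_map A B C (\<lambda>x. x) (\<lambda>y. y) ` carrier h.K.T = pspan ?Zm"
  proof
    show "tensor_map A B C (\<lambda>x. x) (\<lambda>y. y) ` carrier h.K.T \<subseteq> pspan ?Zm"
    proof
      fix Y assume "Y \<in> tensor_map A B C (\<lambda>x. x) (\<lambda>y. y) ` carrier h.K.T"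
      then obtain X where X: "Y = tensor_map A B C (\<lambda>x. x) (\<lambda>y. y) X" "X \<in> carrier h.K.T" by (elim imageE)
      obtain S c where S: "finite S" "S \<subseteq> carrier (B\<lparr>carrier := \<mm>\<rparr>)" "c \<in> S \<rightarrow> carrier C" "X = h.K.tsum S c"
        by (rule h.K.tsum_rep[OF X(2)])
      have cb: "b \<in> \<mm>" "b \<in> carrier B" "c b \<in> carrier C" if "b \<in> S" for b using S that m.Icarr by auto
      show "Y \<in> pspan ?Zm"
        unfolding X(1) S(4) h.tensor_map_tsum[OF S(1-3)]
        by (rule pspan_finsum[OF S(1)]) (use cb in \<open>auto intro!: pspan.pure\<close>)
    qed
    show "pspan ?Zm \<subseteq> tensor_map A B C (\<lambda>x. x) (\<lambda>y. y) ` carrier h.K.T"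
    proof
      fix X assume "X \<in> pspan ?Zm"
      then show "X \<in> tensor_map A B C (\<lambda>x. x) (\<lambda>y. y) ` carrier h.K.T"
      proof (induction X rule: pspan.induct)
        case zero
        show ?case using h.tensor_map_zero by (intro image_eqI[OF _ h.K.T.zero_closed]) simp
      next
        case (pure b c)
        then show ?case
          by (intro image_eqI[of _ _ "h.K.pt b c"]) (auto simp: h.tensor_map_pt)
      next
        case (add X Y)
        then obtain X' Y' where XY: "X' \<in> carrier h.K.T" "X = tensor_map A B C (\<lambda>x. x) (\<lambda>y. y) X'"
          "Y' \<in> carrier h.K.T" "Y = tensor_map A B C (\<lambda>x. x) (\<lambda>y. y) Y'" by (elim imageE)
        then show ?case
          by (intro image_eqI[of _ _ "X' \<oplus>\<^bsub>h.K.T\<^esub> Y'"]) (auto simp: h.tensor_map_add)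
      qed
    qed
  qed
  have 2: "tensor_map A B C (\<lambda>x. x) (\<lambda>y. y) ` carrier k.K.T = pspan ?Zn"
  proof
    show "tensor_map A B C (\<lambda>x. x) (\<lambda>y. y) ` carrier k.K.T \<subseteq> pspan ?Zn"
    proof
      fix Y assume "Y \<in> tensor_map A B C (\<lambda>x. x) (\<lambda>y. y) ` carrier k.K.T"
      then obtain X where X: "Y = tensor_map A B C (\<lambda>x. x) (\<lambda>y. y) X" "X \<in> carrier k.K.T" by (elim imageE)
      obtain S c where S: "finite S" "S \<subseteq> carrier B" "c \<in> S \<rightarrow> carrier (C\<lparr>carrier := \<nn>\<rparr>)" "X = k.K.tsum S c"
        by (rule k.K.tsum_rep[OF X(2)])
      have cb: "b \<in> carrier B" "c b \<in> \<nn>" "c b \<in> carrier C" if "b \<in> S" for b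
        using S(2,3) that n.Icarr by (auto simp: Pi_def)
      show "Y \<in> pspan ?Zn"
        unfolding X(1) S(4) k.tensor_map_tsum[OF S(1-3)]
        by (rule pspan_finsum[OF S(1)]) (use cb in \<open>auto intro!: pspan.pure\<close>)
    qed
    show "pspan ?Zn \<subseteq> tensor_map A B C (\<lambda>x. x) (\<lambda>y. y) ` carrier k.K.T"
    proof
      fix X assume "X \<in> pspan ?Zn"
      then show "X \<in> tensor_map A B C (\<lambda>x. x) (\<lambda>y. y) ` carrier k.K.T"
      proof (induction X rule: pspan.induct)
        case zero
        show ?case using k.tensor_map_zero by (intro image_eqI[OF _ k.K.T.zero_closed]) simp
      next
        case (pure b c)
        then show ?case
          by (intro image_eqI[of _ _ "k.K.pt b c"]) (auto simp: k.tensor_map_pt)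
      next
        case (add X Y)
        then obtain X' Y' where XY: "X' \<in> carrier k.K.T" "X = tensor_map A B C (\<lambda>x. x) (\<lambda>y. y) X'"
          "Y' \<in> carrier k.K.T" "Y = tensor_map A B C (\<lambda>x. x) (\<lambda>y. y) Y'" by (elim imageE)
        then show ?case
          by (intro image_eqI[of _ _ "X' \<oplus>\<^bsub>k.K.T\<^esub> Y'"]) (auto simp: k.tensor_map_add)
      qed
    qed
  qed
  let ?Z = "{(b, c) \<in> BC. b \<in> \<mm> \<or> c \<in> \<nn>}"
  have "\<rr> = pspan ?Zm <+>\<^bsub>T\<^esub> pspan ?Zn"
    unfolding tensor_ideal_def 1 2 ..
  also have "\<dots> = pspan ?Z"
  proof
    show "pspan ?Zm <+>\<^bsub>T\<^esub> pspan ?Zn \<subseteq> pspan ?Z"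
      by (auto simp: set_add_def' intro!: pspan.add elim: pspan_mono)
    show "pspan ?Z \<subseteq> pspan ?Zm <+>\<^bsub>T\<^esub> pspan ?Zn"
    proof
      fix X assume "X \<in> pspan ?Z"
      then show "X \<in> pspan ?Zm <+>\<^bsub>T\<^esub> pspan ?Zn"
      proof (induction X rule: pspan.induct)
        case zero
        have "\<zero>\<^bsub>T\<^esub> \<oplus>\<^bsub>T\<^esub> \<zero>\<^bsub>T\<^esub> = \<zero>\<^bsub>T\<^esub>" by simp
        then show ?case using pspan.zero[of ?Zm] pspan.zero[of ?Zn] by (force simp: set_add_def')
      next
        case (pure b c)
        then have p: "pt b c \<in> carrier T" by auto
        from pure consider "(b, c) \<in> ?Zm" | "(b, c) \<in> ?Zn" by blast
        then show ?case
        proof cases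
          case 1
          then have "pt b c \<in> pspan ?Zm" by (rule pspan.pure)
          moreover have "pt b c = pt b c \<oplus>\<^bsub>T\<^esub> \<zero>\<^bsub>T\<^esub>" using p by simp
          ultimately show ?thesis using pspan.zero[of ?Zn] unfolding set_add_def' by blast
        next
          case 2
          then have "pt b c \<in> pspan ?Zn" by (rule pspan.pure)
          moreover have "pt b c = \<zero>\<^bsub>T\<^esub> \<oplus>\<^bsub>T\<^esub> pt b c" using p by simp
          ultimately show ?thesis using pspan.zero[of ?Zm] unfolding set_add_def' by blast
        qed
      next
        case (add X Y)
        obtain X1 X2 where X: "X1 \<in> pspan ?Zm" "X2 \<in> pspan ?Zn" "X = X1 \<oplus>\<^bsub>T\<^esub> X2"
          using add.IH(1) unfolding set_add_def' by blast
        obtain Y1 Y2 where Y: "Y1 \<in> pspan ?Zm" "Y2 \<in> pspan ?Zn" "Y = Y1 \<oplus>\<^bsub>T\<^esub> Y2"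
          using add.IH(2) unfolding set_add_def' by blast
        have c: "X1 \<in> carrier T" "X2 \<in> carrier T" "Y1 \<in> carrier T" "Y2 \<in> carrier T"
          by (rule pspan_closed, rule X Y, blast)+
        have "X \<oplus>\<^bsub>T\<^esub> Y = (X1 \<oplus>\<^bsub>T\<^esub> Y1) \<oplus>\<^bsub>T\<^esub> (X2 \<oplus>\<^bsub>T\<^esub> Y2)"
          unfolding X(3) Y(3) using c by (simp add: T.a_assoc T.a_lcomm)
        then show ?case
          using pspan.add[OF X(1) Y(1)] pspan.add[OF X(2) Y(2)] unfolding set_add_def' by blast
      qed
    qed
  qed
  finally show ?thesis .
qed

lemma tensor_ideal_ideal: "ideal \<rr> T"
  unfolding tensor_ideal_pspan
  by (rule pspan_ideal) (auto intro: m.I_l_closed n.I_l_closed)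

sublocale r: ideal \<rr> T
  by (rule tensor_ideal_ideal)

sublocale rp: ideal "ideal_power T \<rr> k" T for k
  by (rule T.ideal_power_ideal[OF r.is_ideal])

text \<open>Multiplying by a pure tensor with a factor in \<open>\<mm>\<close> or in
  \<open>\<nn>\<close> raises one of the two exponents by one.\<close>

lemma tensor_ideal_power_bifiltration: "ideal_power T \<rr> k \<subseteq> pspan (bifiltration k)"
proof (induction k)
  case 0
  have "bifiltration 0 = BC" by (auto simp: bifiltration_def ideals_set_def)
  then show ?case using pspan_carrier by (simp add: ideals_set_def)
next
  case (Suc k)
  let ?Z = "{(b, c) \<in> BC. b \<in> \<mm> \<or> c \<in> \<nn>}"
  have m: "(b \<otimes>\<^bsub>B\<^esub> b', c \<otimes>\<^bsub>C\<^esub> c') \<in> bifiltration (Suc k)"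
    if bc: "(b, c) \<in> bifiltration k" and bc': "(b', c') \<in> ?Z" for b c b' c'
  proof -
    obtain i j where ij: "i + j = k" "b \<in> ideal_power B \<mm> i" "c \<in> ideal_power C \<nn> j"
      using bc by (auto simp: bifiltration_def)
    have car: "b' \<in> carrier B" "c' \<in> carrier C" using bc' by auto
    from bc' consider "b' \<in> \<mm>" | "c' \<in> \<nn>" by blast
    then show ?thesis
    proof cases
      case 1
      have "b \<otimes>\<^bsub>B\<^esub> b' \<in> ideal_power B \<mm> (Suc i)"
        unfolding BB.ideal_power_Suc using ij(2) 1 by (rule ideal_prod.prod)
      moreover have "c \<otimes>\<^bsub>C\<^esub> c' \<in> ideal_power C \<nn> j" using ij(3) car(2) by (rule np.I_r_closed)
      ultimately show ?thesis
        unfolding bifiltration_def using ij(1)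
        by (intro CollectI case_prodI exI[of _ "Suc i"] exI[of _ j]) simp_all
    next
      case 2
      have "c \<otimes>\<^bsub>C\<^esub> c' \<in> ideal_power C \<nn> (Suc j)"
        unfolding CC.ideal_power_Suc using ij(3) 2 by (rule ideal_prod.prod)
      moreover have "b \<otimes>\<^bsub>B\<^esub> b' \<in> ideal_power B \<mm> i" using ij(2) car(1) by (rule mp.I_r_closed)
      ultimately show ?thesis
        unfolding bifiltration_def using ij(1)
        by (intro CollectI case_prodI exI[of _ i] exI[of _ "Suc j"]) simp_all
    qed
  qed
  show ?case
    unfolding T.ideal_power_Suc
  proof
    fix X assume "X \<in> ideal_power T \<rr> k \<cdot>\<^bsub>T\<^esub> \<rr>"
    then show "X \<in> pspan (bifiltration (Suc k))"
    proof (induction X rule: ideal_prod.induct)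
      case (prod X Y)
      have "X \<in> pspan (bifiltration k)" using prod(1) Suc by blast
      moreover have "Y \<in> pspan ?Z" using prod(2) unfolding tensor_ideal_pspan .
      ultimately show ?case
        by (rule pspan_mult[OF _ _ bifiltration_carrier _ m]) auto
    next
      case (sum X Y)
      then show ?case by (intro pspan.add)
    qed
  qed
qed

text \<open>If \<open>i + j = 2k\<close>, one of the two exponents is at least
  \<open>k\<close>.\<close>

lemma tensor_ideal_power_double:
  "ideal_power T \<rr> (k + k) \<subseteq> pspan {(b, c) \<in> BC. b \<in> ideal_power B \<mm> k \<or> c \<in> ideal_power C \<nn> k}"
proof -
  have "bifiltration (k + k) \<subseteq> {(b, c) \<in> BC. b \<in> ideal_power B \<mm> k \<or> c \<in> ideal_power C \<nn> k}"
  proof clarify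
    fix b c assume bc: "(b, c) \<in> bifiltration (k + k)"
    then obtain i j where ij: "i + j = k + k" "b \<in> ideal_power B \<mm> i" "c \<in> ideal_power C \<nn> j"
      by (auto simp: bifiltration_def)
    have "k \<le> i \<or> k \<le> j" using ij(1) by linarith
    then have "b \<in> ideal_power B \<mm> k \<or> c \<in> ideal_power C \<nn> k"
      using ij BB.ideal_power_mono[OF m.is_ideal, of k i] CC.ideal_power_mono[OF n.is_ideal, of k j] by blast
    then show "(b, c) \<in> BC \<and> (b \<in> ideal_power B \<mm> k \<or> c \<in> ideal_power C \<nn> k)"
      using bc bifiltration_carrier by blast
  qed
  then show ?thesis
    using tensor_ideal_power_bifiltration[of "k + k"] pspan_mono by blast
qed

lemma pt_l_power: "b \<in> ideal_power B \<mm> k \<Longrightarrow> pt b \<one>\<^bsub>C\<^esub> \<in> ideal_power T \<rr> k"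
proof (induction k arbitrary: b)
  case 0
  then show ?case by (simp add: ideals_set_def)
next
  case (Suc k)
  from Suc.prems show ?case
    unfolding BB.ideal_power_Suc
  proof (induction b rule: ideal_prod.induct)
    case (prod i j)
    have c: "i \<in> carrier B" "j \<in> carrier B" using prod mp.Icarr m.Icarr by auto
    have "pt j \<one>\<^bsub>C\<^esub> \<in> \<rr>" unfolding tensor_ideal_pspan using prod c by (intro pspan.pure) auto
    then have "pt i \<one>\<^bsub>C\<^esub> \<otimes>\<^bsub>T\<^esub> pt j \<one>\<^bsub>C\<^esub> \<in> ideal_power T \<rr> (Suc k)"
      unfolding T.ideal_power_Suc by (intro ideal_prod.prod Suc.IH prod(1))
    then show ?case using c by (simp only: pt_mult CC.one_closed CC.l_one)
  next
    case (sum s1 s2)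
    have "s1 \<in> carrier B" "s2 \<in> carrier B"
      using sum(1,2) BB.ideal_prod_in_carrier[OF mp.is_ideal m.is_ideal] by blast+
    then have e: "pt (s1 \<oplus>\<^bsub>B\<^esub> s2) \<one>\<^bsub>C\<^esub> = pt s1 \<one>\<^bsub>C\<^esub> \<oplus>\<^bsub>T\<^esub> pt s2 \<one>\<^bsub>C\<^esub>"
      by (intro pt_add_l) auto
    show ?case unfolding e by (rule rp.a_closed) (rule sum)+
  qed
qed

lemma pt_r_power: "c \<in> ideal_power C \<nn> k \<Longrightarrow> pt \<one>\<^bsub>B\<^esub> c \<in> ideal_power T \<rr> k"
proof (induction k arbitrary: c)
  case 0
  then show ?case by (simp add: ideals_set_def)
next
  case (Suc k)
  from Suc.prems show ?case
    unfolding CC.ideal_power_Suc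
  proof (induction c rule: ideal_prod.induct)
    case (prod i j)
    have c: "i \<in> carrier C" "j \<in> carrier C" using prod np.Icarr n.Icarr by auto
    have "pt \<one>\<^bsub>B\<^esub> j \<in> \<rr>" unfolding tensor_ideal_pspan using prod c by (intro pspan.pure) auto
    then have "pt \<one>\<^bsub>B\<^esub> i \<otimes>\<^bsub>T\<^esub> pt \<one>\<^bsub>B\<^esub> j \<in> ideal_power T \<rr> (Suc k)"
      unfolding T.ideal_power_Suc by (intro ideal_prod.prod Suc.IH prod(1))
    then show ?case using c by (simp only: pt_mult BB.one_closed BB.l_one)
  next
    case (sum s1 s2)
    have "s1 \<in> carrier C" "s2 \<in> carrier C"
      using sum(1,2) CC.ideal_prod_in_carrier[OF np.is_ideal n.is_ideal] by blast+
    then have e: "pt \<one>\<^bsub>B\<^esub> (s1 \<oplus>\<^bsub>C\<^esub> s2) = pt \<one>\<^bsub>B\<^esub> s1 \<oplus>\<^bsub>T\<^esub> pt \<one>\<^bsub>B\<^esub> s2"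
      by (intro pt_add_r) auto
    show ?case unfolding e by (rule rp.a_closed) (rule sum)+
  qed
qed

lemma pt_split: "b \<in> carrier B \<Longrightarrow> c \<in> carrier C \<Longrightarrow> pt b c = pt b \<one>\<^bsub>C\<^esub> \<otimes>\<^bsub>T\<^esub> pt \<one>\<^bsub>B\<^esub> c"
  by (simp add: pt_mult)

text \<open>An estimate in the opposite direction, from
  \<open>b \<otimes> c = (b \<otimes> 1) (1 \<otimes> c)\<close>: a single factor in a
  \<open>k\<close>-th power is enough to be small in \<open>T\<close>.\<close>

lemma pt_power:
  assumes "b \<in> carrier B" "c \<in> carrier C" "b \<in> ideal_power B \<mm> k \<or> c \<in> ideal_power C \<nn> k"
  shows "pt b c \<in> ideal_power T \<rr> k"
  using assms(3)
proof
  assume "b \<in> ideal_power B \<mm> k"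
  then show ?thesis
    unfolding pt_split[OF assms(1,2)] using assms by (intro rp.I_r_closed pt_l_power) auto
next
  assume "c \<in> ideal_power C \<nn> k"
  then show ?thesis
    unfolding pt_split[OF assms(1,2)] using assms by (intro rp.I_l_closed pt_r_power) auto
qed

text \<open>Generators are the \<open>b \<otimes> 1\<close> and \<open>1 \<otimes> c\<close> for
  generators \<open>b\<close> of \<open>\<mm>\<close> and \<open>c\<close> of \<open>\<nn>\<close>.
  The elements of \<open>B\<close>, and of \<open>C\<close>, that land in the ideal generated by
  these form an ideal, which therefore contains \<open>\<mm>\<close>, respectively
  \<open>\<nn>\<close>.\<close>

lemma tensor_ideal_fin_gen:
  assumes "fin_gen_ideal B \<mm>" "fin_gen_ideal C \<nn>"
  obtains g and l :: nat where "\<And>s. g s \<in> carrier T" "\<rr> = Idl\<^bsub>T\<^esub> (g ` {..<l})"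
proof -
  obtain U where U: "finite U" "U \<subseteq> carrier B" "\<mm> = Idl\<^bsub>B\<^esub> U" using assms(1) by (auto simp: fin_gen_ideal_def)
  obtain V where V: "finite V" "V \<subseteq> carrier C" "\<nn> = Idl\<^bsub>C\<^esub> V" using assms(2) by (auto simp: fin_gen_ideal_def)
  let ?G = "(\<lambda>b. pt b \<one>\<^bsub>C\<^esub>) ` U \<union> (\<lambda>c. pt \<one>\<^bsub>B\<^esub> c) ` V"
  have G: "finite ?G" "?G \<subseteq> carrier T" using U V by auto
  have Um: "U \<subseteq> \<mm>" unfolding U(3) by (rule BB.genideal_self[OF U(2)])
  have Vn: "V \<subseteq> \<nn>" unfolding V(3) by (rule CC.genideal_self[OF V(2)])
  interpret I: ideal "Idl\<^bsub>T\<^esub> ?G" T by (rule T.genideal_ideal[OF G(2)])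
  have GI: "?G \<subseteq> Idl\<^bsub>T\<^esub> ?G" by (rule T.genideal_self[OF G(2)])
  have mI: "pt b \<one>\<^bsub>C\<^esub> \<in> Idl\<^bsub>T\<^esub> ?G" if "b \<in> \<mm>" for b
  proof -
    have "ring_hom_ring B T (\<lambda>b. pt b \<one>\<^bsub>C\<^esub>)"
      by (intro ring_hom_ringI2 BB.ring_axioms T.ring_axioms ring_hom_memI)
        (simp_all add: pt_mult pt_add_l T_one)
    then have "ideal {b \<in> carrier B. pt b \<one>\<^bsub>C\<^esub> \<in> Idl\<^bsub>T\<^esub> ?G} B"
      by (rule ring_hom_ring.ideal_vimage) (rule I.is_ideal)
    moreover have "U \<subseteq> {b \<in> carrier B. pt b \<one>\<^bsub>C\<^esub> \<in> Idl\<^bsub>T\<^esub> ?G}" using U(2) GI by blast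
    ultimately have "\<mm> \<subseteq> {b \<in> carrier B. pt b \<one>\<^bsub>C\<^esub> \<in> Idl\<^bsub>T\<^esub> ?G}"
      unfolding U(3) by (rule BB.genideal_minimal)
    then show ?thesis using that by blast
  qed
  have nI: "pt \<one>\<^bsub>B\<^esub> c \<in> Idl\<^bsub>T\<^esub> ?G" if "c \<in> \<nn>" for c
  proof -
    have "ring_hom_ring C T (\<lambda>c. pt \<one>\<^bsub>B\<^esub> c)"
      by (intro ring_hom_ringI2 CC.ring_axioms T.ring_axioms ring_hom_memI)
        (simp_all add: pt_mult pt_add_r T_one)
    then have "ideal {c \<in> carrier C. pt \<one>\<^bsub>B\<^esub> c \<in> Idl\<^bsub>T\<^esub> ?G} C"
      by (rule ring_hom_ring.ideal_vimage) (rule I.is_ideal)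
    moreover have "V \<subseteq> {c \<in> carrier C. pt \<one>\<^bsub>B\<^esub> c \<in> Idl\<^bsub>T\<^esub> ?G}" using V(2) GI by blast
    ultimately have "\<nn> \<subseteq> {c \<in> carrier C. pt \<one>\<^bsub>B\<^esub> c \<in> Idl\<^bsub>T\<^esub> ?G}"
      unfolding V(3) by (rule CC.genideal_minimal)
    then show ?thesis using that by blast
  qed
  have rG: "\<rr> = Idl\<^bsub>T\<^esub> ?G"
  proof
    show "\<rr> \<subseteq> Idl\<^bsub>T\<^esub> ?G"
      unfolding tensor_ideal_pspan
    proof
      fix X assume "X \<in> pspan {(b, c) \<in> BC. b \<in> \<mm> \<or> c \<in> \<nn>}"
      then show "X \<in> Idl\<^bsub>T\<^esub> ?G"
      proof (induction X rule: pspan.induct)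
        case (pure b c)
        then have bc: "b \<in> carrier B" "c \<in> carrier C" "b \<in> \<mm> \<or> c \<in> \<nn>" by auto
        show ?case
          unfolding pt_split[OF bc(1,2)] using bc(3)
        proof
          assume "b \<in> \<mm>"
          then show "pt b \<one>\<^bsub>C\<^esub> \<otimes>\<^bsub>T\<^esub> pt \<one>\<^bsub>B\<^esub> c \<in> Idl\<^bsub>T\<^esub> ?G" using bc by (intro I.I_r_closed mI) auto
        next
          assume "c \<in> \<nn>"
          then show "pt b \<one>\<^bsub>C\<^esub> \<otimes>\<^bsub>T\<^esub> pt \<one>\<^bsub>B\<^esub> c \<in> Idl\<^bsub>T\<^esub> ?G" using bc by (intro I.I_l_closed nI) auto
        qed
      next
        case (add X Y)
        then show ?case by (intro I.a_closed)
      qed (rule I.zero_closed)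
    qed
    have "?G \<subseteq> \<rr>"
      unfolding tensor_ideal_pspan using U(2) V(2) Um Vn by (auto intro!: pspan.pure)
    then show "Idl\<^bsub>T\<^esub> ?G \<subseteq> \<rr>" by (rule T.genideal_minimal[OF r.is_ideal])
  qed
  obtain l and f :: "nat \<Rightarrow> ('c \<times> 'e \<Rightarrow>\<^sub>0 int) set" where f: "?G = f ` {i. i < l}"
    using finite_imp_nat_seg_image_inj_on[OF G(1)] by (elim exE conjE)
  define g where "g = (\<lambda>s. if s < l then f s else \<zero>\<^bsub>T\<^esub>)"
  have Gg: "?G = g ` {..<l}" unfolding f by (auto simp: g_def)
  have gT: "g s \<in> carrier T" for s
  proof (cases "s < l")
    case True
    then have "f s \<in> ?G" unfolding f by blast
    then show ?thesis using True G(2) by (auto simp: g_def)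
  qed (simp add: g_def)
  show ?thesis by (rule that[OF gT]) (rule rG[unfolded Gg])
qed

text \<open>Artin--Rees in \<open>C\<close> lifts relations modulo a high power of \<open>\<rr>\<close>: flatness of \<open>B / \<mm>\<^sup>N\<close> over
  \<open>A\<close>, used on the first tensor factors, reduces the statement to relations in \<open>C\<close>.\<close>

lemma relation_approximation:
  fixes q p :: nat and h :: nat
  assumes tr: "\<And>H. submodule H A B \<Longrightarrow> trivial_relations A B H"
    and ap: "APf C \<nn>" and h: "h > 0"
    and c: "\<And>s. c s \<in> carrier C" and k: "\<And>j s. k j s \<in> carrier C"
    and kgen: "\<And>x. (\<And>s. x s \<in> carrier C) \<Longrightarrow> (\<Oplus>\<^bsub>C\<^esub>s\<in>{..<q}. c s \<otimes>\<^bsub>C\<^esub> x s) = \<zero>\<^bsub>C\<^esub> \<Longrightarrow>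
      \<exists>y. (\<forall>j. y j \<in> carrier C) \<and> (\<forall>s<q. x s = (\<Oplus>\<^bsub>C\<^esub>j\<in>{..<p}. y j \<otimes>\<^bsub>C\<^esub> k j s))"
  obtains N where "N \<ge> h" "\<And>x. (\<And>s. x s \<in> carrier T) \<Longrightarrow>
    (\<Oplus>\<^bsub>T\<^esub>s\<in>{..<q}. pt \<one>\<^bsub>B\<^esub> (c s) \<otimes>\<^bsub>T\<^esub> x s) \<in> ideal_power T \<rr> N \<Longrightarrow>
    \<exists>t. (\<forall>j. t j \<in> carrier T) \<and>
      (\<forall>s<q. x s \<ominus>\<^bsub>T\<^esub> (\<Oplus>\<^bsub>T\<^esub>j\<in>{..<p}. pt \<one>\<^bsub>B\<^esub> (k j s) \<otimes>\<^bsub>T\<^esub> t j) \<in> ideal_power T \<rr> h)"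
proof -
  \<comment> \<open>(APf) for the ideal generated by the \<open>c s\<close>, seen as a submodule of
    the free module of rank 1.\<close>
  obtain \<kappa> where \<kappa>: "\<And>t. (\<And>j. t j \<in> carrier C) \<Longrightarrow>
    (\<And>i. i < (1::nat) \<Longrightarrow> (\<Oplus>\<^bsub>C\<^esub>j\<in>{..<q}. t j \<otimes>\<^bsub>C\<^esub> c j) \<in> ideal_power C \<nn> \<kappa>) \<Longrightarrow>
    \<exists>t'. (\<forall>j. t' j \<in> ideal_power C \<nn> h) \<and>
      (\<forall>i<(1::nat). (\<Oplus>\<^bsub>C\<^esub>j\<in>{..<q}. t j \<otimes>\<^bsub>C\<^esub> c j) = (\<Oplus>\<^bsub>C\<^esub>j\<in>{..<q}. t' j \<otimes>\<^bsub>C\<^esub> c j))"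
    by (rule APf_relations[OF CC.is_cring n.is_ideal ap, of "\<lambda>j _. c j" h 1 q]) (use c h in auto)
  \<comment> \<open>\<open>\<kappa>\<close> is the order at which (APf) for \<open>\<nn>\<close>
    applies; \<open>h\<close> ensures that remainders in \<open>\<mm>^M\<close> are negligible
    modulo \<open>\<rr>^h\<close>.\<close>
  define M where "M = max \<kappa> h"
  have M: "\<kappa> \<le> M" "h \<le> M" by (auto simp: M_def)
  show ?thesis
  proof (rule that[of "M + M"])
    show "h \<le> M + M" using M by simp
    fix x assume x: "\<And>s. x s \<in> carrier T"
      and rel: "(\<Oplus>\<^bsub>T\<^esub>s\<in>{..<q}. pt \<one>\<^bsub>B\<^esub> (c s) \<otimes>\<^bsub>T\<^esub> x s) \<in> ideal_power T \<rr> (M + M)"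
    have "\<exists>S \<xi>. finite S \<and> S \<subseteq> carrier B \<and> \<xi> \<in> S \<rightarrow> carrier C \<and> x s = tsum S \<xi>" for s
    proof -
      obtain S \<xi> where "finite S" "S \<subseteq> carrier B" "\<xi> \<in> S \<rightarrow> carrier C" "x s = tsum S \<xi>"
        by (rule tsum_rep[OF x[of s]])
      then show ?thesis by (intro exI[of _ S] exI[of _ \<xi>] conjI)
    qed
    then obtain S0 \<xi>0 where S0: "\<And>s. finite (S0 s)" "\<And>s. S0 s \<subseteq> carrier B"
      "\<And>s. \<xi>0 s \<in> S0 s \<rightarrow> carrier C" "\<And>s. x s = tsum (S0 s) (\<xi>0 s)"
      by metis
    obtain S1 d0 where S1: "finite S1" "S1 \<subseteq> carrier B" "d0 \<in> S1 \<rightarrow> carrier C"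
      "(\<Oplus>\<^bsub>T\<^esub>s\<in>{..<q}. pt \<one>\<^bsub>B\<^esub> (c s) \<otimes>\<^bsub>T\<^esub> x s) = tsum S1 d0"
      "\<forall>b\<in>S1. b \<in> ideal_power B \<mm> M \<or> d0 b \<in> ideal_power C \<nn> M"
      using pspan_tsum[OF subsetD[OF tensor_ideal_power_double rel] np.is_ideal] by (elim exE conjE)
    \<comment> \<open>All \<open>x s\<close> and the value of the relation are written over one
      common set of first factors; \<open>\<xi>\<close> and \<open>d\<close> are their coefficients,
      padded with zero.\<close>
    define S where "S = S1 \<union> (\<Union>s<q. S0 s)"
    have S: "finite S" "S \<subseteq> carrier B" using S0 S1 by (auto simp: S_def)
    define \<xi> where "\<xi> = (\<lambda>s b. if b \<in> S0 s then \<xi>0 s b else \<zero>\<^bsub>C\<^esub>)"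
    define d where "d = (\<lambda>b. if b \<in> S1 then d0 b else \<zero>\<^bsub>C\<^esub>)"
    have \<xi>: "\<xi> s b \<in> carrier C" for s b using S0(3)[of s] by (auto simp: \<xi>_def)
    have d: "d b \<in> carrier C" for b using S1(3) by (auto simp: d_def)
    have x\<xi>: "x s = tsum S (\<xi> s)" if "s < q" for s
      unfolding S0(4) \<xi>_def using that S S0 by (intro tsum_enlarge [symmetric]) (auto simp: S_def)
    have Dd: "(\<Oplus>\<^bsub>T\<^esub>s\<in>{..<q}. pt \<one>\<^bsub>B\<^esub> (c s) \<otimes>\<^bsub>T\<^esub> x s) = tsum S d"
      unfolding S1(4) d_def using S S1 by (intro tsum_enlarge [symmetric]) (auto simp: S_def)
    have dM: "b \<in> ideal_power B \<mm> M \<or> d b \<in> ideal_power C \<nn> M" for b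
      using S1(5) np.zero_closed by (auto simp: d_def)
    \<comment> \<open>The coefficient at \<open>b\<close> when the left-hand side is computed from
      the \<open>x s\<close>; \<open>d\<close> gives a second expression of the same tensor, in
      which smallness is visible.\<close>
    define e where "e = (\<lambda>b. (\<Oplus>\<^bsub>C\<^esub>s\<in>{..<q}. c s \<otimes>\<^bsub>C\<^esub> \<xi> s b))"
    have e: "e b \<in> carrier C" for b unfolding e_def using c \<xi> by (intro CC.finsum_closed) auto
    have De: "(\<Oplus>\<^bsub>T\<^esub>s\<in>{..<q}. pt \<one>\<^bsub>B\<^esub> (c s) \<otimes>\<^bsub>T\<^esub> x s) = tsum S e"
    proof -
      have "(\<Oplus>\<^bsub>T\<^esub>s\<in>{..<q}. pt \<one>\<^bsub>B\<^esub> (c s) \<otimes>\<^bsub>T\<^esub> x s) = (\<Oplus>\<^bsub>T\<^esub>s\<in>{..<q}. \<Oplus>\<^bsub>T\<^esub>b\<in>S. pt b (c s \<otimes>\<^bsub>C\<^esub> \<xi> s b))"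
      proof (rule T.finsum_cong')
        fix s assume "s \<in> {..<q}"
        then show "pt \<one>\<^bsub>B\<^esub> (c s) \<otimes>\<^bsub>T\<^esub> x s = (\<Oplus>\<^bsub>T\<^esub>b\<in>S. pt b (c s \<otimes>\<^bsub>C\<^esub> \<xi> s b))"
          using tsum_mult[OF S, of "\<xi> s" "c s"] x\<xi> c \<xi> by (simp add: tsum_def)
      qed (use S c \<xi> in \<open>auto intro!: T.finsum_closed\<close>)
      also have "\<dots> = (\<Oplus>\<^bsub>T\<^esub>b\<in>S. \<Oplus>\<^bsub>T\<^esub>s\<in>{..<q}. pt b (c s \<otimes>\<^bsub>C\<^esub> \<xi> s b))"
        using S c \<xi> by (intro T.finsum_swap) auto
      also have "\<dots> = tsum S e"
        unfolding tsum_def e_def using S c \<xi>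
        by (intro T.finsum_cong') (auto simp: pt_finsum_r Pi_def subset_iff intro!: T.finsum_closed)
      finally show ?thesis .
    qed
    have z: "tsum S (\<lambda>b. e b \<oplus>\<^bsub>C\<^esub> \<ominus>\<^bsub>C\<^esub> d b) = \<zero>\<^bsub>T\<^esub>"
    proof -
      have "tsum S (\<lambda>b. e b \<oplus>\<^bsub>C\<^esub> \<ominus>\<^bsub>C\<^esub> d b) = tsum S e \<oplus>\<^bsub>T\<^esub> tsum S (\<lambda>b. \<ominus>\<^bsub>C\<^esub> d b)"
        using S e d by (intro tsum_add) auto
      also have "tsum S (\<lambda>b. \<ominus>\<^bsub>C\<^esub> d b) = \<ominus>\<^bsub>T\<^esub> tsum S d"
        using S d by (intro tsum_minus) auto
      also have "tsum S d = tsum S e" using De Dd by simp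
      also have "tsum S e \<oplus>\<^bsub>T\<^esub> \<ominus>\<^bsub>T\<^esub> tsum S e = \<zero>\<^bsub>T\<^esub>"
        using S e by (intro T.r_neg tsum_closed) auto
      finally show ?thesis .
    qed
    let ?H = "ideal_power B \<mm> M"
    have H: "submodule ?H A B" by (rule B.ideal_submodule[OF mp.is_ideal])
    have edC: "(\<lambda>b. e b \<oplus>\<^bsub>C\<^esub> \<ominus>\<^bsub>C\<^esub> d b) \<in> S \<rightarrow> carrier C" using e d by auto
    \<comment> \<open>\<open>e - d\<close> represents the zero tensor. The relations behind this are
      solved modulo \<open>\<mm>^M\<close> with coordinates vanishing at each \<open>b\<close> in
      \<open>\<mm>^M\<close>; hence only those \<open>d b\<close> survive that lie in
      \<open>\<nn>^M\<close>.\<close>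
    obtain r :: nat and w a where w: "\<And>u. w u \<in> carrier B" and a: "\<And>b u. a b u \<in> carrier A"
      and wa: "\<And>b. b \<in> S \<Longrightarrow> b \<ominus>\<^bsub>B\<^esub> (\<Oplus>\<^bsub>B\<^esub>u\<in>{..<r}. a b u \<odot>\<^bsub>B\<^esub> w u) \<in> ?H"
      and aH: "\<And>b u. b \<in> S \<Longrightarrow> b \<in> ?H \<Longrightarrow> u < r \<Longrightarrow> a b u = \<zero>\<^bsub>A\<^esub>"
      and ae: "\<And>u. u < r \<Longrightarrow> (\<Oplus>\<^bsub>C\<^esub>b\<in>S. a b u \<odot>\<^bsub>C\<^esub> (e b \<oplus>\<^bsub>C\<^esub> \<ominus>\<^bsub>C\<^esub> d b)) = \<zero>\<^bsub>C\<^esub>"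
      by (rule tsum_zero_trivial[OF tr[OF H] H S edC z]) (rule that, assumption+)
    \<comment> \<open>The vectors over \<open>C\<close> that belong to the new first factors
      \<open>w u\<close>. Each satisfies the relation modulo \<open>\<nn>^M\<close>, so the problem
      has moved from \<open>T\<close> to \<open>C\<close>.\<close>
    define X where "X = (\<lambda>s u. \<Oplus>\<^bsub>C\<^esub>b\<in>S. a b u \<odot>\<^bsub>C\<^esub> \<xi> s b)"
    have X: "X s u \<in> carrier C" for s u unfolding X_def using a \<xi> by (intro CC.finsum_closed) auto
    have XN: "(\<Oplus>\<^bsub>C\<^esub>s\<in>{..<q}. X s u \<otimes>\<^bsub>C\<^esub> c s) \<in> ideal_power C \<nn> M" if u: "u < r" for u
    proof -
      have "(\<Oplus>\<^bsub>C\<^esub>s\<in>{..<q}. X s u \<otimes>\<^bsub>C\<^esub> c s) = (\<Oplus>\<^bsub>C\<^esub>s\<in>{..<q}. \<Oplus>\<^bsub>C\<^esub>b\<in>S. a b u \<odot>\<^bsub>C\<^esub> (c s \<otimes>\<^bsub>C\<^esub> \<xi> s b))"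
      proof (rule CC.finsum_cong')
        fix s
        have "X s u \<otimes>\<^bsub>C\<^esub> c s = (\<Oplus>\<^bsub>C\<^esub>b\<in>S. (a b u \<odot>\<^bsub>C\<^esub> \<xi> s b) \<otimes>\<^bsub>C\<^esub> c s)"
          unfolding X_def using S a \<xi> c by (intro CC.finsum_ldistr) auto
        also have "\<dots> = (\<Oplus>\<^bsub>C\<^esub>b\<in>S. a b u \<odot>\<^bsub>C\<^esub> (c s \<otimes>\<^bsub>C\<^esub> \<xi> s b))"
        proof (rule CC.finsum_cong')
          fix b
          have "(a b u \<odot>\<^bsub>C\<^esub> \<xi> s b) \<otimes>\<^bsub>C\<^esub> c s = a b u \<odot>\<^bsub>C\<^esub> (\<xi> s b \<otimes>\<^bsub>C\<^esub> c s)"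
            using a \<xi> c by (rule C.smult_assoc2)
          also have "\<xi> s b \<otimes>\<^bsub>C\<^esub> c s = c s \<otimes>\<^bsub>C\<^esub> \<xi> s b" using \<xi> c by (rule CC.m_comm)
          finally show "(a b u \<odot>\<^bsub>C\<^esub> \<xi> s b) \<otimes>\<^bsub>C\<^esub> c s = a b u \<odot>\<^bsub>C\<^esub> (c s \<otimes>\<^bsub>C\<^esub> \<xi> s b)" .
        qed (use a \<xi> c in auto)
        finally show "X s u \<otimes>\<^bsub>C\<^esub> c s = (\<Oplus>\<^bsub>C\<^esub>b\<in>S. a b u \<odot>\<^bsub>C\<^esub> (c s \<otimes>\<^bsub>C\<^esub> \<xi> s b))" .
      qed (use a \<xi> c in \<open>auto intro!: CC.finsum_closed\<close>)
      also have "\<dots> = (\<Oplus>\<^bsub>C\<^esub>b\<in>S. \<Oplus>\<^bsub>C\<^esub>s\<in>{..<q}. a b u \<odot>\<^bsub>C\<^esub> (c s \<otimes>\<^bsub>C\<^esub> \<xi> s b))"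
        using S a \<xi> c by (intro CC.finsum_swap) auto
      also have "\<dots> = (\<Oplus>\<^bsub>C\<^esub>b\<in>S. a b u \<odot>\<^bsub>C\<^esub> e b)"
        unfolding e_def using a \<xi> c
        by (intro CC.finsum_cong') (auto simp: C.finsum_smult_ldistr Pi_def intro!: CC.finsum_closed)
      also have "\<dots> = (\<Oplus>\<^bsub>C\<^esub>b\<in>S. a b u \<odot>\<^bsub>C\<^esub> (e b \<oplus>\<^bsub>C\<^esub> \<ominus>\<^bsub>C\<^esub> d b) \<oplus>\<^bsub>C\<^esub> a b u \<odot>\<^bsub>C\<^esub> d b)"
        using a e d by (intro CC.finsum_cong') (auto simp: C.smult_r_distr [symmetric] CC.a_assoc CC.l_neg)
      also have "\<dots> = (\<Oplus>\<^bsub>C\<^esub>b\<in>S. a b u \<odot>\<^bsub>C\<^esub> (e b \<oplus>\<^bsub>C\<^esub> \<ominus>\<^bsub>C\<^esub> d b)) \<oplus>\<^bsub>C\<^esub> (\<Oplus>\<^bsub>C\<^esub>b\<in>S. a b u \<odot>\<^bsub>C\<^esub> d b)"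
        using a e d by (intro CC.finsum_addf) auto
      also have "\<dots> = (\<Oplus>\<^bsub>C\<^esub>b\<in>S. a b u \<odot>\<^bsub>C\<^esub> d b)"
        unfolding ae[OF u] using a d by (intro CC.l_zero CC.finsum_closed) auto
      also have "\<dots> \<in> ideal_power C \<nn> M"
      proof (rule C.submodule_finsum[OF C.ideal_submodule[OF np.is_ideal] S(1)])
        fix b assume b: "b \<in> S"
        show "a b u \<odot>\<^bsub>C\<^esub> d b \<in> ideal_power C \<nn> M"
        proof (cases "b \<in> ?H")
          case True
          then show ?thesis using aH[OF b True u] d np.zero_closed by simp
        next
          case False
          then have "d b \<in> ideal_power C \<nn> M" using dM by blast
          then show ?thesis by (rule C.submoduleE(4)[OF C.ideal_submodule[OF np.is_ideal] a])
        qed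
      qed
      finally show ?thesis .
    qed
    \<comment> \<open>(APf) supplies a correction \<open>z\<close> in \<open>\<nn>^h\<close> after
      which \<open>X s u\<close> satisfies the relation exactly, and is thus a combination of the
      generating relations \<open>k j\<close>.\<close>
    have "\<exists>y z. (\<forall>j. y j \<in> carrier C) \<and> (\<forall>s. z s \<in> ideal_power C \<nn> h) \<and>
      (\<forall>s<q. X s u = z s \<oplus>\<^bsub>C\<^esub> (\<Oplus>\<^bsub>C\<^esub>j\<in>{..<p}. y j \<otimes>\<^bsub>C\<^esub> k j s))" if u: "u < r" for u
    proof -
      have "(\<Oplus>\<^bsub>C\<^esub>s\<in>{..<q}. X s u \<otimes>\<^bsub>C\<^esub> c s) \<in> ideal_power C \<nn> \<kappa>"
        using XN[OF u] CC.ideal_power_mono[OF n.is_ideal M(1)] by blast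
      from \<kappa>[of "\<lambda>s. X s u", OF X this]
      obtain z where z: "\<forall>s. z s \<in> ideal_power C \<nn> h"
        and Xz: "(\<Oplus>\<^bsub>C\<^esub>s\<in>{..<q}. X s u \<otimes>\<^bsub>C\<^esub> c s) = (\<Oplus>\<^bsub>C\<^esub>s\<in>{..<q}. z s \<otimes>\<^bsub>C\<^esub> c s)"
        by auto
      have zc: "z s \<in> carrier C" for s using z np.Icarr by blast
      have "(\<Oplus>\<^bsub>C\<^esub>s\<in>{..<q}. c s \<otimes>\<^bsub>C\<^esub> (X s u \<ominus>\<^bsub>C\<^esub> z s)) =
          (\<Oplus>\<^bsub>C\<^esub>s\<in>{..<q}. X s u \<otimes>\<^bsub>C\<^esub> c s \<oplus>\<^bsub>C\<^esub> \<ominus>\<^bsub>C\<^esub> (z s \<otimes>\<^bsub>C\<^esub> c s))"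
        using c X zc by (intro CC.finsum_cong') (auto simp: CC.minus_eq CC.r_distr CC.r_minus CC.m_comm)
      also have "\<dots> = (\<Oplus>\<^bsub>C\<^esub>s\<in>{..<q}. X s u \<otimes>\<^bsub>C\<^esub> c s) \<oplus>\<^bsub>C\<^esub> (\<Oplus>\<^bsub>C\<^esub>s\<in>{..<q}. \<ominus>\<^bsub>C\<^esub> (z s \<otimes>\<^bsub>C\<^esub> c s))"
        using c X zc by (intro CC.finsum_addf) auto
      also have "(\<Oplus>\<^bsub>C\<^esub>s\<in>{..<q}. \<ominus>\<^bsub>C\<^esub> (z s \<otimes>\<^bsub>C\<^esub> c s)) = \<ominus>\<^bsub>C\<^esub> (\<Oplus>\<^bsub>C\<^esub>s\<in>{..<q}. z s \<otimes>\<^bsub>C\<^esub> c s)"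
        using c zc by (intro CC.finsum_minus) auto
      also have "(\<Oplus>\<^bsub>C\<^esub>s\<in>{..<q}. X s u \<otimes>\<^bsub>C\<^esub> c s) \<oplus>\<^bsub>C\<^esub> \<ominus>\<^bsub>C\<^esub> (\<Oplus>\<^bsub>C\<^esub>s\<in>{..<q}. z s \<otimes>\<^bsub>C\<^esub> c s) = \<zero>\<^bsub>C\<^esub>"
        unfolding Xz using c zc by (intro CC.r_neg CC.finsum_closed) auto
      finally obtain y where y: "\<forall>j. y j \<in> carrier C"
        and yk: "\<forall>s<q. X s u \<ominus>\<^bsub>C\<^esub> z s = (\<Oplus>\<^bsub>C\<^esub>j\<in>{..<p}. y j \<otimes>\<^bsub>C\<^esub> k j s)"
        using kgen[of "\<lambda>s. X s u \<ominus>\<^bsub>C\<^esub> z s"] X zc by auto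
      have "X s u = z s \<oplus>\<^bsub>C\<^esub> (\<Oplus>\<^bsub>C\<^esub>j\<in>{..<p}. y j \<otimes>\<^bsub>C\<^esub> k j s)" if "s < q" for s
      proof -
        have "z s \<oplus>\<^bsub>C\<^esub> (X s u \<ominus>\<^bsub>C\<^esub> z s) = X s u" using X zc by (intro CC.add_diff_cancel)
        then show ?thesis using yk that by simp
      qed
      then show ?thesis using y z by (intro exI[of _ y] exI[of _ z]) auto
    qed
    then have "\<forall>u. \<exists>yz. u < r \<longrightarrow> (\<forall>j. fst yz j \<in> carrier C) \<and> (\<forall>s. snd yz s \<in> ideal_power C \<nn> h) \<and>
      (\<forall>s<q. X s u = snd yz s \<oplus>\<^bsub>C\<^esub> (\<Oplus>\<^bsub>C\<^esub>j\<in>{..<p}. fst yz j \<otimes>\<^bsub>C\<^esub> k j s))"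
      by simp
    from choice[OF this] obtain F where F: "\<forall>u. u < r \<longrightarrow> (\<forall>j. fst (F u) j \<in> carrier C) \<and>
      (\<forall>s. snd (F u) s \<in> ideal_power C \<nn> h) \<and>
      (\<forall>s<q. X s u = snd (F u) s \<oplus>\<^bsub>C\<^esub> (\<Oplus>\<^bsub>C\<^esub>j\<in>{..<p}. fst (F u) j \<otimes>\<^bsub>C\<^esub> k j s))"
      by (elim exE)
    define y where "y = (\<lambda>u. fst (F u))"
    define z where "z = (\<lambda>u. snd (F u))"
    have y: "y u j \<in> carrier C" if "u < r" for u j
      using F that by (simp add: y_def)
    have z: "z u s \<in> ideal_power C \<nn> h" if "u < r" for u s
      using F that by (simp add: z_def)
    have Xyz: "X s u = z u s \<oplus>\<^bsub>C\<^esub> (\<Oplus>\<^bsub>C\<^esub>j\<in>{..<p}. y u j \<otimes>\<^bsub>C\<^esub> k j s)" if "u < r" "s < q" for u s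
      using F[rule_format, OF that(1)] that(2) unfolding y_def z_def by (elim conjE allE[of _ s] impE)
    have zc: "z u s \<in> carrier C" if "u < r" for u s using z[OF that] np.Icarr by blast
    \<comment> \<open>Coefficients over \<open>T\<close> of the relations \<open>k j\<close>,
      assembled along the first factors \<open>w u\<close>.\<close>
    define t where "t = (\<lambda>j. \<Oplus>\<^bsub>T\<^esub>u\<in>{..<r}. pt (w u) (y u j))"
    have t: "t j \<in> carrier T" for j unfolding t_def using w y by (intro T.finsum_closed) auto
    have "x s \<ominus>\<^bsub>T\<^esub> (\<Oplus>\<^bsub>T\<^esub>j\<in>{..<p}. pt \<one>\<^bsub>B\<^esub> (k j s) \<otimes>\<^bsub>T\<^esub> t j) \<in> ideal_power T \<rr> h" if s: "s < q" for s
    proof -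
      \<comment> \<open>The remainder of \<open>b\<close> after expansion in the \<open>w u\<close>.
        It contributes one of the two error terms; the other comes from \<open>z\<close>.\<close>
      define \<eta> where "\<eta> = (\<lambda>b. b \<ominus>\<^bsub>B\<^esub> (\<Oplus>\<^bsub>B\<^esub>u\<in>{..<r}. a b u \<odot>\<^bsub>B\<^esub> w u))"
      have sB: "(\<Oplus>\<^bsub>B\<^esub>u\<in>{..<r}. a b u \<odot>\<^bsub>B\<^esub> w u) \<in> carrier B" for b using a w by (intro BB.finsum_closed) auto
      have \<eta>: "\<eta> b \<in> carrier B" if "b \<in> S" for b using S that sB by (auto simp: \<eta>_def)
      have b\<eta>: "b = \<eta> b \<oplus>\<^bsub>B\<^esub> (\<Oplus>\<^bsub>B\<^esub>u\<in>{..<r}. a b u \<odot>\<^bsub>B\<^esub> w u)" if "b \<in> S" for b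
        using S that sB[of b] by (auto simp: \<eta>_def BB.minus_eq BB.a_assoc BB.l_neg)
      let ?Y = "\<Oplus>\<^bsub>T\<^esub>b\<in>S. pt (\<eta> b) (\<xi> s b)" and ?Z = "\<Oplus>\<^bsub>T\<^esub>u\<in>{..<r}. pt (w u) (z u s)"
      let ?K = "\<Oplus>\<^bsub>T\<^esub>j\<in>{..<p}. pt \<one>\<^bsub>B\<^esub> (k j s) \<otimes>\<^bsub>T\<^esub> t j"
      have YP: "?Y \<in> ideal_power T \<rr> h"
      proof (rule T.finsum_mem[OF S(1) rp.zero_closed rp.a_closed rp.a_subset])
        fix b assume b: "b \<in> S"
        have "\<eta> b \<in> ideal_power B \<mm> h"
          using wa[OF b] BB.ideal_power_mono[OF m.is_ideal M(2)] by (auto simp: \<eta>_def)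
        then show "pt (\<eta> b) (\<xi> s b) \<in> ideal_power T \<rr> h" using \<eta>[OF b] \<xi> by (intro pt_power) auto
      qed
      have ZP: "?Z \<in> ideal_power T \<rr> h"
        by (rule T.finsum_mem[OF _ rp.zero_closed rp.a_closed rp.a_subset])
          (use w z zc in \<open>auto intro!: pt_power\<close>)
      have KT: "?K \<in> carrier T" using k t by (intro T.finsum_closed) auto
      have "x s = ?Y \<oplus>\<^bsub>T\<^esub> (\<Oplus>\<^bsub>T\<^esub>u\<in>{..<r}. pt (w u) (X s u))"
        unfolding x\<xi>[OF s] X_def using S \<xi> w a \<eta> b\<eta> by (intro tsum_factor) auto
      also have "(\<Oplus>\<^bsub>T\<^esub>u\<in>{..<r}. pt (w u) (X s u)) =
          (\<Oplus>\<^bsub>T\<^esub>u\<in>{..<r}. pt (w u) (z u s) \<oplus>\<^bsub>T\<^esub> (\<Oplus>\<^bsub>T\<^esub>j\<in>{..<p}. pt \<one>\<^bsub>B\<^esub> (k j s) \<otimes>\<^bsub>T\<^esub> pt (w u) (y u j)))"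
      proof (rule T.finsum_cong')
        fix u assume "u \<in> {..<r}"
        then have u: "u < r" by simp
        have sc: "(\<Oplus>\<^bsub>C\<^esub>j\<in>{..<p}. y u j \<otimes>\<^bsub>C\<^esub> k j s) \<in> carrier C" using y[OF u] k by (intro CC.finsum_closed) auto
        have "pt (w u) (X s u) = pt (w u) (z u s) \<oplus>\<^bsub>T\<^esub> pt (w u) (\<Oplus>\<^bsub>C\<^esub>j\<in>{..<p}. y u j \<otimes>\<^bsub>C\<^esub> k j s)"
          unfolding Xyz[OF u s] using w zc[OF u] sc by (intro pt_add_r) auto
        also have "pt (w u) (\<Oplus>\<^bsub>C\<^esub>j\<in>{..<p}. y u j \<otimes>\<^bsub>C\<^esub> k j s) = (\<Oplus>\<^bsub>T\<^esub>j\<in>{..<p}. pt (w u) (y u j \<otimes>\<^bsub>C\<^esub> k j s))"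
          using w y[OF u] k by (intro pt_finsum_r) auto
        also have "\<dots> = (\<Oplus>\<^bsub>T\<^esub>j\<in>{..<p}. pt \<one>\<^bsub>B\<^esub> (k j s) \<otimes>\<^bsub>T\<^esub> pt (w u) (y u j))"
          using w y[OF u] k by (intro T.finsum_cong') (auto simp: pt_mult CC.m_comm)
        finally show "pt (w u) (X s u) = pt (w u) (z u s) \<oplus>\<^bsub>T\<^esub>
          (\<Oplus>\<^bsub>T\<^esub>j\<in>{..<p}. pt \<one>\<^bsub>B\<^esub> (k j s) \<otimes>\<^bsub>T\<^esub> pt (w u) (y u j))" .
      qed (use w zc y k in \<open>auto intro!: T.finsum_closed\<close>)
      also have "\<dots> = ?Z \<oplus>\<^bsub>T\<^esub> (\<Oplus>\<^bsub>T\<^esub>u\<in>{..<r}. \<Oplus>\<^bsub>T\<^esub>j\<in>{..<p}. pt \<one>\<^bsub>B\<^esub> (k j s) \<otimes>\<^bsub>T\<^esub> pt (w u) (y u j))"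
        using w zc y k by (intro T.finsum_addf) (auto intro!: T.finsum_closed)
      also have "(\<Oplus>\<^bsub>T\<^esub>u\<in>{..<r}. \<Oplus>\<^bsub>T\<^esub>j\<in>{..<p}. pt \<one>\<^bsub>B\<^esub> (k j s) \<otimes>\<^bsub>T\<^esub> pt (w u) (y u j)) =
          (\<Oplus>\<^bsub>T\<^esub>j\<in>{..<p}. \<Oplus>\<^bsub>T\<^esub>u\<in>{..<r}. pt \<one>\<^bsub>B\<^esub> (k j s) \<otimes>\<^bsub>T\<^esub> pt (w u) (y u j))"
        using w y k by (intro T.finsum_swap) auto
      also have "\<dots> = ?K"
        unfolding t_def using w y k
        by (intro T.finsum_cong') (auto simp: T.finsum_rdistr Pi_def intro!: T.finsum_closed)
      finally have "x s = ?Y \<oplus>\<^bsub>T\<^esub> (?Z \<oplus>\<^bsub>T\<^esub> ?K)" .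
      then have "x s \<ominus>\<^bsub>T\<^esub> ?K = ?Y \<oplus>\<^bsub>T\<^esub> ?Z"
        using rp.Icarr[OF YP] rp.Icarr[OF ZP] KT by (simp add: T.minus_eq T.a_assoc T.r_neg)
      then show ?thesis using rp.a_closed[OF YP ZP] by simp
    qed
    then show "\<exists>t. (\<forall>j. t j \<in> carrier T) \<and>
      (\<forall>s<q. x s \<ominus>\<^bsub>T\<^esub> (\<Oplus>\<^bsub>T\<^esub>j\<in>{..<p}. pt \<one>\<^bsub>B\<^esub> (k j s) \<otimes>\<^bsub>T\<^esub> t j) \<in> ideal_power T \<rr> h)"
      using t by (intro exI[of _ t]) auto
  qed
qed

end

section \<open>Flatness of the completed tensor product\<close>

lemma module_restrict_scalars:
  assumes "cring R" "cring S" and \<phi>: "\<phi> \<in> ring_hom R S"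
  shows "module R (restrict_scalars \<phi> S)"
proof -
  interpret R: cring R by fact
  interpret S: cring S by fact
  note h = ring_hom_closed[OF \<phi>] ring_hom_add[OF \<phi>] ring_hom_mult[OF \<phi>] ring_hom_one[OF \<phi>]
  have e: "carrier (restrict_scalars \<phi> S) = carrier S"
    "x \<oplus>\<^bsub>restrict_scalars \<phi> S\<^esub> y = x \<oplus>\<^bsub>S\<^esub> y" "\<zero>\<^bsub>restrict_scalars \<phi> S\<^esub> = \<zero>\<^bsub>S\<^esub>"
    "a \<odot>\<^bsub>restrict_scalars \<phi> S\<^esub> x = \<phi> a \<otimes>\<^bsub>S\<^esub> x" for a x y
    by (simp_all add: restrict_scalars_def)
  show ?thesis
  proof (rule moduleI[OF R.is_cring])
    show "abelian_group (restrict_scalars \<phi> S)"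
    proof (rule abelian_groupI)
      show "\<exists>y\<in>carrier (restrict_scalars \<phi> S). y \<oplus>\<^bsub>restrict_scalars \<phi> S\<^esub> x = \<zero>\<^bsub>restrict_scalars \<phi> S\<^esub>"
        if "x \<in> carrier (restrict_scalars \<phi> S)" for x
        using that by (intro bexI[of _ "\<ominus>\<^bsub>S\<^esub> x"]) (simp_all add: e S.l_neg)
      show "x \<oplus>\<^bsub>restrict_scalars \<phi> S\<^esub> y = y \<oplus>\<^bsub>restrict_scalars \<phi> S\<^esub> x"
        if "x \<in> carrier (restrict_scalars \<phi> S)" "y \<in> carrier (restrict_scalars \<phi> S)" for x y
        using that unfolding e by (rule S.a_comm)
    qed (simp_all add: e S.a_assoc)
  qed (simp_all add: e h S.l_distr S.r_distr S.m_assoc)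
qed

lemma (in ring) diff_diff_diff:
  assumes "x \<in> carrier R" "y \<in> carrier R" "z \<in> carrier R"
  shows "(x \<ominus> z) \<ominus> (x \<ominus> y) = y \<oplus> \<ominus> z"
  using assms by algebra

text \<open>Isolates \<open>e\<close> as in the proof of Nakayama's lemma: once \<open>e\<close> is
  expressed through \<open>a e\<close>, it remains to divide by \<open>1 - a\<close>.\<close>

lemma (in cring) eigen_cancel:
  assumes "e \<in> carrier R" "k \<in> carrier R" "a \<in> carrier R" "l \<in> carrier R"
    and eq: "e \<ominus> k = a \<otimes> e \<oplus> l"
  shows "(\<one> \<ominus> a) \<otimes> e = k \<oplus> l"
proof -
  have "(\<one> \<ominus> a) \<otimes> e = (e \<ominus> k) \<oplus> (k \<ominus> a \<otimes> e)" using assms(1-4) one_closed by algebra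
  also have "\<dots> = (a \<otimes> e \<oplus> l) \<oplus> (k \<ominus> a \<otimes> e)" by (simp only: eq)
  also have "\<dots> = k \<oplus> l" using assms(1-4) by algebra
  finally show ?thesis .
qed

section \<open>The completion as an algebra over \<open>C\<close>\<close>

context algebra_pair_ideals
begin

sublocale ad: adic \<rr> T
  by (intro adic.intro T_cring tensor_ideal_ideal)

text \<open>The structure map from \<open>C\<close> to \<open>E\<close>.\<close>

definition scalar :: "'e \<Rightarrow> nat \<Rightarrow> ('c \<times> 'e \<Rightarrow>\<^sub>0 int) set set" where
  "scalar c = ad.\<iota> (pt \<one>\<^bsub>B\<^esub> c)"

lemma scalar_hom: "scalar \<in> ring_hom C ad.E"
proof -
  have "(\<lambda>c. pt \<one>\<^bsub>B\<^esub> c) \<in> ring_hom C T"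
    by (rule ring_hom_memI) (simp_all add: pt_mult pt_add_r T_one)
  then have "ad.\<iota> \<circ> (\<lambda>c. pt \<one>\<^bsub>B\<^esub> c) \<in> ring_hom C ad.E"
    using ad.\<iota>_hom by (rule ring_hom_trans)
  then show ?thesis by (simp add: comp_def scalar_def [abs_def])
qed

lemma scalar_closed: "c \<in> carrier C \<Longrightarrow> scalar c \<in> carrier ad.E"
  by (rule ring_hom_closed[OF scalar_hom])

lemma scalar_mult_limit:
  assumes "c \<in> carrier C" "ad.coherent_seq x"
  shows "scalar c \<otimes>\<^bsub>ad.E\<^esub> ad.limit x = ad.limit (\<lambda>n. pt \<one>\<^bsub>B\<^esub> c \<otimes>\<^bsub>T\<^esub> x n)"
    "ad.coherent_seq (\<lambda>n. pt \<one>\<^bsub>B\<^esub> c \<otimes>\<^bsub>T\<^esub> x n)"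
  using assms by (simp_all add: scalar_def ad.\<iota>_limit ad.limit_ops ad.coherent_const ad.coherent_mult)

lemma completed_module_eq: "completed_tensor_module A B C \<mm> \<nn> = restrict_scalars scalar ad.E"
  by (simp add: completed_tensor_module_def completed_tensor_def tensor_to_completed_def scalar_def [abs_def])

lemma completed_module: "module C (completed_tensor_module A B C \<mm> \<nn>)"
  unfolding completed_module_eq by (rule module_restrict_scalars[OF CC.is_cring ad.E_cring scalar_hom])

text \<open>The relation lies in the closure of the submodule generated by the relations over \<open>C\<close>. The
  weak Artin property of \<open>\<rr>E\<close>, applied to that submodule enlarged by the given vector \<open>e\<close>, gives
  \<open>(1 - a) e\<close> in the submodule for some \<open>a \<in> \<rr>E\<close>, and \<open>1 - a\<close> is a unit.\<close>

lemma completed_relation: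
  fixes q :: nat
  assumes tr: "\<And>H. submodule H A B \<Longrightarrow> trivial_relations A B H"
    and fg: "fin_gen_ideal B \<mm>" "fin_gen_ideal C \<nn>" and coh: "coherent_ring C"
    and ap: "APf C \<nn>" "APf ad.E ad.J"
    and \<rho>: "\<And>s. \<rho> s \<in> carrier C" and e: "\<And>s. e s \<in> carrier ad.E"
    and rel: "(\<Oplus>\<^bsub>ad.E\<^esub>s\<in>{..<q}. scalar (\<rho> s) \<otimes>\<^bsub>ad.E\<^esub> e s) = \<zero>\<^bsub>ad.E\<^esub>"
  shows "\<exists>(p::nat) w k. (\<forall>j. w j \<in> carrier ad.E) \<and> (\<forall>s j. k s j \<in> carrier C) \<and>
    (\<forall>s<q. e s = (\<Oplus>\<^bsub>ad.E\<^esub>j\<in>{..<p}. scalar (k s j) \<otimes>\<^bsub>ad.E\<^esub> w j)) \<and>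
    (\<forall>j<p. (\<Oplus>\<^bsub>C\<^esub>s\<in>{..<q}. \<rho> s \<otimes>\<^bsub>C\<^esub> k s j) = \<zero>\<^bsub>C\<^esub>)"
proof -
  obtain p :: nat and k where k: "\<And>j s. k j s \<in> carrier C"
    and k0: "\<And>j. j < p \<Longrightarrow> (\<Oplus>\<^bsub>C\<^esub>s\<in>{..<q}. \<rho> s \<otimes>\<^bsub>C\<^esub> k j s) = \<zero>\<^bsub>C\<^esub>"
    and kgen: "\<And>x. (\<And>s. x s \<in> carrier C) \<Longrightarrow> (\<Oplus>\<^bsub>C\<^esub>s\<in>{..<q}. \<rho> s \<otimes>\<^bsub>C\<^esub> x s) = \<zero>\<^bsub>C\<^esub> \<Longrightarrow>
      \<exists>y. (\<forall>j. y j \<in> carrier C) \<and> (\<forall>s<q. x s = (\<Oplus>\<^bsub>C\<^esub>j\<in>{..<p}. y j \<otimes>\<^bsub>C\<^esub> k j s))"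
  proof (rule coherent_relations[OF coh \<rho>])
    fix p :: nat and k
    assume *: "\<And>j s. k j s \<in> carrier C"
      "\<And>j. j < p \<Longrightarrow> (\<Oplus>\<^bsub>C\<^esub>s\<in>{..<q}. \<rho> s \<otimes>\<^bsub>C\<^esub> k j s) = \<zero>\<^bsub>C\<^esub>"
      "\<And>x. (\<And>s. x s \<in> carrier C) \<Longrightarrow> (\<Oplus>\<^bsub>C\<^esub>s\<in>{..<q}. \<rho> s \<otimes>\<^bsub>C\<^esub> x s) = \<zero>\<^bsub>C\<^esub> \<Longrightarrow>
        \<exists>y. (\<forall>j. y j \<in> carrier C) \<and> (\<forall>s<q. x s = (\<Oplus>\<^bsub>C\<^esub>j\<in>{..<p}. y j \<otimes>\<^bsub>C\<^esub> k j s))"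
    show thesis by (rule that[OF *])
  qed
  have kE: "scalar (k j s) \<in> carrier ad.E" for j s by (rule scalar_closed[OF k])
  obtain g and l :: nat where g: "\<And>s. g s \<in> carrier T" and gens: "\<rr> = Idl\<^bsub>T\<^esub> (g ` {..<l})"
    by (rule tensor_ideal_fin_gen[OF fg]) (rule that, assumption+)
  have "\<exists>x. ad.coherent_seq x \<and> e s = ad.limit x" for s
    using e[of s] ad.E_carrier by blast
  then obtain x where x: "\<And>s. ad.coherent_seq (x s)" and ex: "\<And>s. e s = ad.limit (x s)"
    by metis
  have xT: "x s n \<in> carrier T" for s n by (rule ad.coherent_seqD(1)[OF x])
  \<comment> \<open>Rows \<open>0\<close> to \<open>p - 1\<close> are the generating relations, row
    \<open>p\<close> is the vector \<open>e\<close> itself.\<close>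
  define v where "v = (\<lambda>j i. if j < p then scalar (k j i) else e i)"
  have v: "v j i \<in> carrier ad.E" for j i using kE e by (simp add: v_def)
  \<comment> \<open>Exponent 1 on the right suffices: all that is needed is that the coefficient of
    \<open>e\<close> lies in \<open>\<rr>E\<close>.\<close>
  obtain \<kappa> where \<kappa>: "\<kappa> > 0" and art: "\<And>t. (\<And>j. t j \<in> carrier ad.E) \<Longrightarrow>
    (\<And>i. i < q \<Longrightarrow> (\<Oplus>\<^bsub>ad.E\<^esub>j\<in>{..<Suc p}. t j \<otimes>\<^bsub>ad.E\<^esub> v j i) \<in> ideal_power ad.E ad.J \<kappa>) \<Longrightarrow>
    \<exists>t'. (\<forall>j. t' j \<in> ideal_power ad.E ad.J (Suc 0)) \<and>
      (\<forall>i<q. (\<Oplus>\<^bsub>ad.E\<^esub>j\<in>{..<Suc p}. t j \<otimes>\<^bsub>ad.E\<^esub> v j i) = (\<Oplus>\<^bsub>ad.E\<^esub>j\<in>{..<Suc p}. t' j \<otimes>\<^bsub>ad.E\<^esub> v j i))"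
  proof (rule APf_relations[where n = "Suc 0" and p = q and q = "Suc p" and v = v, OF ad.E_cring ad.J.is_ideal ap(2) v])
    fix \<kappa> :: nat
    assume *: "\<kappa> > 0" "\<And>t. (\<And>j. t j \<in> carrier ad.E) \<Longrightarrow>
      (\<And>i. i < q \<Longrightarrow> (\<Oplus>\<^bsub>ad.E\<^esub>j\<in>{..<Suc p}. t j \<otimes>\<^bsub>ad.E\<^esub> v j i) \<in> ideal_power ad.E ad.J \<kappa>) \<Longrightarrow>
      \<exists>t'. (\<forall>j. t' j \<in> ideal_power ad.E ad.J (Suc 0)) \<and>
        (\<forall>i<q. (\<Oplus>\<^bsub>ad.E\<^esub>j\<in>{..<Suc p}. t j \<otimes>\<^bsub>ad.E\<^esub> v j i) = (\<Oplus>\<^bsub>ad.E\<^esub>j\<in>{..<Suc p}. t' j \<otimes>\<^bsub>ad.E\<^esub> v j i))"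
    show thesis by (rule that[OF *])
  qed simp
  obtain N where N: "\<kappa> \<le> N" and approx: "\<And>x. (\<And>s. x s \<in> carrier T) \<Longrightarrow>
    (\<Oplus>\<^bsub>T\<^esub>s\<in>{..<q}. pt \<one>\<^bsub>B\<^esub> (\<rho> s) \<otimes>\<^bsub>T\<^esub> x s) \<in> ideal_power T \<rr> N \<Longrightarrow>
    \<exists>t. (\<forall>j. t j \<in> carrier T) \<and>
      (\<forall>s<q. x s \<ominus>\<^bsub>T\<^esub> (\<Oplus>\<^bsub>T\<^esub>j\<in>{..<p}. pt \<one>\<^bsub>B\<^esub> (k j s) \<otimes>\<^bsub>T\<^esub> t j) \<in> ideal_power T \<rr> \<kappa>)"
  proof (rule relation_approximation[where c = \<rho> and k = k and q = q and p = p, OF tr ap(1) \<kappa> \<rho> k kgen])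
    fix N :: nat
    assume *: "\<kappa> \<le> N" "\<And>x. (\<And>s. x s \<in> carrier T) \<Longrightarrow>
      (\<Oplus>\<^bsub>T\<^esub>s\<in>{..<q}. pt \<one>\<^bsub>B\<^esub> (\<rho> s) \<otimes>\<^bsub>T\<^esub> x s) \<in> ideal_power T \<rr> N \<Longrightarrow>
      \<exists>t. (\<forall>j. t j \<in> carrier T) \<and>
        (\<forall>s<q. x s \<ominus>\<^bsub>T\<^esub> (\<Oplus>\<^bsub>T\<^esub>j\<in>{..<p}. pt \<one>\<^bsub>B\<^esub> (k j s) \<otimes>\<^bsub>T\<^esub> t j) \<in> ideal_power T \<rr> \<kappa>)"
    show thesis by (rule that[OF *])
  qed
  \<comment> \<open>An equation between limits, read at index \<open>N\<close>, is a congruence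
    modulo \<open>\<rr>^N\<close>.\<close>
  have relN: "(\<Oplus>\<^bsub>T\<^esub>s\<in>{..<q}. pt \<one>\<^bsub>B\<^esub> (\<rho> s) \<otimes>\<^bsub>T\<^esub> x s N) \<in> ideal_power T \<rr> N"
  proof -
    let ?f = "\<lambda>s n. pt \<one>\<^bsub>B\<^esub> (\<rho> s) \<otimes>\<^bsub>T\<^esub> x s n"
    have f: "ad.coherent_seq (?f s)" for s by (rule scalar_mult_limit(2)[OF \<rho> x])
    have "(\<Oplus>\<^bsub>ad.E\<^esub>s\<in>{..<q}. scalar (\<rho> s) \<otimes>\<^bsub>ad.E\<^esub> e s) = (\<Oplus>\<^bsub>ad.E\<^esub>s\<in>{..<q}. ad.limit (?f s))"
      unfolding ex scalar_mult_limit(1)[OF \<rho> x] ..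
    also have "\<dots> = ad.limit (\<lambda>n. \<Oplus>\<^bsub>T\<^esub>s\<in>{..<q}. ?f s n)"
      using f by (intro ad.finsum_limit(2)) auto
    finally have "ad.limit (\<lambda>n. \<Oplus>\<^bsub>T\<^esub>s\<in>{..<q}. ?f s n) = ad.limit (\<lambda>_. \<zero>\<^bsub>T\<^esub>)"
      using rel by (simp add: ad.limit_ops)
    then have "(\<Oplus>\<^bsub>T\<^esub>s\<in>{..<q}. ?f s N) \<ominus>\<^bsub>T\<^esub> \<zero>\<^bsub>T\<^esub> \<in> ideal_power T \<rr> N"
      using ad.limit_eq[OF ad.finsum_limit(1)[of "{..<q}" ?f] ad.coherent_const[OF T.zero_closed]] f by simp
    moreover have "(\<Oplus>\<^bsub>T\<^esub>s\<in>{..<q}. ?f s N) \<in> carrier T"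
      using \<rho> xT by (intro T.finsum_closed) auto
    ultimately show ?thesis by (simp add: T.minus_eq T.a_inv_zero)
  qed
  obtain t where t0: "\<forall>j. t j \<in> carrier T"
    and tx0: "\<forall>s<q. x s N \<ominus>\<^bsub>T\<^esub> (\<Oplus>\<^bsub>T\<^esub>j\<in>{..<p}. pt \<one>\<^bsub>B\<^esub> (k j s) \<otimes>\<^bsub>T\<^esub> t j) \<in> ideal_power T \<rr> \<kappa>"
    using approx[of "\<lambda>s. x s N", OF xT relN] by (elim exE conjE)
  have t: "t j \<in> carrier T" for j using t0 by blast
  have tE: "ad.\<iota> (t j) \<in> carrier ad.E" for j by (rule ad.\<iota>_closed[OF t])
  let ?K = "\<lambda>s. \<Oplus>\<^bsub>ad.E\<^esub>j\<in>{..<p}. scalar (k j s) \<otimes>\<^bsub>ad.E\<^esub> ad.\<iota> (t j)"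
  have KE: "?K s \<in> carrier ad.E" for s using kE tE by (intro ad.E.finsum_closed) auto
  \<comment> \<open>The approximation was made for the term \<open>x s N\<close>; as
    \<open>\<kappa> \<le> N\<close>, coherence transfers it to the term of index
    \<open>\<kappa>\<close>. Then \<open>kernel_in_power\<close> converts congruence modulo
    \<open>\<rr>^\<kappa>\<close> into membership in a power of \<open>\<rr>E\<close>.\<close>
  have close: "e s \<ominus>\<^bsub>ad.E\<^esub> ?K s \<in> ideal_power ad.E ad.J \<kappa>" if s: "s < q" for s
  proof -
    let ?d = "\<Oplus>\<^bsub>T\<^esub>j\<in>{..<p}. pt \<one>\<^bsub>B\<^esub> (k j s) \<otimes>\<^bsub>T\<^esub> t j"
    have d: "?d \<in> carrier T" using k t by (intro T.finsum_closed) auto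
    have "?K s = (\<Oplus>\<^bsub>ad.E\<^esub>j\<in>{..<p}. ad.limit (\<lambda>_. pt \<one>\<^bsub>B\<^esub> (k j s) \<otimes>\<^bsub>T\<^esub> t j))"
      using scalar_mult_limit(1)[OF k ad.coherent_const[OF t]] by (simp add: ad.\<iota>_limit)
    also have "\<dots> = ad.limit (\<lambda>_. ?d)"
      using k t by (intro ad.finsum_limit(2) ad.coherent_const) auto
    finally have "?K s = ad.limit (\<lambda>_. ?d)" .
    then have "e s \<ominus>\<^bsub>ad.E\<^esub> ?K s = ad.limit (\<lambda>n. x s n \<oplus>\<^bsub>T\<^esub> \<ominus>\<^bsub>T\<^esub> ?d)"
      using x d by (simp add: ex ad.E.minus_eq ad.limit_minus ad.limit_ops ad.coherent_intros)
    moreover have "ad.coherent_seq (\<lambda>n. x s n \<oplus>\<^bsub>T\<^esub> \<ominus>\<^bsub>T\<^esub> ?d)"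
      by (intro ad.coherent_add x ad.coherent_const T.a_inv_closed d)
    moreover have "x s \<kappa> \<oplus>\<^bsub>T\<^esub> \<ominus>\<^bsub>T\<^esub> ?d \<in> ideal_power T \<rr> \<kappa>"
    proof -
      have "(x s N \<ominus>\<^bsub>T\<^esub> ?d) \<ominus>\<^bsub>T\<^esub> (x s N \<ominus>\<^bsub>T\<^esub> x s \<kappa>) \<in> ideal_power T \<rr> \<kappa>"
        by (rule ad.P_diff[OF tx0[rule_format, OF s] ad.coherent_seqD(2)[OF x N]])
      also have "(x s N \<ominus>\<^bsub>T\<^esub> ?d) \<ominus>\<^bsub>T\<^esub> (x s N \<ominus>\<^bsub>T\<^esub> x s \<kappa>) = x s \<kappa> \<oplus>\<^bsub>T\<^esub> \<ominus>\<^bsub>T\<^esub> ?d"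
        by (rule T.diff_diff_diff) (use xT d in auto)
      finally show ?thesis .
    qed
    ultimately show ?thesis
      using ad.kernel_in_power[OF gens g] by simp
  qed
  \<comment> \<open>Coefficients of \<open>e - K\<close> with respect to the rows of
    \<open>v\<close>: \<open>1\<close> on \<open>e\<close>, and minus the approximating coefficients
    on the relations.\<close>
  define c where "c = (\<lambda>j. if j < p then \<ominus>\<^bsub>ad.E\<^esub> ad.\<iota> (t j) else \<one>\<^bsub>ad.E\<^esub>)"
  have c: "c j \<in> carrier ad.E" for j using tE by (simp add: c_def)
  have split: "(\<Oplus>\<^bsub>ad.E\<^esub>j\<in>{..<Suc p}. y j \<otimes>\<^bsub>ad.E\<^esub> v j s) =
      y p \<otimes>\<^bsub>ad.E\<^esub> e s \<oplus>\<^bsub>ad.E\<^esub> (\<Oplus>\<^bsub>ad.E\<^esub>j\<in>{..<p}. y j \<otimes>\<^bsub>ad.E\<^esub> scalar (k j s))"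
    if y: "\<And>j. y j \<in> carrier ad.E" for y s
  proof -
    have "(\<Oplus>\<^bsub>ad.E\<^esub>j\<in>{..<Suc p}. y j \<otimes>\<^bsub>ad.E\<^esub> v j s) =
        y p \<otimes>\<^bsub>ad.E\<^esub> v p s \<oplus>\<^bsub>ad.E\<^esub> (\<Oplus>\<^bsub>ad.E\<^esub>j\<in>{..<p}. y j \<otimes>\<^bsub>ad.E\<^esub> v j s)"
      unfolding lessThan_Suc using y v by (intro ad.E.finsum_insert) auto
    also have "(\<Oplus>\<^bsub>ad.E\<^esub>j\<in>{..<p}. y j \<otimes>\<^bsub>ad.E\<^esub> v j s) = (\<Oplus>\<^bsub>ad.E\<^esub>j\<in>{..<p}. y j \<otimes>\<^bsub>ad.E\<^esub> scalar (k j s))"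
      using y kE by (intro ad.E.finsum_cong') (auto simp: v_def)
    finally show ?thesis by (simp add: v_def)
  qed
  have cK: "(\<Oplus>\<^bsub>ad.E\<^esub>j\<in>{..<p}. c j \<otimes>\<^bsub>ad.E\<^esub> scalar (k j s)) = \<ominus>\<^bsub>ad.E\<^esub> ?K s" for s
  proof -
    have "(\<Oplus>\<^bsub>ad.E\<^esub>j\<in>{..<p}. c j \<otimes>\<^bsub>ad.E\<^esub> scalar (k j s)) =
        (\<Oplus>\<^bsub>ad.E\<^esub>j\<in>{..<p}. \<ominus>\<^bsub>ad.E\<^esub> (scalar (k j s) \<otimes>\<^bsub>ad.E\<^esub> ad.\<iota> (t j)))"
      using tE kE by (intro ad.E.finsum_cong') (auto simp: c_def ad.E.l_minus ad.E.r_minus ad.E.m_comm)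
    also have "\<dots> = \<ominus>\<^bsub>ad.E\<^esub> ?K s" using tE kE by (intro ad.E.finsum_minus) auto
    finally show ?thesis .
  qed
  have csum: "(\<Oplus>\<^bsub>ad.E\<^esub>j\<in>{..<Suc p}. c j \<otimes>\<^bsub>ad.E\<^esub> v j s) = e s \<ominus>\<^bsub>ad.E\<^esub> ?K s" for s
    using split[of c s, OF c] cK[of s] e[of s] by (simp add: c_def ad.E.minus_eq)
  \<comment> \<open>(APf) rewrites \<open>e - K\<close> with coefficients in \<open>\<rr>E\<close>;
    the one in front of \<open>e\<close>, namely \<open>t' p\<close>, is then moved to the other
    side.\<close>
  have "\<exists>t'. (\<forall>j. t' j \<in> ideal_power ad.E ad.J (Suc 0)) \<and>
      (\<forall>i<q. (\<Oplus>\<^bsub>ad.E\<^esub>j\<in>{..<Suc p}. c j \<otimes>\<^bsub>ad.E\<^esub> v j i) = (\<Oplus>\<^bsub>ad.E\<^esub>j\<in>{..<Suc p}. t' j \<otimes>\<^bsub>ad.E\<^esub> v j i))"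
    by (rule art[OF c]) (simp only: csum close)
  then obtain t' where t'0: "\<forall>j. t' j \<in> ideal_power ad.E ad.J (Suc 0)"
    and t'e: "\<forall>i<q. (\<Oplus>\<^bsub>ad.E\<^esub>j\<in>{..<Suc p}. c j \<otimes>\<^bsub>ad.E\<^esub> v j i) = (\<Oplus>\<^bsub>ad.E\<^esub>j\<in>{..<Suc p}. t' j \<otimes>\<^bsub>ad.E\<^esub> v j i)"
    by (elim exE conjE)
  have t'J: "t' j \<in> ad.J" for j using t'0 ad.E.ideal_power_1[OF ad.J.is_ideal] by blast
  have t'E: "t' j \<in> carrier ad.E" for j by (rule ad.J.Icarr[OF t'J])
  obtain b where b: "b \<in> carrier ad.E" "b \<otimes>\<^bsub>ad.E\<^esub> (\<one>\<^bsub>ad.E\<^esub> \<ominus>\<^bsub>ad.E\<^esub> t' p) = \<one>\<^bsub>ad.E\<^esub>"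
    using ad.one_minus_J_unit[OF t'J] by blast
  \<comment> \<open>\<open>(1 - t' p) e\<close> is the combination of the relations with
    coefficients \<open>\<iota> (t j) + t' j\<close>; multiplying by the inverse \<open>b\<close> of
    \<open>1 - t' p\<close> gives those of \<open>e\<close>.\<close>
  define w where "w = (\<lambda>j. b \<otimes>\<^bsub>ad.E\<^esub> (ad.\<iota> (t j) \<oplus>\<^bsub>ad.E\<^esub> t' j))"
  have w: "w j \<in> carrier ad.E" for j using b tE t'E by (simp add: w_def)
  have "e s = (\<Oplus>\<^bsub>ad.E\<^esub>j\<in>{..<p}. scalar (k j s) \<otimes>\<^bsub>ad.E\<^esub> w j)" if s: "s < q" for s
  proof -
    let ?L = "\<Oplus>\<^bsub>ad.E\<^esub>j\<in>{..<p}. t' j \<otimes>\<^bsub>ad.E\<^esub> scalar (k j s)"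
    have LE: "?L \<in> carrier ad.E" using t'E kE by (intro ad.E.finsum_closed) auto
    have "e s \<ominus>\<^bsub>ad.E\<^esub> ?K s = t' p \<otimes>\<^bsub>ad.E\<^esub> e s \<oplus>\<^bsub>ad.E\<^esub> ?L"
      using t'e[rule_format, OF s] unfolding csum split[of t' s, OF t'E] .
    then have eq: "(\<one>\<^bsub>ad.E\<^esub> \<ominus>\<^bsub>ad.E\<^esub> t' p) \<otimes>\<^bsub>ad.E\<^esub> e s = ?K s \<oplus>\<^bsub>ad.E\<^esub> ?L"
      by (rule ad.E.eigen_cancel[OF e KE t'E LE])
    have "e s = b \<otimes>\<^bsub>ad.E\<^esub> (\<one>\<^bsub>ad.E\<^esub> \<ominus>\<^bsub>ad.E\<^esub> t' p) \<otimes>\<^bsub>ad.E\<^esub> e s" using b e[of s] by simp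
    also have "\<dots> = b \<otimes>\<^bsub>ad.E\<^esub> (?K s \<oplus>\<^bsub>ad.E\<^esub> ?L)"
      unfolding eq[symmetric] using b(1) t'E e by (intro ad.E.m_assoc) auto
    also have "?K s \<oplus>\<^bsub>ad.E\<^esub> ?L = (\<Oplus>\<^bsub>ad.E\<^esub>j\<in>{..<p}. scalar (k j s) \<otimes>\<^bsub>ad.E\<^esub> ad.\<iota> (t j) \<oplus>\<^bsub>ad.E\<^esub> t' j \<otimes>\<^bsub>ad.E\<^esub> scalar (k j s))"
      using kE tE t'E by (intro ad.E.finsum_addf [symmetric]) auto
    also have "b \<otimes>\<^bsub>ad.E\<^esub> \<dots> = (\<Oplus>\<^bsub>ad.E\<^esub>j\<in>{..<p}. b \<otimes>\<^bsub>ad.E\<^esub> (scalar (k j s) \<otimes>\<^bsub>ad.E\<^esub> ad.\<iota> (t j) \<oplus>\<^bsub>ad.E\<^esub> t' j \<otimes>\<^bsub>ad.E\<^esub> scalar (k j s)))"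
      using b(1) kE tE t'E by (intro ad.E.finsum_rdistr) auto
    also have "\<dots> = (\<Oplus>\<^bsub>ad.E\<^esub>j\<in>{..<p}. scalar (k j s) \<otimes>\<^bsub>ad.E\<^esub> w j)"
      using b(1) kE tE t'E
      by (intro ad.E.finsum_cong') (auto simp: w_def ad.E.r_distr ad.E.m_ac)
    finally show ?thesis .
  qed
  then show ?thesis
    using w k k0 by (intro exI[of _ p] exI[of _ w] exI[of _ "\<lambda>s j. k j s"]) auto
qed

text \<open>In \<open>completed_relation\<close> the vector is recovered exactly, so the criterion
  holds relative to the zero submodule; sums in the module and in the ring \<open>E\<close>
  agree.\<close>

theorem completed_trivial_relations:
  assumes "\<And>H. submodule H A B \<Longrightarrow> trivial_relations A B H"
    and "fin_gen_ideal B \<mm>" "fin_gen_ideal C \<nn>" "coherent_ring C" "APf C \<nn>" "APf ad.E ad.J"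
  shows "trivial_relations C (completed_tensor_module A B C \<mm> \<nn>)
    {\<zero>\<^bsub>completed_tensor_module A B C \<mm> \<nn>\<^esub>}"
  unfolding trivial_relations_def
proof (intro allI impI)
  let ?M = "completed_tensor_module A B C \<mm> \<nn>"
  interpret M: module C ?M by (rule completed_module)
  have M: "carrier ?M = carrier ad.E" "\<zero>\<^bsub>?M\<^esub> = \<zero>\<^bsub>ad.E\<^esub>" "c \<odot>\<^bsub>?M\<^esub> x = scalar c \<otimes>\<^bsub>ad.E\<^esub> x" for c x
    by (simp_all add: completed_module_eq restrict_scalars_def)
  have fs: "finsum ?M f I = finsum ad.E f I" for f and I :: "nat set"
    by (simp add: finsum_def finprod_def completed_module_eq restrict_scalars_def)
  fix q :: nat and \<rho> e
  assume \<rho>: "\<forall>s. \<rho> s \<in> carrier C" and e: "\<forall>s. e s \<in> carrier ?M"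
    and rel: "(\<Oplus>\<^bsub>?M\<^esub>s\<in>{..<q}. \<rho> s \<odot>\<^bsub>?M\<^esub> e s) \<in> {\<zero>\<^bsub>?M\<^esub>}"
  have "\<exists>(p::nat) w k. (\<forall>j. w j \<in> carrier ad.E) \<and> (\<forall>s j. k s j \<in> carrier C) \<and>
    (\<forall>s<q. e s = (\<Oplus>\<^bsub>ad.E\<^esub>j\<in>{..<p}. scalar (k s j) \<otimes>\<^bsub>ad.E\<^esub> w j)) \<and>
    (\<forall>j<p. (\<Oplus>\<^bsub>C\<^esub>s\<in>{..<q}. \<rho> s \<otimes>\<^bsub>C\<^esub> k s j) = \<zero>\<^bsub>C\<^esub>)"
    by (rule completed_relation[OF assms]) (use \<rho> e rel in \<open>simp_all add: M fs\<close>)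
  then obtain p :: nat and w k where w: "\<forall>j. w j \<in> carrier ad.E" and k: "\<forall>s j. k s j \<in> carrier C"
    and ew: "\<forall>s<q. e s = (\<Oplus>\<^bsub>ad.E\<^esub>j\<in>{..<p}. scalar (k s j) \<otimes>\<^bsub>ad.E\<^esub> w j)"
    and k0: "\<forall>j<p. (\<Oplus>\<^bsub>C\<^esub>s\<in>{..<q}. \<rho> s \<otimes>\<^bsub>C\<^esub> k s j) = \<zero>\<^bsub>C\<^esub>"
    by (elim exE conjE)
  have "e s \<ominus>\<^bsub>?M\<^esub> (\<Oplus>\<^bsub>?M\<^esub>j\<in>{..<p}. k s j \<odot>\<^bsub>?M\<^esub> w j) \<in> {\<zero>\<^bsub>?M\<^esub>}" if s: "s < q" for s
  proof -
    have "(\<Oplus>\<^bsub>?M\<^esub>j\<in>{..<p}. k s j \<odot>\<^bsub>?M\<^esub> w j) = e s"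
      unfolding fs M(3) using ew s by simp
    then show ?thesis using e by (simp add: M.M.minus_eq M.M.r_neg)
  qed
  then show "\<exists>(r::nat) w g. (\<forall>u. w u \<in> carrier ?M) \<and> (\<forall>s u. g s u \<in> carrier C) \<and>
        (\<forall>s<q. e s \<ominus>\<^bsub>?M\<^esub> (\<Oplus>\<^bsub>?M\<^esub>u\<in>{..<r}. g s u \<odot>\<^bsub>?M\<^esub> w u) \<in> {\<zero>\<^bsub>?M\<^esub>}) \<and>
        (\<forall>u<r. (\<Oplus>\<^bsub>C\<^esub>s\<in>{..<q}. \<rho> s \<otimes>\<^bsub>C\<^esub> g s u) = \<zero>\<^bsub>C\<^esub>)"
    using w k k0 by (intro exI[of _ p] exI[of _ w] exI[of _ k]) (simp add: M)
qed

end

theorem mainTheorem1: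
  fixes A :: "('a, 'r) ring_scheme" and TA :: "'a topology"
    and B :: "('a, 'b, 's) module_scheme" and TB :: "'b topology"
    and C :: "('a, 'c, 't) module_scheme" and TC :: "'c topology"
    and \<mm> :: "'b set" and \<nn> :: "'c set"
  assumes "topological_ring A TA"
    and "preadic_topological_algebra A TA B TB"
    and "preadic_topological_algebra A TA C TC"
    and "ideal_of_definition B TB \<mm>"
    and "ideal_of_definition C TC \<nn>"
    and "fin_gen_ideal B \<mm>"
    and "fin_gen_ideal C \<nn>"
    and "coherent_ring C"
    and "APf C \<nn>"
    and "APf (completed_tensor A B C \<mm> \<nn>)
           (Idl\<^bsub>completed_tensor A B C \<mm> \<nn>\<^esub>
              (tensor_to_completed A B C \<mm> \<nn> ` tensor_ideal A B C \<mm> \<nn>))"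
    and "absolutely_flat A"
  shows "flat TYPE('u) C (completed_tensor_module A B C \<mm> \<nn>)"
proof -
  have AB: "algebra A B" and AC: "algebra A C"
    using assms(2,3) by (simp_all add: preadic_topological_algebra_def)
  have m: "ideal \<mm> B" and n: "ideal \<nn> C"
    using assms(4,5) by (simp_all add: ideal_of_definition_def)
  interpret algebra_pair_ideals A B C \<mm> \<nn>
    by (intro algebra_pair_ideals.intro algebra_pair.intro algebra.M_cring[OF AB] algebra.M_cring[OF AC]
        AB AC m n)
  \<comment> \<open>Regularity makes every quotient of \<open>B\<close> flat over \<open>A\<close>;
    the quotients by powers of \<open>\<mm>\<close> are the ones that enter the
    approximation.\<close>
  have tr: "trivial_relations A B H" if "submodule H A B" for H
    by (rule module.von_neumann_regular_trivial_relations[OF algebra.module[OF AB] _ that])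
      (rule absolutely_flat_regular[OF assms(11)])
  have ap: "APf ad.E ad.J"
    using assms(10) by (simp add: completed_tensor_def tensor_to_completed_def [abs_def] ad.J_def)
  show ?thesis
    by (rule flat_if_trivial_relations[OF completed_module])
      (rule completed_trivial_relations[OF tr assms(6-9) ap])
qed

end
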